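(* The group $GL(n+2)$ acts on germs of admissible pairs $(f,g)$ of functions in $n$ variables at generic point.
   Context: $\mathbf k$ is a field of characteristic $0$; functions are germs of analytic functions (if $\mathbf k=\mathbb R,\mathbb C$) or formal germs (power series) over $\mathbf k$. **Admissible pairs.** Let $f$ be a function of $x=(x_1,\dots,x_n)$ whose Hessian matrix $H=(\partial_i\partial_j f)$ has $\det H\not\equiv 0$, and $g$ another function. At points $t$ with $\det H(t)\neq0$ put $R_t(u)=f(t+u)-f(t)-\sum_i\partial_if(t)u_i-\frac12\sum_{i,j}H_{ij}(t)u_iu_j$, $\Delta_t=-\frac12\sum_{i,j}(H(t)^{-1})_{ij}\partial_{u_i}\partial_{u_j}$, and $$A_k(t)=\sum_{v=0}^{2k}\frac{1}{v!\,(k+v)!}\,\Delta_t^{\,k+v}\big[g(t+u)R_t(u)^v\big]\Big|_{u=0},\qquad k\ge0.$$ These are the coefficients of the formal stationary phase expansion $\int g\,e^{(f+x\cdot y)/\hbar}dx=(2\pi\hbar)^{n/2}e^{\hat f(y)/\hbar}\det(-H(t))^{-1/2}\sum_kA_k(t)\hbar^k$ at the critical point $t$ ($y_i=-\partial_if(t)$, $\hat f(y)=f(t)+t\cdot y$). The pair $(f,g)$ is *admissible* if $\det H\not\equiv0$, $g\not\equiv 0$ and $A_k\equiv0$ for all $k\ge1$. **Which action is meant.** It is the action induced by the linear action of $GL(n+2)$ on the affine space $\mathbb A^{n+2}$ with coordinates $x_0,\dots,x_{n+1}$, via the assignment to a pair $(f,g)$ of the density $$G(x_0,\dots,x_{n+1})=\delta\Big(\frac{x_{n+1}}{x_0}-f\Big(\frac{x_1}{x_0},\dots,\frac{x_n}{x_0}\Big)\Big)\,g\Big(\frac{x_1}{x_0},\dots,\frac{x_n}{x_0}\Big)\,x_0^{-\frac{n+2}{2}},$$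 which is homogeneous of degree $-\frac{n+2}{2}$ and supported on the germ of conical hypersurface $x_{n+1}=x_0f(x_1/x_0,\dots,x_n/x_0)$. "At generic point" refers to points where the transformed conical hypersurface can again be written in this form, with $x_0\ne0$. *)

theory Defs
  imports "HOL-Analysis.Analysis" "HOL-Computational_Algebra.Fraction_Field"
begin

section \<open>Formal power series in finitely many variables\<close>

text \<open>The variables are indexed by a finite type; a multi-index is a function to \<^typ>\<open>nat\<close>.\<close>

typedef ('a, 'n) mfps = "UNIV :: (('n \<Rightarrow> nat) \<Rightarrow> 'a) set"
  morphisms mcoeff Abs_mfps
  by simp

lemma mcoeff_Abs [simp]: "mcoeff (Abs_mfps c) = c"
  by (simp add: Abs_mfps_inverse)

lemma mfps_eqI: "(\<And>\<alpha>. mcoeff F \<alpha> = mcoeff G \<alpha>) \<Longrightarrow> F = G"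
  by (metis ext mcoeff_inject)

abbreviation midx_add :: "('n \<Rightarrow> nat) \<Rightarrow> ('n \<Rightarrow> nat) \<Rightarrow> 'n \<Rightarrow> nat" where
  "midx_add \<beta> \<gamma> \<equiv> (\<lambda>i. \<beta> i + \<gamma> i)"

definition midx_splits :: "('n \<Rightarrow> nat) \<Rightarrow> (('n \<Rightarrow> nat) \<times> ('n \<Rightarrow> nat)) set" where
  "midx_splits \<alpha> = {(\<beta>, \<gamma>). midx_add \<beta> \<gamma> = \<alpha>}"

lemma mem_midx_splits: "(\<beta>, \<gamma>) \<in> midx_splits \<alpha> \<longleftrightarrow> midx_add \<beta> \<gamma> = \<alpha>"
  by (simp add: midx_splits_def)

lemma finite_midx_le: "finite {\<beta> :: 'n::finite \<Rightarrow> nat. \<forall>i. \<beta> i \<le> \<alpha> i}"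
proof -
  have "{\<beta>. \<forall>i. \<beta> i \<le> \<alpha> i} = PiE UNIV (\<lambda>i. {..\<alpha> i})"
    by (auto simp: PiE_def Pi_def)
  then show ?thesis
    by (simp add: finite_PiE)
qed

lemma finite_midx_splits [simp]: "finite (midx_splits (\<alpha> :: 'n::finite \<Rightarrow> nat))"
proof -
  let ?B = "{\<beta> :: 'n \<Rightarrow> nat. \<forall>i. \<beta> i \<le> \<alpha> i}"
  have "midx_splits \<alpha> \<subseteq> ?B \<times> ?B"
    by (auto simp: midx_splits_def)
  then show ?thesis
    using finite_midx_le[of \<alpha>] by (meson finite_SigmaI finite_subset)
qed

instantiation mfps :: (comm_ring_1, finite) comm_ring_1
begin

definition "0 = Abs_mfps (\<lambda>_. 0)"
definition "1 = Abs_mfps (\<lambda>\<alpha>. if \<alpha> = (\<lambda>_. 0) then 1 else 0)"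
definition "F + G = Abs_mfps (\<lambda>\<alpha>. mcoeff F \<alpha> + mcoeff G \<alpha>)"
definition "F - G = Abs_mfps (\<lambda>\<alpha>. mcoeff F \<alpha> - mcoeff G \<alpha>)"
definition "- F = Abs_mfps (\<lambda>\<alpha>. - mcoeff F \<alpha>)"
definition "F * G = Abs_mfps (\<lambda>\<alpha>. \<Sum>(\<beta>, \<gamma>)\<in>midx_splits \<alpha>. mcoeff F \<beta> * mcoeff G \<gamma>)"

instance
proof
  fix F G K :: "('a, 'b) mfps"
  show "F + G + K = F + (G + K)" "F + G = G + F" "0 + F = F" "- F + F = 0" "F - G = F + - G"
    by (simp_all add: zero_mfps_def plus_mfps_def uminus_mfps_def minus_mfps_def
        add_ac mcoeff_inverse)
  show "F * G = G * F"
  proof (rule mfps_eqI)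
    fix \<alpha> :: "'b \<Rightarrow> nat"
    have "(\<Sum>(\<beta>, \<gamma>)\<in>midx_splits \<alpha>. mcoeff F \<beta> * mcoeff G \<gamma>) =
          (\<Sum>(\<beta>, \<gamma>)\<in>midx_splits \<alpha>. mcoeff G \<beta> * mcoeff F \<gamma>)"
      by (rule sum.reindex_bij_witness[where i = prod.swap and j = prod.swap])
         (auto simp: midx_splits_def add.commute mult.commute)
    then show "mcoeff (F * G) \<alpha> = mcoeff (G * F) \<alpha>"
      by (simp add: times_mfps_def)
  qed
  show "F * G * K = F * (G * K)"
  proof (rule mfps_eqI)
    fix \<alpha> :: "'b \<Rightarrow> nat"
    have "mcoeff (F * G * K) \<alpha> = (\<Sum>p\<in>midx_splits \<alpha>. \<Sum>q\<in>midx_splits (fst p).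
            mcoeff F (fst q) * mcoeff G (snd q) * mcoeff K (snd p))"
      by (simp add: times_mfps_def case_prod_unfold sum_distrib_right)
    also have "\<dots> = (\<Sum>z\<in>(SIGMA p:midx_splits \<alpha>. midx_splits (fst p)).
            mcoeff F (fst (snd z)) * mcoeff G (snd (snd z)) * mcoeff K (snd (fst z)))"
      by (subst sum.Sigma) (auto simp: case_prod_unfold)
    also have "\<dots> = (\<Sum>z\<in>(SIGMA p:midx_splits \<alpha>. midx_splits (snd p)).
            mcoeff F (fst (fst z)) * (mcoeff G (fst (snd z)) * mcoeff K (snd (snd z))))"
      by (rule sum.reindex_bij_witness[where
            j = "\<lambda>z. ((fst (snd z), midx_add (snd (snd z)) (snd (fst z))), (snd (snd z), snd (fst z)))"
            and i = "\<lambda>z. ((midx_add (fst (fst z)) (fst (snd z)), snd (snd z)), (fst (fst z), fst (snd z)))"])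
         (auto simp: midx_splits_def add.assoc mult.assoc)
    also have "\<dots> = (\<Sum>p\<in>midx_splits \<alpha>. \<Sum>q\<in>midx_splits (snd p).
            mcoeff F (fst p) * (mcoeff G (fst q) * mcoeff K (snd q)))"
      by (subst sum.Sigma) (auto simp: case_prod_unfold)
    also have "\<dots> = mcoeff (F * (G * K)) \<alpha>"
      by (simp add: times_mfps_def case_prod_unfold sum_distrib_left)
    finally show "mcoeff (F * G * K) \<alpha> = mcoeff (F * (G * K)) \<alpha>" .
  qed
  show "1 * F = F"
  proof (rule mfps_eqI)
    fix \<alpha> :: "'b \<Rightarrow> nat"
    have "mcoeff (1 * F) \<alpha> = (\<Sum>p\<in>midx_splits \<alpha>. if p = ((\<lambda>_. 0), \<alpha>) then mcoeff F \<alpha> else 0)"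
      by (auto simp: times_mfps_def one_mfps_def midx_splits_def intro!: sum.cong)
    also have "\<dots> = mcoeff F \<alpha>"
      by (subst sum.delta) (simp_all add: mem_midx_splits)
    finally show "mcoeff (1 * F) \<alpha> = mcoeff F \<alpha>" .
  qed
  show "(F + G) * K = F * K + G * K"
    by (simp add: times_mfps_def plus_mfps_def case_prod_unfold distrib_right sum.distrib)
  have "mcoeff (0 :: ('a, 'b) mfps) (\<lambda>_. 0) \<noteq> mcoeff 1 (\<lambda>_. 0)"
    by (simp add: zero_mfps_def one_mfps_def)
  then show "(0 :: ('a, 'b) mfps) \<noteq> 1"
    by fastforce
qed

end

text \<open>
  Integrality: choose in the support of a nonzero series a lexicographically least multi-index.
\<close>

primrec lex_min :: "'n list \<Rightarrow> ('n \<Rightarrow> nat) set \<Rightarrow> ('n \<Rightarrow> nat) set" where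
  "lex_min [] S = S"
| "lex_min (x # xs) S = lex_min xs {\<alpha>\<in>S. \<forall>\<beta>\<in>S. \<alpha> x \<le> \<beta> x}"

lemma lex_min_subset: "lex_min xs S \<subseteq> S"
  by (induction xs arbitrary: S) fastforce+

lemma lex_min_nonempty: "S \<noteq> {} \<Longrightarrow> lex_min xs S \<noteq> {}"
proof (induction xs arbitrary: S)
  case (Cons x xs)
  then obtain a where "a \<in> S" by blast
  then have "\<exists>\<alpha>\<in>S. \<forall>\<beta>\<in>S. \<alpha> x \<le> \<beta> x"
    using ex_has_least_nat[of "\<lambda>\<alpha>. \<alpha> \<in> S" a "\<lambda>\<alpha>. \<alpha> x"] by blast
  then show ?case
    using Cons.IH[of "{\<alpha>\<in>S. \<forall>\<beta>\<in>S. \<alpha> x \<le> \<beta> x}"] by auto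
qed simp

lemma lex_min_unique:
  assumes "\<alpha> \<in> lex_min xs S" "\<beta> \<in> lex_min xs T" "\<alpha>' \<in> S" "\<beta>' \<in> T"
    "midx_add \<alpha>' \<beta>' = midx_add \<alpha> \<beta>"
  shows "\<forall>x\<in>set xs. \<alpha>' x = \<alpha> x \<and> \<beta>' x = \<beta> x"
  using assms
proof (induction xs arbitrary: S T)
  case (Cons x xs)
  let ?S = "{\<alpha>\<in>S. \<forall>\<beta>\<in>S. \<alpha> x \<le> \<beta> x}" and ?T = "{\<alpha>\<in>T. \<forall>\<beta>\<in>T. \<alpha> x \<le> \<beta> x}"
  have "\<alpha> \<in> ?S" "\<beta> \<in> ?T"
    using Cons.prems(1,2) lex_min_subset by (simp_all, blast+)
  moreover have "\<alpha>' x + \<beta>' x = \<alpha> x + \<beta> x"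
    using Cons.prems(5) by meson
  ultimately have *: "\<alpha>' x = \<alpha> x" "\<beta>' x = \<beta> x"
    using Cons.prems(3,4) by fastforce+
  then have "\<alpha>' \<in> ?S" "\<beta>' \<in> ?T"
    using \<open>\<alpha> \<in> ?S\<close> \<open>\<beta> \<in> ?T\<close> Cons.prems(3,4) by auto
  then show ?case
    using Cons.IH[of ?S ?T] Cons.prems * by simp
qed simp

instance mfps :: (idom, finite) idom
proof
  fix F G :: "('a, 'b) mfps"
  assume "F \<noteq> 0" "G \<noteq> 0"
  let ?S = "\<lambda>F :: ('a, 'b) mfps. {\<alpha>. mcoeff F \<alpha> \<noteq> 0}"
  have ne: "?S F \<noteq> {}" "?S G \<noteq> {}"
    using \<open>F \<noteq> 0\<close> \<open>G \<noteq> 0\<close> by (auto simp: zero_mfps_def intro: mfps_eqI)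
  obtain xs :: "'b list" where xs: "set xs = UNIV"
    using finite_list[of "UNIV :: 'b set"] by auto
  obtain \<alpha> \<beta> where min: "\<alpha> \<in> lex_min xs (?S F)" "\<beta> \<in> lex_min xs (?S G)"
    using lex_min_nonempty[OF ne(1)] lex_min_nonempty[OF ne(2)] by blast
  then have nz: "mcoeff F \<alpha> \<noteq> 0" "mcoeff G \<beta> \<noteq> 0"
    using lex_min_subset by blast+
  have uniq: "p = (\<alpha>, \<beta>)"
    if "p \<in> midx_splits (midx_add \<alpha> \<beta>)" "mcoeff F (fst p) \<noteq> 0" "mcoeff G (snd p) \<noteq> 0" for p
  proof -
    have "\<forall>x\<in>set xs. fst p x = \<alpha> x \<and> snd p x = \<beta> x"
      using that by (intro lex_min_unique[OF min]) (auto simp: midx_splits_def)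
    then show ?thesis
      using xs by (auto simp: prod_eq_iff)
  qed
  have "mcoeff (F * G) (midx_add \<alpha> \<beta>) =
      (\<Sum>p\<in>midx_splits (midx_add \<alpha> \<beta>). mcoeff F (fst p) * mcoeff G (snd p))"
    by (simp add: times_mfps_def case_prod_unfold)
  also have "\<dots> =
      (\<Sum>p\<in>midx_splits (midx_add \<alpha> \<beta>). if p = (\<alpha>, \<beta>) then mcoeff F \<alpha> * mcoeff G \<beta> else 0)"
  proof (rule sum.cong[OF refl])
    fix p
    assume p: "p \<in> midx_splits (midx_add \<alpha> \<beta>)"
    show "mcoeff F (fst p) * mcoeff G (snd p) =
        (if p = (\<alpha>, \<beta>) then mcoeff F \<alpha> * mcoeff G \<beta> else 0)"
    proof (cases "p = (\<alpha>, \<beta>)")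
      case False
      then have "mcoeff F (fst p) = 0 \<or> mcoeff G (snd p) = 0"
        using uniq[OF p] by blast
      then show ?thesis
        using False by auto
    qed simp
  qed
  also have "\<dots> = mcoeff F \<alpha> * mcoeff G \<beta>"
    by (subst sum.delta) (simp_all add: mem_midx_splits)
  finally have "mcoeff (F * G) (midx_add \<alpha> \<beta>) \<noteq> 0"
    using nz by simp
  then show "F * G \<noteq> 0"
    by (metis mcoeff_Abs zero_mfps_def)
qed

definition mconst :: "'a::zero \<Rightarrow> ('a, 'n) mfps" where
  "mconst c = Abs_mfps (\<lambda>\<alpha>. if \<alpha> = (\<lambda>_. 0) then c else 0)"

definition mvar :: "'n \<Rightarrow> ('a::zero_neq_one, 'n) mfps" where
  "mvar i = Abs_mfps (\<lambda>\<alpha>. if \<alpha> = (\<lambda>j. if j = i then 1 else 0) then 1 else 0)"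

abbreviation mcoeff0 :: "('a, 'n) mfps \<Rightarrow> 'a" where
  "mcoeff0 F \<equiv> mcoeff F (\<lambda>_. 0)"

definition mderiv :: "'n \<Rightarrow> ('a::comm_ring_1, 'n) mfps \<Rightarrow> ('a, 'n) mfps" where
  "mderiv i F = Abs_mfps (\<lambda>\<alpha>. of_nat (Suc (\<alpha> i)) * mcoeff F (\<alpha>(i := Suc (\<alpha> i))))"

text \<open>Multiplicative inverse; only meaningful if the constant coefficient is a unit.\<close>

definition minv :: "('a::comm_ring_1, 'n::finite) mfps \<Rightarrow> ('a, 'n) mfps" where
  "minv F = (THE G. F * G = 1)"

text \<open>
  Substitution of series \<open>s i\<close> without constant term for the variables of \<open>F\<close>. Since
  \<open>\<Prod>i. s i ^ \<alpha> i\<close> has order at least \<open>\<Sum>i. \<alpha> i\<close>, the sum below contains all contributions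
  to the coefficient at \<open>\<beta>\<close>.
\<close>

definition msubst ::
    "('a::comm_ring_1, 'n::finite) mfps \<Rightarrow> ('n \<Rightarrow> ('a, 'm::finite) mfps) \<Rightarrow> ('a, 'm) mfps" where
  "msubst F s = Abs_mfps (\<lambda>\<beta>. \<Sum>\<alpha> | (\<Sum>i\<in>UNIV. \<alpha> i) \<le> (\<Sum>j\<in>UNIV. \<beta> j).
      mcoeff F \<alpha> * mcoeff (\<Prod>i\<in>UNIV. s i ^ \<alpha> i) \<beta>)"


section \<open>The coefficients of the stationary phase expansion\<close>

text \<open>
  Here \<open>F\<close> and \<open>G\<close> are the Taylor series in \<open>u\<close> of \<open>f(t + u)\<close> and \<open>g(t + u)\<close> at a point \<open>t\<close>.
\<close>

definition hess :: "('a::comm_ring_1, 'n::finite) mfps \<Rightarrow> 'a ^ 'n ^ 'n" where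
  "hess F = (\<chi> i j. mcoeff0 (mderiv i (mderiv j F)))"

definition taylor_rem :: "('a::field, 'n::finite) mfps \<Rightarrow> ('a, 'n) mfps" where
  "taylor_rem F = F - mconst (mcoeff0 F)
     - (\<Sum>i\<in>UNIV. mconst (mcoeff0 (mderiv i F)) * mvar i)
     - mconst (1 / 2) * (\<Sum>i\<in>UNIV. \<Sum>j\<in>UNIV. mconst (hess F $ i $ j) * mvar i * mvar j)"

definition sp_laplacian :: "'a::field ^ 'n::finite ^ 'n \<Rightarrow> ('a, 'n) mfps \<Rightarrow> ('a, 'n) mfps" where
  "sp_laplacian H \<phi> = - mconst (1 / 2) *
     (\<Sum>i\<in>UNIV. \<Sum>j\<in>UNIV. mconst (matrix_inv H $ i $ j) * mderiv i (mderiv j \<phi>))"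

definition sp_coeff :: "nat \<Rightarrow> ('a::field, 'n::finite) mfps \<Rightarrow> ('a, 'n) mfps \<Rightarrow> 'a" where
  "sp_coeff k F G = (\<Sum>v = 0..2 * k. 1 / of_nat (fact v * fact (k + v)) *
     mcoeff0 ((sp_laplacian (hess F) ^^ (k + v)) (G * taylor_rem F ^ v)))"


section \<open>Homogeneous coordinates\<close>

text \<open>Index type of the coordinates \<open>x\<^sub>0, x\<^sub>1, \<dots>, x\<^sub>n, x\<^sub>n\<^sub>+\<^sub>1\<close>, where \<open>n = CARD('n)\<close>.\<close>

datatype 'n hindex = Zeroth | Mid 'n | Last

lemma UNIV_hindex: "UNIV = insert Zeroth (insert Last (range Mid))"
  by (metis (full_types) UNIV_eq_I hindex.exhaust insertCI rangeI)

instance hindex :: (finite) finite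
  by standard (simp add: UNIV_hindex)

lemma card_hindex: "CARD('n::finite hindex) = CARD('n) + 2"
proof -
  have card_Mid: "card (range (Mid :: 'n \<Rightarrow> 'n hindex)) = CARD('n)"
    by (intro card_image injI) simp
  have insert2: "card (insert Zeroth (insert Last R)) = card R + 2"
    if "finite R" "Last \<notin> R" "Zeroth \<notin> R" for R :: "'n hindex set"
    using that by simp
  have "card (insert Zeroth (insert Last (range (Mid :: 'n \<Rightarrow> 'n hindex)))) =
      card (range (Mid :: 'n \<Rightarrow> 'n hindex)) + 2"
    by (intro insert2) auto
  with card_Mid show ?thesis
    by (simp only: UNIV_hindex)
qed

text \<open>The point \<open>(1, p, z)\<close> of the affine space of dimension \<open>n + 2\<close>.\<close>

definition cone_point :: "'a::one ^ 'n \<Rightarrow> 'a \<Rightarrow> 'a ^ 'n hindex" where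
  "cone_point p z = (\<chi> i. case i of Zeroth \<Rightarrow> 1 | Mid j \<Rightarrow> p $ j | Last \<Rightarrow> z)"

definition affine_part :: "'a::field ^ 'n hindex \<Rightarrow> 'a ^ 'n" where
  "affine_part X = (\<chi> i. X $ Mid i / X $ Zeroth)"

text \<open>
  The weight \<open>(n + 2) / 2\<close> is a half-integer if \<open>n\<close> is odd, so that \<open>x\<^sub>0\<^bsup>-(n+2)/2\<^esup>\<close> and hence the
  density are only determined up to sign. Identities between densities are therefore stated for the
  \<open>e\<close>-th powers of their amplitudes, where \<open>e = 1\<close> for even and \<open>e = 2\<close> for odd \<open>n\<close>;
  \<open>half_weight\<close> is the integer \<open>e (n + 2) / 2\<close>.
\<close>

definition wt_den :: "'n::finite itself \<Rightarrow> nat" where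
  "wt_den _ = (if even CARD('n) then 1 else 2)"

definition half_weight :: "'n::finite itself \<Rightarrow> nat" where
  "half_weight T = wt_den T * (CARD('n) + 2) div 2"


section \<open>Formal germs\<close>

text \<open>
  A formal germ \<open>(p, F, G)\<close> of a pair \<open>(f, g)\<close> at the point \<open>p\<close>: \<open>F\<close> and \<open>G\<close> are power series in
  \<open>x - p\<close>.
\<close>

type_synonym ('k, 'n) formal_germ = "('k ^ 'n) \<times> ('k, 'n) mfps \<times> ('k, 'n) mfps"

definition to_fract :: "'a::idom \<Rightarrow> 'a fract" where
  "to_fract a = Fract a 1"

text \<open>
  The expansion of \<open>F(t + u)\<close> as a power series in \<open>u\<close> with coefficients in \<open>k[[t]]\<close>, viewed inside
  the field of fractions: the coefficient of \<open>u\<^bsup>\<alpha>\<^esup>\<close> is the partial derivative of \<open>F\<close> of multi-order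
  \<open>\<alpha>\<close>, divided by \<open>\<Prod>i. fact (\<alpha> i)\<close>.
\<close>

definition generic_expansion ::
    "('k::field, 'n::finite) mfps \<Rightarrow> (('k, 'n) mfps fract, 'n) mfps" where
  "generic_expansion F = Abs_mfps (\<lambda>\<alpha>. to_fract (Abs_mfps (\<lambda>\<beta>.
     (\<Prod>i\<in>UNIV. of_nat ((\<alpha> i + \<beta> i) choose \<alpha> i)) * mcoeff F (midx_add \<alpha> \<beta>))))"

text \<open>
  The Hessian and the coefficients \<open>A\<^sub>k\<close> are computed at the generic point \<open>t\<close>, as elements of the
  field of fractions of \<open>k[[t]]\<close>.
\<close>

definition formal_admissible :: "('k::field, 'n::finite) formal_germ \<Rightarrow> bool" where
  "formal_admissible P \<longleftrightarrow> (case P of (p, F, G) \<Rightarrow>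
     det (hess (generic_expansion F)) \<noteq> 0 \<and> G \<noteq> 0 \<and>
     (\<forall>k\<ge>1. sp_coeff k (generic_expansion F) (generic_expansion G) = 0))"

text \<open>
  Germs in \<open>n + 2\<close> variables at a point \<open>Q\<close> with \<open>Q $ Zeroth \<noteq> 0\<close> are power series in \<open>X - Q\<close>.
  \<open>formal_dehom Q F\<close> is the germ of \<open>f(x\<^sub>1/x\<^sub>0, \<dots>, x\<^sub>n/x\<^sub>0)\<close>, for \<open>F\<close> a germ at \<open>affine_part Q\<close>.
\<close>

definition hcoord :: "'k::field ^ 'n hindex \<Rightarrow> 'n hindex \<Rightarrow> ('k, 'n::finite hindex) mfps" where
  "hcoord Q i = mconst (Q $ i) + mvar i"

definition formal_dehom ::
    "'k::field ^ 'n hindex \<Rightarrow> ('k, 'n::finite) mfps \<Rightarrow> ('k, 'n hindex) mfps" where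
  "formal_dehom Q F =
     msubst F (\<lambda>i. hcoord Q (Mid i) * minv (hcoord Q Zeroth) - mconst (affine_part Q $ i))"

text \<open>
  The density is \<open>\<delta>(h) a\<close>, where \<open>h\<close> is \<open>formal_cone\<close> and the \<open>e\<close>-th power of \<open>a\<close> is
  \<open>formal_ampl\<close>.
\<close>

definition formal_cone ::
    "'k::field ^ 'n hindex \<Rightarrow> ('k, 'n::finite) mfps \<Rightarrow> ('k, 'n hindex) mfps" where
  "formal_cone Q F = hcoord Q Last * minv (hcoord Q Zeroth) - formal_dehom Q F"

definition formal_ampl ::
    "'k::field ^ 'n hindex \<Rightarrow> ('k, 'n::finite) mfps \<Rightarrow> ('k, 'n hindex) mfps" where
  "formal_ampl Q G = formal_dehom Q G ^ wt_den TYPE('n) *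
     minv (hcoord Q Zeroth) ^ half_weight TYPE('n)"

definition formal_linear ::
    "'k::field ^ 'm ^ 'm \<Rightarrow> ('k, 'm::finite) mfps \<Rightarrow> ('k, 'm) mfps" where
  "formal_linear N \<phi> = msubst \<phi> (\<lambda>i. \<Sum>j\<in>UNIV. mconst (N $ i $ j) * mvar j)"

text \<open>
  \<open>formal_transform M c P P'\<close>: the density of \<open>P\<close>, transported by \<open>M\<close> from the point \<open>Q\<close> to
  \<open>Q' = M Q\<close>, is the density of \<open>P'\<close>, up to the constant \<open>c\<close> (on the level of \<open>e\<close>-th powers).
  As \<open>\<delta>(U h') = U\<^bsup>-1\<^esup> \<delta>(h')\<close>, the densities \<open>\<delta>(h) a\<close> and \<open>\<delta>(h') a'\<close> are equal iff \<open>h = U h'\<close> with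
  a unit \<open>U\<close> and \<open>a = U a'\<close> on \<open>h' = 0\<close>, that is, modulo \<open>h'\<close>.

  The group action proper is the case \<open>c = 1\<close>. If \<open>n\<close> is odd and the coordinate \<open>x\<^sub>0\<close> of \<open>Q'\<close> is not
  a square in the field (for instance negative in the reals), then no branch of \<open>x\<^sub>0\<^bsup>-(n+2)/2\<^esup>\<close> at \<open>Q'\<close>
  has values in the field, and it exists only after multiplication by a constant; \<open>c\<close> accounts for
  this.
\<close>

definition formal_transform ::
    "'k::field ^ 'n hindex ^ 'n hindex \<Rightarrow> 'k \<Rightarrow>
     ('k, 'n::finite) formal_germ \<Rightarrow> ('k, 'n) formal_germ \<Rightarrow> bool" where
  "formal_transform M c P P' \<longleftrightarrow> (case (P, P') of ((p, F, G), (p', F', G')) \<Rightarrow>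
     let Q = cone_point p (mcoeff0 F); Q' = M *v Q; N = matrix_inv M in
     Q' $ Zeroth \<noteq> 0 \<and> p' = affine_part Q' \<and> mcoeff0 F' = Q' $ Last / Q' $ Zeroth \<and>
     (\<exists>U V. mcoeff0 U \<noteq> 0 \<and>
        formal_linear N (formal_cone Q F) = U * formal_cone Q' F' \<and>
        U ^ wt_den TYPE('n) * formal_ampl Q' G' =
          mconst c * formal_linear N (formal_ampl Q G) + V * formal_cone Q' F'))"

text \<open>Equality of germs of pairs; if \<open>n\<close> is odd, up to the sign of \<open>g\<close>.\<close>

definition formal_same ::
    "('k::field, 'n::finite) formal_germ \<Rightarrow> ('k, 'n) formal_germ \<Rightarrow> bool" where
  "formal_same P P' \<longleftrightarrow> (case (P, P') of ((p, F, G), (p', F', G')) \<Rightarrow>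
     p = p' \<and> F = F' \<and> G ^ wt_den TYPE('n) = G' ^ wt_den TYPE('n))"

text \<open>
  The germ at the generic point \<open>p + t\<close>, defined over the field of fractions of \<open>k[[t]]\<close>, and
  the extension of scalars of a matrix to that field.
\<close>

definition generic_germ ::
    "('k::field, 'n::finite) formal_germ \<Rightarrow> (('k, 'n) mfps fract, 'n) formal_germ" where
  "generic_germ P = (case P of (p, F, G) \<Rightarrow>
     (\<chi> i. to_fract (mconst (p $ i) + mvar i), generic_expansion F, generic_expansion G))"

definition generic_matrix ::
    "'k::field ^ 'm ^ 'm \<Rightarrow> ('k, 'n::finite) mfps fract ^ 'm ^ 'm" where
  "generic_matrix M = (\<chi> i j. to_fract (mconst (M $ i $ j)))"


section \<open>Analytic germs\<close>

text \<open>To be used over the real and the complex numbers.\<close>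

definition has_mfps_expansion ::
    "('c::real_normed_field ^ 'n::finite \<Rightarrow> 'c) \<Rightarrow> 'c ^ 'n \<Rightarrow> ('c, 'n) mfps \<Rightarrow> bool" where
  "has_mfps_expansion f t F \<longleftrightarrow> (\<exists>r>0. \<forall>u. norm u < r \<longrightarrow>
     ((\<lambda>\<alpha>. mcoeff F \<alpha> * (\<Prod>i\<in>UNIV. (u $ i) ^ \<alpha> i)) has_sum f (t + u)) UNIV)"

definition manalytic_at :: "('c::real_normed_field ^ 'n::finite \<Rightarrow> 'c) \<Rightarrow> 'c ^ 'n \<Rightarrow> bool" where
  "manalytic_at f t \<longleftrightarrow> (\<exists>F. has_mfps_expansion f t F)"

definition taylor :: "('c::real_normed_field ^ 'n::finite \<Rightarrow> 'c) \<Rightarrow> 'c ^ 'n \<Rightarrow> ('c, 'n) mfps" where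
  "taylor f t = (THE F. has_mfps_expansion f t F)"

text \<open>A germ of a pair \<open>(f, g)\<close> at \<open>p\<close>; only the values of the functions near \<open>p\<close> matter.\<close>

type_synonym ('c, 'n) analytic_germ = "('c ^ 'n) \<times> ('c ^ 'n \<Rightarrow> 'c) \<times> ('c ^ 'n \<Rightarrow> 'c)"

definition analytic_admissible :: "('c::real_normed_field, 'n::finite) analytic_germ \<Rightarrow> bool" where
  "analytic_admissible P \<longleftrightarrow> (case P of (p, f, g) \<Rightarrow>
     manalytic_at f p \<and> manalytic_at g p \<and>
     \<not> (\<forall>\<^sub>F t in nhds p. det (hess (taylor f t)) = 0) \<and>
     \<not> (\<forall>\<^sub>F t in nhds p. g t = 0) \<and>
     (\<forall>k\<ge>1. \<forall>\<^sub>F t in nhds p. det (hess (taylor f t)) \<noteq> 0 \<longrightarrow>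
        sp_coeff k (taylor f t) (taylor g t) = 0))"

definition analytic_cone ::
    "('c::real_normed_field ^ 'n::finite \<Rightarrow> 'c) \<Rightarrow> 'c ^ 'n hindex \<Rightarrow> 'c" where
  "analytic_cone f X = X $ Last / X $ Zeroth - f (affine_part X)"

definition analytic_ampl ::
    "('c::real_normed_field ^ 'n::finite \<Rightarrow> 'c) \<Rightarrow> 'c ^ 'n hindex \<Rightarrow> 'c" where
  "analytic_ampl g X = g (affine_part X) ^ wt_den TYPE('n) / (X $ Zeroth) ^ half_weight TYPE('n)"

text \<open>The analytic counterpart of \<^const>\<open>formal_transform\<close>.\<close>

definition analytic_transform ::
    "'c::real_normed_field ^ 'n hindex ^ 'n hindex \<Rightarrow> 'c \<Rightarrow>
     ('c, 'n::finite) analytic_germ \<Rightarrow> ('c, 'n) analytic_germ \<Rightarrow> bool" where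
  "analytic_transform M c P P' \<longleftrightarrow> (case (P, P') of ((p, f, g), (p', f', g')) \<Rightarrow>
     let Q = cone_point p (f p); Q' = M *v Q; N = matrix_inv M in
     Q' $ Zeroth \<noteq> 0 \<and> p' = affine_part Q' \<and> f' p' = Q' $ Last / Q' $ Zeroth \<and>
     manalytic_at f' p' \<and> manalytic_at g' p' \<and>
     (\<exists>U. manalytic_at U Q' \<and> U Q' \<noteq> 0 \<and>
        (\<forall>\<^sub>F X in nhds Q'. analytic_cone f (N *v X) = U X * analytic_cone f' X) \<and>
        (\<forall>\<^sub>F X in nhds Q'. analytic_cone f' X = 0 \<longrightarrow>
           U X ^ wt_den TYPE('n) * analytic_ampl g' X = c * analytic_ampl g (N *v X))))"

definition analytic_same ::
    "('c::real_normed_field, 'n::finite) analytic_germ \<Rightarrow> ('c, 'n) analytic_germ \<Rightarrow> bool" where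
  "analytic_same P P' \<longleftrightarrow> (case (P, P') of ((p, f, g), (p', f', g')) \<Rightarrow>
     p = p' \<and> manalytic_at f' p \<and> manalytic_at g' p \<and> (\<forall>\<^sub>F t in nhds p. f t = f' t) \<and>
     (\<forall>\<^sub>F t in nhds p. g t ^ wt_den TYPE('n) = g' t ^ wt_den TYPE('n)))"

text \<open>
  The points at which the transformed cone can again be written as a graph, with constants from \<open>C\<close>.
\<close>

definition good_points ::
    "'c set \<Rightarrow> 'c::real_normed_field ^ 'n hindex ^ 'n hindex \<Rightarrow> ('c ^ 'n::finite \<Rightarrow> 'c) \<Rightarrow>
     ('c ^ 'n \<Rightarrow> 'c) \<Rightarrow> ('c ^ 'n) set" where
  "good_points C M f g = {t. \<exists>c\<in>C. \<exists>P'. analytic_transform M c (t, f, g) P'}"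


section \<open>Partially defined actions of the general linear group\<close>

text \<open>
  \<open>T M c P P'\<close> says that \<open>M\<close> transforms \<open>P\<close> into \<open>P'\<close>, up to the constant \<open>c\<close>. The transformation
  preserves the set \<open>A\<close>, is single-valued and well-defined modulo \<open>E\<close>, and satisfies the laws of an
  action wherever it is defined.
\<close>

definition partial_GL_action ::
    "('g \<Rightarrow> bool) \<Rightarrow> ('g \<Rightarrow> 'g \<Rightarrow> bool) \<Rightarrow>
     ('k::field ^ 'm ^ 'm::finite \<Rightarrow> 'k \<Rightarrow> 'g \<Rightarrow> 'g \<Rightarrow> bool) \<Rightarrow> bool" where
  "partial_GL_action A E T \<longleftrightarrow>
     (\<forall>M c P P'. invertible M \<and> c \<noteq> 0 \<and> A P \<and> T M c P P' \<longrightarrow> A P') \<and>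
     (\<forall>M c P P' P''. invertible M \<and> c \<noteq> 0 \<and> A P \<and> T M c P P' \<longrightarrow>
        (T M c P P'' \<longleftrightarrow> E P' P'')) \<and>
     (\<forall>M c P P' P''. invertible M \<and> c \<noteq> 0 \<and> A P \<and> T M c P P' \<and> E P P'' \<longrightarrow> T M c P'' P') \<and>
     (\<forall>P. A P \<longrightarrow> T (mat 1) 1 P P) \<and>
     (\<forall>M c P P'. invertible M \<and> c \<noteq> 0 \<and> A P \<and> T M c P P' \<longrightarrow>
        T (matrix_inv M) (inverse c) P' P) \<and>
     (\<forall>M M' c c' P P' P''. invertible M \<and> invertible M' \<and> c \<noteq> 0 \<and> c' \<noteq> 0 \<and>
        A P \<and> T M c P P' \<and> T M' c' P' P'' \<longrightarrow> T (M' ** M) (c' * c) P P'')"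

end

theory Submission
  imports Defs
begin

text \<open>
  At a point \<open>t\<close> put \<open>\<phi>(u) = f(t + u) - f(t) - \<Sum>\<^sub>i \<partial>\<^sub>if(t) u\<^sub>i\<close> and let \<open>A\<^sub>k[b]\<close> be the coefficient of stationary phase
  with amplitude \<open>b\<close>. Integration by parts gives \<open>A\<^sub>k\<^sub>+\<^sub>1[b \<partial>\<^sub>i\<phi>] = -A\<^sub>k[\<partial>\<^sub>ib]\<close>, and differentiation
  in the expansion parameter gives \<open>A\<^sub>k\<^sub>+\<^sub>1[\<phi> b] = -(k + n/2) A\<^sub>k[b]\<close>; together with \<open>A\<^sub>0\<close> these relations
  determine all \<open>A\<^sub>k\<close>. Differentiating in \<open>t\<close>, one finds that admissibility of \<open>(f, g)\<close> means
  \<open>A\<^sub>k\<^sub>+\<^sub>1[g q] = 0\<close> at the generic point for all \<open>k\<close> and all \<open>q\<close> that are polynomials of degree at most \<open>k\<close> in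
  \<open>1, u, f\<close>, that is, in the linear coordinates of the cone. This condition does not depend on the chart
  of the cone: a linear map \<open>M\<close> replaces \<open>\<phi>\<close> by its multiple by a coordinate \<open>\<lambda> = x\<^sub>0 \<circ> M\<close>, and
  \<open>b' \<mapsto> A\<^sub>k[g \<lambda>\<^sup>k\<^sup>-\<^sup>1 b']\<close> satisfies the relations that characterise the functionals of the image germ.

  The image of \<open>(f, g)\<close> exists at a point exactly if \<open>\<lambda>\<close> and the derivative of the transformed equation of the cone
  along \<open>x\<^sub>n\<^sub>+\<^sub>1\<close> do not vanish there; both are nonzero functions because the Hessian is nondegenerate. In the
  analytic case all series involved converge, so that everything reduces to Taylor series, and the
  identity theorem gives density.
\<close>

section \<open>Power series: order, substitution, inverses\<close>

text \<open>Under a change of chart every ingredient of the sum in \<open>sp_coeff\<close> changes: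
  Hessian, remainder and Laplacian. The proof therefore never compares two such sums; only the
  relations between the functionals are transformed. The weight (n + 2)/2 is forced by them.
  Logarithmic derivatives of \<lambda> occur with factor k - 1 from the amplitude g \<lambda>^(k-1)
  and with factor -(k + n/2) from the phase relation, so k cancels and -(n/2 + 1) remains; the
  Jacobian of the chart supplies n + 1. Since half-integral powers enter through logarithmic
  derivatives alone, invariance requires no root of \<lambda>; existence does. Differentiation in t
  requires coefficients that are functions of t. The generic point is therefore taken literally, as
  a point over the fraction field of \<open>k[[t]]\<close>, and the theory at a point is applied
  over that field. Many identities of series are proved by induction on the order of vanishing:
  derivatives of a defect are combinations of defects of the same shape.\<close>

abbreviation mdeg :: "('n::finite \<Rightarrow> nat) \<Rightarrow> nat" where
  "mdeg \<alpha> \<equiv> sum \<alpha> UNIV"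

abbreviation unit_idx :: "'n \<Rightarrow> 'n \<Rightarrow> nat" where
  "unit_idx i \<equiv> (\<lambda>j. if j = i then 1 else 0)"

lemma mcoeff_zero [simp]: "mcoeff 0 \<alpha> = 0"
  by (simp add: zero_mfps_def)

lemma mcoeff_one: "mcoeff 1 \<alpha> = (if \<alpha> = (\<lambda>_. 0) then 1 else 0)"
  by (simp add: one_mfps_def)

lemma mcoeff_add [simp]: "mcoeff (F + G) \<alpha> = mcoeff F \<alpha> + mcoeff G \<alpha>"
  by (simp add: plus_mfps_def)

lemma mcoeff_diff [simp]: "mcoeff (F - G) \<alpha> = mcoeff F \<alpha> - mcoeff G \<alpha>"
  by (simp add: minus_mfps_def)

lemma mcoeff_uminus [simp]: "mcoeff (- F) \<alpha> = - mcoeff F \<alpha>"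
  by (simp add: uminus_mfps_def)

lemma mcoeff_sum [simp]: "mcoeff (sum f A) \<alpha> = (\<Sum>x\<in>A. mcoeff (f x) \<alpha>)"
  by (induction A rule: infinite_finite_induct) auto

lemma mcoeff_mult:
  "mcoeff (F * G) \<alpha> = (\<Sum>p\<in>midx_splits \<alpha>. mcoeff F (fst p) * mcoeff G (snd p))"
  by (simp add: times_mfps_def case_prod_unfold)

lemma mcoeff_mconst: "mcoeff (mconst c) \<alpha> = (if \<alpha> = (\<lambda>_. 0) then c else 0)"
  by (simp add: mconst_def)

lemma mcoeff0_mconst [simp]: "mcoeff0 (mconst c) = c"
  by (simp add: mcoeff_mconst)

lemma mcoeff_mvar: "mcoeff (mvar i) \<alpha> = (if \<alpha> = unit_idx i then 1 else 0)"
  by (simp add: mvar_def)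

lemma mcoeff0_mvar [simp]: "mcoeff0 (mvar i) = 0"
  by (auto simp: mcoeff_mvar fun_eq_iff)

lemma mcoeff0_one [simp]: "mcoeff0 1 = 1"
  by (simp add: mcoeff_one)

lemma mcoeff_mderiv:
  "mcoeff (mderiv i F) \<alpha> = of_nat (Suc (\<alpha> i)) * mcoeff F (\<alpha>(i := Suc (\<alpha> i)))"
  by (simp add: mderiv_def)

lemma midx_splits_zero: "midx_splits (\<lambda>_. 0) = {(\<lambda>_. 0, \<lambda>_. 0)}"
  by (auto simp: midx_splits_def fun_eq_iff)

lemma mcoeff0_mult [simp]: "mcoeff0 (F * G) = mcoeff0 F * mcoeff0 G"
  by (simp add: mcoeff_mult midx_splits_zero)

lemma mcoeff0_power [simp]: "mcoeff0 (F ^ k) = mcoeff0 F ^ k"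
  by (induction k) auto

lemma mcoeff_mconst_mult [simp]: "mcoeff (mconst c * F) \<alpha> = c * mcoeff F \<alpha>"
proof -
  have "mcoeff (mconst c * F) \<alpha> =
      (\<Sum>p\<in>midx_splits \<alpha>. if p = (\<lambda>_. 0, \<alpha>) then c * mcoeff F \<alpha> else 0)"
    unfolding mcoeff_mult by (rule sum.cong) (auto simp: mcoeff_mconst midx_splits_def)
  also have "\<dots> = c * mcoeff F \<alpha>"
    by (subst sum.delta) (simp_all add: mem_midx_splits)
  finally show ?thesis .
qed

lemma mcoeff_mvar_mult:
  "mcoeff (mvar i * F) \<alpha> = (if \<alpha> i = 0 then 0 else mcoeff F (\<alpha>(i := \<alpha> i - 1)))"
proof -
  have eq: "p = (unit_idx i, \<alpha>(i := \<alpha> i - 1)) \<and> \<alpha> i \<noteq> 0"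
    if "p \<in> midx_splits \<alpha>" "fst p = unit_idx i" for p
  proof -
    have "\<alpha> = midx_add (unit_idx i) (snd p)"
      using that by (metis (mono_tags, lifting) mem_midx_splits prod.collapse)
    then show ?thesis
      using that(2) by (auto simp: prod_eq_iff fun_eq_iff)
  qed
  have "mcoeff (mvar i * F) \<alpha> =
      (\<Sum>p\<in>midx_splits \<alpha>. if p = (unit_idx i, \<alpha>(i := \<alpha> i - 1))
         then (if \<alpha> i = 0 then 0 else mcoeff F (\<alpha>(i := \<alpha> i - 1))) else 0)"
    unfolding mcoeff_mult
  proof (rule sum.cong[OF refl])
    fix p assume p: "p \<in> midx_splits \<alpha>"
    then show "mcoeff (mvar i) (fst p) * mcoeff F (snd p) =
      (if p = (unit_idx i, \<alpha>(i := \<alpha> i - 1))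
         then (if \<alpha> i = 0 then 0 else mcoeff F (\<alpha>(i := \<alpha> i - 1))) else 0)"
    proof (cases "fst p = unit_idx i")
      case True
      then have "p = (unit_idx i, \<alpha>(i := \<alpha> i - 1))" "\<alpha> i \<noteq> 0"
        using eq[OF p] by blast+
      then show ?thesis by (simp add: mcoeff_mvar)
    next
      case False
      then have "p \<noteq> (unit_idx i, \<alpha>(i := \<alpha> i - 1))" by auto
      with False show ?thesis by (simp add: mcoeff_mvar)
    qed
  qed
  also have "\<dots> = (if \<alpha> i = 0 then 0 else mcoeff F (\<alpha>(i := \<alpha> i - 1)))"
  proof -
    have "(unit_idx i, \<alpha>(i := \<alpha> i - 1)) \<in> midx_splits \<alpha>" if "\<alpha> i \<noteq> 0"
      using that by (auto simp: mem_midx_splits)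
    then show ?thesis by (subst sum.delta) auto
  qed
  finally show ?thesis .
qed

lemma mconst_0 [simp]: "mconst 0 = 0"
  and mconst_1 [simp]: "mconst 1 = 1"
  and mconst_add: "mconst (a + b) = mconst a + mconst b"
  and mconst_diff: "mconst (a - b) = mconst a - mconst b"
  and mconst_uminus: "mconst (- a) = - mconst a"
  by (auto intro!: mfps_eqI simp: mcoeff_mconst mcoeff_one)

lemma mconst_mult: "mconst (a * b) = (mconst a * mconst b :: ('a::comm_ring_1, 'n::finite) mfps)"
  by (rule mfps_eqI) (simp add: mcoeff_mconst)

lemma mconst_power: "mconst (a ^ k) = (mconst a ^ k :: ('a::comm_ring_1, 'n::finite) mfps)"
  by (induction k) (auto simp: mconst_mult)

lemma mconst_sum: "mconst (sum f A) = (\<Sum>x\<in>A. mconst (f x) :: ('a::comm_ring_1, 'n::finite) mfps)"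
  by (induction A rule: infinite_finite_induct) (auto simp: mconst_add)

lemma mconst_of_nat: "mconst (of_nat k) = (of_nat k :: ('a::comm_ring_1, 'n::finite) mfps)"
  by (induction k) (auto simp: mconst_add)

lemma mconst_numeral: "mconst (numeral k) = (numeral k :: ('a::comm_ring_1, 'n::finite) mfps)"
  by (metis mconst_of_nat of_nat_numeral)

lemma mcoeff_of_nat_mult [simp]: "mcoeff (of_nat k * F) \<alpha> = of_nat k * mcoeff F \<alpha>"
  by (metis mcoeff_mconst_mult mconst_of_nat)

lemma mconst_eq_iff [simp]: "mconst a = mconst b \<longleftrightarrow> a = b"
  by (metis mcoeff0_mconst)

lemma mconst_eq_0_iff [simp]: "(mconst a :: ('a::comm_ring_1, 'n::finite) mfps) = 0 \<longleftrightarrow> a = 0"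
  by (metis mconst_0 mcoeff0_mconst)

instance mfps :: ("{comm_ring_1, ring_char_0}", finite) ring_char_0
proof
  show "inj (of_nat :: nat \<Rightarrow> ('a, 'b) mfps)"
    by (rule injI) (metis mconst_of_nat mconst_eq_iff of_nat_eq_iff)
qed

text \<open>The fraction field of a series ring thereby becomes a field of characteristic 0, so
  whatever is proved for points over such fields holds for the generic point.\<close>

instance fract :: ("{idom, ring_char_0}") field_char_0
proof
  show "inj (of_nat :: nat \<Rightarrow> 'a fract)"
    by (rule injI) (simp add: Fract_of_nat_eq[symmetric] eq_fract)
qed

lemma mderiv_add: "mderiv i (F + G) = mderiv i F + mderiv i G"
  and mderiv_diff: "mderiv i (F - G) = mderiv i F - mderiv i G"
  and mderiv_uminus: "mderiv i (- F) = - mderiv i F"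
  and mderiv_0 [simp]: "mderiv i 0 = 0"
  by (auto intro!: mfps_eqI simp: mcoeff_mderiv algebra_simps)

lemma mderiv_sum: "mderiv i (sum f A) = (\<Sum>x\<in>A. mderiv i (f x))"
  by (induction A rule: infinite_finite_induct) (auto simp: mderiv_add)

lemma mderiv_mconst [simp]: "mderiv i (mconst c) = 0"
  by (rule mfps_eqI) (auto simp: mcoeff_mderiv mcoeff_mconst fun_eq_iff)

lemma mderiv_1 [simp]: "mderiv i 1 = 0"
  by (metis mderiv_mconst mconst_1)

lemma mderiv_mvar: "mderiv i (mvar j) = (if i = j then 1 else 0)"
proof (rule mfps_eqI)
  fix \<alpha>
  have "\<alpha>(i := Suc (\<alpha> i)) = unit_idx j \<longleftrightarrow> i = j \<and> \<alpha> = (\<lambda>_. 0)"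
  proof
    assume e: "\<alpha>(i := Suc (\<alpha> i)) = unit_idx j"
    have "i = j" using fun_cong[OF e, of i] by (auto split: if_splits)
    moreover have "\<alpha> k = 0" for k
      using fun_cong[OF e, of k] \<open>i = j\<close> by (cases "k = i") (auto split: if_splits)
    ultimately show "i = j \<and> \<alpha> = (\<lambda>_. 0)" by auto
  qed (auto simp: fun_eq_iff)
  then show "mcoeff (mderiv i (mvar j)) \<alpha> = mcoeff (if i = j then 1 else 0) \<alpha>"
    by (auto simp: mcoeff_mderiv mcoeff_mvar mcoeff_one)
qed

lemma mderiv_commute: "mderiv i (mderiv j F) = mderiv j (mderiv i F)"
  by (rule mfps_eqI) (cases "i = j"; simp add: mcoeff_mderiv fun_upd_twist algebra_simps)

lemma midx_splits_swap: "prod.swap p \<in> midx_splits \<alpha> \<longleftrightarrow> p \<in> midx_splits \<alpha>"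
  by (auto simp: midx_splits_def add.commute)

text \<open>The factor \<open>of_nat (fst p i)\<close> removes the splits whose first part does not
  contain \<open>i\<close>; the others arise uniquely by raising the first part of a split of
  \<open>\<alpha>\<close>. This is the combinatorial half of the Leibniz rule.\<close>

lemma sum_midx_splits_upd:
  fixes \<alpha> :: "'n::finite \<Rightarrow> nat" and f :: "_ \<Rightarrow> 'a::comm_ring_1"
  shows "(\<Sum>p\<in>midx_splits (\<alpha>(i := Suc (\<alpha> i))). of_nat (fst p i) * f p) =
    (\<Sum>p\<in>midx_splits \<alpha>. of_nat (Suc (fst p i)) * f ((fst p)(i := Suc (fst p i)), snd p))"
proof -
  let ?\<alpha> = "\<alpha>(i := Suc (\<alpha> i))"
  have "(\<Sum>p\<in>midx_splits ?\<alpha>. of_nat (fst p i) * f p) =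
      (\<Sum>p | p \<in> midx_splits ?\<alpha> \<and> fst p i \<noteq> 0. of_nat (fst p i) * f p)"
    by (rule sum.mono_neutral_right) auto
  also have "\<dots> = (\<Sum>p\<in>midx_splits \<alpha>. of_nat (Suc (fst p i)) * f ((fst p)(i := Suc (fst p i)), snd p))"
  proof (rule sum.reindex_bij_witness[where i = "\<lambda>p. ((fst p)(i := Suc (fst p i)), snd p)"
          and j = "\<lambda>p. ((fst p)(i := fst p i - 1), snd p)"])
    fix p assume p: "p \<in> {p. p \<in> midx_splits ?\<alpha> \<and> fst p i \<noteq> 0}"
    show "((fst p)(i := fst p i - 1), snd p) \<in> midx_splits \<alpha>"
      unfolding mem_midx_splits
    proof
      fix k
      have "fst p k + snd p k = ?\<alpha> k"
        using p by (auto simp: midx_splits_def dest: fun_cong[of _ _ k])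
      then show "midx_add ((fst p)(i := fst p i - 1)) (snd p) k = \<alpha> k"
        using p by (cases "k = i") auto
    qed
  qed (auto simp: midx_splits_def fun_eq_iff)
  finally show ?thesis .
qed

lemma mderiv_mult:
  fixes F G :: "('a::comm_ring_1, 'n::finite) mfps"
  shows "mderiv i (F * G) = mderiv i F * G + F * mderiv i G"
proof (rule mfps_eqI)
  fix \<alpha> :: "'n \<Rightarrow> nat"
  let ?\<alpha> = "\<alpha>(i := Suc (\<alpha> i))"
  have gen: "(\<Sum>p\<in>midx_splits ?\<alpha>. of_nat (fst p i) * (mcoeff F (fst p) * mcoeff G (snd p))) =
     mcoeff (mderiv i F * G) \<alpha>" for F G :: "('a, 'n) mfps"
    by (subst sum_midx_splits_upd) (simp add: mcoeff_mult mcoeff_mderiv mult.assoc del: of_nat_Suc)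
  note 1 = gen[of F G]
  have 2: "(\<Sum>p\<in>midx_splits ?\<alpha>. of_nat (snd p i) * (mcoeff F (fst p) * mcoeff G (snd p))) =
     mcoeff (F * mderiv i G) \<alpha>"
  proof -
    have "(\<Sum>p\<in>midx_splits ?\<alpha>. of_nat (snd p i) * (mcoeff F (fst p) * mcoeff G (snd p))) =
        (\<Sum>p\<in>midx_splits ?\<alpha>. of_nat (fst p i) * (mcoeff G (fst p) * mcoeff F (snd p)))"
      by (rule sum.reindex_bij_witness[where i = prod.swap and j = prod.swap])
         (simp_all add: midx_splits_swap mult_ac)
    also have "\<dots> = mcoeff (F * mderiv i G) \<alpha>"
      unfolding gen by (simp add: mult.commute)
    finally show ?thesis .
  qed
  have "mcoeff (mderiv i (F * G)) \<alpha> = of_nat (Suc (\<alpha> i)) *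
      (\<Sum>p\<in>midx_splits ?\<alpha>. mcoeff F (fst p) * mcoeff G (snd p))"
    by (simp only: mcoeff_mderiv mcoeff_mult)
  \<comment> \<open>The outer factor is the exponent of \<open>i\<close> in the raised index; each
    split divides it between the two series.\<close>
  also have "\<dots> = (\<Sum>p\<in>midx_splits ?\<alpha>. of_nat (fst p i) * (mcoeff F (fst p) * mcoeff G (snd p)) +
      of_nat (snd p i) * (mcoeff F (fst p) * mcoeff G (snd p)))"
    unfolding sum_distrib_left
  proof (rule sum.cong[OF refl])
    fix p assume "p \<in> midx_splits ?\<alpha>"
    then have "fst p i + snd p i = Suc (\<alpha> i)"
      by (auto simp: midx_splits_def fun_eq_iff dest: spec[of _ i])
    then show "of_nat (Suc (\<alpha> i)) * (mcoeff F (fst p) * mcoeff G (snd p)) =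
        of_nat (fst p i) * (mcoeff F (fst p) * mcoeff G (snd p)) +
        of_nat (snd p i) * (mcoeff F (fst p) * mcoeff G (snd p))"
      by (metis distrib_right of_nat_add)
  qed
  also have "\<dots> = mcoeff (mderiv i F * G + F * mderiv i G) \<alpha>"
    unfolding sum.distrib 1 2 by simp
  finally show "mcoeff (mderiv i (F * G)) \<alpha> = mcoeff (mderiv i F * G + F * mderiv i G) \<alpha>" .
qed

lemma mderiv_mconst_mult [simp]: "mderiv i (mconst c * F) = mconst c * mderiv i F"
  by (simp add: mderiv_mult)

lemma mderiv_power: "mderiv i (F ^ k) = of_nat k * F ^ (k - 1) * mderiv i F"
proof (induction k)
  case (Suc k)
  show ?case
  proof (cases k)
    case (Suc m)
    have "mderiv i (F ^ Suc k) = mderiv i F * F ^ k + F * mderiv i (F ^ k)"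
      by (simp add: mderiv_mult)
    also have "\<dots> = mderiv i F * F ^ k + of_nat k * (F * F ^ (k - 1)) * mderiv i F"
      unfolding Suc.IH by (simp add: mult_ac)
    also have "F * F ^ (k - 1) = F ^ k"
      using Suc by simp
    finally show ?thesis
      by (simp add: algebra_simps)
  qed simp
qed simp

lemma mderiv_prod:
  assumes "finite A"
  shows "mderiv i (prod f A) = (\<Sum>x\<in>A. mderiv i (f x) * prod f (A - {x}))"
  using assms
proof (induction A)
  case (insert a A)
  have "prod f (insert a A - {x}) = f a * prod f (A - {x})" if "x \<in> A" for x
    using that insert.hyps by (subst insert_Diff_if) auto
  then have "(\<Sum>x\<in>A. mderiv i (f x) * prod f (insert a A - {x})) = f a * mderiv i (prod f A)"
    by (simp add: insert.IH sum_distrib_left mult_ac)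
  moreover have "insert a A - {a} = A"
    using insert.hyps by auto
  ultimately show ?case
    using insert.hyps by (simp add: mderiv_mult)
qed simp

section \<open>Order of vanishing\<close>

definition mord :: "nat \<Rightarrow> ('a::zero, 'n::finite) mfps \<Rightarrow> bool" where
  "mord d F \<longleftrightarrow> (\<forall>\<alpha>. mdeg \<alpha> < d \<longrightarrow> mcoeff F \<alpha> = 0)"

lemma mord_0 [simp]: "mord 0 F"
  by (simp add: mord_def)

lemma mord_zero [simp]: "mord d 0"
  by (simp add: mord_def)

lemma mdeg_eq_0: "mdeg \<alpha> = 0 \<longleftrightarrow> \<alpha> = (\<lambda>_. 0)"
  by (auto simp: fun_eq_iff)

lemma mord_1: "mord (Suc 0) F \<longleftrightarrow> mcoeff0 F = 0"
  by (auto simp: mord_def mdeg_eq_0)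

lemma mord_mono: "mord d F \<Longrightarrow> e \<le> d \<Longrightarrow> mord e F"
  by (auto simp: mord_def)

lemma mord_all: "(\<And>d. mord d F) \<Longrightarrow> F = 0"
  by (rule mfps_eqI) (auto simp: mord_def)

lemma mord_add: "mord d F \<Longrightarrow> mord d G \<Longrightarrow> mord d (F + G)"
  and mord_diff: "mord d F \<Longrightarrow> mord d G \<Longrightarrow> mord d (F - G)"
  and mord_uminus: "mord d F \<Longrightarrow> mord d (- F)"
  by (auto simp: mord_def)

lemma mord_sum: "(\<And>x. x \<in> A \<Longrightarrow> mord d (f x)) \<Longrightarrow> mord d (sum f A)"
  by (auto simp: mord_def)

lemma mord_mult:
  fixes F G :: "('a::comm_ring_1, 'n::finite) mfps"
  shows "mord a F \<Longrightarrow> mord b G \<Longrightarrow> mord (a + b) (F * G)"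
  unfolding mord_def
proof (intro allI impI)
  fix \<alpha> :: "'n \<Rightarrow> nat"
  assume F: "\<forall>\<alpha>. mdeg \<alpha> < a \<longrightarrow> mcoeff F \<alpha> = 0" and G: "\<forall>\<alpha>. mdeg \<alpha> < b \<longrightarrow> mcoeff G \<alpha> = 0"
    and "mdeg \<alpha> < a + b"
  have "mcoeff F (fst p) * mcoeff G (snd p) = 0" if "p \<in> midx_splits \<alpha>" for p
  proof -
    have "mdeg \<alpha> = mdeg (fst p) + mdeg (snd p)"
      using that by (auto simp: midx_splits_def sum.distrib)
    then have "mdeg (fst p) < a \<or> mdeg (snd p) < b"
      using \<open>mdeg \<alpha> < a + b\<close> by linarith
    then show ?thesis
      using F G by auto
  qed
  then show "mcoeff (F * G) \<alpha> = 0"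
    unfolding mcoeff_mult by (rule sum.neutral[OF ballI])
qed

lemma mord_mult_left: "mord d G \<Longrightarrow> mord d (F * G)"
  and mord_mult_right: "mord d F \<Longrightarrow> mord d (F * G)"
  using mord_mult[of 0 F d G] mord_mult[of d F 0 G] by simp_all

lemma mord_power: "mord a F \<Longrightarrow> mord (k * a) (F ^ k)"
  by (induction k) (auto intro: mord_mult)

lemma mord_prod: "(\<And>x. x \<in> A \<Longrightarrow> mord (a x) (f x)) \<Longrightarrow> mord (sum a A) (prod f A)"
  by (induction A rule: infinite_finite_induct) (auto intro: mord_mult)

lemma mdeg_upd_Suc: "mdeg (\<alpha>(i := Suc (\<alpha> i))) = Suc (mdeg \<alpha>)"
proof -
  have "\<alpha>(i := Suc (\<alpha> i)) = (\<lambda>j. \<alpha> j + unit_idx i j)" by auto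
  then show ?thesis by (simp add: sum.distrib sum.delta)
qed

lemma mord_mderiv: "mord (Suc d) F \<Longrightarrow> mord d (mderiv i F)"
  unfolding mord_def mcoeff_mderiv by (metis Suc_less_eq mdeg_upd_Suc mult_zero_right)

text \<open>In characteristic 0 a coefficient of positive degree can be recovered from a partial
  derivative. This drives the inductions behind the series identities: check the constant term, then
  lower the order by differentiating.\<close>

lemma mord_Suc_iff:
  fixes F :: "('a::{idom, ring_char_0}, 'n::finite) mfps"
  shows "mord (Suc d) F \<longleftrightarrow> mcoeff0 F = 0 \<and> (\<forall>i. mord d (mderiv i F))"
proof
  assume "mord (Suc d) F"
  then show "mcoeff0 F = 0 \<and> (\<forall>i. mord d (mderiv i F))"
    using mord_mderiv mord_mono[of "Suc d" F "Suc 0"] by (auto simp: mord_1)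
next
  assume F: "mcoeff0 F = 0 \<and> (\<forall>i. mord d (mderiv i F))"
  show "mord (Suc d) F"
    unfolding mord_def
  proof (intro allI impI)
    fix \<alpha> :: "'n \<Rightarrow> nat" assume "mdeg \<alpha> < Suc d"
    show "mcoeff F \<alpha> = 0"
    proof (cases "\<alpha> = (\<lambda>_. 0)")
      case False
      then obtain i where i: "\<alpha> i \<noteq> 0" by auto
      define \<beta> where "\<beta> = \<alpha>(i := \<alpha> i - 1)"
      have \<alpha>: "\<alpha> = \<beta>(i := Suc (\<beta> i))" using i by (auto simp: \<beta>_def)
      then have "mdeg \<beta> < d" using mdeg_upd_Suc[of \<beta> i] \<open>mdeg \<alpha> < Suc d\<close> by simp
      then have "mcoeff (mderiv i F) \<beta> = 0" using F by (auto simp: mord_def)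
      then show ?thesis unfolding mcoeff_mderiv using \<alpha>
        by (metis mult_eq_0_iff of_nat_eq_0_iff nat.distinct(1))
    qed (use F in auto)
  qed
qed

lemma mfps_eq_0_if_mderiv_0:
  fixes F :: "('a::{idom, ring_char_0}, 'n::finite) mfps"
  assumes "mcoeff0 F = 0" "\<And>i. mderiv i F = 0"
  shows "F = 0"
proof (rule mord_all)
  fix d show "mord d F" by (cases d) (auto simp: mord_Suc_iff assms)
qed

lemma mord_mvar: "mord (Suc 0) (mvar i)"
  by (simp add: mord_1)

lemma finite_mdeg_le: "finite {\<alpha> :: 'n::finite \<Rightarrow> nat. mdeg \<alpha> \<le> d}"
proof (rule finite_subset[OF _ finite_midx_le[of "\<lambda>_. d"]])
  have "\<alpha> i \<le> mdeg \<alpha>" for \<alpha> :: "'n \<Rightarrow> nat" and i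
    by (rule member_le_sum) auto
  then show "{\<alpha> :: 'n \<Rightarrow> nat. mdeg \<alpha> \<le> d} \<subseteq> {\<beta>. \<forall>i. \<beta> i \<le> d}"
    using order_trans by blast
qed

section \<open>Substitution of series\<close>

abbreviation mmono :: "('n::finite \<Rightarrow> ('a::comm_ring_1, 'm::finite) mfps) \<Rightarrow> ('n \<Rightarrow> nat) \<Rightarrow> ('a, 'm) mfps" where
  "mmono s \<alpha> \<equiv> (\<Prod>i\<in>UNIV. s i ^ \<alpha> i)"

lemma mord_mmono: "(\<And>i. mcoeff0 (s i) = 0) \<Longrightarrow> mord (mdeg \<alpha>) (mmono s \<alpha>)"
proof (rule mord_prod)
  fix i assume "\<And>i. mcoeff0 (s i) = 0"
  then show "mord (\<alpha> i) (s i ^ \<alpha> i)" using mord_power[of "Suc 0" "s i" "\<alpha> i"] by (simp add: mord_1)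
qed

text \<open>The summation bound in \<open>msubst\<close> depends on the coefficient asked for. A
  bound common to all coefficients gives a polynomial expression, to which the rules for finite sums
  and products apply.\<close>

definition msubst_upto where
  "msubst_upto d F s = (\<Sum>\<alpha> | mdeg \<alpha> \<le> d. mconst (mcoeff F \<alpha>) * mmono s \<alpha>)"

lemma mcoeff_msubst:
  fixes F :: "('a::comm_ring_1, 'n::finite) mfps" and s :: "'n \<Rightarrow> ('a, 'm::finite) mfps"
  assumes "\<And>i. mcoeff0 (s i) = 0" "mdeg \<beta> \<le> d"
  shows "mcoeff (msubst F s) \<beta> = mcoeff (msubst_upto d F s) \<beta>"
proof -
  have "mcoeff (mmono s \<alpha>) \<beta> = 0" if "mdeg \<beta> < mdeg \<alpha>" for \<alpha>
    using mord_mmono[of s \<alpha>] assms that by (auto simp: mord_def)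
  then have "(\<Sum>\<alpha> | mdeg \<alpha> \<le> mdeg \<beta>. mcoeff F \<alpha> * mcoeff (mmono s \<alpha>) \<beta>) =
      (\<Sum>\<alpha> | mdeg \<alpha> \<le> d. mcoeff F \<alpha> * mcoeff (mmono s \<alpha>) \<beta>)"
    using assms(2) by (intro sum.mono_neutral_left finite_mdeg_le) (auto simp: not_le)
  then show ?thesis
    by (simp add: msubst_def msubst_upto_def)
qed

lemma mord_msubst_upto:
  assumes "\<And>i. mcoeff0 (s i) = 0"
  shows "mord (Suc d) (msubst F s - msubst_upto d F s)"
  using mcoeff_msubst[of s _ d F] assms by (simp add: mord_def less_Suc_eq_le)

lemma msubst_add: "msubst (F + G) s = msubst F s + msubst G s"
  and msubst_diff: "msubst (F - G) s = msubst F s - msubst G s"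
  and msubst_uminus: "msubst (- F) s = - msubst F s"
  and msubst_0 [simp]: "msubst 0 s = 0"
  by (auto intro!: mfps_eqI simp: msubst_def algebra_simps sum.distrib sum_subtractf sum_negf)

lemma msubst_sum: "msubst (sum f A) s = (\<Sum>x\<in>A. msubst (f x) s)"
  by (induction A rule: infinite_finite_induct) (auto simp: msubst_add)

lemma msubst_mconst [simp]:
  fixes s :: "'n::finite \<Rightarrow> ('a::comm_ring_1, 'm::finite) mfps"
  shows "msubst (mconst c) s = mconst c"
proof (rule mfps_eqI)
  fix \<beta>
  have "mcoeff (msubst (mconst c) s) \<beta> = (\<Sum>\<alpha> :: 'n \<Rightarrow> nat | mdeg \<alpha> \<le> mdeg \<beta>. if \<alpha> = (\<lambda>_. 0) then c * mcoeff (1 :: ('a, 'm) mfps) \<beta> else 0)"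
    unfolding msubst_def mcoeff_Abs by (intro sum.cong refl) (auto simp: mcoeff_mconst)
  also have "\<dots> = mcoeff (mconst c) \<beta>"
    by (subst sum.delta) (auto simp: finite_mdeg_le mcoeff_one mcoeff_mconst)
  finally show "mcoeff (msubst (mconst c) s) \<beta> = mcoeff (mconst c) \<beta>" .
qed

lemma msubst_1 [simp]: "msubst 1 s = 1"
  by (metis msubst_mconst mconst_1)

lemma mcoeff0_msubst [simp]: "mcoeff0 (msubst F s) = mcoeff0 F"
proof -
  have "{\<alpha> :: 'c \<Rightarrow> nat. mdeg \<alpha> \<le> 0} = {\<lambda>_. 0}"
    using mdeg_eq_0 by auto
  then show ?thesis by (simp add: msubst_def)
qed

lemma mmono_unit_idx: "mmono s (unit_idx i) = s i"
proof -
  have "mmono s (unit_idx i) = (\<Prod>j\<in>UNIV. if j = i then s j else 1)"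
    by (rule prod.cong) auto
  then show ?thesis by (simp add: prod.delta)
qed

lemma msubst_mvar:
  assumes "\<And>i. mcoeff0 (s i) = 0"
  shows "msubst (mvar i) s = s i"
proof -
  have "msubst_upto d (mvar i) s = s i" if "d \<ge> 1" for d
  proof -
    have "msubst_upto d (mvar i) s = (\<Sum>\<alpha> | mdeg \<alpha> \<le> d. if \<alpha> = unit_idx i then mmono s \<alpha> else 0)"
      unfolding msubst_upto_def by (rule sum.cong) (auto simp: mcoeff_mvar)
    also have "\<dots> = mmono s (unit_idx i)"
      using that by (subst sum.delta) (auto simp: finite_mdeg_le sum.delta)
    finally show ?thesis by (simp only: mmono_unit_idx)
  qed
  then have "mord (Suc d) (msubst (mvar i) s - s i)" for d
    using mord_msubst_upto[of s "Suc d" "mvar i"] assms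
    by (auto elim: mord_mono[of "Suc (Suc d)"])
  then have "mord d (msubst (mvar i) s - s i)" for d
    by (meson mord_mono le_SucI le_refl)
  then have "msubst (mvar i) s - s i = 0"
    by (rule mord_all)
  then show ?thesis by simp
qed

lemma mderiv_mmono:
  "mderiv j (mmono s \<alpha>) = (\<Sum>i\<in>UNIV. of_nat (\<alpha> i) * mmono s (\<alpha>(i := \<alpha> i - 1)) * mderiv j (s i))"
proof -
  have "mderiv j (s i ^ \<alpha> i) * (\<Prod>k\<in>UNIV - {i}. s k ^ \<alpha> k) =
     of_nat (\<alpha> i) * mmono s (\<alpha>(i := \<alpha> i - 1)) * mderiv j (s i)" for i
  proof -
    have "mmono s (\<alpha>(i := \<alpha> i - 1)) = s i ^ (\<alpha> i - 1) * (\<Prod>k\<in>UNIV - {i}. s k ^ (\<alpha>(i := \<alpha> i - 1)) k)"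
      by (subst prod.remove[of _ i]) auto
    also have "(\<Prod>k\<in>UNIV - {i}. s k ^ (\<alpha>(i := \<alpha> i - 1)) k) = (\<Prod>k\<in>UNIV - {i}. s k ^ \<alpha> k)"
      by (rule prod.cong) auto
    finally show ?thesis by (simp add: mderiv_power mult_ac)
  qed
  then show ?thesis by (simp add: mderiv_prod)
qed

text \<open>For polynomial truncations this is an exact reindexing with the degree bound lowered by
  one; the truncation errors have order at least \<open>d\<close> on both sides, for every
  \<open>d\<close>.\<close>

lemma mderiv_msubst:
  fixes F :: "('a::comm_ring_1, 'n::finite) mfps" and s :: "'n \<Rightarrow> ('a, 'm::finite) mfps"
  assumes s: "\<And>i. mcoeff0 (s i) = 0"
  shows "mderiv j (msubst F s) = (\<Sum>i\<in>UNIV. msubst (mderiv i F) s * mderiv j (s i))"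
proof -
  have upto: "mderiv j (msubst_upto (Suc d) F s) =
      (\<Sum>i\<in>UNIV. msubst_upto d (mderiv i F) s * mderiv j (s i))" for d
  proof -
    have *: "(\<Sum>\<alpha> | mdeg \<alpha> \<le> Suc d. mconst (mcoeff F \<alpha>) * (of_nat (\<alpha> i) * mmono s (\<alpha>(i := \<alpha> i - 1)))) =
      msubst_upto d (mderiv i F) s" for i
    proof -
      let ?S = "{\<alpha> :: 'n \<Rightarrow> nat. mdeg \<alpha> \<le> Suc d \<and> \<alpha> i \<noteq> 0}"
      have "(\<Sum>\<alpha> | mdeg \<alpha> \<le> Suc d. mconst (mcoeff F \<alpha>) * (of_nat (\<alpha> i) * mmono s (\<alpha>(i := \<alpha> i - 1)))) =
        (\<Sum>\<alpha>\<in>?S. mconst (mcoeff F \<alpha>) * (of_nat (\<alpha> i) * mmono s (\<alpha>(i := \<alpha> i - 1))))"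
        by (rule sum.mono_neutral_right) (auto simp: finite_mdeg_le)
      also have "\<dots> = (\<Sum>\<alpha> | mdeg \<alpha> \<le> d. mconst (mcoeff (mderiv i F) \<alpha>) * mmono s \<alpha>)"
    proof (rule sum.reindex_bij_witness[where i = "\<lambda>\<alpha>. \<alpha>(i := Suc (\<alpha> i))" and j = "\<lambda>\<alpha>. \<alpha>(i := \<alpha> i - 1)"])
      fix \<alpha> :: "'n \<Rightarrow> nat"
      assume a: "\<alpha> \<in> ?S"
      define \<beta> where "\<beta> = \<alpha>(i := \<alpha> i - 1)"
      have "\<alpha> = \<beta>(i := Suc (\<beta> i))" using a by (auto simp: \<beta>_def)
      then have "mdeg \<beta> \<le> d" using mdeg_upd_Suc[of \<beta> i] a by simp
      then show "\<alpha>(i := \<alpha> i - 1) \<in> {\<alpha>. mdeg \<alpha> \<le> d}" by (simp add: \<beta>_def)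
    next
      fix \<beta> :: "'n \<Rightarrow> nat" assume "\<beta> \<in> {\<alpha>. mdeg \<alpha> \<le> d}"
      then show "\<beta>(i := Suc (\<beta> i)) \<in> ?S"
        using mdeg_upd_Suc[of \<beta> i] by simp
    next
      fix \<alpha> :: "'n \<Rightarrow> nat"
      assume a: "\<alpha> \<in> ?S"
      define \<beta> where "\<beta> = \<alpha>(i := \<alpha> i - 1)"
      have \<alpha>: "\<alpha> = \<beta>(i := Suc (\<beta> i))" and \<alpha>i: "\<alpha> i = Suc (\<beta> i)" using a by (auto simp: \<beta>_def)
      have "mconst (mcoeff (mderiv i F) \<beta>) * mmono s \<beta> = mconst (mcoeff F \<alpha>) * (of_nat (\<alpha> i) * mmono s \<beta>)"
        unfolding mcoeff_mderiv \<alpha>[symmetric] mconst_mult mconst_of_nat unfolding \<alpha>i by (simp only: mult_ac)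
      then show "mconst (mcoeff (mderiv i F) (\<alpha>(i := \<alpha> i - 1))) * mmono s (\<alpha>(i := \<alpha> i - 1)) =
          mconst (mcoeff F \<alpha>) * (of_nat (\<alpha> i) * mmono s (\<alpha>(i := \<alpha> i - 1)))"
        unfolding \<beta>_def .
    qed auto
      finally show ?thesis unfolding msubst_upto_def .
    qed
    have "mderiv j (msubst_upto (Suc d) F s) = (\<Sum>i\<in>UNIV. (\<Sum>\<alpha> | mdeg \<alpha> \<le> Suc d.
        mconst (mcoeff F \<alpha>) * (of_nat (\<alpha> i) * mmono s (\<alpha>(i := \<alpha> i - 1)))) * mderiv j (s i))"
      unfolding msubst_upto_def mderiv_sum mderiv_mconst_mult mderiv_mmono sum_distrib_left sum_distrib_right
      by (subst sum.swap) (simp only: mult.assoc)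
    then show ?thesis by (simp only: *)
  qed
  let ?R = "\<Sum>i\<in>UNIV. msubst (mderiv i F) s * mderiv j (s i)"
  have "mord d (mderiv j (msubst F s) - ?R)" for d
  proof -
    have "mord d (mderiv j (msubst F s - msubst_upto (Suc d) F s))"
      by (rule mord_mono[OF mord_mderiv[OF mord_msubst_upto]]) (simp_all add: s)
    moreover have "mord d (\<Sum>i\<in>UNIV. (msubst (mderiv i F) s - msubst_upto d (mderiv i F) s) * mderiv j (s i))"
      by (intro mord_sum mord_mult_right mord_mono[OF mord_msubst_upto]) (simp_all add: s)
    ultimately have "mord d (mderiv j (msubst F s - msubst_upto (Suc d) F s) -
      (\<Sum>i\<in>UNIV. (msubst (mderiv i F) s - msubst_upto d (mderiv i F) s) * mderiv j (s i)))"
      by (rule mord_diff)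
    then show ?thesis
      by (simp add: mderiv_diff upto left_diff_distrib sum_subtractf)
  qed
  then show ?thesis using mord_all by fastforce
qed

text \<open>By the Leibniz and chain rules the derivatives of the defect are combinations of defects
  in which one factor has been differentiated, so the order of the defect exceeds every
  bound.\<close>

lemma msubst_mult:
  fixes F :: "('a::{idom, ring_char_0}, 'n::finite) mfps" and s :: "'n \<Rightarrow> ('a, 'm::finite) mfps"
  assumes s: "\<And>i. mcoeff0 (s i) = 0"
  shows "msubst (F * G) s = msubst F s * msubst G s"
proof -
  have "mord d (msubst (F * G) s - msubst F s * msubst G s)" for d
  proof (induction d arbitrary: F G)
    case (Suc d)
    have "mderiv j (msubst (F * G) s - msubst F s * msubst G s) = (\<Sum>i\<in>UNIV.
      ((msubst (mderiv i F * G) s - msubst (mderiv i F) s * msubst G s) +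
       (msubst (F * mderiv i G) s - msubst F s * msubst (mderiv i G) s)) * mderiv j (s i))" for j
      by (simp add: mderiv_diff mderiv_mult mderiv_msubst[OF s] msubst_add algebra_simps
          sum.distrib sum_subtractf sum_distrib_left)
    then show ?case
      by (auto simp: mord_Suc_iff intro!: mord_sum mord_mult_right mord_add Suc.IH)
  qed simp
  then show ?thesis using mord_all by fastforce
qed

lemma msubst_power:
  fixes F :: "('a::{idom, ring_char_0}, 'n::finite) mfps" and s :: "'n \<Rightarrow> ('a, 'm::finite) mfps"
  shows "(\<And>i. mcoeff0 (s i) = 0) \<Longrightarrow> msubst (F ^ k) s = msubst F s ^ k"
  by (induction k) (auto simp: msubst_mult)

lemma msubst_assoc:
  fixes F :: "('a::{idom, ring_char_0}, 'n::finite) mfps"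
    and s :: "'n \<Rightarrow> ('a, 'm::finite) mfps" and r :: "'m \<Rightarrow> ('a, 'l::finite) mfps"
  assumes s: "\<And>i. mcoeff0 (s i) = 0" and r: "\<And>i. mcoeff0 (r i) = 0"
  shows "msubst (msubst F s) r = msubst F (\<lambda>i. msubst (s i) r)"
proof -
  have s': "mcoeff0 (msubst (s i) r) = 0" for i by (simp add: s)
  have "mord d (msubst (msubst F s) r - msubst F (\<lambda>i. msubst (s i) r))" for d
  proof (induction d arbitrary: F)
    case (Suc d)
    have "mderiv j (msubst (msubst F s) r - msubst F (\<lambda>i. msubst (s i) r)) = (\<Sum>i\<in>UNIV.
      (msubst (msubst (mderiv i F) s) r - msubst (mderiv i F) (\<lambda>i. msubst (s i) r)) *
        mderiv j (msubst (s i) r))" for j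
      unfolding mderiv_diff mderiv_msubst[OF s'] left_diff_distrib sum_subtractf mderiv_msubst[OF r]
        mderiv_msubst[OF s] msubst_sum msubst_mult[OF r] sum_distrib_left sum_distrib_right
      by (subst sum.swap) (simp add: mult_ac)
    then show ?case
      by (auto simp: mord_Suc_iff intro!: mord_sum mord_mult_right Suc.IH)
  qed simp
  then show ?thesis using mord_all by fastforce
qed

lemma msubst_ident [simp]:
  fixes F :: "('a::{idom, ring_char_0}, 'n::finite) mfps"
  shows "msubst F mvar = F"
proof -
  have "mord d (msubst F mvar - F)" for d
  proof (induction d arbitrary: F)
    case (Suc d)
    have "mderiv j (msubst F mvar - F) = msubst (mderiv j F) mvar - mderiv j F" for j
    proof -
      have "(\<Sum>i\<in>UNIV. msubst (mderiv i F) mvar * mderiv j (mvar i)) =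
          (\<Sum>i\<in>UNIV. if j = i then msubst (mderiv i F) mvar else 0)"
        by (rule sum.cong) (auto simp: mderiv_mvar)
      then show ?thesis by (simp add: mderiv_diff mderiv_msubst)
    qed
    then show ?case using Suc.IH by (auto simp: mord_Suc_iff)
  qed simp
  then show ?thesis using mord_all by fastforce
qed

lemma mord_msubst:
  assumes s: "\<And>i. mcoeff0 (s i) = 0" and F: "mord d F"
  shows "mord d (msubst F s)"
  unfolding mord_def
proof (intro allI impI)
  fix \<beta> :: "'c \<Rightarrow> nat" assume \<beta>: "mdeg \<beta> < d"
  have "mcoeff F \<alpha> = 0" if "mdeg \<alpha> \<le> mdeg \<beta>" for \<alpha>
    using F that \<beta> by (auto simp: mord_def)
  then show "mcoeff (msubst F s) \<beta> = 0"
    by (auto simp: msubst_def intro!: sum.neutral)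
qed

section \<open>Multiplicative inverses\<close>

lemma mult_minv:
  fixes F :: "('a::field, 'n::finite) mfps"
  assumes F: "mcoeff0 F \<noteq> 0"
  shows "F * minv F = 1"
proof -
  define c where "c = mcoeff0 F"
  define X where "X = 1 - mconst (1 / c) * F"
  have c: "c \<noteq> 0" using F by (simp add: c_def)
  have FX: "F = mconst c * (1 - X)"
    by (rule mfps_eqI) (use c in \<open>simp add: X_def\<close>)
  have X: "mord (Suc 0) X"
    using c by (simp add: X_def mord_1 c_def)
  \<comment> \<open>The geometric series for \<open>1 / (1 - X)\<close>: as \<open>X\<close> has no
    constant term, powers beyond the degree of \<alpha> do not reach its coefficient.\<close>
  define S where "S = Abs_mfps (\<lambda>\<alpha>. \<Sum>k\<le>mdeg \<alpha>. mcoeff (X ^ k) \<alpha>)"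
  have XS: "mord (Suc d) (S - (\<Sum>k\<le>d. X ^ k))" for d
    unfolding mord_def
  proof (intro allI impI)
    fix \<alpha> :: "'n \<Rightarrow> nat" assume \<alpha>: "mdeg \<alpha> < Suc d"
    have "mcoeff (X ^ k) \<alpha> = 0" if "k > mdeg \<alpha>" for k
      using mord_power[OF X, of k] that by (auto simp: mord_def)
    then have "(\<Sum>k\<le>mdeg \<alpha>. mcoeff (X ^ k) \<alpha>) = (\<Sum>k\<le>d. mcoeff (X ^ k) \<alpha>)"
      using \<alpha> by (intro sum.mono_neutral_left) auto
    then show "mcoeff (S - (\<Sum>k\<le>d. X ^ k)) \<alpha> = 0"
      by (simp add: S_def)
  qed
  have "mord d ((1 - X) * S - 1)" for d
  proof -
    have geo: "(1 - X) * (\<Sum>k\<le>d. X ^ k) = 1 - X ^ Suc d"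
      by (rule sum_gp_basic)
    have "(1 - X) * S - 1 = (1 - X) * (S - (\<Sum>k\<le>d. X ^ k)) + ((1 - X) * (\<Sum>k\<le>d. X ^ k) - 1)"
      by (simp add: algebra_simps)
    also have "\<dots> = (1 - X) * (S - (\<Sum>k\<le>d. X ^ k)) - X ^ Suc d"
      unfolding geo by simp
    finally show ?thesis
      using mord_mono[OF mord_mult_left[OF XS[of d], of "1 - X"], of d] mord_mono[OF mord_power[OF X, of "Suc d"], of d]
      by (simp add: mord_diff)
  qed
  then have "(1 - X) * S = 1" using mord_all by fastforce
  moreover have "F * (mconst (1 / c) * S) = mconst c * mconst (1 / c) * ((1 - X) * S)"
    by (simp add: FX mult_ac)
  ultimately have "F * (mconst (1 / c) * S) = mconst (c * (1 / c))"
    by (simp only: mconst_mult mult_1_right)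
  then have ex: "F * (mconst (1 / c) * S) = 1" using c by simp
  moreover have "G = mconst (1 / c) * S" if "F * G = 1" for G
  proof -
    have "F * (G - mconst (1 / c) * S) = 0" "F \<noteq> 0"
      using ex that by (auto simp: right_diff_distrib)
    then show ?thesis by simp
  qed
  ultimately show ?thesis
    unfolding minv_def by (rule theI2)
qed

lemma minv_unique:
  fixes F :: "('a::field, 'n::finite) mfps"
  assumes "F * G = 1"
  shows "minv F = G"
proof -
  have "mcoeff0 F * mcoeff0 G = 1" using assms by (metis mcoeff0_mult mcoeff0_one)
  then have "F * minv F = 1" by (intro mult_minv) auto
  then have "F * (minv F - G) = 0" "F \<noteq> 0"
    using assms by (auto simp: right_diff_distrib)
  then show ?thesis by simp
qed

lemma mcoeff0_minv [simp]:
  fixes F :: "('a::field, 'n::finite) mfps"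
  shows "mcoeff0 F \<noteq> 0 \<Longrightarrow> mcoeff0 (minv F) = inverse (mcoeff0 F)"
  by (metis mult_minv mcoeff0_mult mcoeff0_one inverse_unique)

lemma mderiv_minv:
  fixes F :: "('a::field, 'n::finite) mfps"
  assumes "mcoeff0 F \<noteq> 0"
  shows "mderiv i (minv F) = - mderiv i F * minv F * minv F"
proof -
  have "mderiv i (F * minv F) = 0" using mult_minv[OF assms] by simp
  then have "mderiv i F * minv F + F * mderiv i (minv F) = 0" by (simp add: mderiv_mult)
  then have "minv F * (F * mderiv i (minv F)) = minv F * (- mderiv i F * minv F)"
    by (metis add.commute add_eq_0_iff mult_minus_left)
  then show ?thesis
    using mult_minv[OF assms] by (metis mult.assoc mult.commute mult_1)
qed

lemma msubst_minv:
  fixes F :: "('a::field_char_0, 'n::finite) mfps" and s :: "'n \<Rightarrow> ('a, 'm::finite) mfps"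
  assumes "\<And>i. mcoeff0 (s i) = 0" "mcoeff0 F \<noteq> 0"
  shows "msubst (minv F) s = minv (msubst F s)"
  by (metis assms minv_unique msubst_mult mult_minv msubst_1)

section \<open>The functionals \<open>A\<^sub>k\<close> and their characterisation\<close>

definition phase :: "('a::comm_ring_1, 'n::finite) mfps \<Rightarrow> ('a, 'n) mfps" where
  "phase F = F - mconst (mcoeff0 F) - (\<Sum>i\<in>UNIV. mconst (mcoeff0 (mderiv i F)) * mvar i)"

definition lin_form :: "'a::comm_ring_1 ^ 'n::finite ^ 'n \<Rightarrow> 'n \<Rightarrow> ('a, 'n) mfps" where
  "lin_form H i = (\<Sum>j\<in>UNIV. mconst (H $ i $ j) * mvar j)"

definition quad_form :: "'a::field ^ 'n::finite ^ 'n \<Rightarrow> ('a, 'n) mfps" where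
  "quad_form H = mconst (1 / 2) * (\<Sum>i\<in>UNIV. mvar i * lin_form H i)"

text \<open>An arbitrary matrix \<open>B\<close> takes the role of the inverse Hessian; the
  commutation rules are derived from symmetry and \<open>H ** B = mat 1\<close>.\<close>

definition lap :: "'a::field ^ 'n::finite ^ 'n \<Rightarrow> ('a, 'n) mfps \<Rightarrow> ('a, 'n) mfps" where
  "lap B \<phi> = - mconst (1 / 2) * (\<Sum>i\<in>UNIV. \<Sum>j\<in>UNIV. mconst (B $ i $ j) * mderiv i (mderiv j \<phi>))"

lemma sp_laplacian_eq_lap: "sp_laplacian H = lap (matrix_inv H)"
  by (rule ext) (simp add: sp_laplacian_def lap_def)

lemma taylor_rem_eq: "taylor_rem F = phase F - quad_form (hess F)"
  by (simp add: taylor_rem_def phase_def quad_form_def lin_form_def sum_distrib_left mult_ac)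

lemma sum_delta_mult [simp]:
  fixes f :: "'n::finite \<Rightarrow> 'a::comm_ring_1"
  shows "(\<Sum>j\<in>UNIV. f j * (if i = j then 1 else 0)) = f i"
    "(\<Sum>j\<in>UNIV. (if i = j then 1 else 0) * f j) = f i"
    "(\<Sum>j\<in>UNIV. f j * (if j = i then 1 else 0)) = f i"
    "(\<Sum>j\<in>UNIV. (if j = i then 1 else 0) * f j) = f i"
  by (simp_all add: if_distrib[of "\<lambda>x. f _ * x"] if_distrib[of "\<lambda>x. x * f _"] cong: if_cong)

lemma mderiv_lin_form: "mderiv l (lin_form H i) = mconst (H $ i $ l)"
  by (simp add: lin_form_def mderiv_sum mderiv_mvar)

lemma mcoeff0_lin_form [simp]: "mcoeff0 (lin_form H i) = 0"
  by (simp add: lin_form_def)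

lemma mderiv_phase: "mderiv i (phase F) = mderiv i F - mconst (mcoeff0 (mderiv i F))"
  by (simp add: phase_def mderiv_diff mderiv_sum mderiv_mvar)

lemma mcoeff0_phase [simp]: "mcoeff0 (phase F) = 0"
  by (simp add: phase_def)

lemma hess_symmetric: "hess F $ i $ j = hess F $ j $ i"
  by (simp add: hess_def mderiv_commute)

lemma mderiv_quad_form:
  fixes H :: "'a::field_char_0 ^ 'n::finite ^ 'n"
  assumes "\<And>i j. H $ i $ j = H $ j $ i"
  shows "mderiv l (quad_form H) = lin_form H l"
proof -
  have "mderiv l (\<Sum>i\<in>UNIV. mvar i * lin_form H i) =
      (\<Sum>i\<in>UNIV. (if l = i then 1 else 0) * lin_form H i) + (\<Sum>i\<in>UNIV. mvar i * mconst (H $ i $ l))"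
    unfolding mderiv_sum mderiv_mult mderiv_lin_form mderiv_mvar sum.distrib ..
  also have "\<dots> = lin_form H l + (\<Sum>i\<in>UNIV. mconst (H $ l $ i) * mvar i)"
    using assms by (simp add: mult.commute)
  also have "\<dots> = 2 * lin_form H l"
    by (simp add: lin_form_def)
  finally have "mderiv l (quad_form H) = mconst (1 / 2) * mconst 2 * lin_form H l"
    by (simp add: quad_form_def mconst_numeral)
  then show ?thesis by (simp add: mconst_mult[symmetric])
qed

lemma mcoeff0_quad_form [simp]: "mcoeff0 (quad_form H) = 0"
  by (simp add: quad_form_def)

lemma mderiv_taylor_rem:
  fixes F :: "('a::field_char_0, 'n::finite) mfps"
  shows "mderiv i (taylor_rem F) = mderiv i (phase F) - lin_form (hess F) i"
  by (simp add: taylor_rem_eq mderiv_diff mderiv_quad_form hess_symmetric)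

lemma mord_phase:
  fixes F :: "('a::field_char_0, 'n::finite) mfps"
  shows "mord 2 (phase F)"
  by (simp add: numeral_2_eq_2 mord_Suc_iff mderiv_phase)

lemma mord_taylor_rem:
  fixes F :: "('a::field_char_0, 'n::finite) mfps"
  shows "mord 3 (taylor_rem F)"
proof -
  have "mcoeff0 (mderiv j (mderiv i (taylor_rem F))) = 0" for i j
    unfolding mderiv_taylor_rem mderiv_diff mderiv_phase mderiv_lin_form
    by (simp add: hess_def mderiv_commute)
  moreover have "mcoeff0 (mderiv i (taylor_rem F)) = 0" for i
    by (simp add: mderiv_taylor_rem mderiv_phase)
  ultimately show ?thesis
    by (simp add: numeral_3_eq_3 mord_Suc_iff taylor_rem_eq)
qed

lemma lap_add: "lap B (\<phi> + \<psi>) = lap B \<phi> + lap B \<psi>"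
  by (simp add: lap_def mderiv_add distrib_left sum.distrib)

lemma lap_0 [simp]: "lap B 0 = 0"
  by (simp add: lap_def)

lemma lap_mconst_mult: "lap B (mconst c * \<phi>) = mconst c * lap B \<phi>"
  unfolding lap_def mderiv_mconst_mult sum_distrib_left by (simp only: mult_ac)

lemma lap_sum: "lap B (sum f A) = (\<Sum>x\<in>A. lap B (f x))"
  by (induction A rule: infinite_finite_induct) (auto simp: lap_add)

lemma lap_uminus: "lap B (- \<phi>) = - lap B \<phi>"
  using lap_mconst_mult[of B "-1" \<phi>] by (simp add: mconst_uminus)

lemma lap_diff: "lap B (\<phi> - \<psi>) = lap B \<phi> - lap B \<psi>"
  using lap_add[of B \<phi> "- \<psi>"] by (simp add: lap_uminus)

lemma mderiv_lap: "mderiv l (lap B \<phi>) = lap B (mderiv l \<phi>)"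
proof -
  have "mderiv l (mderiv i (mderiv j \<phi>)) = mderiv i (mderiv j (mderiv l \<phi>))" for i j
    by (metis mderiv_commute)
  then show ?thesis
    by (simp add: lap_def mderiv_mult mderiv_sum mderiv_uminus)
qed

lemma lap_funpow_add: "(lap B ^^ N) (\<phi> + \<psi>) = (lap B ^^ N) \<phi> + (lap B ^^ N) \<psi>"
  by (induction N) (auto simp: lap_add)

lemma lap_funpow_mconst: "(lap B ^^ N) (mconst c * \<phi>) = mconst c * (lap B ^^ N) \<phi>"
  by (induction N) (auto simp: lap_mconst_mult)

lemma lap_funpow_0 [simp]: "(lap B ^^ N) 0 = 0"
  by (induction N) auto

lemma lap_funpow_of_nat: "(lap B ^^ N) (of_nat k * \<phi>) = of_nat k * (lap B ^^ N) \<phi>"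
  using lap_funpow_mconst[of N B "of_nat k" \<phi>] by (simp add: mconst_of_nat)

lemma lap_funpow_sum: "(lap B ^^ N) (sum f A) = (\<Sum>x\<in>A. (lap B ^^ N) (f x))"
  by (induction A rule: infinite_finite_induct) (auto simp: lap_funpow_add)

lemma lap_funpow_mderiv: "(lap B ^^ N) (mderiv l \<phi>) = mderiv l ((lap B ^^ N) \<phi>)"
  by (induction N) (auto simp: mderiv_lap)

lemma mord_lap: "mord (Suc (Suc d)) \<phi> \<Longrightarrow> mord d (lap B \<phi>)"
  unfolding lap_def by (intro mord_mult_left mord_sum mord_mderiv)

lemma mord_lap_funpow: "mord (2 * N + d) \<phi> \<Longrightarrow> mord d ((lap B ^^ N) \<phi>)"
  by (induction N arbitrary: d) (auto intro!: mord_lap)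

text \<open>A second-order operator meets the coordinate once through each of its two derivatives;
  the two equal contributions cancel the factor 1/2.\<close>

lemma lap_mvar_mult:
  fixes B :: "'a::field_char_0 ^ 'n::finite ^ 'n"
  assumes B: "\<And>i j. B $ i $ j = B $ j $ i"
  shows "lap B (mvar j * \<phi>) = mvar j * lap B \<phi> - (\<Sum>l\<in>UNIV. mconst (B $ j $ l) * mderiv l \<phi>)"
proof -
  have d: "mderiv a (mderiv b (mvar j * \<phi>)) = mvar j * mderiv a (mderiv b \<phi>)
      + ((if j = b then 1 else 0) * mderiv a \<phi> + (if j = a then 1 else 0) * mderiv b \<phi>)" for a b
    by (simp add: mderiv_mult mderiv_mvar mderiv_add)
  have "(\<Sum>a\<in>UNIV. \<Sum>b\<in>UNIV. mconst (B $ a $ b) * mderiv a (mderiv b (mvar j * \<phi>))) =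
    mvar j * (\<Sum>a\<in>UNIV. \<Sum>b\<in>UNIV. mconst (B $ a $ b) * mderiv a (mderiv b \<phi>)) +
    ((\<Sum>a\<in>UNIV. \<Sum>b\<in>UNIV. (mconst (B $ a $ b) * mderiv a \<phi>) * (if j = b then 1 else 0)) +
     (\<Sum>a\<in>UNIV. (\<Sum>b\<in>UNIV. mconst (B $ a $ b) * mderiv b \<phi>) * (if j = a then 1 else 0)))"
    unfolding d by (simp add: algebra_simps sum.distrib sum_distrib_left sum_distrib_right)
  also have "\<dots> = mvar j * (\<Sum>a\<in>UNIV. \<Sum>b\<in>UNIV. mconst (B $ a $ b) * mderiv a (mderiv b \<phi>)) +
     (\<Sum>l\<in>UNIV. mconst (B $ j $ l) * mderiv l \<phi>) * 2"
    unfolding sum_delta_mult using B by simp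
  finally have "lap B (mvar j * \<phi>) = mvar j * lap B \<phi>
     - mconst (1 / 2) * mconst 2 * (\<Sum>l\<in>UNIV. mconst (B $ j $ l) * mderiv l \<phi>)"
    by (simp add: lap_def mconst_numeral algebra_simps)
  then show ?thesis by (simp add: mconst_mult[symmetric])
qed

section \<open>Gaussian integration by parts\<close>

locale sp_data =
  fixes H B :: "'a::field_char_0 ^ 'n::finite ^ 'n"
  assumes H_sym: "\<And>i j. H $ i $ j = H $ j $ i"
    and B_sym: "\<And>i j. B $ i $ j = B $ j $ i"
    and HB: "H ** B = mat 1"
begin

lemma HB_sum: "(\<Sum>j\<in>UNIV. H $ i $ j * B $ j $ l) = (if i = l then 1 else 0)"
  using HB by (simp add: vec_eq_iff matrix_matrix_mult_def mat_def)

text \<open>Since \<open>H\<close> and \<open>B\<close> are inverse to each other, the commutator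
  with a component of the gradient of the quadratic form is a plain partial derivative.\<close>

lemma lap_lin_form_mult: "lap B (lin_form H i * \<phi>) = lin_form H i * lap B \<phi> - mderiv i \<phi>"
proof -
  have "lap B (lin_form H i * \<phi>) = (\<Sum>j\<in>UNIV. mconst (H $ i $ j) * lap B (mvar j * \<phi>))"
    by (simp add: lin_form_def sum_distrib_right mult.assoc lap_sum lap_mconst_mult)
  also have "\<dots> = lin_form H i * lap B \<phi> -
      (\<Sum>l\<in>UNIV. mconst (\<Sum>j\<in>UNIV. H $ i $ j * B $ j $ l) * mderiv l \<phi>)"
    unfolding lap_mvar_mult[OF B_sym] right_diff_distrib sum_subtractf lin_form_def mconst_sum
      mconst_mult sum_distrib_right sum_distrib_left
    by (subst (2) sum.swap) (simp add: mult.assoc)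
  also have "(\<Sum>l\<in>UNIV. mconst (\<Sum>j\<in>UNIV. H $ i $ j * B $ j $ l) * mderiv l \<phi>) = mderiv i \<phi>"
    unfolding HB_sum if_distrib[of mconst] mconst_0 mconst_1 by simp
  finally show ?thesis .
qed

lemma lap_funpow_lin_form_mult:
  "(lap B ^^ Suc N) (lin_form H i * \<phi>) =
    lin_form H i * (lap B ^^ Suc N) \<phi> - of_nat (Suc N) * mderiv i ((lap B ^^ N) \<phi>)"
proof (induction N)
  case 0
  show ?case by (simp add: lap_lin_form_mult)
next
  case (Suc N)
  have "(lap B ^^ Suc (Suc N)) (lin_form H i * \<phi>) = lap B (lin_form H i * (lap B ^^ Suc N) \<phi>)
      - of_nat (Suc N) * mderiv i (lap B ((lap B ^^ N) \<phi>))"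
    using lap_mconst_mult[of B "of_nat (Suc N)"]
    unfolding funpow.simps(2)[of "Suc N"] o_apply Suc.IH lap_diff mderiv_lap mconst_of_nat by simp
  then show ?case
    by (simp add: lap_lin_form_mult algebra_simps)
qed

text \<open>At the origin the linear form vanishes and the commutator term alone survives:
  integration by parts against the Gaussian.\<close>

lemma mcoeff0_lap_lin_form:
  "mcoeff0 ((lap B ^^ Suc N) (lin_form H i * \<phi>)) = - of_nat (Suc N) * mcoeff0 ((lap B ^^ N) (mderiv i \<phi>))"
  unfolding lap_funpow_lin_form_mult lap_funpow_mderiv mcoeff_diff mcoeff_of_nat_mult
  by (simp del: of_nat_Suc)

text \<open>The Laplacian lowers the degree by two, so its commutator with the Euler field is twice
  itself.\<close>

lemma lap_euler:
  "lap B (\<Sum>j\<in>UNIV. mvar j * mderiv j \<phi>) = (\<Sum>j\<in>UNIV. mvar j * mderiv j (lap B \<phi>)) + 2 * lap B \<phi>"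
proof -
  have "lap B (\<Sum>j\<in>UNIV. mvar j * mderiv j \<phi>) = (\<Sum>j\<in>UNIV. mvar j * mderiv j (lap B \<phi>)) -
      (\<Sum>j\<in>UNIV. \<Sum>l\<in>UNIV. mconst (B $ j $ l) * mderiv l (mderiv j \<phi>))"
    by (simp add: lap_sum lap_mvar_mult[OF B_sym] sum_subtractf mderiv_lap)
  also have "(\<Sum>j\<in>UNIV. \<Sum>l\<in>UNIV. mconst (B $ j $ l) * mderiv l (mderiv j \<phi>)) =
      (\<Sum>j\<in>UNIV. \<Sum>l\<in>UNIV. mconst (B $ j $ l) * mderiv j (mderiv l \<phi>))"
    by (simp add: mderiv_commute)
  also have "\<dots> = - (mconst 2 * lap B \<phi>)"
    by (simp add: lap_def mult.assoc[symmetric] mconst_mult[symmetric])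
  finally show ?thesis by (simp add: mconst_numeral)
qed

lemma lap_funpow_euler:
  "(lap B ^^ N) (\<Sum>j\<in>UNIV. mvar j * mderiv j \<phi>) =
    (\<Sum>j\<in>UNIV. mvar j * mderiv j ((lap B ^^ N) \<phi>)) + of_nat (2 * N) * (lap B ^^ N) \<phi>"
proof (induction N)
  case (Suc N)
  have "lap B (of_nat (2 * N) * (lap B ^^ N) \<phi>) = of_nat (2 * N) * lap B ((lap B ^^ N) \<phi>)"
    by (metis lap_mconst_mult mconst_of_nat)
  then show ?case
    by (simp add: Suc.IH lap_add lap_euler algebra_simps)
qed simp

text \<open>Twice the quadratic form is the sum of the \<open>lin_form H i * mvar i\<close>.
  Integration by parts produces the divergence of the field \<open>mvar i * \<phi>\<close>: its
  constant part gives \<open>n\<close>; the Euler field gives \<open>2 * N\<close> by its commutator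
  and vanishes itself at the origin.\<close>

lemma mcoeff0_lap_quad_form:
  "mcoeff0 ((lap B ^^ Suc N) (quad_form H * \<phi>)) =
    - of_nat (Suc N) * (of_nat CARD('n) / 2 + of_nat N) * mcoeff0 ((lap B ^^ N) \<phi>)"
proof -
  have q: "quad_form H * \<phi> = mconst (1 / 2) * (\<Sum>i\<in>UNIV. lin_form H i * (mvar i * \<phi>))"
    by (simp add: quad_form_def sum_distrib_left sum_distrib_right mult_ac)
  have *: "(\<Sum>i\<in>UNIV. mderiv i (mvar i * \<phi>)) = of_nat CARD('n) * \<phi> + (\<Sum>i\<in>UNIV. mvar i * mderiv i \<phi>)"
    by (simp add: mderiv_mult mderiv_mvar sum.distrib)
  have "mcoeff0 ((lap B ^^ Suc N) (quad_form H * \<phi>)) =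
      (1 / 2) * (\<Sum>i\<in>UNIV. mcoeff0 ((lap B ^^ Suc N) (lin_form H i * (mvar i * \<phi>))))"
    unfolding q lap_funpow_mconst lap_funpow_sum by simp
  also have "\<dots> = (1 / 2) * (- of_nat (Suc N) * mcoeff0 ((lap B ^^ N) (\<Sum>i\<in>UNIV. mderiv i (mvar i * \<phi>))))"
    unfolding mcoeff0_lap_lin_form lap_funpow_sum mcoeff_sum sum_distrib_left ..
  also have "mcoeff0 ((lap B ^^ N) (\<Sum>i\<in>UNIV. mderiv i (mvar i * \<phi>))) =
      of_nat CARD('n) * mcoeff0 ((lap B ^^ N) \<phi>) + of_nat (2 * N) * mcoeff0 ((lap B ^^ N) \<phi>)"
    unfolding * lap_funpow_add lap_funpow_of_nat lap_funpow_euler mcoeff_add mcoeff_of_nat_mult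
    by simp
  finally show ?thesis by (simp add: field_simps)
qed

end

lemma matrix_inv_right_field:
  fixes A :: "'a::field ^ 'n::finite ^ 'n"
  assumes "invertible A" shows "A ** matrix_inv A = mat 1" "matrix_inv A ** A = mat 1"
  using someI_ex[OF assms[unfolded invertible_def]] by (simp_all add: matrix_inv_def)

lemma matrix_inv_unique_field:
  fixes A B :: "'a::field ^ 'n::finite ^ 'n"
  assumes "A ** B = mat 1" shows "matrix_inv A = B"
proof -
  have "invertible A" using assms matrix_left_right_inverse invertible_def by blast
  then show ?thesis
    by (metis assms matrix_inv_right_field(2) matrix_mul_assoc matrix_mul_lid matrix_mul_rid)
qed

lemma sp_data_hess:
  fixes F :: "('a::field_char_0, 'n::finite) mfps"
  assumes "invertible (hess F)"
  shows "sp_data (hess F) (matrix_inv (hess F))"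
proof
  let ?H = "hess F" and ?B = "matrix_inv (hess F)"
  show H: "?H $ i $ j = ?H $ j $ i" for i j by (rule hess_symmetric)
  show HB: "?H ** ?B = mat 1" using assms by (rule matrix_inv_right_field)
  have "transpose ?H = ?H" by (simp add: transpose_def vec_eq_iff hess_symmetric)
  then have "transpose ?B ** ?H = mat 1"
    by (metis HB matrix_transpose_mul transpose_mat)
  then have "transpose ?B = ?B"
    by (metis HB matrix_mul_assoc matrix_mul_lid matrix_mul_rid)
  then show "?B $ i $ j = ?B $ j $ i" for i j
    unfolding transpose_def vec_eq_iff by simp
qed

lemma fact_coeff_shift:
  "1 / of_nat (fact v * fact (Suc k + v)) * of_nat (Suc (k + v)) =
    (1 / of_nat (fact v * fact (k + v)) :: 'a::field_char_0)"
proof -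
  have "of_nat (fact v * fact (Suc k + v)) = (of_nat (fact v * fact (k + v)) * of_nat (Suc (k + v)) :: 'a)"
    by (simp only: add_Suc fact_Suc of_nat_mult of_nat_fact of_nat_id mult_ac)
  moreover have "(of_nat (Suc (k + v)) :: 'a) \<noteq> 0" by (simp only: of_nat_eq_0_iff)
  moreover have "x \<noteq> 0 \<Longrightarrow> 1 / (y * x) * x = 1 / y" for x y :: 'a by simp
  ultimately show ?thesis by (simp only:)
qed

lemma fact_coeff_Suc:
  "1 / of_nat (fact (Suc v) * fact (k + Suc v)) * of_nat (Suc v) =
    (1 / of_nat (fact v * fact (Suc k + v)) :: 'a::field_char_0)"
proof -
  have "of_nat (fact (Suc v) * fact (k + Suc v)) = (of_nat (fact v * fact (Suc k + v)) * of_nat (Suc v) :: 'a)"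
    by (simp only: add_Suc add_Suc_right fact_Suc[of v] of_nat_mult of_nat_fact of_nat_id mult_ac)
  moreover have "(of_nat (Suc v) :: 'a) \<noteq> 0" by (simp only: of_nat_eq_0_iff)
  moreover have "x \<noteq> 0 \<Longrightarrow> 1 / (y * x) * x = 1 / y" for x y :: 'a by simp
  ultimately show ?thesis by (simp only:)
qed

section \<open>Relations between successive coefficients\<close>

definition sp_term :: "nat \<Rightarrow> ('a::field, 'n::finite) mfps \<Rightarrow> nat \<Rightarrow> ('a, 'n) mfps \<Rightarrow> 'a" where
  "sp_term N F v b = mcoeff0 ((lap (matrix_inv (hess F)) ^^ (N + v)) (b * taylor_rem F ^ v))"

text \<open>\<open>taylor_rem F ^ v\<close> has order \<open>3 * v\<close>, while
  \<open>N + v\<close> Laplacians remove only \<open>2 * (N + v)\<close>. Hence the sum defining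
  \<open>sp_coeff k\<close> may stop at \<open>2 * k\<close>, and it may be prolonged so that the
  sums for consecutive \<open>k\<close> get a common range.\<close>

lemma sp_term_eq_0:
  fixes F :: "('a::field_char_0, 'n::finite) mfps"
  assumes "mord d b" "2 * N < d + v"
  shows "sp_term N F v b = 0"
proof -
  have "mord (d + v * 3) (b * taylor_rem F ^ v)"
    by (intro mord_mult assms mord_power mord_taylor_rem)
  then have "mord (2 * (N + v) + Suc 0) (b * taylor_rem F ^ v)"
    by (rule mord_mono) (use assms(2) in simp)
  from mord_lap_funpow[OF this] show ?thesis
    by (simp add: sp_term_def mord_1)
qed

lemma sp_coeff_eq:
  fixes F :: "('a::field_char_0, 'n::finite) mfps"
  assumes "2 * k \<le> N"
  shows "sp_coeff k F b = (\<Sum>v\<le>N. 1 / of_nat (fact v * fact (k + v)) * sp_term k F v b)"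
proof -
  have "sp_coeff k F b = (\<Sum>v\<le>2 * k. 1 / of_nat (fact v * fact (k + v)) * sp_term k F v b)"
    unfolding sp_coeff_def sp_term_def sp_laplacian_eq_lap by (simp add: atLeast0AtMost)
  also have "\<dots> = (\<Sum>v\<le>N. 1 / of_nat (fact v * fact (k + v)) * sp_term k F v b)"
    using assms by (intro sum.mono_neutral_left) (auto intro!: sp_term_eq_0[where d = 0])
  finally show ?thesis .
qed

lemma sp_term_add: "sp_term N F v (b + c) = sp_term N F v b + sp_term N F v c"
  by (simp add: sp_term_def distrib_right lap_funpow_add)

lemma sp_term_mconst: "sp_term N F v (mconst a * b) = a * sp_term N F v b"
  by (simp add: sp_term_def mult.assoc lap_funpow_mconst)

lemma sp_coeff_add:
  fixes F :: "('a::field_char_0, 'n::finite) mfps"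
  shows "sp_coeff k F (b + c) = sp_coeff k F b + sp_coeff k F c"
  by (simp add: sp_coeff_eq[OF order_refl] sp_term_add distrib_left add_divide_distrib sum.distrib)

lemma sp_coeff_mconst:
  fixes F :: "('a::field_char_0, 'n::finite) mfps"
  shows "sp_coeff k F (mconst a * b) = a * sp_coeff k F b"
  by (simp add: sp_coeff_eq[OF order_refl] sp_term_mconst sum_distrib_left)

lemma sp_coeff_uminus:
  fixes F :: "('a::field_char_0, 'n::finite) mfps"
  shows "sp_coeff k F (- b) = - sp_coeff k F b"
  using sp_coeff_mconst[of k F "-1" b] by (simp add: mconst_uminus)

lemma sp_coeff_diff:
  fixes F :: "('a::field_char_0, 'n::finite) mfps"
  shows "sp_coeff k F (b - c) = sp_coeff k F b - sp_coeff k F c"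
  using sp_coeff_add[of k F b "- c"] by (simp add: sp_coeff_uminus)

lemma sp_coeff_sum:
  fixes F :: "('a::field_char_0, 'n::finite) mfps"
  shows "sp_coeff k F (sum f A) = (\<Sum>x\<in>A. sp_coeff k F (f x))"
  using sp_coeff_mconst[of k F 0 0]
  by (induction A rule: infinite_finite_induct) (auto simp: sp_coeff_add)

lemma sp_coeff_eq_0:
  fixes F :: "('a::field_char_0, 'n::finite) mfps"
  assumes "mord (Suc (2 * k)) b"
  shows "sp_coeff k F b = 0"
  unfolding sp_coeff_eq[OF order_refl]
  by (rule sum.neutral) (auto intro!: sp_term_eq_0[OF assms])

lemma sp_coeff_0: "sp_coeff 0 F b = mcoeff0 b"
  by (simp add: sp_coeff_def)

text \<open>Split the derivative of the phase into its linear part and the derivative of the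
  remainder \<open>R\<close>. The linear part turns into a derivative of \<open>b * R ^ v\<close>;
  where \<open>R ^ v\<close> is differentiated, a factor \<open>v\<close> appears, and this term
  cancels the contribution of the remainder at \<open>v - 1\<close>.\<close>

lemma sp_coeff_mult_mderiv_phase:
  fixes F :: "('a::field_char_0, 'n::finite) mfps"
  assumes "invertible (hess F)"
  shows "sp_coeff (Suc k) F (b * mderiv i (phase F)) = - sp_coeff k F (mderiv i b)"
proof -
  interpret sp_data "hess F" "matrix_inv (hess F)" by (rule sp_data_hess[OF assms])
  let ?R = "taylor_rem F"
  let ?c = "\<lambda>k v. 1 / of_nat (fact v * fact (k + v)) :: 'a"
  define N where "N = 2 * Suc k"
  define X where "X v = sp_term k F v (mderiv i b)" for v
  define Y where "Y v = sp_term (Suc k) F v (b * mderiv i ?R)" for v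
  \<comment> \<open>The one summand without a partner vanishes, because the differentiated remainder
    still has order 2.\<close>
  have Y_last: "Y N = 0"
    unfolding Y_def
  proof (rule sp_term_eq_0)
    show "mord (0 + 2) (b * mderiv i ?R)"
      using mord_mderiv[of 2 ?R] mord_taylor_rem[of F] by (intro mord_mult) (auto simp: numeral_3_eq_3 numeral_2_eq_2)
  qed (simp add: N_def)
  have split: "sp_term (Suc k) F v (b * mderiv i (phase F)) = Y v
      - of_nat (k + Suc v) * (X v + of_nat v * mcoeff0 ((lap (matrix_inv (hess F)) ^^ (k + v))
          (b * mderiv i ?R * ?R ^ (v - 1))))" for v
  proof -
    have e: "b * mderiv i (phase F) * ?R ^ v = lin_form (hess F) i * (b * ?R ^ v) + b * mderiv i ?R * ?R ^ v"
      by (simp add: mderiv_taylor_rem algebra_simps)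
    have d: "mderiv i (b * ?R ^ v) = mderiv i b * ?R ^ v + of_nat v * (b * mderiv i ?R * ?R ^ (v - 1))"
      by (simp add: mderiv_mult mderiv_power algebra_simps)
    show ?thesis
      unfolding sp_term_def e lap_funpow_add Y_def X_def
      by (simp only: add_Suc mcoeff_add mcoeff0_lap_lin_form d lap_funpow_add lap_funpow_of_nat mcoeff_of_nat_mult add_Suc_right)
        (simp add: algebra_simps)
  qed
  have "sp_coeff (Suc k) F (b * mderiv i (phase F)) =
      (\<Sum>v\<le>N. ?c (Suc k) v * Y v) - (\<Sum>v\<le>N. ?c (Suc k) v * of_nat (k + Suc v) * X v)
      - (\<Sum>v\<le>N. ?c (Suc k) v * of_nat (k + Suc v) * of_nat v * mcoeff0 ((lap (matrix_inv (hess F)) ^^ (k + v))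
          (b * mderiv i ?R * ?R ^ (v - 1))))"
    unfolding sp_coeff_eq[OF order_refl[of "2 * Suc k"], folded N_def] split
    by (simp only: right_diff_distrib distrib_left sum_subtractf sum.distrib mult.assoc) simp
  also have "(\<Sum>v\<le>N. ?c (Suc k) v * of_nat (k + Suc v) * X v) = sp_coeff k F (mderiv i b)"
    unfolding add_Suc_right fact_coeff_shift using sp_coeff_eq[of k N F "mderiv i b"] by (simp add: N_def X_def)
  also have "(\<Sum>v\<le>N. ?c (Suc k) v * of_nat (k + Suc v) * of_nat v * mcoeff0 ((lap (matrix_inv (hess F)) ^^ (k + v))
          (b * mderiv i ?R * ?R ^ (v - 1)))) = (\<Sum>v<N. ?c (Suc k) v * Y v)"
  proof -
    have c: "?c (Suc k) (Suc v) * of_nat (k + Suc (Suc v)) * of_nat (Suc v) = ?c (Suc k) v" for v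
      unfolding add_Suc_right[of k "Suc v"] fact_coeff_shift fact_coeff_Suc ..
    show ?thesis
      unfolding lessThan_Suc_atMost[symmetric] sum.lessThan_Suc_shift c
      by (simp add: Y_def sp_term_def)
  qed
  also have "(\<Sum>v\<le>N. ?c (Suc k) v * Y v) = (\<Sum>v<N. ?c (Suc k) v * Y v)"
    using Y_last by (simp add: lessThan_Suc_atMost[symmetric])
  finally show ?thesis by simp
qed

text \<open>The quadratic part of the phase contributes \<open>-(n / 2 + k + v)\<close> to the
  \<open>v\<close>-th summand. The remainder raises \<open>v\<close> by one; after shifting and
  comparing factorials it contributes \<open>+v\<close>, and the dependence on \<open>v\<close>
  disappears.\<close>

lemma sp_coeff_phase_mult:
  fixes F :: "('a::field_char_0, 'n::finite) mfps"
  assumes "invertible (hess F)"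
  shows "sp_coeff (Suc k) F (phase F * b) = - (of_nat k + of_nat CARD('n) / 2) * sp_coeff k F b"
proof -
  interpret sp_data "hess F" "matrix_inv (hess F)" by (rule sp_data_hess[OF assms])
  let ?R = "taylor_rem F"
  let ?c = "\<lambda>k v. 1 / of_nat (fact v * fact (k + v)) :: 'a"
  define N where "N = 2 * Suc k"
  define X where "X v = sp_term k F v b" for v
  have X_last: "X (Suc N) = 0"
    unfolding X_def by (rule sp_term_eq_0[where d = 0]) (simp_all add: N_def)
  have split: "sp_term (Suc k) F v (phase F * b) =
      X (Suc v) - of_nat (Suc (k + v)) * (of_nat CARD('n) / 2 + of_nat (k + v)) * X v" for v
  proof -
    have e: "phase F * b * ?R ^ v = quad_form (hess F) * (b * ?R ^ v) + b * ?R ^ Suc v"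
      by (simp add: taylor_rem_eq algebra_simps)
    show ?thesis
      unfolding sp_term_def e lap_funpow_add X_def
      by (simp only: add_Suc mcoeff_add mcoeff0_lap_quad_form add_Suc_right) (simp add: algebra_simps)
  qed
  have c1: "?c (Suc k) v * (of_nat (Suc (k + v)) * y) = ?c k v * y" for v y
    unfolding mult.assoc[symmetric] fact_coeff_shift ..
  have c2: "?c (Suc k) v = of_nat (Suc v) * ?c k (Suc v)" for v
    unfolding fact_coeff_Suc[symmetric] by (rule mult.commute)
  have "sp_coeff (Suc k) F (phase F * b) = (\<Sum>v\<le>N. ?c (Suc k) v * X (Suc v)) -
      (\<Sum>v\<le>N. ?c k v * ((of_nat CARD('n) / 2 + of_nat (k + v)) * X v))"
    unfolding sp_coeff_eq[OF order_refl[of "2 * Suc k"], folded N_def] split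
    by (simp only: right_diff_distrib sum_subtractf mult.assoc c1)
  also have "(\<Sum>v\<le>N. ?c (Suc k) v * X (Suc v)) = (\<Sum>v\<le>N. of_nat v * (?c k v * X v))"
  proof -
    have "(\<Sum>v\<le>N. ?c (Suc k) v * X (Suc v)) = (\<Sum>v<Suc N. of_nat (Suc v) * (?c k (Suc v) * X (Suc v)))"
      unfolding c2 lessThan_Suc_atMost by (simp only: mult.assoc)
    also have "\<dots> = (\<Sum>v<Suc (Suc N). of_nat v * (?c k v * X v))"
      unfolding sum.lessThan_Suc_shift[of _ "Suc N"] by simp
    finally show ?thesis
      unfolding lessThan_Suc_atMost[symmetric] using X_last by simp
  qed
  also have "\<dots> - (\<Sum>v\<le>N. ?c k v * ((of_nat CARD('n) / 2 + of_nat (k + v)) * X v)) =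
      (\<Sum>v\<le>N. - (of_nat k + of_nat CARD('n) / 2) * (?c k v * X v))"
    unfolding sum_subtractf[symmetric] by (rule sum.cong) (simp_all add: algebra_simps)
  also have "\<dots> = - (of_nat k + of_nat CARD('n) / 2) * sp_coeff k F b"
  proof -
    have "2 * k \<le> N" by (simp add: N_def)
    show ?thesis unfolding sp_coeff_eq[OF \<open>2 * k \<le> N\<close>] sum_distrib_left X_def ..
  qed
  finally show ?thesis .
qed

section \<open>Uniqueness of the functionals\<close>

lemma mord_decomp:
  fixes b :: "('a::field_char_0, 'n::finite) mfps"
  assumes "mord (Suc d) b"
  obtains c where "b = (\<Sum>i\<in>UNIV. mvar i * c i)" "\<And>i. mord d (c i)"
proof
  \<comment> \<open>Each monomial of \<open>b\<close> is shared among its variables in proportion to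
    their exponents; the shares add up to 1.\<close>
  define c where "c i = Abs_mfps (\<lambda>\<gamma>. of_nat (Suc (\<gamma> i)) / of_nat (Suc (mdeg \<gamma>)) * mcoeff b (\<gamma>(i := Suc (\<gamma> i))))" for i
  show "mord d (c i)" for i
    unfolding mord_def
  proof (intro allI impI)
    fix \<alpha> :: "'n \<Rightarrow> nat" assume "mdeg \<alpha> < d"
    then have "mcoeff b (\<alpha>(i := Suc (\<alpha> i))) = 0"
      using assms mdeg_upd_Suc[of \<alpha> i] by (simp add: mord_def)
    then show "mcoeff (c i) \<alpha> = 0" by (simp add: c_def)
  qed
  show "b = (\<Sum>i\<in>UNIV. mvar i * c i)"
  proof (rule mfps_eqI)
    fix \<alpha> :: "'n \<Rightarrow> nat"
    have *: "mcoeff (mvar i * c i) \<alpha> = of_nat (\<alpha> i) / of_nat (mdeg \<alpha>) * mcoeff b \<alpha>" for i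
    proof (cases "\<alpha> i")
      case (Suc m)
      define \<beta> where "\<beta> = \<alpha>(i := m)"
      have \<alpha>: "\<alpha> = \<beta>(i := Suc (\<beta> i))" "\<alpha> i = Suc (\<beta> i)" using Suc by (auto simp: \<beta>_def)
      have "mcoeff (mvar i * c i) \<alpha> = mcoeff (c i) \<beta>"
        using Suc by (simp add: mcoeff_mvar_mult \<beta>_def)
      also have "\<dots> = of_nat (\<alpha> i) / of_nat (Suc (mdeg \<beta>)) * mcoeff b \<alpha>"
        unfolding c_def mcoeff_Abs \<alpha>(1)[symmetric] unfolding \<alpha>(2) ..
      also have "Suc (mdeg \<beta>) = mdeg \<alpha>" using mdeg_upd_Suc[of \<beta> i] \<alpha>(1) by simp
      finally show ?thesis .
    qed (simp add: mcoeff_mvar_mult)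
    have "mcoeff (\<Sum>i\<in>UNIV. mvar i * c i) \<alpha> = of_nat (mdeg \<alpha>) / of_nat (mdeg \<alpha>) * mcoeff b \<alpha>"
      unfolding mcoeff_sum * sum_distrib_right[symmetric] sum_divide_distrib[symmetric] by (simp only: of_nat_sum)
    also have "\<dots> = mcoeff b \<alpha>"
    proof (cases "mdeg \<alpha> = 0")
      case True
      then have "mcoeff b \<alpha> = 0" using assms by (simp add: mord_def del: sum_eq_0_iff)
      then show ?thesis by simp
    next
      case False
      then have "(of_nat (mdeg \<alpha>) :: 'a) \<noteq> 0" by (simp only: of_nat_eq_0_iff) simp
      from divide_self[OF this] show ?thesis by (simp only: mult_1_left)
    qed
    finally show "mcoeff b \<alpha> = mcoeff (\<Sum>i\<in>UNIV. mvar i * c i) \<alpha>" by simp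
  qed
qed

lemma mvar_eq_lin_forms:
  assumes "B ** H = mat 1"
  shows "mvar i = (\<Sum>j\<in>UNIV. mconst (B $ i $ j) * lin_form H j)"
proof -
  have BH: "(\<Sum>j\<in>UNIV. B $ i $ j * H $ j $ l) = (if i = l then 1 else 0)" for l
    using assms by (simp add: vec_eq_iff matrix_matrix_mult_def mat_def)
  have "(\<Sum>j\<in>UNIV. mconst (B $ i $ j) * lin_form H j) =
      (\<Sum>l\<in>UNIV. mconst (\<Sum>j\<in>UNIV. B $ i $ j * H $ j $ l) * mvar l)"
    unfolding lin_form_def sum_distrib_left mconst_sum sum_distrib_right mconst_mult
    by (subst sum.swap) (simp only: mult.assoc)
  also have "\<dots> = mvar i"
    unfolding BH if_distrib[of mconst] mconst_0 mconst_1 by simp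
  finally show ?thesis ..
qed

text \<open>An invertible Hessian makes the derivatives of the phase a coordinate system to first
  order. The error comes from derivatives of \<open>taylor_rem F\<close>, which have order 2, and so
  gains one order.\<close>

lemma mord_decomp_phase:
  fixes F b :: "('a::field_char_0, 'n::finite) mfps"
  assumes inv: "invertible (hess F)" and b: "mord (Suc d) b"
  obtains c b' where "b = (\<Sum>j\<in>UNIV. c j * mderiv j (phase F)) + b'" "\<And>j. mord d (c j)" "mord (Suc (Suc d)) b'"
proof -
  define B where "B = matrix_inv (hess F)"
  have BH: "B ** hess F = mat 1" unfolding B_def using inv by (rule matrix_inv_right_field)
  obtain a where a: "b = (\<Sum>i\<in>UNIV. mvar i * a i)" "\<And>i. mord d (a i)"
    using mord_decomp[OF b] by metis
  define c where "c j = (\<Sum>i\<in>UNIV. mconst (B $ i $ j) * a i)" for j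
  define b' where "b' = - (\<Sum>j\<in>UNIV. c j * mderiv j (taylor_rem F))"
  have c: "mord d (c j)" for j
    unfolding c_def by (intro mord_sum mord_mult_left a)
  have "mord (d + 2) (c j * mderiv j (taylor_rem F))" for j
    using mord_taylor_rem[of F] by (intro mord_mult c mord_mderiv) (simp add: numeral_3_eq_3)
  then have b': "mord (Suc (Suc d)) b'"
    unfolding b'_def by (intro mord_uminus mord_sum) simp
  have "b = (\<Sum>i\<in>UNIV. \<Sum>j\<in>UNIV. (mconst (B $ i $ j) * a i) * lin_form (hess F) j)"
    unfolding a(1) by (rule sum.cong[OF refl], subst mvar_eq_lin_forms[OF BH]) (simp add: sum_distrib_left sum_distrib_right mult_ac)
  also have "\<dots> = (\<Sum>j\<in>UNIV. c j * lin_form (hess F) j)"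
    unfolding c_def sum_distrib_right by (rule sum.swap)
  also have "\<dots> = (\<Sum>j\<in>UNIV. c j * mderiv j (phase F)) + b'"
    by (simp add: b'_def mderiv_taylor_rem algebra_simps sum_subtractf)
  finally show ?thesis using that c b' by blast
qed

text \<open>Abstract form of b \<mapsto> \<open>sp_coeff k F (G * b)\<close>, with \<open>w\<close>
  as the logarithmic gradient of \<open>G\<close>. \<open>L_cont\<close> is continuity with respect
  to the order of vanishing; \<open>L_0\<close> reflects that \<open>sp_coeff 0\<close> evaluates at
  the origin.\<close>

locale sp_functional =
  fixes F :: "('a::field_char_0, 'n::finite) mfps" and w :: "'n \<Rightarrow> ('a, 'n) mfps"
    and L :: "nat \<Rightarrow> ('a, 'n) mfps \<Rightarrow> 'a"
  assumes inv: "invertible (hess F)"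
    and L_add: "L k (b + c) = L k b + L k c"
    and L_mconst: "L k (mconst a * b) = a * L k b"
    and L_cont: "\<exists>N. \<forall>b. mord N b \<longrightarrow> L k b = 0"
    and L_0: "L 0 (b * mderiv i (phase F)) = 0"
    and L_Suc: "L (Suc k) (b * mderiv i (phase F)) = - L k (mderiv i b + w i * b)"
    and L_phase: "L (Suc k) (phase F * b) = - (of_nat k + of_nat CARD('n) / 2) * L k b"
begin

lemma L_zero: "L k 0 = 0"
  using L_mconst[of k 0 0] by simp

lemma L_diff: "L k (b - c) = L k b - L k c"
  using L_add[of k b "mconst (-1) * c"] L_mconst[of k "-1" c] by (simp add: mconst_uminus)

lemma L_sum: "L k (sum f A) = (\<Sum>x\<in>A. L k (f x))"
  by (induction A rule: infinite_finite_induct) (auto simp: L_zero L_add)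

text \<open>Replace \<open>b\<close> repeatedly by a combination of derivatives of the phase plus an
  error of higher order; after finitely many steps the error lies where \<open>L_cont\<close> makes
  \<open>L k\<close> vanish.\<close>

lemma L_vanish:
  assumes d: "\<And>c j. mord d c \<Longrightarrow> L k (c * mderiv j (phase F)) = 0" and b: "mord (Suc d) b"
  shows "L k b = 0"
proof -
  obtain N where N: "\<And>b. mord N b \<Longrightarrow> L k b = 0" using L_cont by blast
  have "L k b = 0" if "e \<ge> d" "mord (Suc e) b" for e b
    using that
  proof (induction "N - e" arbitrary: e b rule: less_induct)
    case less
    show ?case
    proof (cases "N \<le> e")
      case True
      then show ?thesis using less.prems N mord_mono by (meson le_SucI)
    next
      case False
      obtain c b' where c: "b = (\<Sum>j\<in>UNIV. c j * mderiv j (phase F)) + b'"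
        "\<And>j. mord e (c j)" "mord (Suc (Suc e)) b'"
        using mord_decomp_phase[OF inv less.prems(2)] by metis
      have "L k (c j * mderiv j (phase F)) = 0" for j
        using d mord_mono[OF c(2) less.prems(1)] by blast
      moreover have "L k b' = 0"
        using False less.prems c(3) by (intro less.hyps[of "Suc e"]) auto
      ultimately show ?thesis
        unfolding c(1) by (simp add: L_add L_sum)
    qed
  qed
  then show ?thesis using b by blast
qed

text \<open>Once \<open>L k\<close> is zero, integration by parts leaves of \<open>L (Suc k)\<close>
  only its value x at 1. To kill x, evaluate the functional of index k + 2 on the phase twice:
  Euler's identity for the quadratic part followed by integration by parts gives -(n/2) x, the phase
  relation gives -(k + 1 + n/2) x. In characteristic 0 this forces x = 0.\<close>

lemma L_eq_0:
  assumes one: "L 0 1 = 0"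
  shows "L k b = 0"
proof (induction k arbitrary: b)
  case 0
  have "L 0 (b - mconst (mcoeff0 b)) = 0"
    by (rule L_vanish[where d = 0]) (simp_all add: L_0 mord_1)
  moreover have "L 0 (mconst (mcoeff0 b)) = 0"
    using L_mconst[of 0 "mcoeff0 b" 1] one by simp
  ultimately show ?case by (simp add: L_diff)
next
  case (Suc k)
  have v1: "L (Suc k) b = 0" if "mord (Suc 0) b" for b
    by (rule L_vanish[OF _ that]) (simp add: L_Suc Suc.IH)
  have v3: "L (Suc (Suc k)) b = 0" if "mord 3 b" for b
  proof (rule L_vanish[where d = 2])
    fix c :: "('a, 'n) mfps" and j assume c: "mord 2 c"
    have "mord (Suc 0) (mderiv j c + w j * c)"
      using c by (intro mord_add mord_mderiv mord_mult_left) (auto simp: numeral_2_eq_2 elim: mord_mono)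
    then show "L (Suc (Suc k)) (c * mderiv j (phase F)) = 0"
      by (simp add: L_Suc v1)
  qed (use that in \<open>simp add: numeral_3_eq_3 numeral_2_eq_2\<close>)
  define x where "x = L (Suc k) 1"
  let ?n = "of_nat CARD('n) :: 'a"
  \<comment> \<open>The deviation of the phase from homogeneity of degree two; the quadratic part
    drops out of it.\<close>
  define r where "r = taylor_rem F - mconst (1 / 2) * (\<Sum>i\<in>UNIV. mvar i * mderiv i (taylor_rem F))"
  have "mord (1 + 2) (mvar i * mderiv i (taylor_rem F))" for i
    using mord_taylor_rem[of F] by (intro mord_mult mord_mderiv) (simp_all add: numeral_3_eq_3 mord_1)
  then have r: "mord 3 r"
    unfolding r_def by (intro mord_diff[OF mord_taylor_rem] mord_mult_left[OF mord_sum]) (simp add: numeral_3_eq_3)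
  have phase: "phase F = mconst (1 / 2) * (\<Sum>i\<in>UNIV. mvar i * mderiv i (phase F)) + r"
  proof -
    have "(\<Sum>i\<in>UNIV. mvar i * mderiv i (phase F)) =
      (\<Sum>i\<in>UNIV. mvar i * lin_form (hess F) i) + (\<Sum>i\<in>UNIV. mvar i * mderiv i (taylor_rem F))"
      by (simp add: mderiv_taylor_rem sum.distrib[symmetric] algebra_simps)
    then show ?thesis
      by (simp add: r_def taylor_rem_eq quad_form_def algebra_simps)
  qed
  have "L (Suc (Suc k)) (mvar i * mderiv i (phase F)) = - x" for i
  proof -
    have "L (Suc k) (w i * mvar i) = 0"
      by (intro v1 mord_mult_left mord_mvar)
    then show ?thesis by (simp add: L_Suc mderiv_mvar L_add x_def)
  qed
  then have "L (Suc (Suc k)) (phase F) = - (?n / 2) * x"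
    by (subst phase) (simp add: L_add L_mconst L_sum v3[OF r])
  moreover have "L (Suc (Suc k)) (phase F) = - (of_nat (Suc k) + ?n / 2) * x"
    using L_phase[of "Suc k" 1] by (simp add: x_def)
  ultimately have "- (of_nat (Suc k) + ?n / 2) * x = - (?n / 2) * x"
    by metis
  then have "of_nat (Suc k) * x + ?n / 2 * x = ?n / 2 * x"
    by (simp only: minus_mult_left[symmetric] neg_equal_iff_equal distrib_right)
  moreover have "p + q = q \<Longrightarrow> p = 0" for p q :: 'a by simp
  ultimately have "of_nat (Suc k) * x = 0" by metis
  then have "x = 0" by (simp only: mult_eq_0_iff of_nat_eq_0_iff) simp
  then have "L (Suc k) (mconst (mcoeff0 b)) = 0"
    using L_mconst[of "Suc k" "mcoeff0 b" 1] by (simp add: x_def)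
  moreover have "L (Suc k) (b - mconst (mcoeff0 b)) = 0"
    by (rule v1) (simp add: mord_1)
  ultimately show ?case by (simp add: L_diff)
qed

end

text \<open>The relations are linear in the functional, so the difference of \<open>L\<close> and
  \<open>a\<close> times \<open>L'\<close> satisfies them, and it vanishes on 1 at index 0.\<close>

lemma sp_functional_unique:
  assumes L: "sp_functional F w L" and L': "sp_functional F w L'" and a: "L 0 1 = a * L' 0 1"
  shows "L k b = a * L' k b"
proof -
  interpret L: sp_functional F w L by fact
  interpret L': sp_functional F w L' by fact
  have "sp_functional F w (\<lambda>k b. L k b - a * L' k b)"
  proof
    fix k
    obtain N where N: "\<forall>b. mord N b \<longrightarrow> L k b = 0" using L.L_cont by blast
    obtain N' where N': "\<forall>b. mord N' b \<longrightarrow> L' k b = 0" using L'.L_cont by blast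
    have "\<forall>b. mord (max N N') b \<longrightarrow> L k b - a * L' k b = 0"
      using N N' mord_mono by (metis diff_zero max.cobounded1 max.cobounded2 mult_zero_right)
    then show "\<exists>N. \<forall>b. mord N b \<longrightarrow> L k b - a * L' k b = 0" by blast
    fix b c :: "('a, 'b) mfps" and x i
    show "L k (b + c) - a * L' k (b + c) = L k b - a * L' k b + (L k c - a * L' k c)"
      by (simp add: L.L_add L'.L_add algebra_simps)
    show "L k (mconst x * b) - a * L' k (mconst x * b) = x * (L k b - a * L' k b)"
      unfolding L.L_mconst L'.L_mconst by (simp add: algebra_simps)
    show "L 0 (b * mderiv i (phase F)) - a * L' 0 (b * mderiv i (phase F)) = 0"
      by (simp add: L.L_0 L'.L_0)
    show "L (Suc k) (b * mderiv i (phase F)) - a * L' (Suc k) (b * mderiv i (phase F)) =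
        - (L k (mderiv i b + w i * b) - a * L' k (mderiv i b + w i * b))"
      unfolding L.L_Suc L'.L_Suc by (simp add: algebra_simps)
    show "L (Suc k) (phase F * b) - a * L' (Suc k) (phase F * b) =
        - (of_nat k + of_nat CARD('b) / 2) * (L k b - a * L' k b)"
      unfolding L.L_phase L'.L_phase by (simp add: algebra_simps)
  qed (rule L.inv)
  from sp_functional.L_eq_0[OF this] a show ?thesis by simp
qed

text \<open>Prescribing \<open>w\<close> by \<open>G * w i = mderiv i G\<close> also covers
  \<open>G = 1\<close> with \<open>w = 0\<close>, the case against which \<open>drift_defect\<close>
  is compared.\<close>

lemma sp_functional_sp_coeff:
  fixes F G :: "('a::field_char_0, 'n::finite) mfps"
  assumes inv: "invertible (hess F)" and w: "\<And>i. G * w i = mderiv i G"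
  shows "sp_functional F w (\<lambda>k b. sp_coeff k F (G * b))"
proof
  show "\<exists>N. \<forall>b. mord N b \<longrightarrow> sp_coeff k F (G * b) = 0" for k
    using sp_coeff_eq_0 mord_mult_left by blast
  show "sp_coeff k F (G * (b + c)) = sp_coeff k F (G * b) + sp_coeff k F (G * c)" for k b c
    by (simp add: distrib_left sp_coeff_add)
  show "sp_coeff k F (G * (mconst a * b)) = a * sp_coeff k F (G * b)" for k a b
    by (metis mult.left_commute sp_coeff_mconst)
  show "sp_coeff 0 F (G * (b * mderiv i (phase F))) = 0" for b i
    by (simp add: sp_coeff_0 mderiv_phase)
  show "sp_coeff (Suc k) F (G * (b * mderiv i (phase F))) = - sp_coeff k F (G * (mderiv i b + w i * b))" for k b i
  proof -
    have "mderiv i (G * b) = G * (mderiv i b + w i * b)"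
      by (simp add: mderiv_mult w[symmetric] algebra_simps)
    then show ?thesis using sp_coeff_mult_mderiv_phase[OF inv, of k "G * b" i] by (simp add: mult.assoc)
  qed
  show "sp_coeff (Suc k) F (G * (phase F * b)) = - (of_nat k + of_nat CARD('n) / 2) * sp_coeff k F (G * b)" for k b
    using sp_coeff_phase_mult[OF inv, of k "G * b"] by (simp add: mult.left_commute)
qed (rule inv)

section \<open>Differentiation in the base point\<close>

definition map_coeffs :: "('a \<Rightarrow> 'b) \<Rightarrow> ('a, 'n) mfps \<Rightarrow> ('b, 'n) mfps" where
  "map_coeffs h F = Abs_mfps (\<lambda>\<alpha>. h (mcoeff F \<alpha>))"

lemma mcoeff_map_coeffs [simp]: "mcoeff (map_coeffs h F) \<alpha> = h (mcoeff F \<alpha>)"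
  by (simp add: map_coeffs_def)

locale derivation =
  fixes D :: "'a::field_char_0 \<Rightarrow> 'a"
  assumes D_add: "D (a + b) = D a + D b" and D_mult: "D (a * b) = D a * b + a * D b"
begin

lemma D_0 [simp]: "D 0 = 0" using D_add[of 0 0] by simp
lemma D_1 [simp]: "D 1 = 0" using D_mult[of 1 1] by simp
lemma D_uminus: "D (- a) = - D a" using D_add[of a "- a"] by (simp add: eq_neg_iff_add_eq_0 add.commute)
lemma D_diff: "D (a - b) = D a - D b" using D_add[of a "- b"] by (simp add: D_uminus)
lemma D_sum: "D (sum f A) = (\<Sum>x\<in>A. D (f x))"
  by (induction A rule: infinite_finite_induct) (auto simp: D_add)
lemma D_of_nat [simp]: "D (of_nat k) = 0" by (induction k) (auto simp: D_add)

lemma map_D_add: "map_coeffs D (F + G) = map_coeffs D F + map_coeffs D G"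
  and map_D_diff: "map_coeffs D (F - G) = map_coeffs D F - map_coeffs D G"
  and map_D_mconst: "map_coeffs D (mconst c) = mconst (D c)"
  and map_D_mvar: "map_coeffs D (mvar i) = 0"
  by (auto intro!: mfps_eqI simp: D_add D_diff mcoeff_mconst mcoeff_mvar)

lemma map_D_sum: "map_coeffs D (sum f A) = (\<Sum>x\<in>A. map_coeffs D (f x))"
  by (rule mfps_eqI) (simp add: D_sum)

lemma map_D_mult: "map_coeffs D (F * G) = map_coeffs D F * G + F * map_coeffs D G"
  by (rule mfps_eqI) (simp add: mcoeff_mult D_sum D_mult sum.distrib)

lemma map_D_mderiv: "map_coeffs D (mderiv i F) = mderiv i (map_coeffs D F)"
  by (rule mfps_eqI) (simp add: mcoeff_mderiv D_mult del: of_nat_Suc)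

end

text \<open>The phase differs from f(t + u) by an affine function of u with scalar coefficients, so
  for \<open>\<phi> = phase F\<close> these are the polynomials of degree at most \<open>d\<close>
  in the linear coordinates of the cone. The inductive form lets proofs strip off one factor at a
  time.\<close>

inductive phase_poly :: "('a::comm_ring_1, 'n::finite) mfps \<Rightarrow> nat \<Rightarrow> ('a, 'n) mfps \<Rightarrow> bool" for \<phi> where
  phase_poly_const: "phase_poly \<phi> d (mconst c)"
| phase_poly_add: "phase_poly \<phi> d a \<Longrightarrow> phase_poly \<phi> d b \<Longrightarrow> phase_poly \<phi> d (a + b)"
| phase_poly_scale: "phase_poly \<phi> d b \<Longrightarrow> phase_poly \<phi> d (mconst c * b)"
| phase_poly_mvar: "phase_poly \<phi> d b \<Longrightarrow> phase_poly \<phi> (Suc d) (mvar j * b)"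
| phase_poly_phase: "phase_poly \<phi> d b \<Longrightarrow> phase_poly \<phi> (Suc d) (\<phi> * b)"

lemma phase_poly_Suc: "phase_poly \<phi> d b \<Longrightarrow> phase_poly \<phi> (Suc d) b"
  by (induction rule: phase_poly.induct) (auto intro: phase_poly.intros)

lemma phase_poly_0: "phase_poly \<phi> d 0"
  using phase_poly_const[of \<phi> d 0] by simp

lemma phase_poly_sum: "(\<And>x. x \<in> A \<Longrightarrow> phase_poly \<phi> d (f x)) \<Longrightarrow> phase_poly \<phi> d (sum f A)"
  by (induction A rule: infinite_finite_induct) (auto intro: phase_poly_0 phase_poly_add)

lemma phase_poly_diff: "phase_poly \<phi> d a \<Longrightarrow> phase_poly \<phi> d b \<Longrightarrow> phase_poly \<phi> d (a - b)"
  using phase_poly_add[of \<phi> d a "mconst (-1) * b"] phase_poly_scale[of \<phi> d b "-1"]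
  by (simp add: mconst_uminus)

lemma phase_poly_lin_form: "phase_poly \<phi> d b \<Longrightarrow> phase_poly \<phi> (Suc d) (lin_form H i * b)"
  unfolding lin_form_def sum_distrib_right mult.assoc
  by (intro phase_poly_sum phase_poly_scale phase_poly_mvar)

lemma phase_poly_power:
  assumes "\<eta> = mconst a + (\<Sum>j\<in>UNIV. mconst (b j) * mvar j) + mconst c * \<phi>"
  shows "phase_poly \<phi> k (\<eta> ^ k)"
proof (induction k)
  case 0
  show ?case using phase_poly_const[of \<phi> 0 1] by simp
next
  case (Suc k)
  have "\<eta> ^ Suc k = mconst a * \<eta> ^ k + (\<Sum>j\<in>UNIV. mconst (b j) * (mvar j * \<eta> ^ k)) + mconst c * (\<phi> * \<eta> ^ k)"
    using assms by (simp add: algebra_simps sum_distrib_left sum_distrib_right)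
  then show ?case
    using Suc.IH
    by (auto intro!: phase_poly_add phase_poly_sum phase_poly_scale intro: phase_poly_mvar phase_poly_phase phase_poly_Suc)
qed

text \<open>
  The coefficients of \<open>F\<close> are functions of the base point \<open>t\<close>, and \<open>F\<close> is the expansion of
  \<open>f(t + u)\<close>: differentiating the coefficients is the same as differentiating in \<open>u\<close>.
\<close>

locale moving_point =
  fixes D :: "'n::finite \<Rightarrow> 'a::field_char_0 \<Rightarrow> 'a" and F :: "('a, 'n) mfps"
  assumes D: "\<And>i. derivation (D i)"
    and flat: "\<And>i. map_coeffs (D i) F = mderiv i F"
    and inv: "invertible (hess F)"
begin

text \<open>Differentiation in t with the point t + u held fixed; by \<open>flat\<close> it
  annihilates \<open>F\<close>.\<close>

definition drift :: "'n \<Rightarrow> ('a, 'n) mfps \<Rightarrow> ('a, 'n) mfps" where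
  "drift i b = map_coeffs (D i) b - mderiv i b"

lemma drift_add: "drift i (b + c) = drift i b + drift i c"
  and drift_diff: "drift i (b - c) = drift i b - drift i c"
  and drift_mult: "drift i (b * c) = drift i b * c + b * drift i c"
  and drift_mconst: "drift i (mconst a) = mconst (D i a)"
  and drift_mvar: "drift i (mvar j) = - (if i = j then 1 else 0)"
  and drift_mderiv: "drift i (mderiv j b) = mderiv j (drift i b)"
  by (simp_all add: drift_def derivation.map_D_add[OF D] derivation.map_D_diff[OF D] mderiv_add mderiv_diff
      derivation.map_D_mult[OF D] mderiv_mult derivation.map_D_mconst[OF D] derivation.map_D_mvar[OF D]
      mderiv_mvar derivation.map_D_mderiv[OF D] mderiv_commute algebra_simps)

lemma drift_sum: "drift i (sum f A) = (\<Sum>x\<in>A. drift i (f x))"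
  by (simp add: drift_def derivation.map_D_sum[OF D] mderiv_sum sum_subtractf)

lemma D_mcoeff0: "D i (mcoeff0 b) = mcoeff0 (drift i b) + mcoeff0 (mderiv i b)"
  by (simp add: drift_def)

lemma drift_F: "drift i F = 0"
  by (simp add: drift_def flat)

text \<open>With t + u fixed only the tangent hyperplane at t moves, and its motion is governed by
  the Hessian.\<close>

lemma drift_phase: "drift i (phase F) = - lin_form (hess F) i"
proof -
  have 1: "D i (mcoeff0 F) = mcoeff0 (mderiv i F)"
    by (simp add: D_mcoeff0 drift_F)
  have 2: "D i (mcoeff0 (mderiv j F)) = hess F $ i $ j" for j
    by (simp add: D_mcoeff0 drift_mderiv drift_F hess_def)
  have "drift i (phase F) = - mconst (mcoeff0 (mderiv i F)) - (\<Sum>j\<in>UNIV. mconst (hess F $ i $ j) * mvar j)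
      + (\<Sum>j\<in>UNIV. mconst (mcoeff0 (mderiv j F)) * (if i = j then 1 else 0))"
    unfolding phase_def drift_diff drift_sum drift_mult drift_mconst drift_mvar drift_F 1 2
    by (simp only: sum.distrib mult_minus_right sum_negf) simp
  then show ?thesis by (simp add: lin_form_def)
qed

lemma drift_mderiv_phase: "drift i (mderiv j (phase F)) = - mconst (hess F $ i $ j)"
  unfolding drift_mderiv drift_phase by (simp add: mderiv_uminus mderiv_lin_form)

lemma mord_drift: "mord (Suc d) b \<Longrightarrow> mord d (drift i b)"
  unfolding drift_def
  by (intro mord_diff mord_mderiv) (auto simp: mord_def derivation.D_0[OF D])

text \<open>Formally, differentiate the integral of b e^(phase/h) in t: the amplitude drifts, and
  the exponent brings down -(Hu)_i/h, which raises the index. What is left over stems from the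
  normalising factor and should be a scalar multiple of \<open>sp_coeff k F b\<close>; uniqueness of
  functionals shows this without computing the scalar.\<close>

definition drift_defect :: "'n \<Rightarrow> nat \<Rightarrow> ('a, 'n) mfps \<Rightarrow> 'a" where
  "drift_defect i k b = D i (sp_coeff k F b) - sp_coeff k F (drift i b)
     + sp_coeff (Suc k) F (lin_form (hess F) i * b)"

lemma sp_functional_drift_defect: "sp_functional F (\<lambda>_. 0) (drift_defect i)"
proof
  interpret derivation "D i" by (rule D)
  let ?H = "hess F" and ?A = "\<lambda>k. sp_coeff k F" and ?\<phi> = "phase F"
  note A = sp_coeff_mult_mderiv_phase[OF inv] and A\<phi> = sp_coeff_phase_mult[OF inv]
  show "invertible ?H" by (rule inv)
  show "drift_defect i k (b + c) = drift_defect i k b + drift_defect i k c" for k b c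
    by (simp add: drift_defect_def drift_add sp_coeff_add D_add distrib_left)
  show "drift_defect i k (mconst a * b) = a * drift_defect i k b" for k a b
  proof -
    have l: "lin_form ?H i * (mconst a * b) = mconst a * (lin_form ?H i * b)" by (simp add: mult_ac)
    show ?thesis
      unfolding drift_defect_def drift_mult drift_mconst l sp_coeff_add sp_coeff_mconst D_mult
      by (simp add: algebra_simps)
  qed
  show "\<exists>N. \<forall>b. mord N b \<longrightarrow> drift_defect i k b = 0" for k
  proof (intro exI allI impI)
    fix b :: "('a, 'n) mfps" assume b: "mord (2 * Suc k + 1) b"
    have "mord (Suc (2 * k)) b" "mord (Suc (2 * k)) (drift i b)" "mord (Suc (2 * Suc k)) (lin_form ?H i * b)"
      using b by (auto intro!: mord_drift mord_mult_left elim: mord_mono)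
    then show "drift_defect i k b = 0"
      by (simp add: drift_defect_def sp_coeff_eq_0)
  qed
  show "drift_defect i 0 (b * mderiv j ?\<phi>) = 0" for b j
  proof -
    have "?A (Suc 0) (lin_form ?H i * (b * mderiv j ?\<phi>)) = - mcoeff0 (mderiv j (lin_form ?H i * b))"
      using A[of 0 "lin_form ?H i * b" j] by (simp add: mult.assoc sp_coeff_0)
    moreover have "mcoeff0 (mderiv j ?\<phi>) = 0" by (simp add: mderiv_phase)
    ultimately show ?thesis
      by (simp add: drift_defect_def sp_coeff_0 drift_mult drift_mderiv_phase mderiv_mult mderiv_lin_form)
  qed
  show "drift_defect i (Suc k) (b * mderiv j ?\<phi>) = - drift_defect i k (mderiv j b + 0 * b)" for k b j
  proof -
    have 1: "?A (Suc k) (drift i (b * mderiv j ?\<phi>)) = - ?A k (mderiv j (drift i b)) - ?H $ i $ j * ?A (Suc k) b"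
    proof -
      have "drift i (b * mderiv j ?\<phi>) = drift i b * mderiv j ?\<phi> - mconst (?H $ i $ j) * b"
        by (simp add: drift_mult drift_mderiv_phase mult.commute)
      then show ?thesis by (simp only: sp_coeff_diff A sp_coeff_mconst)
    qed
    have 2: "?A (Suc (Suc k)) (lin_form ?H i * (b * mderiv j ?\<phi>)) =
        - (?H $ i $ j * ?A (Suc k) b) - ?A (Suc k) (lin_form ?H i * mderiv j b)"
      using A[of "Suc k" "lin_form ?H i * b" j]
      by (simp add: mult.assoc mderiv_mult mderiv_lin_form sp_coeff_add sp_coeff_mconst)
    show ?thesis
      unfolding drift_defect_def 1 2 A by (simp add: drift_mderiv D_uminus)
  qed
  show "drift_defect i (Suc k) (?\<phi> * b) = - (of_nat k + of_nat CARD('n) / 2) * drift_defect i k b" for k b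
  proof -
    let ?n = "of_nat CARD('n) / 2 :: 'a"
    have "D i (of_nat 2 * ?n) = 2 * D i ?n" by (simp only: D_mult D_of_nat) simp
    moreover have "of_nat 2 * ?n = of_nat CARD('n)" by simp
    ultimately have 0: "D i ?n = 0" by simp
    have 1: "?A (Suc k) (drift i (?\<phi> * b)) = - ?A (Suc k) (lin_form ?H i * b) - (of_nat k + ?n) * ?A k (drift i b)"
    proof -
      have "drift i (?\<phi> * b) = ?\<phi> * drift i b - lin_form ?H i * b"
        by (simp add: drift_mult drift_phase)
      then show ?thesis by (simp only: sp_coeff_diff A\<phi> minus_mult_left[symmetric]) simp
    qed
    have 2: "?A (Suc (Suc k)) (lin_form ?H i * (?\<phi> * b)) = - (of_nat (Suc k) + ?n) * ?A (Suc k) (lin_form ?H i * b)"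
      using A\<phi>[of "Suc k" "lin_form ?H i * b"] by (simp add: mult.left_commute)
    have 3: "D i (- (of_nat k + ?n) * x) = - (of_nat k + ?n) * D i x" for x
      unfolding D_mult D_uminus D_add 0 D_of_nat by simp
    show ?thesis
      unfolding drift_defect_def 1 2 A\<phi> 3 by (simp add: algebra_simps)
  qed
qed

text \<open>The scalar of proportionality is the value of the defect at \<open>k = 0\<close>,
  \<open>b = 1\<close>. In this form a linear factor of the amplitude is traded for one index, at
  the price of a derivative in t and a drift.\<close>

lemma sp_coeff_lin_form:
  "sp_coeff (Suc k) F (lin_form (hess F) i * b) =
    drift_defect i 0 1 * sp_coeff k F b - D i (sp_coeff k F b) + sp_coeff k F (drift i b)"
proof -
  have "sp_functional F (\<lambda>_. 0) (\<lambda>k b. sp_coeff k F (1 * b))"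
    by (rule sp_functional_sp_coeff[OF inv]) simp
  then have "drift_defect i k b = drift_defect i 0 1 * sp_coeff k F (1 * b)"
    by (rule sp_functional_unique[OF sp_functional_drift_defect]) (simp add: sp_coeff_0)
  then have "D i (sp_coeff k F b) - sp_coeff k F (drift i b) + sp_coeff (Suc k) F (lin_form (hess F) i * b) =
      drift_defect i 0 1 * sp_coeff k F b"
    by (simp only: drift_defect_def[of i k b] mult_1_left)
  moreover have "x = (p - q + x) - p + q" for x p q :: 'a by simp
  ultimately show ?thesis by metis
qed

lemma phase_poly_drift: "phase_poly (phase F) d b \<Longrightarrow> phase_poly (phase F) d (drift i b)"
proof (induction rule: phase_poly.induct)
  case (phase_poly_const d c)
  then show ?case by (simp add: drift_mconst phase_poly.intros)
next
  case (phase_poly_mvar d b j)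
  then show ?case
    by (auto simp: drift_mult drift_mvar intro!: phase_poly_diff phase_poly.phase_poly_mvar intro: phase_poly_Suc)
next
  case (phase_poly_phase d b)
  then show ?case
    by (auto simp: drift_mult drift_phase intro!: phase_poly_diff phase_poly.phase_poly_phase phase_poly_lin_form)
qed (auto simp: drift_add drift_mult drift_mconst intro: phase_poly.intros)

text \<open>Each factor \<open>mvar j\<close> or \<open>phase F\<close> is traded for one index, and
  \<open>d \<le> k\<close> keeps the index positive until a constant remains, where
  \<open>adm\<close> applies. The outer induction on \<open>d\<close> is there because
  \<open>drift i b\<close> is not a constituent of \<open>b\<close>, although it has the same
  degree.\<close>

lemma sp_coeff_phase_poly:
  assumes G: "\<And>i. map_coeffs (D i) G = mderiv i G"
    and adm: "\<And>k. sp_coeff (Suc k) F G = 0"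
  shows "phase_poly (phase F) d b \<Longrightarrow> d \<le> k \<Longrightarrow> sp_coeff (Suc k) F (G * b) = 0"
proof (induction d arbitrary: b k rule: less_induct)
  case (less d)
  have dG: "drift i (G * c) = G * drift i c" for i c
    by (simp add: drift_mult) (simp add: drift_def G)
  from less.prems(1) show ?case
    using less.prems(2) less.IH
  proof (induction arbitrary: k rule: phase_poly.induct)
    case (phase_poly_const d c)
    show ?case using sp_coeff_mconst[of "Suc k" F c G] adm by (simp add: mult.commute)
  next
    case (phase_poly_add d a b)
    then show ?case by (simp add: distrib_left sp_coeff_add)
  next
    case (phase_poly_scale d b c)
    then show ?case using sp_coeff_mconst[of "Suc k" F c "G * b"] by (simp add: mult.left_commute)
  next
    case (phase_poly_phase d b)
    then obtain k' where k': "k = Suc k'" "d \<le> k'" by (cases k) auto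
    have "sp_coeff (Suc k') F (G * b) = 0"
      using phase_poly_phase k' by blast
    then show ?case
      using sp_coeff_phase_mult[OF inv, of k "G * b"] k' by (simp add: mult.left_commute)
  next
    case (phase_poly_mvar d b j)
    then obtain k' where k': "k = Suc k'" "d \<le> k'" by (cases k) auto
    have z: "sp_coeff (Suc k') F (G * c) = 0" if "phase_poly (phase F) d c" for c
      using phase_poly_mvar.prems(2) that k' by blast
    have 1: "sp_coeff (Suc k) F (lin_form (hess F) i * (G * b)) = 0" for i
      unfolding k' sp_coeff_lin_form dG z[OF phase_poly_mvar.hyps]
        z[OF phase_poly_drift[OF phase_poly_mvar.hyps]] by (simp add: derivation.D_0[OF D])
    have "G * (mvar j * b) = (\<Sum>i\<in>UNIV. mconst (matrix_inv (hess F) $ j $ i) * (lin_form (hess F) i * (G * b)))"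
      using mvar_eq_lin_forms[OF matrix_inv_right_field(2)[OF inv], of j]
      by (simp add: sum_distrib_left sum_distrib_right mult_ac)
    moreover have "sp_coeff (Suc k) F (\<Sum>i\<in>UNIV. mconst (matrix_inv (hess F) $ j $ i) * (lin_form (hess F) i * (G * b))) = 0"
      by (simp add: sp_coeff_sum sp_coeff_mconst 1)
    ultimately show ?case by simp
  qed
qed

end

section \<open>Change of chart of the cone\<close>

lemma to_fract_0 [simp]: "to_fract 0 = 0"
  and to_fract_1 [simp]: "to_fract 1 = 1"
  and to_fract_add: "to_fract (a + b) = to_fract a + to_fract b"
  and to_fract_diff: "to_fract (a - b) = to_fract a - to_fract b"
  and to_fract_uminus: "to_fract (- a) = - to_fract a"
  and to_fract_mult: "to_fract (a * b) = to_fract a * to_fract b"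
  and to_fract_eq_iff [simp]: "to_fract a = to_fract b \<longleftrightarrow> a = b"
  by (simp_all add: to_fract_def eq_fract Zero_fract_def One_fract_def)

lemma to_fract_eq_0_iff [simp]: "to_fract a = 0 \<longleftrightarrow> a = 0"
  using to_fract_eq_iff[of a 0] by simp

lemma to_fract_sum: "to_fract (sum f A) = (\<Sum>x\<in>A. to_fract (f x))"
  by (induction A rule: infinite_finite_induct) (auto simp: to_fract_add)

lemma to_fract_power: "to_fract (a ^ k) = to_fract a ^ k"
  by (induction k) (auto simp: to_fract_mult)

lemma to_fract_of_nat: "to_fract (of_nat k) = of_nat k"
  by (induction k) (auto simp: to_fract_add)

text \<open>Over the fraction field one-sided inverses of square matrices are two-sided, and the
  domain embeds into it.\<close>

lemma idom_left_inverse_right_inverse: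
  fixes Z J :: "'n::finite \<Rightarrow> 'n \<Rightarrow> 'a::idom"
  assumes ZJ: "\<And>j l. (\<Sum>i\<in>UNIV. Z j i * J i l) = (if j = l then 1 else 0)"
  shows "(\<Sum>i\<in>UNIV. J j i * Z i l) = (if j = l then 1 else 0)"
proof -
  define Zf Jf where "Zf = (\<chi> i j. to_fract (Z i j))" and "Jf = (\<chi> i j. to_fract (J i j))"
  have "to_fract (\<Sum>i\<in>UNIV. Z j i * J i l) = to_fract (if j = l then 1 else 0)" for j l
    by (simp only: ZJ)
  then have "Zf ** Jf = mat 1"
    by (simp add: vec_eq_iff matrix_matrix_mult_def mat_def Zf_def Jf_def to_fract_sum to_fract_mult if_distrib[of to_fract])
  then have "Jf ** Zf = mat 1" by (rule matrix_left_right_inverse1)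
  then have "to_fract (\<Sum>i\<in>UNIV. J j i * Z i l) = to_fract (if j = l then 1 else 0)"
    by (simp add: vec_eq_iff matrix_matrix_mult_def mat_def Zf_def Jf_def to_fract_sum to_fract_mult if_distrib[of to_fract])
  then show ?thesis by simp
qed

section \<open>The parametrised cone and its image\<close>

lemma sum_hindex:
  fixes f :: "'n::finite hindex \<Rightarrow> 'a::comm_monoid_add"
  shows "(\<Sum>a\<in>UNIV. f a) = f Zeroth + f Last + (\<Sum>i\<in>UNIV. f (Mid i))"
proof -
  have "(\<Sum>a\<in>UNIV. f a) = f Zeroth + (f Last + (\<Sum>a\<in>range Mid. f a))"
    unfolding UNIV_hindex by (subst sum.insert, simp, force)+ simp
  also have "(\<Sum>a\<in>range Mid. f a) = (\<Sum>i\<in>UNIV. f (Mid i))"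
    by (subst sum.reindex) (auto simp: inj_on_def)
  finally show ?thesis by (simp add: add.assoc)
qed

text \<open>The point \<open>(1, t + u, F(u))\<close> of the cone and its image under \<open>M\<close>.\<close>

definition cone_param :: "'a::comm_ring_1 ^ 'n \<Rightarrow> ('a, 'n::finite) mfps \<Rightarrow> 'n hindex \<Rightarrow> ('a, 'n) mfps" where
  "cone_param t F a = (case a of Zeroth \<Rightarrow> 1 | Mid i \<Rightarrow> mconst (t $ i) + mvar i | Last \<Rightarrow> F)"

definition cone_image ::
    "'a::comm_ring_1 ^ 'n hindex ^ 'n hindex \<Rightarrow> 'a ^ 'n \<Rightarrow> ('a, 'n::finite) mfps \<Rightarrow> 'n hindex \<Rightarrow> ('a, 'n) mfps" where
  "cone_image M t F a = (\<Sum>b\<in>UNIV. mconst (M $ a $ b) * cone_param t F b)"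

lemma cone_param_simps [simp]:
  "cone_param t F Zeroth = 1" "cone_param t F (Mid i) = mconst (t $ i) + mvar i" "cone_param t F Last = F"
  by (simp_all add: cone_param_def)

lemma mderiv_cone_image:
  "mderiv j (cone_image M t F a) = mconst (M $ a $ Mid j) + mconst (M $ a $ Last) * mderiv j F"
  by (simp add: cone_image_def sum_hindex mderiv_add mderiv_sum mderiv_mvar)

lemma mderiv2_cone_image:
  "mderiv b (mderiv j (cone_image M t F a)) = mconst (M $ a $ Last) * mderiv b (mderiv j F)"
  by (simp add: mderiv_cone_image mderiv_add)

lemma cone_image_mat_1: "cone_image (mat 1) t F = cone_param t F"
proof
  fix a show "cone_image (mat 1) t F a = cone_param t F a"
    unfolding cone_image_def mat_def vec_lambda_beta if_distrib[of mconst] mconst_0 mconst_1 by simp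
qed

lemma sum_cone_image:
  "(\<Sum>b\<in>UNIV. mconst (N $ a $ b) * cone_image M t F b) = cone_image (N ** M) t F a"
  unfolding cone_image_def sum_distrib_left matrix_matrix_mult_def
  by (subst sum.swap) (simp add: mconst_sum sum_distrib_right mconst_mult mult.assoc)

text \<open>Turns products and powers into sums and multiples, so that an identity of
  \<open>wt_den\<close>-th powers yields information on the amplitude itself without extracting
  roots.\<close>

definition dlog :: "'n \<Rightarrow> ('a::field_char_0, 'n::finite) mfps \<Rightarrow> ('a, 'n) mfps" where
  "dlog b X = mderiv b X * minv X"

lemma dlog_mult:
  fixes X Y :: "('a::field_char_0, 'n::finite) mfps"
  assumes "mcoeff0 X \<noteq> 0" "mcoeff0 Y \<noteq> 0"
  shows "dlog b (X * Y) = dlog b X + dlog b Y"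
proof -
  have "minv (X * Y) = minv X * minv Y"
  proof (rule minv_unique)
    have "X * Y * (minv X * minv Y) = (X * minv X) * (Y * minv Y)" by (simp only: mult_ac)
    then show "X * Y * (minv X * minv Y) = 1" using assms by (simp add: mult_minv)
  qed
  then have "dlog b (X * Y) = mderiv b X * minv X * (Y * minv Y) + mderiv b Y * minv Y * (X * minv X)"
    by (simp add: dlog_def mderiv_mult algebra_simps)
  then show ?thesis using assms by (simp add: mult_minv dlog_def)
qed

lemma dlog_power:
  fixes X :: "('a::field_char_0, 'n::finite) mfps"
  assumes "mcoeff0 X \<noteq> 0"
  shows "dlog b (X ^ k) = of_nat k * dlog b X"
proof (induction k)
  case 0
  then show ?case by (simp add: dlog_def)
next
  case (Suc k)
  then show ?case using assms by (simp add: dlog_mult algebra_simps)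
qed

lemma dlog_mconst [simp]: "dlog b (mconst c) = 0"
  by (simp add: dlog_def)

lemma mderiv_eq_dlog:
  fixes X :: "('a::field_char_0, 'n::finite) mfps"
  assumes "mcoeff0 X \<noteq> 0" shows "mderiv b X = X * dlog b X"
  using mult_minv[OF assms] by (simp add: dlog_def mult.left_commute)

lemma dlog_minv:
  fixes X :: "('a::field_char_0, 'n::finite) mfps"
  assumes "mcoeff0 X \<noteq> 0" shows "dlog b (minv X) = - dlog b X"
proof -
  have "dlog b (X * minv X) = dlog b X + dlog b (minv X)"
    using assms by (intro dlog_mult) auto
  then show ?thesis
    using mult_minv[OF assms] by (simp add: dlog_def eq_neg_iff_add_eq_0 add.commute)
qed

lemma half_weight: "2 * half_weight TYPE('n::finite) = wt_den TYPE('n) * (CARD('n) + 2)"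
  by (auto simp: half_weight_def wt_den_def)

lemma wt_den_pos: "wt_den TYPE('n::finite) > 0"
  by (simp add: wt_den_def)

text \<open>\<open>M\<close> carries the graph of \<open>F\<close> at \<open>t\<close> to the graph
  of \<open>F'\<close> at \<open>t'\<close>. The inverse matrix is a parameter \<open>N\<close>,
  which suits matrices whose scalars have been extended to the field of the generic point.\<close>

locale cone_chart =
  fixes F F' :: "('a::field_char_0, 'n::finite) mfps" and M N :: "'a ^ 'n hindex ^ 'n hindex" and t t' :: "'a ^ 'n"
  assumes NM: "N ** M = mat 1"
    and lam0: "mcoeff0 (cone_image M t F Zeroth) \<noteq> 0"
    and base: "\<And>i. mcoeff0 (cone_image M t F (Mid i)) = t' $ i * mcoeff0 (cone_image M t F Zeroth)"
    and graph: "msubst F' (\<lambda>i. cone_image M t F (Mid i) * minv (cone_image M t F Zeroth) - mconst (t' $ i))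
        * cone_image M t F Zeroth = cone_image M t F Last"
begin

abbreviation "y \<equiv> cone_image M t F"

definition "lam = y Zeroth"

definition "\<psi> i = y (Mid i) * minv lam"

definition "s i = \<psi> i - mconst (t' $ i)"

abbreviation "m a \<equiv> mconst (M $ a $ Last)"

definition "\<mu> i = m (Mid i) - m Zeroth * \<psi> i"

definition "f = msubst F' s"

definition "f' i = msubst (mderiv i F') s"

text \<open>On the cone, the quotient of this series by \<open>lam\<close> is the derivative of the
  new equation x_(n+1)/x_0 - F'(x/x_0) along the image under \<open>M\<close> of the direction
  x_(n+1).\<close>

definition "\<theta> = m Last - m Zeroth * f - (\<Sum>i\<in>UNIV. f' i * \<mu> i)"

definition "J i j = mderiv j (\<psi> i)"

text \<open>Differentiating the inverse chart, which is \<open>N\<close> followed by division by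
  x_0, gives this explicit inverse of the Jacobian \<open>J\<close>; \<open>lam\<close> is the
  reciprocal of the denominator.\<close>

definition "Z j i = lam * ((mconst (N $ Mid j $ Mid i) + mconst (N $ Mid j $ Last) * f' i) -
   cone_param t F (Mid j) * (mconst (N $ Zeroth $ Mid i) + mconst (N $ Zeroth $ Last) * f' i))"

lemma lam_nz: "mcoeff0 lam \<noteq> 0" using lam0 by (simp add: lam_def)

lemma s0: "mcoeff0 (s i) = 0"
  using base[of i] lam_nz by (simp add: s_def \<psi>_def lam_def)

lemma y_Mid: "y (Mid i) = lam * \<psi> i"
  using mult_minv[OF lam_nz] by (simp add: \<psi>_def mult.left_commute)

lemma y_Last: "y Last = lam * f"
  using graph by (simp add: f_def s_def[abs_def] \<psi>_def lam_def mult.commute)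

lemma mderiv_s: "mderiv j (s i) = J i j"
  by (simp add: s_def J_def mderiv_diff)

lemma mderiv_f: "mderiv j f = (\<Sum>i\<in>UNIV. f' i * J i j)"
  unfolding f_def f'_def by (simp add: mderiv_msubst[OF s0] mderiv_s)

lemma mderiv_J: "mderiv b (J i j) = mderiv j (J i b)"
  by (simp add: J_def mderiv_commute)

lemma mderiv2_lam: "mderiv b (mderiv j lam) = m Zeroth * mderiv b (mderiv j F)"
  by (simp add: lam_def mderiv2_cone_image)

text \<open>Each component of \<open>y\<close> is affine in \<open>u\<close> and \<open>F\<close>,
  hence its second derivatives are multiples of those of \<open>F\<close>; this is compared with the
  product rule for \<open>y (Mid i) = lam * \<psi> i\<close>.\<close>

lemma lam_mderiv_J:
  "lam * mderiv b (J i j) = mderiv b (mderiv j F) * \<mu> i - mderiv j lam * J i b - mderiv b lam * J i j"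
proof -
  have "m (Mid i) * mderiv b (mderiv j F) = mderiv b (mderiv j (lam * \<psi> i))"
    using mderiv2_cone_image[of b j M t F "Mid i"] by (simp add: y_Mid)
  also have "\<dots> = m Zeroth * mderiv b (mderiv j F) * \<psi> i + mderiv j lam * J i b + mderiv b lam * J i j
      + lam * mderiv b (J i j)"
    by (simp add: mderiv_mult mderiv_add mderiv2_lam J_def)
  finally show ?thesis by (simp add: \<mu>_def algebra_simps)
qed

text \<open>The transformation law of Hessians: H \<theta> is \<open>lam\<close> times J^T H' J. It
  comes from the same comparison for \<open>lam * f\<close>, in which the first derivatives of
  \<open>lam\<close> cancel against those in \<open>lam_mderiv_J\<close>.\<close>

lemma hess_F_theta:
  "mderiv b (mderiv j F) * \<theta> = lam * (\<Sum>i\<in>UNIV. mderiv b (f' i) * J i j)"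
proof -
  let ?H = "mderiv b (mderiv j F)"
  have "m Last * ?H = mderiv b (mderiv j (lam * f))"
    using mderiv2_cone_image[of b j M t F Last] by (simp add: y_Last)
  also have "\<dots> = m Zeroth * ?H * f + mderiv j lam * mderiv b f + mderiv b lam * mderiv j f
      + lam * mderiv b (mderiv j f)"
    by (simp add: mderiv_mult mderiv_add mderiv2_lam)
  also have "lam * mderiv b (mderiv j f) = lam * (\<Sum>i\<in>UNIV. mderiv b (f' i) * J i j) +
      (\<Sum>i\<in>UNIV. f' i * (lam * mderiv b (J i j)))"
    by (simp add: mderiv_f mderiv_sum mderiv_mult sum.distrib distrib_left sum_distrib_left mult_ac)
  also have "(\<Sum>i\<in>UNIV. f' i * (lam * mderiv b (J i j))) =
      ?H * (\<Sum>i\<in>UNIV. f' i * \<mu> i) - mderiv j lam * mderiv b f - mderiv b lam * mderiv j f"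
    unfolding lam_mderiv_J mderiv_f sum_distrib_left sum_subtractf[symmetric]
    by (rule sum.cong) (simp_all add: algebra_simps)
  finally show ?thesis by (simp add: \<theta>_def algebra_simps)
qed

lemma mderiv_theta: "mderiv b \<theta> = - (\<Sum>i\<in>UNIV. mderiv b (f' i) * \<mu> i)"
proof -
  have "mderiv b (\<mu> i) = - (m Zeroth * J i b)" for i
    by (simp add: \<mu>_def mderiv_diff J_def)
  then have "mderiv b \<theta> = - (m Zeroth * mderiv b f) - (\<Sum>i\<in>UNIV. mderiv b (f' i) * \<mu> i - m Zeroth * (f' i * J i b))"
    by (simp add: \<theta>_def mderiv_diff mderiv_sum mderiv_mult mult_ac)
  then show ?thesis
    by (simp add: mderiv_f sum_subtractf sum_distrib_left)
qed

lemma ZJ: "(\<Sum>i\<in>UNIV. Z j i * J i l) = (if j = l then 1 else 0)"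
proof -
  define X where "X a = mconst (N $ a $ Zeroth) + mconst (N $ a $ Last) * f + (\<Sum>i\<in>UNIV. mconst (N $ a $ Mid i) * \<psi> i)" for a
  have x: "cone_param t F a = lam * X a" for a
  proof -
    have "cone_param t F a = (\<Sum>b\<in>UNIV. mconst (N $ a $ b) * y b)"
      unfolding sum_cone_image NM cone_image_mat_1 ..
    then show ?thesis
      by (simp add: sum_hindex y_Mid y_Last lam_def[symmetric] X_def algebra_simps sum_distrib_left)
  qed
  have dX: "mderiv l (X a) = (\<Sum>i\<in>UNIV. (mconst (N $ a $ Mid i) + mconst (N $ a $ Last) * f' i) * J i l)" for a
    by (simp add: X_def mderiv_add mderiv_sum mderiv_f J_def distrib_right sum.distrib sum_distrib_left mult.assoc)
  have e0: "(\<Sum>i\<in>UNIV. Z j i * J i l) = lam * mderiv l (X (Mid j)) - cone_param t F (Mid j) * (lam * mderiv l (X Zeroth))"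
    unfolding dX sum_distrib_left sum_subtractf[symmetric] Z_def
    by (rule sum.cong) (simp_all add: algebra_simps)
  have e1: "lam * mderiv l (X (Mid j)) = (if j = l then 1 else 0) - mderiv l lam * X (Mid j)"
  proof -
    have "mderiv l (cone_param t F (Mid j)) = mderiv l (lam * X (Mid j))" by (simp only: x)
    then show ?thesis by (auto simp: mderiv_mult mderiv_add mderiv_mvar algebra_simps)
  qed
  have one: "lam * X Zeroth = 1" using x[of Zeroth] by simp
  have e2: "lam * mderiv l (X Zeroth) = - mderiv l lam * X Zeroth"
  proof -
    have "mderiv l (lam * X Zeroth) = 0" unfolding one by simp
    then show ?thesis by (simp add: mderiv_mult eq_neg_iff_add_eq_0 add.commute)
  qed
  have "(\<Sum>i\<in>UNIV. Z j i * J i l) = ((if j = l then 1 else 0) - mderiv l lam * X (Mid j)) -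
      (lam * X (Mid j)) * (- mderiv l lam * X Zeroth)"
    unfolding e0 e1 e2 x[of "Mid j"] ..
  also have "\<dots> = (if j = l then 1 else 0) - mderiv l lam * X (Mid j) + (lam * X Zeroth) * (X (Mid j) * mderiv l lam)"
    by (simp only: mult_minus_left mult_minus_right diff_minus_eq_add mult_ac)
  finally show ?thesis unfolding one by simp
qed

lemma JZ: "(\<Sum>j\<in>UNIV. J i j * Z j l) = (if i = l then 1 else 0)"
  using ZJ by (rule idom_left_inverse_right_inverse)

text \<open>The logarithmic derivative of det J by Jacobi's formula; the trace form avoids
  determinants of series.\<close>

definition "T b = (\<Sum>i\<in>UNIV. \<Sum>j\<in>UNIV. Z j i * mderiv b (J i j))"

text \<open>Differentiating \<open>ZJ\<close> expresses the derivatives of \<open>Z\<close> by those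
  of \<open>J\<close>; as the rows of \<open>J\<close> are gradients, the direction of
  differentiation may be exchanged with the column index, and a trace appears.\<close>

lemma divergence_Z: "(\<Sum>j\<in>UNIV. mderiv j (Z j k)) = - (\<Sum>b\<in>UNIV. Z b k * T b)"
proof -
  have dZ: "mderiv c (Z j k) = - (\<Sum>l\<in>UNIV. \<Sum>i\<in>UNIV. Z j i * mderiv c (J i l) * Z l k)" for c j
  proof -
    have "mderiv c (\<Sum>i\<in>UNIV. Z j i * J i l) = 0" for l
      unfolding ZJ by simp
    then have "(\<Sum>l\<in>UNIV. mderiv c (\<Sum>i\<in>UNIV. Z j i * J i l) * Z l k) = 0" by simp
    then have "(\<Sum>l\<in>UNIV. \<Sum>i\<in>UNIV. mderiv c (Z j i) * (J i l * Z l k)) +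
        (\<Sum>l\<in>UNIV. \<Sum>i\<in>UNIV. Z j i * mderiv c (J i l) * Z l k) = 0"
      by (simp add: mderiv_sum mderiv_mult sum_distrib_right sum.distrib distrib_right mult.assoc)
    moreover have "(\<Sum>l\<in>UNIV. \<Sum>i\<in>UNIV. mderiv c (Z j i) * (J i l * Z l k)) = mderiv c (Z j k)"
      by (subst sum.swap) (simp add: sum_distrib_left[symmetric] JZ)
    ultimately show ?thesis by (simp add: eq_neg_iff_add_eq_0)
  qed
  have "(\<Sum>j\<in>UNIV. mderiv j (Z j k)) = - (\<Sum>j\<in>UNIV. \<Sum>l\<in>UNIV. \<Sum>i\<in>UNIV. Z j i * mderiv l (J i j) * Z l k)"
    unfolding dZ sum_negf by (simp add: mderiv_J)
  also have "(\<Sum>j\<in>UNIV. \<Sum>l\<in>UNIV. \<Sum>i\<in>UNIV. Z j i * mderiv l (J i j) * Z l k) =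
      (\<Sum>l\<in>UNIV. \<Sum>i\<in>UNIV. \<Sum>j\<in>UNIV. Z l k * (Z j i * mderiv l (J i j)))"
    by (subst sum.swap, rule sum.cong[OF refl], subst sum.swap) (simp add: mult_ac)
  finally show ?thesis by (simp add: T_def sum_distrib_left)
qed

text \<open>Says that det J is a constant divided by \<theta> times the power n + 1 of
  \<open>lam\<close>, in a form free of inverses. Of the factor n + 1, n is the trace of the
  identity, and 1 comes from the gradient of \<open>lam\<close> contracted with the
  identity.\<close>

lemma theta_lam_T:
  "\<theta> * (lam * T b) + of_nat (CARD('n) + 1) * (\<theta> * mderiv b lam) + lam * mderiv b \<theta> = 0"
proof -
  let ?F = "\<lambda>j. mderiv b (mderiv j F)"
  have "lam * T b = (\<Sum>i\<in>UNIV. \<Sum>j\<in>UNIV. ?F j * (Z j i * \<mu> i) - mderiv j lam * (Z j i * J i b) - mderiv b lam * (Z j i * J i j))"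
    unfolding T_def sum_distrib_left
  proof (intro sum.cong refl)
    fix i j
    have "lam * (Z j i * mderiv b (J i j)) = Z j i * (lam * mderiv b (J i j))" by (simp add: mult_ac)
    then show "lam * (Z j i * mderiv b (J i j)) =
       ?F j * (Z j i * \<mu> i) - mderiv j lam * (Z j i * J i b) - mderiv b lam * (Z j i * J i j)"
      unfolding lam_mderiv_J by (simp add: algebra_simps)
  qed
  also have "\<dots> = (\<Sum>j\<in>UNIV. ?F j * (\<Sum>i\<in>UNIV. Z j i * \<mu> i)) - (\<Sum>j\<in>UNIV. mderiv j lam * (\<Sum>i\<in>UNIV. Z j i * J i b))
      - mderiv b lam * (\<Sum>j\<in>UNIV. (\<Sum>i\<in>UNIV. Z j i * J i j))"
    unfolding sum_distrib_left by (subst sum.swap) (simp add: sum_subtractf)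
  also have "\<dots> = (\<Sum>j\<in>UNIV. ?F j * (\<Sum>i\<in>UNIV. Z j i * \<mu> i)) - of_nat (CARD('n) + 1) * mderiv b lam"
    unfolding ZJ by (simp add: algebra_simps)
  finally have "\<theta> * (lam * T b) = (\<Sum>j\<in>UNIV. (?F j * \<theta>) * (\<Sum>i\<in>UNIV. Z j i * \<mu> i)) - of_nat (CARD('n) + 1) * (\<theta> * mderiv b lam)"
    by (simp add: right_diff_distrib sum_distrib_left mult_ac)
  also have "(\<Sum>j\<in>UNIV. (?F j * \<theta>) * (\<Sum>i\<in>UNIV. Z j i * \<mu> i)) =
      lam * (\<Sum>k\<in>UNIV. \<Sum>i\<in>UNIV. mderiv b (f' k) * \<mu> i * (\<Sum>j\<in>UNIV. J k j * Z j i))"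
  proof -
    have "(\<Sum>j\<in>UNIV. (?F j * \<theta>) * (\<Sum>i\<in>UNIV. Z j i * \<mu> i)) =
       (\<Sum>j\<in>UNIV. \<Sum>k\<in>UNIV. \<Sum>i\<in>UNIV. lam * (mderiv b (f' k) * \<mu> i * (J k j * Z j i)))"
      unfolding hess_F_theta mult.assoc[of lam] sum_product unfolding sum_distrib_left
      by (intro sum.cong refl) (simp only: mult_ac)
    also have "\<dots> = (\<Sum>k\<in>UNIV. \<Sum>i\<in>UNIV. \<Sum>j\<in>UNIV. lam * (mderiv b (f' k) * \<mu> i * (J k j * Z j i)))"
      by (subst sum.swap, rule sum.cong[OF refl], rule sum.swap)
    finally show ?thesis by (simp only: sum_distrib_left)
  qed
  also have "\<dots> = - (lam * mderiv b \<theta>)"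
    unfolding JZ by (simp add: mderiv_theta)
  finally show ?thesis by (simp only:) (simp add: algebra_simps)
qed

lemma mderiv_msubst_Z: "(\<Sum>j\<in>UNIV. Z j i * mderiv j (msubst b s)) = msubst (mderiv i b) s"
proof -
  have "(\<Sum>j\<in>UNIV. Z j i * mderiv j (msubst b s)) = (\<Sum>l\<in>UNIV. msubst (mderiv l b) s * (\<Sum>j\<in>UNIV. J l j * Z j i))"
    unfolding mderiv_msubst[OF s0] mderiv_s sum_distrib_left by (subst sum.swap) (simp add: mult_ac)
  then show ?thesis by (simp add: JZ)
qed

text \<open>Both sides have order 2, and both are affine in \<open>u\<close> and \<open>F\<close>,
  the left one being a combination of components of \<open>y\<close>. So it suffices to compare the
  coefficients of the second derivatives of \<open>F\<close>, and the left one is the constant term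
  of \<theta>.\<close>

lemma lam_phase:
  "lam * msubst (phase F') s = mconst (mcoeff0 \<theta>) * phase F"
proof -
  define X where "X = lam * msubst (phase F') s - mconst (mcoeff0 \<theta>) * phase F"
  have "mord 2 (msubst (phase F') s)" by (intro mord_msubst mord_phase s0)
  then have X2: "mord 2 X"
    unfolding X_def by (intro mord_diff mord_mult_left mord_phase)
  have Y: "lam * msubst (phase F') s = y Last - mconst (mcoeff0 F') * y Zeroth
      - (\<Sum>i\<in>UNIV. mconst (mcoeff0 (mderiv i F')) * (y (Mid i) - mconst (t' $ i) * y Zeroth))"
  proof -
    have "msubst (phase F') s = f - mconst (mcoeff0 F') - (\<Sum>i\<in>UNIV. mconst (mcoeff0 (mderiv i F')) * s i)"
      by (simp add: phase_def msubst_diff msubst_sum msubst_mult[OF s0] msubst_mvar[of s, OF s0] f_def)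
    moreover have "lam * s i = y (Mid i) - mconst (t' $ i) * y Zeroth" for i
      by (simp add: s_def y_Mid lam_def algebra_simps)
    moreover have "lam * (f - mconst (mcoeff0 F') - (\<Sum>i\<in>UNIV. mconst (mcoeff0 (mderiv i F')) * s i)) =
        lam * f - mconst (mcoeff0 F') * lam - (\<Sum>i\<in>UNIV. mconst (mcoeff0 (mderiv i F')) * (lam * s i))"
      by (simp add: right_diff_distrib sum_distrib_left mult_ac)
    ultimately show ?thesis
      by (simp only: y_Last lam_def[symmetric])
  qed
  have d1: "mderiv b (mderiv j (lam * msubst (phase F') s)) =
      (m Last - mconst (mcoeff0 F') * m Zeroth - (\<Sum>i\<in>UNIV. mconst (mcoeff0 (mderiv i F')) * (m (Mid i) - mconst (t' $ i) * m Zeroth)))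
        * mderiv b (mderiv j F)" for b j
    unfolding Y mderiv_diff mderiv_sum mderiv_mconst_mult mderiv2_cone_image
    by (simp add: algebra_simps sum_distrib_left sum_subtractf)
  have d2: "m Last - mconst (mcoeff0 F') * m Zeroth - (\<Sum>i\<in>UNIV. mconst (mcoeff0 (mderiv i F')) * (m (Mid i) - mconst (t' $ i) * m Zeroth)) =
      mconst (mcoeff0 \<theta>)"
  proof -
    have "mcoeff0 (\<psi> i) = t' $ i" for i using s0[of i] by (simp add: s_def)
    then show ?thesis
      by (simp add: \<theta>_def \<mu>_def f_def f'_def mconst_diff mconst_mult mconst_sum mult_ac)
  qed
  have X3: "mderiv b (mderiv j X) = 0" for b j
    unfolding X_def mderiv_diff d1 d2 by (simp add: mderiv_phase mderiv_diff)
  have X0: "mcoeff0 X = 0" and X1: "mcoeff0 (mderiv j X) = 0" for j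
    using X2 by (auto simp: numeral_2_eq_2 mord_Suc_iff)
  have "mderiv j X = 0" for j
    by (rule mfps_eq_0_if_mderiv_0[OF X1 X3])
  then have "X = 0" by (rule mfps_eq_0_if_mderiv_0[OF X0])
  then show ?thesis by (simp add: X_def)
qed

lemma invertible_hess_image:
  assumes inv: "invertible (hess F)" and th: "mcoeff0 \<theta> \<noteq> 0"
  shows "invertible (hess F')"
proof -
  define B where "B = matrix_inv (hess F)"
  define J0 where "J0 = (\<chi> i j. mcoeff0 (J i j))"
  have "mcoeff0 (mderiv b (f' i)) = (\<Sum>l\<in>UNIV. hess F' $ i $ l * J0 $ l $ b)" for b i
    unfolding f'_def mderiv_msubst[OF s0] by (simp add: hess_def mderiv_s J0_def mderiv_commute)
  then have e1: "hess F $ b $ j * mcoeff0 \<theta> = mcoeff0 lam * (\<Sum>i\<in>UNIV. (\<Sum>l\<in>UNIV. hess F' $ i $ l * J0 $ l $ b) * J0 $ i $ j)" for b j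
    using arg_cong[OF hess_F_theta[of b j], of mcoeff0] by (simp add: hess_def J0_def)
  have e2: "(\<Sum>i\<in>UNIV. (\<Sum>l\<in>UNIV. hess F' $ i $ l * J0 $ l $ b) * J0 $ i $ j) = (transpose J0 ** (hess F' ** J0)) $ b $ j" for b j
    unfolding matrix_matrix_mult_def transpose_def vec_lambda_beta sum_distrib_left sum_distrib_right
    by (subst sum.swap) (simp add: hess_symmetric[of F'] mult_ac)
  have "hess F $ b $ j = (mcoeff0 lam / mcoeff0 \<theta>) * (transpose J0 ** (hess F' ** J0)) $ b $ j" for b j
    using e1[of b j] th unfolding e2 by (simp add: field_simps)
  then have H: "hess F = transpose J0 ** (hess F' ** (\<chi> i j. (mcoeff0 lam / mcoeff0 \<theta>) * J0 $ i $ j))"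
    by (simp add: vec_eq_iff matrix_matrix_mult_def sum_distrib_left mult_ac)
  have "(transpose J0 ** (hess F' ** (\<chi> i j. (mcoeff0 lam / mcoeff0 \<theta>) * J0 $ i $ j))) ** B = mat 1"
    by (simp only: H[symmetric] B_def matrix_inv_right_field(1)[OF inv])
  then have "transpose J0 ** (hess F' ** (\<chi> i j. (mcoeff0 lam / mcoeff0 \<theta>) * J0 $ i $ j) ** B) = mat 1"
    by (simp only: matrix_mul_assoc)
  then have "hess F' ** (\<chi> i j. (mcoeff0 lam / mcoeff0 \<theta>) * J0 $ i $ j) ** B ** transpose J0 = mat 1"
    by (rule matrix_left_right_inverse1)
  then have "hess F' ** ((\<chi> i j. (mcoeff0 lam / mcoeff0 \<theta>) * J0 $ i $ j) ** B ** transpose J0) = mat 1"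
    by (simp only: matrix_mul_assoc)
  then show ?thesis using matrix_left_right_inverse1 invertible_def by blast
qed

text \<open>\<open>lam\<close> has degree at most one in \<open>u\<close> and the phase, so its
  powers are of the kind treated by \<open>sp_coeff_phase_poly\<close>.\<close>

lemma lam_eq_phase: "lam = mconst a + (\<Sum>j\<in>UNIV. mconst (b j) * mvar j) + mconst (M $ Zeroth $ Last) * phase F"
  if "a = M $ Zeroth $ Zeroth + (\<Sum>i\<in>UNIV. M $ Zeroth $ Mid i * t $ i) + M $ Zeroth $ Last * mcoeff0 F"
    "\<And>j. b j = M $ Zeroth $ Mid j + M $ Zeroth $ Last * mcoeff0 (mderiv j F)"
  by (simp add: that lam_def cone_image_def sum_hindex phase_def algebra_simps mconst_add mconst_mult mconst_sum
      sum.distrib sum_distrib_left)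

end

text \<open>\<open>ampl\<close> is the equality of the two densities on the cone: there the unit
  between the two equations is \<open>lam\<close> divided by \<theta>, and the weight of x_0
  accounts for the power \<open>half_weight\<close> of \<open>lam\<close>. Nonvanishing is required
  at the base point, which will be the generic one.\<close>

locale cone_density = cone_chart F F' M N t t'
  for F F' :: "('a::field_char_0, 'n::finite) mfps" and M N :: "'a ^ 'n hindex ^ 'n hindex" and t t' :: "'a ^ 'n" +
  fixes G G' :: "('a, 'n) mfps" and c :: 'a
  assumes inv: "invertible (hess F)" and theta0: "mcoeff0 \<theta> \<noteq> 0" and c: "c \<noteq> 0"
    and G0: "mcoeff0 G \<noteq> 0" and G'0: "mcoeff0 G' \<noteq> 0"
    and ampl: "lam ^ wt_den TYPE('n) * msubst G' s ^ wt_den TYPE('n) =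
       mconst c * \<theta> ^ wt_den TYPE('n) * lam ^ half_weight TYPE('n) * G ^ wt_den TYPE('n)"
begin

definition "g = msubst G' s"

lemma g0: "mcoeff0 g \<noteq> 0" by (simp add: g_def G'0)

abbreviation half_n :: "('a, 'n) mfps" where "half_n \<equiv> mconst (of_nat CARD('n) / 2)"

lemma half_n_double: "half_n + half_n = of_nat CARD('n)"
proof -
  have "of_nat CARD('n) / 2 + of_nat CARD('n) / 2 = (of_nat CARD('n) :: 'a)"
    by (simp add: add_divide_distrib[symmetric] mult_2[symmetric])
  then show ?thesis by (simp only: mconst_add[symmetric] mconst_of_nat)
qed

lemma dlog_g: "dlog b g = dlog b \<theta> + half_n * dlog b lam + dlog b G"
proof -
  let ?e = "wt_den TYPE('n)" and ?h = "half_weight TYPE('n)" and ?n = "CARD('n)"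
  have "dlog b (lam ^ ?e * g ^ ?e) = dlog b (mconst c * \<theta> ^ ?e * lam ^ ?h * G ^ ?e)"
    unfolding g_def ampl ..
  then have "of_nat ?e * dlog b lam + of_nat ?e * dlog b g =
      of_nat ?e * dlog b \<theta> + of_nat ?h * dlog b lam + of_nat ?e * dlog b G"
    using c theta0 G0 g0 lam_nz by (simp add: dlog_mult dlog_power)
  \<comment> \<open>Twice \<open>half_weight\<close> is \<open>wt_den\<close> times n + 2; the
    doubling clears the halves before \<open>2 * wt_den\<close> is cancelled.\<close>
  then have "2 * (of_nat ?e * dlog b lam + of_nat ?e * dlog b g) =
      2 * (of_nat ?e * dlog b \<theta> + of_nat ?h * dlog b lam + of_nat ?e * dlog b G)" by simp
  note X1 = this
  have X2: "2 * (of_nat ?h * dlog b lam) = of_nat ?e * (of_nat (?n + 2) * dlog b lam)"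
    using arg_cong[OF half_weight[where 'n = 'n], of "of_nat :: nat \<Rightarrow> ('a, 'n) mfps"]
    by (simp only: of_nat_mult of_nat_numeral mult.assoc[symmetric])
  have X3: "of_nat (?n + 2) * dlog b lam = 2 * (half_n * dlog b lam) + 2 * dlog b lam"
    unfolding of_nat_add half_n_double[symmetric] by (simp add: algebra_simps)
  have "2 * of_nat ?e * dlog b g = 2 * (of_nat ?e * dlog b lam + of_nat ?e * dlog b g) - 2 * (of_nat ?e * dlog b lam)"
    by (simp only: distrib_left add_diff_cancel_left' mult.assoc)
  also have "\<dots> = 2 * (of_nat ?e * dlog b \<theta>) + of_nat ?e * (2 * (half_n * dlog b lam) + 2 * dlog b lam)
      + 2 * (of_nat ?e * dlog b G) - 2 * (of_nat ?e * dlog b lam)"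
    unfolding X1 unfolding distrib_left[of 2] X2 unfolding X3 ..
  also have "\<dots> = 2 * of_nat ?e * (dlog b \<theta> + half_n * dlog b lam + dlog b G)"
    by (simp only: distrib_left mult.assoc mult.left_commute[of "of_nat ?e" 2]) simp
  finally have "2 * of_nat ?e * dlog b g = 2 * of_nat ?e * (dlog b \<theta> + half_n * dlog b lam + dlog b G)" .
  moreover have "(2 * of_nat ?e :: ('a, 'n) mfps) \<noteq> 0" using wt_den_pos[where 'n = 'n] by simp
  ultimately show ?thesis using mult_left_cancel by blast
qed

lemma T_eq: "T b = - of_nat (CARD('n) + 1) * dlog b lam - dlog b \<theta>"
proof -
  have "\<theta> * lam * (T b + of_nat (CARD('n) + 1) * dlog b lam + dlog b \<theta>) = 0"
    using theta_lam_T[of b] unfolding mderiv_eq_dlog[OF lam_nz] mderiv_eq_dlog[OF theta0]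
    by (simp add: algebra_simps)
  moreover have "\<theta> * lam \<noteq> 0"
    using theta0 lam_nz by (metis mcoeff0_mult mcoeff_zero mult_eq_0_iff)
  ultimately have "T b + of_nat (CARD('n) + 1) * dlog b lam + dlog b \<theta> = 0"
    by (simp only: mult_eq_0_iff) simp
  then show ?thesis by (simp add: algebra_simps add_eq_0_iff)
qed

definition "w' i = dlog i G'"

lemma msubst_w': "msubst (w' i) s = (\<Sum>b\<in>UNIV. Z b i * dlog b g)"
proof -
  have "(\<Sum>b\<in>UNIV. Z b i * dlog b g) = (\<Sum>b\<in>UNIV. Z b i * mderiv b g) * minv g"
    by (simp add: dlog_def sum_distrib_right mult.assoc)
  also have "\<dots> = msubst (mderiv i G') s * minv g"
    unfolding g_def mderiv_msubst_Z ..
  also have "\<dots> = msubst (w' i) s"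
    by (simp add: w'_def dlog_def msubst_mult[OF s0] msubst_minv[OF s0 G'0] g_def)
  finally show ?thesis ..
qed

text \<open>The Jacobian contributes n + 1 logarithmic derivatives of \<open>lam\<close> through
  \<open>T_eq\<close>, the amplitude n/2 through \<open>dlog_g\<close>. The deficit n/2 + 1 is the
  exponent that \<open>image_functional\<close> requires for every k.\<close>

lemma divergence_w':
  "msubst (w' i) s = (\<Sum>j\<in>UNIV. mderiv j (Z j i)) + (\<Sum>j\<in>UNIV. Z j i * (dlog j G - (half_n + 1) * dlog j lam))"
  unfolding msubst_w' divergence_Z T_eq dlog_g sum_negf[symmetric] sum.distrib[symmetric]
    of_nat_add half_n_double[symmetric]
  by (rule sum.cong) (simp_all add: algebra_simps)

definition "\<kappa> = inverse (mcoeff0 \<theta>)"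

lemma phase_eq: "phase F = mconst \<kappa> * lam * msubst (phase F') s"
proof -
  have "mconst \<kappa> * lam * msubst (phase F') s = mconst (\<kappa> * mcoeff0 \<theta>) * phase F"
    by (simp only: mult.assoc lam_phase mconst_mult)
  then show ?thesis using theta0 by (simp add: \<kappa>_def)
qed

text \<open>\<open>lam ^ k * minv lam\<close> is the power k - 1, including the case k = 0;
  \<open>\<kappa> ^ k\<close> absorbs the constant in \<open>lam_phase\<close>.\<close>

definition "image_functional k b = \<kappa> ^ k * sp_coeff k F (G * lam ^ k * minv lam * msubst b s)"

text \<open>The phase relation is inherited through \<open>phase_eq\<close>. For integration by
  parts, a derivative in the new coordinates is \<open>Z\<close> applied to the old derivatives.
  Differentiating the factor \<open>lam\<close> in \<open>phase_eq\<close> leaves a multiple of the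
  phase itself, which the phase relation evaluates with -(k + n/2). Against k - 1 from the power of
  \<open>lam\<close> the index k cancels, and \<open>divergence_w'\<close> recognises
  \<open>w'\<close>.\<close>

lemma sp_functional_image: "sp_functional F' w' image_functional"
proof
  show "invertible (hess F')" using invertible_hess_image[OF inv theta0] .
  show "image_functional k (b + d) = image_functional k b + image_functional k d" for k b d
    by (simp add: image_functional_def msubst_add distrib_left sp_coeff_add)
  show "image_functional k (mconst a * b) = a * image_functional k b" for k a b
  proof -
    have "G * lam ^ k * minv lam * msubst (mconst a * b) s = mconst a * (G * lam ^ k * minv lam * msubst b s)"
      by (simp add: msubst_mult[OF s0] mult_ac)
    then show ?thesis by (simp only: image_functional_def sp_coeff_mconst) simp
  qed
  show "\<exists>N. \<forall>b. mord N b \<longrightarrow> image_functional k b = 0" for k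
    using mord_msubst[of s, OF s0] mord_mult_left sp_coeff_eq_0[of k]
    by (metis image_functional_def mult_zero_right)
  show "image_functional 0 (b * mderiv i (phase F')) = 0" for b i
    by (simp add: image_functional_def sp_coeff_0 mderiv_phase)
  show "image_functional (Suc k) (phase F' * b) = - (of_nat k + of_nat CARD('n) / 2) * image_functional k b" for k b
  proof -
    have "mconst \<kappa> * (G * lam ^ Suc k * minv lam * msubst (phase F' * b) s) =
        phase F * (G * lam ^ k * minv lam * msubst b s)"
      by (simp add: phase_eq msubst_mult[OF s0] mult_ac)
    then have "\<kappa> * sp_coeff (Suc k) F (G * lam ^ Suc k * minv lam * msubst (phase F' * b) s) =
        - (of_nat k + of_nat CARD('n) / 2) * sp_coeff k F (G * lam ^ k * minv lam * msubst b s)"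
      by (simp only: sp_coeff_mconst[symmetric] sp_coeff_phase_mult[OF inv])
    then show ?thesis by (simp add: image_functional_def mult_ac)
  qed
  show "image_functional (Suc k) (b * mderiv i (phase F')) = - image_functional k (mderiv i b + w' i * b)" for k b i
  proof -
    let ?b = "msubst b s" and ?n = "of_nat k + of_nat CARD('n) / 2 :: 'a"
    define P where "P = G * lam ^ k * minv lam"
    have P0: "mcoeff0 P \<noteq> 0" using G0 lam_nz by (simp add: P_def)
    have dP: "mderiv j P = P * (dlog j G + (of_nat k - 1) * dlog j lam)" for j
    proof -
      have "dlog j P = dlog j G + (of_nat k - 1) * dlog j lam"
        using G0 lam_nz by (simp add: P_def dlog_mult dlog_power dlog_minv algebra_simps)
      then show ?thesis using mderiv_eq_dlog[OF P0] by simp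
    qed
    have *: "mconst \<kappa> * lam * mderiv j (msubst (phase F') s) = mderiv j (phase F) - phase F * dlog j lam" for j
    proof -
      have "mderiv j (phase F) = mconst \<kappa> * (lam * dlog j lam * msubst (phase F') s + lam * mderiv j (msubst (phase F') s))"
        by (subst phase_eq) (simp add: mult.assoc mderiv_mult mderiv_eq_dlog[OF lam_nz])
      then show ?thesis by (subst (2) phase_eq) (simp add: algebra_simps)
    qed
    have "mconst \<kappa> * (G * lam ^ Suc k * minv lam * msubst (b * mderiv i (phase F')) s) =
        P * ?b * (\<Sum>j\<in>UNIV. Z j i * (mconst \<kappa> * lam * mderiv j (msubst (phase F') s)))"
      by (simp add: P_def msubst_mult[OF s0] mderiv_msubst_Z[symmetric] sum_distrib_left mult_ac)
    also have "\<dots> = (\<Sum>j\<in>UNIV. (P * ?b * Z j i) * mderiv j (phase F) - phase F * (P * ?b * Z j i * dlog j lam))"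
      unfolding * sum_distrib_left by (rule sum.cong) (simp_all add: algebra_simps)
    finally have h: "mconst \<kappa> * (G * lam ^ Suc k * minv lam * msubst (b * mderiv i (phase F')) s) =
        (\<Sum>j\<in>UNIV. (P * ?b * Z j i) * mderiv j (phase F) - phase F * (P * ?b * Z j i * dlog j lam))" .
    have "\<kappa> * sp_coeff (Suc k) F (G * lam ^ Suc k * minv lam * msubst (b * mderiv i (phase F')) s) =
        (\<Sum>j\<in>UNIV. - sp_coeff k F (mderiv j (P * ?b * Z j i)) + ?n * sp_coeff k F (P * ?b * Z j i * dlog j lam))"
      unfolding sp_coeff_mconst[of "Suc k" F \<kappa>, symmetric] h sp_coeff_sum sp_coeff_diff
        sp_coeff_mult_mderiv_phase[OF inv] sp_coeff_phase_mult[OF inv]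
      by (simp only: minus_mult_left[symmetric] diff_minus_eq_add)
    also have "\<dots> = - sp_coeff k F (\<Sum>j\<in>UNIV. mderiv j (P * ?b * Z j i) - mconst ?n * (P * ?b * Z j i * dlog j lam))"
      unfolding sp_coeff_sum sp_coeff_diff sp_coeff_mconst sum_negf[symmetric] by (rule sum.cong) simp_all
    also have "(\<Sum>j\<in>UNIV. mderiv j (P * ?b * Z j i) - mconst ?n * (P * ?b * Z j i * dlog j lam)) =
       P * ((\<Sum>j\<in>UNIV. Z j i * mderiv j ?b) + (\<Sum>j\<in>UNIV. mderiv j (Z j i)) * ?b +
        (\<Sum>j\<in>UNIV. Z j i * (dlog j G - (half_n + 1) * dlog j lam)) * ?b)"
    proof -
      have n: "mconst ?n = (of_nat k + half_n :: ('a, 'n) mfps)" by (simp only: mconst_add mconst_of_nat)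
      show ?thesis
        unfolding sum_distrib_left sum_distrib_right sum.distrib[symmetric] n
        by (rule sum.cong) (simp_all add: mderiv_mult dP algebra_simps)
    qed
    also have "\<dots> = P * msubst (mderiv i b + w' i * b) s"
      unfolding mderiv_msubst_Z by (simp add: msubst_add msubst_mult[OF s0] divergence_w' algebra_simps)
    finally have fin: "\<kappa> * sp_coeff (Suc k) F (G * lam ^ Suc k * minv lam * msubst (b * mderiv i (phase F')) s) =
        - sp_coeff k F (P * msubst (mderiv i b + w' i * b) s)" .
    have "\<kappa> ^ Suc k * x = \<kappa> ^ k * (\<kappa> * x)" for x by (simp add: mult_ac)
    then show ?thesis
      by (simp only: image_functional_def fin) (simp add: P_def)
  qed
qed

text \<open>Uniqueness compares the two functionals through their values at index 0 and
  \<open>b = 1\<close>; at index \<open>Suc k\<close> and \<open>b = 1\<close> the image functional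
  sees exactly \<open>G * lam ^ k\<close>.\<close>

lemma sp_coeff_image:
  assumes vanish: "\<And>k. sp_coeff (Suc k) F (G * lam ^ k) = 0"
  shows "sp_coeff (Suc k) F' G' = 0"
proof -
  have "sp_functional F' w' (\<lambda>k b. sp_coeff k F' (G' * b))"
    by (rule sp_functional_sp_coeff[OF invertible_hess_image[OF inv theta0]]) (simp add: w'_def mderiv_eq_dlog[OF G'0])
  from sp_functional_unique[OF this sp_functional_image, of "mcoeff0 G' / (mcoeff0 G * inverse (mcoeff0 lam))" "Suc k" 1]
  have "sp_coeff (Suc k) F' G' = mcoeff0 G' / (mcoeff0 G * inverse (mcoeff0 lam)) * image_functional (Suc k) 1"
    using G0 lam_nz by (simp add: sp_coeff_0 image_functional_def)
  moreover have "G * lam ^ Suc k * minv lam * msubst 1 s = G * lam ^ k"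
    using mult_minv[OF lam_nz] by (simp add: mult_ac)
  then have "image_functional (Suc k) 1 = 0"
    using vanish[of k] by (simp only: image_functional_def) simp
  ultimately show ?thesis by simp
qed

end

section \<open>Expansion at the generic point\<close>

text \<open>The divided derivative of multi-order \<alpha>, kept as a series before it is viewed in
  the fraction field.\<close>

definition taylor_coeff :: "('n \<Rightarrow> nat) \<Rightarrow> ('a::field, 'n::finite) mfps \<Rightarrow> ('a, 'n) mfps" where
  "taylor_coeff \<alpha> F = Abs_mfps (\<lambda>\<beta>.
     (\<Prod>i\<in>UNIV. of_nat ((\<alpha> i + \<beta> i) choose \<alpha> i)) * mcoeff F (midx_add \<alpha> \<beta>))"

abbreviation gexp :: "('a::field, 'n::finite) mfps \<Rightarrow> (('a, 'n) mfps fract, 'n) mfps" where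
  "gexp \<equiv> generic_expansion"

lemma mcoeff_gexp: "mcoeff (gexp F) \<alpha> = to_fract (taylor_coeff \<alpha> F)"
  by (simp add: generic_expansion_def taylor_coeff_def)

lemma taylor_coeff_0 [simp]: "taylor_coeff (\<lambda>_. 0) F = F"
  by (rule mfps_eqI) (simp add: taylor_coeff_def)

lemma mcoeff0_gexp [simp]: "mcoeff0 (gexp F) = to_fract F"
  by (simp add: mcoeff_gexp)

lemma taylor_coeff_add: "taylor_coeff \<alpha> (F + G) = taylor_coeff \<alpha> F + taylor_coeff \<alpha> G"
  and taylor_coeff_diff: "taylor_coeff \<alpha> (F - G) = taylor_coeff \<alpha> F - taylor_coeff \<alpha> G"
  by (auto intro!: mfps_eqI simp: taylor_coeff_def algebra_simps)

lemma gexp_add: "gexp (F + G) = gexp F + gexp G"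
  and gexp_diff: "gexp (F - G) = gexp F - gexp G"
  by (auto intro!: mfps_eqI simp: mcoeff_gexp taylor_coeff_add taylor_coeff_diff to_fract_add to_fract_diff)

lemma gexp_0 [simp]: "gexp 0 = 0"
  using gexp_diff[of 0 0] by simp

lemma gexp_sum: "gexp (sum f A) = (\<Sum>x\<in>A. gexp (f x))"
  by (induction A rule: infinite_finite_induct) (auto simp: gexp_add)

lemma prod_upd_one:
  fixes f g :: "'n::finite \<Rightarrow> 'a::comm_semiring_1"
  assumes "\<And>j. j \<noteq> i \<Longrightarrow> f j = g j" "c * f i = d * g i"
  shows "c * (\<Prod>j\<in>UNIV. f j) = d * (\<Prod>j\<in>UNIV. g j)"
proof -
  have "(\<Prod>j\<in>UNIV. f j) = f i * (\<Prod>j\<in>UNIV - {i}. f j)" "(\<Prod>j\<in>UNIV. g j) = g i * (\<Prod>j\<in>UNIV - {i}. g j)"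
    by (simp_all add: prod.remove)
  moreover have "(\<Prod>j\<in>UNIV - {i}. f j) = (\<Prod>j\<in>UNIV - {i}. g j)"
    using assms(1) by (intro prod.cong) auto
  ultimately show ?thesis using assms(2) by (metis mult.assoc)
qed

lemma taylor_coeff_mderiv:
  "taylor_coeff \<alpha> (mderiv i F) = of_nat (Suc (\<alpha> i)) * taylor_coeff (\<alpha>(i := Suc (\<alpha> i))) F"
proof (rule mfps_eqI)
  fix \<beta> :: "'b \<Rightarrow> nat"
  let ?\<alpha> = "\<alpha>(i := Suc (\<alpha> i))"
  have e: "midx_add ?\<alpha> \<beta> = (midx_add \<alpha> \<beta>)(i := Suc (midx_add \<alpha> \<beta> i))" by auto
  have b: "of_nat (Suc (\<alpha> i)) * (\<Prod>j\<in>UNIV. of_nat ((?\<alpha> j + \<beta> j) choose ?\<alpha> j)) =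
    of_nat (Suc (\<alpha> i + \<beta> i)) * (\<Prod>j\<in>UNIV. of_nat ((\<alpha> j + \<beta> j) choose \<alpha> j) :: 'a)"
    using Suc_times_binomial[of "\<alpha> i" "\<alpha> i + \<beta> i"]
    by (intro prod_upd_one[where i = i]) (simp_all only: of_nat_mult[symmetric] fun_upd_apply add_Suc if_False if_True simp_thms)
  show "mcoeff (taylor_coeff \<alpha> (mderiv i F)) \<beta> = mcoeff (of_nat (Suc (\<alpha> i)) * taylor_coeff ?\<alpha> F) \<beta>"
    unfolding taylor_coeff_def mcoeff_Abs mcoeff_of_nat_mult e mcoeff_mderiv
    using arg_cong[OF b, of "\<lambda>z. z * mcoeff F ((midx_add \<alpha> \<beta>)(i := Suc (midx_add \<alpha> \<beta> i)))"]
    by (simp only: mult_ac)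
qed

lemma mderiv_taylor_coeff: "mderiv i (taylor_coeff \<alpha> F) = taylor_coeff \<alpha> (mderiv i F)"
proof (rule mfps_eqI)
  fix \<beta> :: "'b \<Rightarrow> nat"
  let ?\<beta> = "\<beta>(i := Suc (\<beta> i))"
  have e: "midx_add \<alpha> ?\<beta> = (midx_add \<alpha> \<beta>)(i := Suc (midx_add \<alpha> \<beta> i))" by auto
  have "Suc (\<beta> i) * (Suc (\<alpha> i + \<beta> i) choose \<alpha> i) = Suc (\<alpha> i + \<beta> i) * ((\<alpha> i + \<beta> i) choose \<alpha> i)"
    using Suc_times_binomial[of "\<beta> i" "\<alpha> i + \<beta> i"] binomial_symmetric[of "\<alpha> i" "\<alpha> i + \<beta> i"]
      binomial_symmetric[of "\<alpha> i" "Suc (\<alpha> i + \<beta> i)"] by simp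
  then have b: "of_nat (Suc (\<beta> i)) * (\<Prod>j\<in>UNIV. of_nat ((\<alpha> j + ?\<beta> j) choose \<alpha> j)) =
    of_nat (Suc (\<alpha> i + \<beta> i)) * (\<Prod>j\<in>UNIV. of_nat ((\<alpha> j + \<beta> j) choose \<alpha> j) :: 'a)"
    by (intro prod_upd_one[where i = i]) (simp_all only: of_nat_mult[symmetric] fun_upd_apply add_Suc_right if_False if_True simp_thms)
  show "mcoeff (mderiv i (taylor_coeff \<alpha> F)) \<beta> = mcoeff (taylor_coeff \<alpha> (mderiv i F)) \<beta>"
    unfolding mcoeff_mderiv taylor_coeff_def mcoeff_Abs e
    using arg_cong[OF b, of "\<lambda>z. z * mcoeff F ((midx_add \<alpha> \<beta>)(i := Suc (midx_add \<alpha> \<beta> i)))"]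
    by (simp only: mult_ac)
qed

lemma mderiv_gexp: "mderiv i (gexp F) = gexp (mderiv i F)"
  by (rule mfps_eqI) (simp only: mcoeff_mderiv mcoeff_gexp taylor_coeff_mderiv to_fract_mult to_fract_of_nat)

lemma gexp_mconst: "gexp (mconst c :: ('a::field_char_0, 'n::finite) mfps) = mconst (to_fract (mconst c))"
proof -
  have "gexp (mconst c :: ('a, 'n) mfps) - mconst (to_fract (mconst c)) = 0"
    by (rule mfps_eq_0_if_mderiv_0) (simp_all add: mderiv_diff mderiv_gexp)
  then show ?thesis by simp
qed

lemma gexp_1 [simp]: "gexp (1 :: ('a::field_char_0, 'n::finite) mfps) = 1"
  using gexp_mconst[of 1, where 'n = 'n] by simp

lemma gexp_mvar: "gexp (mvar i :: ('a::field_char_0, 'n::finite) mfps) = mconst (to_fract (mvar i)) + mvar i"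
proof -
  have "gexp (mvar i :: ('a, 'n) mfps) - (mconst (to_fract (mvar i)) + mvar i) = 0"
    by (rule mfps_eq_0_if_mderiv_0) (simp_all add: mderiv_diff mderiv_add mderiv_gexp mderiv_mvar)
  then show ?thesis by simp
qed

lemma gexp_mult:
  fixes F G :: "('a::field_char_0, 'n::finite) mfps"
  shows "gexp (F * G) = gexp F * gexp G"
proof -
  have "mord d (gexp (F * G) - gexp F * gexp G)" for d
  proof (induction d arbitrary: F G)
    case (Suc d)
    have "mderiv i (gexp (F * G) - gexp F * gexp G) = (gexp (mderiv i F * G) - gexp (mderiv i F) * gexp G) +
        (gexp (F * mderiv i G) - gexp F * gexp (mderiv i G))" for i
      by (simp add: mderiv_diff mderiv_mult mderiv_gexp gexp_add)
    then show ?case by (simp add: mord_Suc_iff to_fract_mult mord_add Suc.IH)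
  qed simp
  then show ?thesis using mord_all by fastforce
qed

lemma gexp_power:
  fixes F :: "('a::field_char_0, 'n::finite) mfps"
  shows "gexp (F ^ k) = gexp F ^ k"
  by (induction k) (auto simp: gexp_mult)

section \<open>Derivations of fraction fields and transfer of scalars\<close>

definition fract_deriv :: "'n \<Rightarrow> ('a::idom, 'n::finite) mfps fract \<Rightarrow> ('a, 'n) mfps fract" where
  "fract_deriv i x = (SOME y. \<exists>a b. b \<noteq> 0 \<and> x * to_fract b = to_fract a \<and>
     y = (to_fract (mderiv i a) - x * to_fract (mderiv i b)) / to_fract b)"

lemma fract_repr: obtains a b where "b \<noteq> 0" "x * to_fract b = to_fract a"
proof (cases x)
  case (Fract a b)
  then have "x * to_fract b = to_fract a"
    by (simp add: to_fract_def eq_fract)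
  then show ?thesis using Fract that by blast
qed

text \<open>Two presentations of the same fraction satisfy a d = c b; differentiating this identity
  shows that the quotient rule assigns the same value to both.\<close>

lemma fract_deriv_eq:
  fixes a b :: "('a::idom, 'n::finite) mfps"
  assumes b: "b \<noteq> 0" and x: "x * to_fract b = to_fract a"
  shows "fract_deriv i x = (to_fract (mderiv i a) - x * to_fract (mderiv i b)) / to_fract b"
  unfolding fract_deriv_def
proof (rule someI2_ex)
  show "\<exists>y a b. b \<noteq> 0 \<and> x * to_fract b = to_fract a \<and>
      y = (to_fract (mderiv i a) - x * to_fract (mderiv i b)) / to_fract b"
    using assms by blast
  fix y assume "\<exists>c d. d \<noteq> 0 \<and> x * to_fract d = to_fract c \<and>
      y = (to_fract (mderiv i c) - x * to_fract (mderiv i d)) / to_fract d"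
  then obtain c d where d: "d \<noteq> 0" and x': "x * to_fract d = to_fract c"
    and y: "y = (to_fract (mderiv i c) - x * to_fract (mderiv i d)) / to_fract d" by blast
  have "to_fract (a * d) = to_fract (c * b)"
    unfolding to_fract_mult x[symmetric] x'[symmetric] by (simp add: mult_ac)
  then have "mderiv i (a * d) = mderiv i (c * b)" by simp
  then have "to_fract (mderiv i a) * to_fract d + to_fract a * to_fract (mderiv i d) =
      to_fract (mderiv i c) * to_fract b + to_fract c * to_fract (mderiv i b)"
    by (simp only: mderiv_mult to_fract_add[symmetric] to_fract_mult[symmetric])
  then have "to_fract (mderiv i a) * to_fract d + x * to_fract b * to_fract (mderiv i d) =
      to_fract (mderiv i c) * to_fract b + x * to_fract d * to_fract (mderiv i b)"
    by (simp only: x x')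
  then have "(to_fract (mderiv i c) - x * to_fract (mderiv i d)) * to_fract b =
      (to_fract (mderiv i a) - x * to_fract (mderiv i b)) * to_fract d"
    by (simp add: algebra_simps)
  then show "y = (to_fract (mderiv i a) - x * to_fract (mderiv i b)) / to_fract b"
    using b d unfolding y by (simp add: frac_eq_eq)
qed

lemma fract_deriv_to_fract: "fract_deriv i (to_fract a) = to_fract (mderiv i a)"
  by (subst fract_deriv_eq[where b = 1 and a = a]) simp_all

lemma derivation_fract_deriv:
  "derivation (fract_deriv i :: ('a::{idom, ring_char_0}, 'n::finite) mfps fract \<Rightarrow> _)"
proof
  fix x y :: "('a, 'n) mfps fract"
  obtain a b where b: "b \<noteq> 0" and x: "x * to_fract b = to_fract a" by (rule fract_repr)
  obtain c d where d: "d \<noteq> 0" and y: "y * to_fract d = to_fract c" by (rule fract_repr)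
  have bd: "b * d \<noteq> 0" using b d by simp
  note dx = fract_deriv_eq[OF b x, of i] and dy = fract_deriv_eq[OF d y, of i]
  have 1: "(x + y) * to_fract (b * d) = to_fract (a * d + c * b)"
    by (simp add: to_fract_mult to_fract_add x[symmetric] y[symmetric] algebra_simps)
  have 2: "x * y * to_fract (b * d) = to_fract (a * c)"
    by (simp add: to_fract_mult x[symmetric] y[symmetric] algebra_simps)
  have nz: "to_fract b \<noteq> 0" "to_fract d \<noteq> 0" using b d by simp_all
  show "fract_deriv i (x + y) = fract_deriv i x + fract_deriv i y"
    unfolding fract_deriv_eq[OF bd 1] dx dy mderiv_add mderiv_mult to_fract_add to_fract_mult x[symmetric] y[symmetric]
    using nz by (simp add: divide_simps) (simp add: algebra_simps)
  show "fract_deriv i (x * y) = fract_deriv i x * y + x * fract_deriv i y"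
    unfolding fract_deriv_eq[OF bd 2] dx dy mderiv_add mderiv_mult to_fract_add to_fract_mult x[symmetric] y[symmetric]
    using nz by (simp add: divide_simps) (simp add: algebra_simps)
qed

text \<open>Differentiating f(t + u) in t or in u is the same; this provides the hypothesis
  \<open>flat\<close> of \<open>moving_point\<close>.\<close>

lemma map_fract_deriv_gexp: "map_coeffs (fract_deriv i) (gexp F) = mderiv i (gexp F)"
  by (rule mfps_eqI) (simp add: mderiv_gexp mcoeff_gexp fract_deriv_to_fract mderiv_taylor_coeff)

text \<open>
  \<open>R a x\<close> relates a family \<open>a\<close> of scalars to a scalar \<open>x\<close>, compatibly with the field operations. All
  coefficients \<open>A\<^sub>k\<close> are polynomial in the data and the inverse of the Hessian, hence inherit \<open>R\<close>.
\<close>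

locale scalar_rel =
  fixes R :: "('x \<Rightarrow> 'a::field_char_0) \<Rightarrow> 'b::field_char_0 \<Rightarrow> bool"
  assumes R_add: "R a x \<Longrightarrow> R b y \<Longrightarrow> R (\<lambda>t. a t + b t) (x + y)"
    and R_mult: "R a x \<Longrightarrow> R b y \<Longrightarrow> R (\<lambda>t. a t * b t) (x * y)"
    and R_0: "R (\<lambda>_. 0) 0" and R_1: "R (\<lambda>_. 1) 1" and R_m1: "R (\<lambda>_. - 1) (- 1)"
    and R_inverse_nat: "k > 0 \<Longrightarrow> R (\<lambda>_. 1 / of_nat k) (1 / of_nat k)"
begin

lemma R_uminus: "R a x \<Longrightarrow> R (\<lambda>t. - a t) (- x)"
  using R_mult[OF R_m1, of a x] by simp

lemma R_diff: "R a x \<Longrightarrow> R b y \<Longrightarrow> R (\<lambda>t. a t - b t) (x - y)"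
  using R_add[OF _ R_uminus, of a x b y] by simp

lemma R_sum: "(\<And>i. i \<in> A \<Longrightarrow> R (a i) (x i)) \<Longrightarrow> R (\<lambda>t. \<Sum>i\<in>A. a i t) (\<Sum>i\<in>A. x i)"
  by (induction A rule: infinite_finite_induct) (auto intro: R_0 R_add)

lemma R_prod: "(\<And>i. i \<in> A \<Longrightarrow> R (a i) (x i)) \<Longrightarrow> R (\<lambda>t. \<Prod>i\<in>A. a i t) (\<Prod>i\<in>A. x i)"
  by (induction A rule: infinite_finite_induct) (auto intro: R_1 R_mult)

lemma R_of_nat: "R (\<lambda>_. of_nat k) (of_nat k)"
  by (induction k) (auto intro: R_0 R_1 R_add)

lemma R_of_int: "R (\<lambda>_. of_int k) (of_int k)"
  by (cases k) (use R_of_nat R_uminus[OF R_of_nat] in \<open>auto simp del: of_nat_Suc\<close>)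

lemma R_det:
  assumes "\<And>i j. R (\<lambda>t. A t $ i $ j) (B $ i $ j)"
  shows "R (\<lambda>t. det (A t)) (det B)"
  unfolding det_def by (intro R_sum R_mult R_of_int R_prod assms)

definition mrel :: "('x \<Rightarrow> ('a, 'n::finite) mfps) \<Rightarrow> ('b, 'n) mfps \<Rightarrow> bool" where
  "mrel a x \<longleftrightarrow> (\<forall>\<alpha>. R (\<lambda>t. mcoeff (a t) \<alpha>) (mcoeff x \<alpha>))"

lemma mrel_add: "mrel a x \<Longrightarrow> mrel b y \<Longrightarrow> mrel (\<lambda>t. a t + b t) (x + y)"
  and mrel_diff: "mrel a x \<Longrightarrow> mrel b y \<Longrightarrow> mrel (\<lambda>t. a t - b t) (x - y)"
  and mrel_uminus: "mrel a x \<Longrightarrow> mrel (\<lambda>t. - a t) (- x)"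
  by (auto simp: mrel_def intro: R_add R_diff R_uminus)

lemma mrel_mult: "mrel a x \<Longrightarrow> mrel b y \<Longrightarrow> mrel (\<lambda>t. a t * b t) (x * y)"
  by (auto simp: mrel_def mcoeff_mult intro!: R_sum R_mult)

lemma mrel_mconst: "R a x \<Longrightarrow> mrel (\<lambda>t. mconst (a t)) (mconst x)"
  by (auto simp: mrel_def mcoeff_mconst intro: R_0)

lemma mrel_mvar: "mrel (\<lambda>_. mvar i) (mvar i)"
  by (auto simp: mrel_def mcoeff_mvar intro: R_0 R_1)

lemma mrel_1: "mrel (\<lambda>_. 1) 1"
  using mrel_mconst[OF R_1] by simp

lemma mrel_sum: "(\<And>i. i \<in> A \<Longrightarrow> mrel (a i) (x i)) \<Longrightarrow> mrel (\<lambda>t. \<Sum>i\<in>A. a i t) (\<Sum>i\<in>A. x i)"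
  by (auto simp: mrel_def intro!: R_sum)

lemma mrel_power: "mrel a x \<Longrightarrow> mrel (\<lambda>t. a t ^ k) (x ^ k)"
  by (induction k) (auto intro: mrel_1 mrel_mult)

lemma mrel_mderiv: "mrel a x \<Longrightarrow> mrel (\<lambda>t. mderiv i (a t)) (mderiv i x)"
  unfolding mrel_def mcoeff_mderiv by (auto intro!: R_mult R_of_nat simp del: of_nat_Suc)

lemma mrel_mcoeff: "mrel a x \<Longrightarrow> R (\<lambda>t. mcoeff (a t) \<alpha>) (mcoeff x \<alpha>)"
  by (simp add: mrel_def)

lemma R_hess: "mrel a x \<Longrightarrow> R (\<lambda>t. hess (a t) $ i $ j) (hess x $ i $ j)"
  by (auto simp: hess_def intro!: mrel_mcoeff mrel_mderiv)

lemma R_half: "R (\<lambda>_. 1 / 2) (1 / 2)"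
  using R_inverse_nat[of 2] by simp

lemma mrel_taylor_rem: "mrel a x \<Longrightarrow> mrel (\<lambda>t. taylor_rem (a t)) (taylor_rem x)"
  unfolding taylor_rem_def
  by (intro mrel_diff mrel_mconst mrel_mcoeff mrel_sum mrel_mult mrel_mvar mrel_mderiv R_half R_hess)

lemma mrel_sp_laplacian:
  assumes "\<And>i j. R (\<lambda>t. matrix_inv (A t) $ i $ j) (matrix_inv B $ i $ j)" "mrel a x"
  shows "mrel (\<lambda>t. sp_laplacian (A t) (a t)) (sp_laplacian B x)"
  unfolding sp_laplacian_def
  by (intro mrel_uminus mrel_mult mrel_mconst mrel_sum mrel_mderiv R_half assms)

lemma mrel_sp_laplacian_funpow:
  assumes "\<And>i j. R (\<lambda>t. matrix_inv (A t) $ i $ j) (matrix_inv B $ i $ j)" "mrel a x"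
  shows "mrel (\<lambda>t. (sp_laplacian (A t) ^^ N) (a t)) ((sp_laplacian B ^^ N) x)"
  by (induction N) (auto intro: assms mrel_sp_laplacian)

lemma R_sp_coeff:
  assumes "mrel f F" "mrel g G"
    and "\<And>i j. R (\<lambda>t. matrix_inv (hess (f t)) $ i $ j) (matrix_inv (hess F) $ i $ j)"
  shows "R (\<lambda>t. sp_coeff k (f t) (g t)) (sp_coeff k F G)"
proof -
  have pos: "fact v * fact (k + v) > (0 :: nat)" for v by simp
  show ?thesis
    unfolding sp_coeff_def
    by (intro R_sum R_mult mrel_mcoeff mrel_sp_laplacian_funpow mrel_mult mrel_power mrel_taylor_rem assms
        R_inverse_nat[OF pos])
qed

end

locale field_hom =
  fixes h :: "'a::field_char_0 \<Rightarrow> 'b::field_char_0"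
  assumes h_add: "h (a + b) = h a + h b" and h_mult: "h (a * b) = h a * h b" and h_1: "h 1 = 1"
begin

lemma h_0 [simp]: "h 0 = 0" using h_add[of 0 0] by simp
lemma h_uminus: "h (- a) = - h a" using h_add[of a "- a"] by (simp add: eq_neg_iff_add_eq_0 add.commute)
lemma h_of_nat [simp]: "h (of_nat k) = of_nat k" by (induction k) (auto simp: h_add h_1)
lemma h_eq_0_iff [simp]: "h a = 0 \<longleftrightarrow> a = 0"
proof
  assume "h a = 0"
  then have "h (a * inverse a) = 0" by (simp add: h_mult)
  then show "a = 0" using h_1 by (cases "a = 0") auto
qed simp

lemma h_divide: "h (a / b) = h a / h b"
proof (cases "b = 0")
  case False
  have "h (a / b) * h b = h a" using False by (simp add: h_mult[symmetric])
  then show ?thesis using False by (simp add: nonzero_eq_divide_eq)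
qed simp

lemma h_sum: "h (sum f A) = (\<Sum>x\<in>A. h (f x))"
  by (induction A rule: infinite_finite_induct) (auto simp: h_add)

text \<open>Embeddings of fields are the instance with one-point families; meromorphic functions
  near a point will be the other instance.\<close>

sublocale hom: scalar_rel "\<lambda>(a :: unit \<Rightarrow> 'a) x. x = h (a ())"
  by standard (auto simp: h_add h_mult h_1 h_uminus h_divide)

lemma mrel_hom: "hom.mrel (\<lambda>_. F) (map_coeffs h F)"
  by (simp add: hom.mrel_def)

lemma map_hom_mderiv:
  fixes F :: "('a, 'n::finite) mfps"
  shows "map_coeffs h (mderiv i F) = mderiv i (map_coeffs h F)"
  using hom.mrel_mderiv[OF mrel_hom, of i F] by (auto simp: hom.mrel_def intro!: mfps_eqI)

lemma hess_hom:
  fixes F :: "('a, 'n::finite) mfps"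
  shows "hess (map_coeffs h F) $ i $ j = h (hess F $ i $ j)"
  using hom.R_hess[OF mrel_hom] .

lemma det_hess_hom: "det (hess (map_coeffs h F)) = h (det (hess F))"
  by (rule hom.R_det) (rule hom.R_hess[OF mrel_hom])

lemma sp_coeff_hom:
  assumes "det (hess F) \<noteq> 0"
  shows "sp_coeff k (map_coeffs h F) (map_coeffs h G) = h (sp_coeff k F G)"
proof (rule hom.R_sp_coeff[OF mrel_hom mrel_hom])
  fix i j
  have inv: "invertible (hess F)" using assms by (simp add: invertible_det_nz)
  define B where "B = (\<chi> i j. h (matrix_inv (hess F) $ i $ j))"
  have "hess (map_coeffs h F) ** B = (\<chi> i j. h ((hess F ** matrix_inv (hess F)) $ i $ j))"
    by (simp add: vec_eq_iff matrix_matrix_mult_def B_def hess_hom h_sum h_mult)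
  also have "\<dots> = mat 1"
    unfolding matrix_inv_right_field(1)[OF inv] by (simp add: mat_def vec_eq_iff h_1)
  finally have "matrix_inv (hess (map_coeffs h F)) = B" by (rule matrix_inv_unique_field)
  then show "matrix_inv (hess (map_coeffs h F)) $ i $ j = h (matrix_inv (hess F) $ i $ j)"
    by (simp add: B_def)
qed

end

locale idom_hom =
  fixes \<sigma> :: "'a::{idom, ring_char_0} \<Rightarrow> 'b::{idom, ring_char_0}"
  assumes s_add: "\<sigma> (a + b) = \<sigma> a + \<sigma> b" and s_mult: "\<sigma> (a * b) = \<sigma> a * \<sigma> b" and s_1: "\<sigma> 1 = 1"
    and s_inj: "\<sigma> a = 0 \<Longrightarrow> a = 0"
begin

definition fract_map :: "'a fract \<Rightarrow> 'b fract" where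
  "fract_map x = (SOME y. \<exists>a b. b \<noteq> 0 \<and> x * to_fract b = to_fract a \<and> y = to_fract (\<sigma> a) / to_fract (\<sigma> b))"

lemma fract_map_eq:
  assumes b: "b \<noteq> 0" and x: "x * to_fract b = to_fract a"
  shows "fract_map x = to_fract (\<sigma> a) / to_fract (\<sigma> b)"
  unfolding fract_map_def
proof (rule someI2_ex)
  show "\<exists>y a b. b \<noteq> 0 \<and> x * to_fract b = to_fract a \<and> y = to_fract (\<sigma> a) / to_fract (\<sigma> b)"
    using assms by blast
  fix y assume "\<exists>c d. d \<noteq> 0 \<and> x * to_fract d = to_fract c \<and> y = to_fract (\<sigma> c) / to_fract (\<sigma> d)"
  then obtain c d where d: "d \<noteq> 0" and x': "x * to_fract d = to_fract c"
    and y: "y = to_fract (\<sigma> c) / to_fract (\<sigma> d)" by blast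
  have "to_fract (a * d) = to_fract (c * b)"
    unfolding to_fract_mult x[symmetric] x'[symmetric] by (simp add: mult_ac)
  then have "\<sigma> a * \<sigma> d = \<sigma> c * \<sigma> b" by (simp add: s_mult[symmetric])
  moreover have "\<sigma> b \<noteq> 0" "\<sigma> d \<noteq> 0" using b d s_inj by auto
  ultimately show "y = to_fract (\<sigma> a) / to_fract (\<sigma> b)"
    unfolding y by (simp add: frac_eq_eq to_fract_mult[symmetric])
qed

lemma fract_map_to_fract: "fract_map (to_fract a) = to_fract (\<sigma> a)"
  by (subst fract_map_eq[where b = 1 and a = a]) (simp_all add: s_1)

lemma field_hom_fract_map: "field_hom fract_map"
proof
  show "fract_map 1 = 1" using fract_map_to_fract[of 1] by (simp add: s_1)
  fix x y :: "'a fract"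
  obtain a b where b: "b \<noteq> 0" and x: "x * to_fract b = to_fract a" by (rule fract_repr)
  obtain c d where d: "d \<noteq> 0" and y: "y * to_fract d = to_fract c" by (rule fract_repr)
  have bd: "b * d \<noteq> 0" using b d by simp
  have 1: "(x + y) * to_fract (b * d) = to_fract (a * d + c * b)"
    by (simp add: to_fract_mult to_fract_add x[symmetric] y[symmetric] algebra_simps)
  have 2: "x * y * to_fract (b * d) = to_fract (a * c)"
    by (simp add: to_fract_mult x[symmetric] y[symmetric] algebra_simps)
  have nz: "\<sigma> b \<noteq> 0" "\<sigma> d \<noteq> 0" using b d s_inj by auto
  then have nz': "to_fract (\<sigma> b) \<noteq> 0" "to_fract (\<sigma> d) \<noteq> 0" by simp_all
  show "fract_map (x + y) = fract_map x + fract_map y"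
    unfolding fract_map_eq[OF bd 1] fract_map_eq[OF b x] fract_map_eq[OF d y]
    using nz' by (simp add: s_add s_mult to_fract_add to_fract_mult add_frac_eq)
  show "fract_map (x * y) = fract_map x * fract_map y"
    unfolding fract_map_eq[OF bd 2] fract_map_eq[OF b x] fract_map_eq[OF d y]
    by (simp add: s_mult to_fract_mult)
qed

end

text \<open>F(s(t + u)) is expanded in u in two ways: on the left the expansion of F at s(t), with
  coefficients pulled back along s, is composed with the increment s(t + u) - s(t).\<close>

lemma gexp_msubst:
  fixes F :: "('a::field_char_0, 'n::finite) mfps" and s :: "'n \<Rightarrow> ('a, 'm::finite) mfps"
  assumes s: "\<And>i. mcoeff0 (s i) = 0" and \<sigma>: "idom_hom (\<lambda>W. msubst W s)"
  defines "h \<equiv> idom_hom.fract_map (\<lambda>W. msubst W s)"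
  shows "msubst (map_coeffs h (gexp F)) (\<lambda>i. gexp (s i) - mconst (to_fract (s i))) = gexp (msubst F s)"
proof -
  interpret idom_hom "\<lambda>W. msubst W s" by fact
  interpret h: field_hom h unfolding h_def by (rule field_hom_fract_map)
  define r where "r i = gexp (s i) - mconst (to_fract (s i))" for i
  have r: "mcoeff0 (r i) = 0" for i by (simp add: r_def)
  have "mord d (msubst (map_coeffs h (gexp F)) r - gexp (msubst F s))" for d
  proof (induction d arbitrary: F)
    case (Suc d)
    have "mcoeff0 (msubst (map_coeffs h (gexp F)) r - gexp (msubst F s)) = 0"
      by (simp add: h_def fract_map_to_fract)
    moreover have "mderiv j (msubst (map_coeffs h (gexp F)) r - gexp (msubst F s)) =
       (\<Sum>i\<in>UNIV. (msubst (map_coeffs h (gexp (mderiv i F))) r - gexp (msubst (mderiv i F) s)) * gexp (mderiv j (s i)))" for j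
    proof -
      have "mderiv j (r i) = gexp (mderiv j (s i))" for i by (simp add: r_def mderiv_diff mderiv_gexp)
      then show ?thesis
        by (simp add: mderiv_diff mderiv_msubst[OF r] mderiv_gexp mderiv_msubst[OF s] gexp_sum gexp_mult
            h.map_hom_mderiv[symmetric] left_diff_distrib sum_subtractf)
    qed
    ultimately show ?case
      by (auto simp: mord_Suc_iff intro!: mord_sum mord_mult_right Suc.IH)
  qed simp
  then show ?thesis using mord_all unfolding r_def by fastforce
qed

section \<open>Formal germs\<close>

context cone_chart
begin

text \<open>\<open>Z\<close> recovers the pullbacks of the derivatives of \<open>W\<close> from the
  derivatives of the pullback of \<open>W\<close>, so the vanishing passes on to all
  derivatives.\<close>

lemma msubst_s_eq_0: "msubst W s = 0 \<Longrightarrow> W = 0"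
proof -
  assume W: "msubst W s = 0"
  have "mord d W" if "msubst W s = 0" for d W
    using that
  proof (induction d arbitrary: W)
    case (Suc d)
    have "mcoeff0 W = 0" using Suc.prems mcoeff0_msubst[of W s] by simp
    moreover have "msubst (mderiv i W) s = 0" for i
      using mderiv_msubst_Z[of i W] Suc.prems by simp
    ultimately show ?case using Suc.IH by (auto simp: mord_Suc_iff)
  qed simp
  then show "W = 0" using W mord_all by blast
qed

lemma idom_hom_s: "idom_hom (\<lambda>W. msubst W s)"
  by standard (auto simp: msubst_add msubst_mult[OF s0] msubst_s_eq_0)

text \<open>The chart at the generic point \<open>t\<close>: coefficients of \<open>F'\<close> are pulled back by \<open>\<psi>\<close>.\<close>

abbreviation "pull \<equiv> idom_hom.fract_map (\<lambda>W. msubst W s)"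

definition "gpt = (\<chi> i. to_fract (mconst (t $ i) + mvar i))"

definition "gpt' = (\<chi> i. to_fract (\<psi> i))"

lemma field_hom_pull: "field_hom pull"
  by (rule idom_hom.field_hom_fract_map[OF idom_hom_s])

lemma generic_cone_param: "cone_param gpt (gexp F) a = gexp (cone_param t F a)"
  by (cases a) (simp_all add: gpt_def gexp_add gexp_mconst gexp_mvar to_fract_add mconst_add)

lemma generic_cone_image: "cone_image (generic_matrix M) gpt (gexp F) a = gexp (cone_image M t F a)"
  by (simp add: cone_image_def gexp_sum gexp_mult gexp_mconst generic_cone_param generic_matrix_def)

lemma generic_matrix_mult: "generic_matrix A ** generic_matrix B = generic_matrix (A ** B)"
  by (simp add: generic_matrix_def matrix_matrix_mult_def vec_eq_iff to_fract_sum to_fract_mult mconst_sum mconst_mult)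

lemma generic_matrix_nth: "generic_matrix A $ i $ j = to_fract (mconst (A $ i $ j))"
  by (simp add: generic_matrix_def)

lemma generic_matrix_1: "generic_matrix (mat 1) = mat 1"
  by (simp add: generic_matrix_def mat_def vec_eq_iff)

lemma lam_neq_0: "lam \<noteq> 0"
  using lam_nz by auto

lemma generic_psi: "gexp (y (Mid i)) * minv (gexp lam) = gexp (\<psi> i)"
proof -
  have "mcoeff0 (gexp lam) \<noteq> 0" using lam_neq_0 by simp
  from mult_minv[OF this] show ?thesis
    unfolding y_Mid gexp_mult by (simp add: mult_ac)
qed

lemma generic_s: "gexp (\<psi> i) - mconst (to_fract (\<psi> i)) = gexp (s i) - mconst (to_fract (s i))"
  by (simp add: s_def gexp_diff gexp_mconst to_fract_diff mconst_diff)

lemma generic_msubst: "msubst (map_coeffs pull (gexp W)) (\<lambda>i. gexp (\<psi> i) - mconst (to_fract (\<psi> i))) = gexp (msubst W s)"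
  unfolding generic_s by (rule gexp_msubst[OF s0 idom_hom_s])

text \<open>Over the generic point t of the source the image germ is met at \<psi>(t). Pulling its
  coefficients back along the chart moves them into the fraction field in t, where both germs can be
  compared.\<close>

lemma generic_chart:
  "cone_chart (gexp F) (map_coeffs pull (gexp F')) (generic_matrix M) (generic_matrix N) gpt gpt'"
proof
  show "generic_matrix N ** generic_matrix M = mat 1"
    by (simp add: generic_matrix_mult NM generic_matrix_1)
  show "mcoeff0 (cone_image (generic_matrix M) gpt (gexp F) Zeroth) \<noteq> 0"
    using lam_neq_0 by (simp add: generic_cone_image lam_def)
  show "mcoeff0 (cone_image (generic_matrix M) gpt (gexp F) (Mid i)) =
      gpt' $ i * mcoeff0 (cone_image (generic_matrix M) gpt (gexp F) Zeroth)" for i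
    by (simp add: generic_cone_image gpt'_def y_Mid lam_def to_fract_mult mult.commute)
  show "msubst (map_coeffs pull (gexp F'))
     (\<lambda>i. cone_image (generic_matrix M) gpt (gexp F) (Mid i) *
          minv (cone_image (generic_matrix M) gpt (gexp F) Zeroth) - mconst (gpt' $ i)) *
    cone_image (generic_matrix M) gpt (gexp F) Zeroth = cone_image (generic_matrix M) gpt (gexp F) Last"
    unfolding generic_cone_image lam_def[symmetric] generic_psi gpt'_def vec_lambda_beta generic_msubst
    by (simp add: gexp_mult[symmetric] f_def[symmetric] y_Last mult.commute)
qed

end

text \<open>Here \<open>\<theta>\<close> and \<open>G\<close> are nonzero merely as series. At the
  generic point the constant term of an expansion is the series itself, so the nonvanishing required
  at a point follows.\<close>

locale formal_cone_change = cone_chart F F' M N t t'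
  for F F' :: "('a::field_char_0, 'n::finite) mfps" and M N :: "'a ^ 'n hindex ^ 'n hindex" and t t' :: "'a ^ 'n" +
  fixes G G' :: "('a, 'n) mfps" and c :: 'a
  assumes det: "det (hess (gexp F)) \<noteq> 0" and theta: "\<theta> \<noteq> 0" and c: "c \<noteq> 0" and G: "G \<noteq> 0"
    and ampl: "lam ^ wt_den TYPE('n) * msubst G' s ^ wt_den TYPE('n) =
       mconst c * \<theta> ^ wt_den TYPE('n) * lam ^ half_weight TYPE('n) * G ^ wt_den TYPE('n)"
begin

lemma msubst_G'_neq_0: "msubst G' s \<noteq> 0"
proof
  assume "msubst G' s = 0"
  then have "mconst c * \<theta> ^ wt_den TYPE('n) * lam ^ half_weight TYPE('n) * G ^ wt_den TYPE('n) = 0"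
    using ampl wt_den_pos[where 'n = 'n] by (simp add: power_0_left)
  then show False using c theta lam_neq_0 G by simp
qed

interpretation gen: cone_chart "gexp F" "map_coeffs pull (gexp F')" "generic_matrix M" "generic_matrix N" gpt gpt'
  by (rule generic_chart)

lemma generic_lam: "gen.lam = gexp lam"
  by (simp add: gen.lam_def generic_cone_image lam_def)

lemma generic_psi': "gen.\<psi> i = gexp (\<psi> i)"
  by (simp add: gen.\<psi>_def generic_lam generic_cone_image generic_psi)

lemma generic_s': "gen.s = (\<lambda>i. gexp (\<psi> i) - mconst (to_fract (\<psi> i)))"
proof
  show "gen.s i = gexp (\<psi> i) - mconst (to_fract (\<psi> i))" for i
    unfolding gen.s_def generic_psi' by (simp add: gpt'_def)
qed

lemma generic_theta: "gen.\<theta> = gexp \<theta>"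
proof -
  have "gen.f = gexp f" unfolding gen.f_def generic_s' generic_msubst f_def ..
  moreover have "gen.f' i = gexp (f' i)" for i
    unfolding gen.f'_def f'_def field_hom.map_hom_mderiv[OF field_hom_pull, symmetric] mderiv_gexp generic_s' generic_msubst ..
  ultimately show ?thesis
    unfolding gen.\<theta>_def gen.\<mu>_def generic_psi' generic_matrix_nth
    by (simp add: \<theta>_def \<mu>_def gexp_diff gexp_sum gexp_mult gexp_mconst)
qed

lemma generic_density:
  "cone_density (gexp F) (map_coeffs pull (gexp F')) (generic_matrix M) (generic_matrix N) gpt gpt'
     (gexp G) (map_coeffs pull (gexp G')) (to_fract (mconst c))"
proof
  show "invertible (hess (gexp F))" using det by (simp add: invertible_det_nz)
  show "mcoeff0 gen.\<theta> \<noteq> 0" using theta by (simp add: generic_theta)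
  show "to_fract (mconst c :: ('a, 'n) mfps) \<noteq> 0" using c by simp
  show "mcoeff0 (gexp G) \<noteq> 0" using G by simp
  show "mcoeff0 (map_coeffs pull (gexp G')) \<noteq> 0"
    using msubst_G'_neq_0 by (simp add: idom_hom.fract_map_to_fract[OF idom_hom_s])
  show "gen.lam ^ wt_den TYPE('n) * msubst (map_coeffs pull (gexp G')) gen.s ^ wt_den TYPE('n) =
      mconst (to_fract (mconst c)) * gen.\<theta> ^ wt_den TYPE('n) * gen.lam ^ half_weight TYPE('n) * gexp G ^ wt_den TYPE('n)"
    unfolding generic_lam generic_theta generic_s' generic_msubst gexp_mconst[symmetric]
      gexp_power[symmetric] gexp_mult[symmetric] ampl ..
qed

text \<open>\<open>sp_coeff_phase_poly\<close> applies since \<open>lam\<close> is a linear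
  coordinate restricted to the cone; the conclusion for the pulled back coefficients descends
  because \<open>pull\<close> is an embedding of fields.\<close>

lemma generic_image:
  assumes adm: "\<And>k. sp_coeff (Suc k) (gexp F) (gexp G) = 0"
  shows "G' \<noteq> 0" "det (hess (gexp F')) \<noteq> 0" "sp_coeff (Suc k) (gexp F') (gexp G') = 0"
proof -
  interpret gen: cone_density "gexp F" "map_coeffs pull (gexp F')" "generic_matrix M" "generic_matrix N" gpt gpt'
    "gexp G" "map_coeffs pull (gexp G')" "to_fract (mconst c)"
    by (rule generic_density)
  interpret pull: field_hom pull by (rule field_hom_pull)
  interpret moving_point fract_deriv "gexp F"
    by standard (simp_all add: derivation.D_add[OF derivation_fract_deriv] derivation.D_mult[OF derivation_fract_deriv]
        map_fract_deriv_gexp gen.inv)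
  show "G' \<noteq> 0" using msubst_G'_neq_0 by auto
  have "invertible (hess (map_coeffs pull (gexp F')))"
    by (rule gen.invertible_hess_image[OF gen.inv gen.theta0])
  then show det': "det (hess (gexp F')) \<noteq> 0"
    by (simp add: invertible_det_nz pull.det_hess_hom)
  have "sp_coeff (Suc k) (gexp F) (gexp G * gen.lam ^ k) = 0" for k
  proof (rule sp_coeff_phase_poly)
    show "map_coeffs (fract_deriv i) (gexp G) = mderiv i (gexp G)" for i by (rule map_fract_deriv_gexp)
    show "phase_poly (phase (gexp F)) k (gen.lam ^ k)"
      by (rule phase_poly_power[OF gen.lam_eq_phase[OF refl refl]])
  qed (use adm in auto)
  from gen.sp_coeff_image[OF this] show "sp_coeff (Suc k) (gexp F') (gexp G') = 0"
    by (simp add: pull.sp_coeff_hom[OF det'])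
qed

end

section \<open>Germs in homogeneous coordinates\<close>

lemma mderiv_hcoord: "mderiv a (hcoord Q b) = (if a = b then 1 else 0)"
  by (simp add: hcoord_def mderiv_add mderiv_mvar)

lemma mcoeff0_hcoord [simp]: "mcoeff0 (hcoord Q a) = Q $ a"
  by (simp add: hcoord_def)

text \<open>Affine coordinates relative to \<open>Q\<close>, for arbitrary coordinate functions
  \<open>X\<close>; thus the equation of the cone can be restricted to any parametrised set through
  \<open>Q\<close>.\<close>

definition dehom_arg :: "'k::field ^ 'n hindex \<Rightarrow> ('n::finite hindex \<Rightarrow> ('k, 'm::finite) mfps) \<Rightarrow> 'n \<Rightarrow> ('k, 'm) mfps" where
  "dehom_arg Q X i = X (Mid i) * minv (X Zeroth) - mconst (affine_part Q $ i)"

lemma formal_dehom_eq: "formal_dehom Q F = msubst F (dehom_arg Q (hcoord Q))"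
  by (simp add: formal_dehom_def dehom_arg_def[abs_def])

lemma mcoeff0_dehom_arg:
  assumes "Q $ Zeroth \<noteq> 0" "\<And>a. mcoeff0 (X a) = Q $ a"
  shows "mcoeff0 (dehom_arg Q X i) = 0"
  using assms by (simp add: dehom_arg_def affine_part_def field_simps)

lemma msubst_hcoord:
  assumes "\<And>a. mcoeff0 (X a) = Q $ a"
  shows "msubst (hcoord Q a) (\<lambda>a. X a - mconst (Q $ a)) = X a"
  using assms by (simp add: hcoord_def msubst_add msubst_mvar)

context
  fixes Q :: "'k::field_char_0 ^ 'n::finite hindex" and X :: "'n hindex \<Rightarrow> ('k, 'm::finite) mfps"
  assumes Q0: "Q $ Zeroth \<noteq> 0" and X: "\<And>a. mcoeff0 (X a) = Q $ a"
begin

lemma msubst_dehom_arg: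
  "msubst (dehom_arg Q (hcoord Q) i) (\<lambda>a. X a - mconst (Q $ a)) = dehom_arg Q X i"
proof -
  have r: "mcoeff0 (X a - mconst (Q $ a)) = 0" for a by (simp add: X)
  have "mcoeff0 (hcoord Q Zeroth) \<noteq> 0" using Q0 by simp
  then show ?thesis
    unfolding dehom_arg_def
    by (simp add: msubst_diff msubst_mult[OF r] msubst_minv[OF r] msubst_hcoord[OF X])
qed

lemma msubst_formal_dehom:
  "msubst (formal_dehom Q F) (\<lambda>a. X a - mconst (Q $ a)) = msubst F (dehom_arg Q X)"
  unfolding formal_dehom_eq
  by (subst msubst_assoc) (simp_all add: mcoeff0_dehom_arg Q0 X msubst_dehom_arg)

lemma msubst_formal_cone:
  "msubst (formal_cone Q F) (\<lambda>a. X a - mconst (Q $ a)) = X Last * minv (X Zeroth) - msubst F (dehom_arg Q X)"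
proof -
  have r: "mcoeff0 (X a - mconst (Q $ a)) = 0" for a by (simp add: X)
  have "mcoeff0 (hcoord Q Zeroth) \<noteq> 0" using Q0 by simp
  then show ?thesis
    unfolding formal_cone_def msubst_diff msubst_formal_dehom
    by (simp add: msubst_mult[OF r] msubst_minv[OF r] msubst_hcoord[OF X])
qed

lemma msubst_formal_ampl:
  "msubst (formal_ampl Q G) (\<lambda>a. X a - mconst (Q $ a)) =
    msubst G (dehom_arg Q X) ^ wt_den TYPE('n) * minv (X Zeroth) ^ half_weight TYPE('n)"
proof -
  have r: "mcoeff0 (X a - mconst (Q $ a)) = 0" for a by (simp add: X)
  have "mcoeff0 (hcoord Q Zeroth) \<noteq> 0" using Q0 by simp
  then show ?thesis
    unfolding formal_ampl_def msubst_mult[OF r] msubst_power[OF r] msubst_formal_dehom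
    by (simp add: msubst_minv[OF r] msubst_hcoord[OF X])
qed

end

lemma mderiv_dehom_arg:
  fixes Q :: "'k::field_char_0 ^ 'n::finite hindex"
  assumes "Q $ Zeroth \<noteq> 0"
  shows "mderiv a (dehom_arg Q (hcoord Q) i) = (if a = Mid i then 1 else 0) * minv (hcoord Q Zeroth)
     - hcoord Q (Mid i) * (if a = Zeroth then 1 else 0) * minv (hcoord Q Zeroth) * minv (hcoord Q Zeroth)"
proof -
  have "mcoeff0 (hcoord Q Zeroth) \<noteq> 0" using assms by simp
  then show ?thesis
    by (simp add: dehom_arg_def mderiv_diff mderiv_mult mderiv_minv mderiv_hcoord)
qed

lemma mderiv_formal_cone:
  fixes Q :: "'k::field_char_0 ^ 'n::finite hindex"
  assumes Q: "Q $ Zeroth \<noteq> 0"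
  shows "mderiv a (formal_cone Q F) = (if a = Last then 1 else 0) * minv (hcoord Q Zeroth)
     - hcoord Q Last * (if a = Zeroth then 1 else 0) * minv (hcoord Q Zeroth) * minv (hcoord Q Zeroth)
     - (\<Sum>i\<in>UNIV. formal_dehom Q (mderiv i F) * mderiv a (dehom_arg Q (hcoord Q) i))"
proof -
  have "mcoeff0 (hcoord Q Zeroth) \<noteq> 0" using assms by simp
  moreover have "mcoeff0 (dehom_arg Q (hcoord Q) i) = 0" for i
    by (rule mcoeff0_dehom_arg[OF Q]) simp
  ultimately show ?thesis
    by (simp add: formal_cone_def formal_dehom_eq mderiv_diff mderiv_mult mderiv_minv mderiv_hcoord mderiv_msubst)
qed

lemma msubst_formal_linear:
  fixes \<phi> :: "('k::field_char_0, 'm::finite) mfps"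
  assumes r: "\<And>a. mcoeff0 (r a) = 0"
  shows "msubst (formal_linear N \<phi>) r = msubst \<phi> (\<lambda>a. \<Sum>b\<in>UNIV. mconst (N $ a $ b) * r b)"
  unfolding formal_linear_def
  by (subst msubst_assoc) (simp_all add: r msubst_sum msubst_mult[OF r] msubst_mvar[of r, OF r])

lemma mderiv_formal_linear:
  fixes \<phi> :: "('k::field_char_0, 'm::finite) mfps"
  shows "mderiv a (formal_linear N \<phi>) = (\<Sum>b\<in>UNIV. formal_linear N (mderiv b \<phi>) * mconst (N $ b $ a))"
  unfolding formal_linear_def by (subst mderiv_msubst) (simp_all add: mderiv_sum mderiv_mvar)

lemma mcoeff0_cone_param: "mcoeff0 (cone_param p F a) = cone_point p (mcoeff0 F) $ a"
  by (cases a) (simp_all add: cone_point_def)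

lemma mcoeff0_cone_image: "mcoeff0 (cone_image M p F a) = (M *v cone_point p (mcoeff0 F)) $ a"
  by (simp add: cone_image_def matrix_vector_mult_def mcoeff0_cone_param)

lemma affine_part_cone_point [simp]: "affine_part (cone_point p z) = (p :: 'a::field ^ 'n)"
  by (simp add: affine_part_def cone_point_def vec_eq_iff)

lemma dehom_arg_cone_param:
  fixes F :: "('k::field_char_0, 'n::finite) mfps"
  shows "dehom_arg (cone_point p z) (cone_param p F) = mvar"
proof
  have "minv (1 :: ('k, 'n) mfps) = 1" by (rule minv_unique) simp
  then show "dehom_arg (cone_point p z) (cone_param p F) i = mvar i" for i
    by (simp add: dehom_arg_def)
qed

text \<open>Both identities of \<open>formal_transform\<close> are restricted to the cone by
  inserting its parametrisation \<open>y\<close>. The first one puts \<open>y\<close> on the graph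
  of \<open>F'\<close>, the second one loses the term with \<open>V\<close>. The value of the unit
  on the cone is found by differentiating the first identity transversally.\<close>

lemma formal_transform_chart:
  fixes F F' G G' :: "('k::field_char_0, 'n::finite) mfps"
  assumes M: "invertible M" and c: "c \<noteq> 0" and T: "formal_transform M c (p, F, G) (p', F', G')"
  shows "cone_chart F F' M (matrix_inv M) p p'" (is ?chart)
    and "mcoeff0 (cone_chart.\<theta> F F' M p p') \<noteq> 0" (is ?theta)
    and "cone_chart.lam F M p ^ wt_den TYPE('n) * msubst G' (cone_chart.s F M p p') ^ wt_den TYPE('n) =
       mconst c * cone_chart.\<theta> F F' M p p' ^ wt_den TYPE('n) * cone_chart.lam F M p ^ half_weight TYPE('n) * G ^ wt_den TYPE('n)"
      (is ?ampl)
proof -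
  let ?e = "wt_den TYPE('n)" and ?h = "half_weight TYPE('n)"
  define Q where "Q = cone_point p (mcoeff0 F)"
  define Q' where "Q' = M *v Q"
  define N where "N = matrix_inv M"
  have NM1: "N ** M = mat 1" unfolding N_def using M by (rule matrix_inv_right_field)
  from T obtain U V where Q'0: "Q' $ Zeroth \<noteq> 0" and p': "p' = affine_part Q'"
    and U0: "mcoeff0 U \<noteq> 0"
    and cone: "formal_linear N (formal_cone Q F) = U * formal_cone Q' F'"
    and ampl: "U ^ ?e * formal_ampl Q' G' = mconst c * formal_linear N (formal_ampl Q G) + V * formal_cone Q' F'"
    unfolding formal_transform_def Q_def Q'_def N_def Let_def by auto
  define y where "y = cone_image M p F"
  define r where "r a = y a - mconst (Q' $ a)" for a
  have y0: "mcoeff0 (y a) = Q' $ a" for a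
    by (simp add: y_def mcoeff0_cone_image Q'_def Q_def)
  have r0: "mcoeff0 (r a) = 0" for a by (simp add: r_def y0)
  have Q0: "Q $ Zeroth \<noteq> 0" by (simp add: Q_def cone_point_def)
  have x0: "mcoeff0 (cone_param p F a) = Q $ a" for a by (simp add: Q_def mcoeff0_cone_param)
  have Nr: "(\<Sum>b\<in>UNIV. mconst (N $ a $ b) * r b) = cone_param p F a - mconst (Q $ a)" for a
  proof -
    have "(\<Sum>b\<in>UNIV. mconst (N $ a $ b) * y b) = cone_param p F a"
      unfolding y_def sum_cone_image NM1 cone_image_mat_1 ..
    moreover have "(\<Sum>b\<in>UNIV. N $ a $ b * Q' $ b) = Q $ a"
    proof -
      have "N *v Q' = Q" unfolding Q'_def matrix_vector_mul_assoc NM1 by simp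
      from arg_cong[OF this, of "\<lambda>v. v $ a"] show ?thesis by (simp add: matrix_vector_mult_def)
    qed
    then have "(\<Sum>b\<in>UNIV. mconst (N $ a $ b) * mconst (Q' $ b)) = (mconst (Q $ a) :: ('k, 'n) mfps)"
      by (simp only: mconst_mult[symmetric] mconst_sum[symmetric])
    ultimately show ?thesis by (simp add: r_def right_diff_distrib sum_subtractf)
  qed
  have lin: "msubst (formal_linear N \<phi>) r = msubst \<phi> (\<lambda>a. cone_param p F a - mconst (Q $ a))" for \<phi>
    unfolding msubst_formal_linear[OF r0] Nr ..
  have one: "minv (1 :: ('k, 'n) mfps) = 1" by (rule minv_unique) simp
  have x_cone: "msubst (formal_cone Q F) (\<lambda>a. cone_param p F a - mconst (Q $ a)) = 0"
    unfolding msubst_formal_cone[OF Q0 x0] by (simp add: Q_def dehom_arg_cone_param one)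
  have x_ampl: "msubst (formal_ampl Q G) (\<lambda>a. cone_param p F a - mconst (Q $ a)) = G ^ ?e"
    unfolding msubst_formal_ampl[OF Q0 x0] by (simp add: Q_def dehom_arg_cone_param one)
  define pU where "pU = msubst U r"
  have pU0: "mcoeff0 pU \<noteq> 0" by (simp add: pU_def U0)
  have r_def': "r = (\<lambda>a. y a - mconst (Q' $ a))" by (rule ext) (rule r_def)
  have "pU * msubst (formal_cone Q' F') r = 0"
    using arg_cong[OF cone, of "\<lambda>W. msubst W r"] unfolding lin x_cone by (simp add: msubst_mult[OF r0] pU_def)
  moreover have "pU \<noteq> 0" using pU0 by auto
  ultimately have cone0: "msubst (formal_cone Q' F') r = 0" by simp
  then have graph: "y Last * minv (y Zeroth) = msubst F' (dehom_arg Q' y)"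
    unfolding r_def' msubst_formal_cone[OF Q'0 y0] by simp
  have lam0: "mcoeff0 (y Zeroth) \<noteq> 0" by (simp add: y0 Q'0)
  have arg: "dehom_arg Q' y = (\<lambda>i. y (Mid i) * minv (y Zeroth) - mconst (p' $ i))"
    by (rule ext) (simp add: dehom_arg_def p')
  show chart: ?chart
  proof
    show "matrix_inv M ** M = mat 1" using NM1 by (simp add: N_def)
    show "mcoeff0 (cone_image M p F Zeroth) \<noteq> 0" using lam0 by (simp add: y_def)
    show "mcoeff0 (cone_image M p F (Mid i)) = p' $ i * mcoeff0 (cone_image M p F Zeroth)" for i
      unfolding y_def[symmetric] y0 p' using Q'0 by (simp add: affine_part_def)
    show "msubst F' (\<lambda>i. cone_image M p F (Mid i) * minv (cone_image M p F Zeroth) - mconst (p' $ i)) *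
        cone_image M p F Zeroth = cone_image M p F Last"
      unfolding y_def[symmetric] arg[symmetric] graph[symmetric]
      using mult_minv[OF lam0] by (simp add: mult_ac)
  qed
  interpret cone_chart F F' M "matrix_inv M" p p' by (rule chart)
  have s: "dehom_arg Q' y = s" by (rule ext) (simp only: arg, simp add: s_def \<psi>_def lam_def y_def)
  have lam: "y Zeroth = lam" by (simp add: y_def lam_def)
  have mu: "minv lam * lam = 1" using mult_minv[OF lam_nz] by (simp add: mult.commute)
  \<comment> \<open>Differentiate the identity of equations along the image of the direction
    x_(n+1). The left side gives 1, as x_0 = 1 on the parametrised cone; on the right the new
    equation vanishes, and \<open>pU\<close> times the quotient of \<theta> by \<open>lam\<close>
    remains.\<close>
  have cone_theta: "lam = pU * \<theta>"
  proof -
    let ?m = "\<lambda>a. mconst (M $ a $ Last)"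
    have "(\<Sum>a\<in>UNIV. ?m a * mderiv a (formal_linear N (formal_cone Q F))) =
        (\<Sum>b\<in>UNIV. formal_linear N (mderiv b (formal_cone Q F)) * mconst ((N ** M) $ b $ Last))"
      unfolding mderiv_formal_linear sum_distrib_left
      by (subst sum.swap) (simp add: matrix_matrix_mult_def mconst_sum mconst_mult sum_distrib_left mult_ac)
    also have "\<dots> = formal_linear N (mderiv Last (formal_cone Q F))"
      unfolding NM1 mat_def vec_lambda_beta if_distrib[of mconst] mconst_0 mconst_1 by simp
    finally have 1: "msubst (formal_linear N (mderiv Last (formal_cone Q F))) r =
        (\<Sum>a\<in>UNIV. msubst (?m a * mderiv a (U * formal_cone Q' F')) r)"
      unfolding cone by (simp add: msubst_sum[symmetric])
    have "mderiv Last (formal_cone Q F) = minv (hcoord Q Zeroth)"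
      by (simp add: mderiv_formal_cone[OF Q0] mderiv_dehom_arg[OF Q0])
    then have 2: "msubst (formal_linear N (mderiv Last (formal_cone Q F))) r = 1"
      unfolding lin using Q0 x0 by (simp add: msubst_minv msubst_hcoord[of "cone_param p F"] one)
    have z: "mcoeff0 (hcoord Q' Zeroth) \<noteq> 0" using Q'0 by simp
    have rh: "msubst (hcoord Q' a) r = y a" for a unfolding r_def' by (rule msubst_hcoord[OF y0])
    have rm: "msubst (minv (hcoord Q' Zeroth)) r = minv lam"
      unfolding msubst_minv[OF r0 z] rh lam ..
    have rd: "msubst (formal_dehom Q' W) r = msubst W s" for W
      unfolding r_def' msubst_formal_dehom[OF Q'0 y0] s ..
    have dm: "(\<Sum>a\<in>UNIV. ?m a * (if a = b then 1 else 0)) = ?m b" for b by simp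
    have da: "(\<Sum>a\<in>UNIV. ?m a * msubst (mderiv a (dehom_arg Q' (hcoord Q') i)) r) =
       ?m (Mid i) * minv lam - ?m Zeroth * (y (Mid i) * minv lam) * minv lam" for i
    proof -
      have "?m a * msubst (mderiv a (dehom_arg Q' (hcoord Q') i)) r =
        ?m a * (if a = Mid i then 1 else 0) * minv lam - ?m a * (if a = Zeroth then 1 else 0) * (y (Mid i) * minv lam * minv lam)" for a
        by (simp add: mderiv_dehom_arg[OF Q'0] msubst_diff msubst_mult[OF r0] rh rm mult_ac)
      then show ?thesis by (simp only: sum_subtractf sum_distrib_right[symmetric] dm) (simp add: mult_ac)
    qed
    have "(\<Sum>a\<in>UNIV. ?m a * msubst (mderiv a (formal_cone Q' F')) r) =
       (\<Sum>a\<in>UNIV. ?m a * (if a = Last then 1 else 0)) * minv lam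
       - (\<Sum>a\<in>UNIV. ?m a * (if a = Zeroth then 1 else 0)) * (y Last * minv lam * minv lam)
       - (\<Sum>i\<in>UNIV. f' i * (\<Sum>a\<in>UNIV. ?m a * msubst (mderiv a (dehom_arg Q' (hcoord Q') i)) r))"
    proof -
      have "?m a * msubst (mderiv a (formal_cone Q' F')) r =
         ?m a * (if a = Last then 1 else 0) * minv lam - ?m a * (if a = Zeroth then 1 else 0) * (y Last * minv lam * minv lam)
         - (\<Sum>i\<in>UNIV. f' i * (?m a * msubst (mderiv a (dehom_arg Q' (hcoord Q') i)) r))" for a
        by (simp add: mderiv_formal_cone[OF Q'0] msubst_diff msubst_mult[OF r0] msubst_sum rh rm rd f'_def
            right_diff_distrib sum_distrib_left mult_ac)
      then show ?thesis
        by (simp only: sum_subtractf sum_distrib_right[symmetric]) (subst sum.swap, simp add: sum_distrib_left)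
    qed
    also have "\<dots> = \<theta> * minv lam"
    proof -
      have yl: "y Last * minv lam = f" using y_Last mu by (simp add: y_def mult_ac)
      have ym: "y (Mid i) * minv lam = \<psi> i" for i by (simp add: \<psi>_def y_def)
      show ?thesis
        unfolding dm da yl ym by (simp add: \<theta>_def \<mu>_def left_diff_distrib right_diff_distrib sum_distrib_left mult_ac)
    qed
    finally have 3: "(\<Sum>a\<in>UNIV. ?m a * msubst (mderiv a (formal_cone Q' F')) r) = \<theta> * minv lam" .
    have "1 = (\<Sum>a\<in>UNIV. msubst (?m a * mderiv a (U * formal_cone Q' F')) r)"
      using 1 2 by simp
    also have "\<dots> = pU * (\<Sum>a\<in>UNIV. ?m a * msubst (mderiv a (formal_cone Q' F')) r)"
      by (simp add: mderiv_mult msubst_add msubst_mult[OF r0] cone0 pU_def sum_distrib_left mult_ac)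
    finally have "1 = pU * (\<theta> * minv lam)" unfolding 3 .
    then have "lam = pU * (\<theta> * minv lam) * lam" by simp
    also have "\<dots> = pU * (\<theta> * (minv lam * lam))" by (simp only: mult.assoc)
    finally have "lam = pU * (\<theta> * (minv lam * lam))" .
    then show ?thesis by (simp add: mu)
  qed
  then have "mcoeff0 lam = mcoeff0 pU * mcoeff0 \<theta>" by (metis mcoeff0_mult)
  then show ?theta using lam_nz by auto
  have "pU ^ ?e * (msubst G' s ^ ?e * minv lam ^ ?h) = mconst c * G ^ ?e"
    using arg_cong[OF ampl, of "\<lambda>W. msubst W r"]
    unfolding msubst_mult[OF r0] msubst_add msubst_power[OF r0] lin x_ampl cone0 pU_def[symmetric]
    unfolding r_def' msubst_formal_ampl[OF Q'0 y0] s lam by simp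
  then have "\<theta> ^ ?e * lam ^ ?h * (pU ^ ?e * (msubst G' s ^ ?e * minv lam ^ ?h)) = \<theta> ^ ?e * lam ^ ?h * (mconst c * G ^ ?e)"
    by simp
  also have "\<theta> ^ ?e * lam ^ ?h * (pU ^ ?e * (msubst G' s ^ ?e * minv lam ^ ?h)) =
      (pU * \<theta>) ^ ?e * msubst G' s ^ ?e * (minv lam * lam) ^ ?h"
    by (simp add: power_mult_distrib mult_ac)
  finally show ?ampl
    unfolding mu cone_theta[symmetric] by (simp add: mult_ac)
qed

lemma formal_admissible_transform:
  fixes P P' :: "('k::field_char_0, 'n::finite) formal_germ"
  assumes M: "invertible M" and c: "c \<noteq> 0" and P: "formal_admissible P" and T: "formal_transform M c P P'"
  shows "formal_admissible P'"
proof -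
  obtain p F G where P_eq: "P = (p, F, G)" by (cases P)
  obtain p' F' G' where P'_eq: "P' = (p', F', G')" by (cases P')
  note T = T[unfolded P_eq P'_eq]
  have adm: "det (hess (gexp F)) \<noteq> 0" "G \<noteq> 0" "\<And>k. sp_coeff (Suc k) (gexp F) (gexp G) = 0"
    using P by (auto simp: formal_admissible_def P_eq)
  interpret cone_chart F F' M "matrix_inv M" p p' by (rule formal_transform_chart(1)[OF M c T])
  interpret formal_cone_change F F' M "matrix_inv M" p p' G G' c
    by standard (use adm c formal_transform_chart(2,3)[OF M c T] in auto)
  have "sp_coeff k (gexp F') (gexp G') = 0" if "k \<ge> 1" for k
    using generic_image(3)[OF adm(3), of "k - 1"] that by simp
  then show ?thesis
    using generic_image(1,2)[OF adm(3)] by (simp add: formal_admissible_def P'_eq)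
qed

section \<open>Homogeneity: change of the representative of the base point\<close>

lemma mat_scalar_mult:
  fixes A :: "'a::comm_ring_1 ^ 'n::finite ^ 'n"
  shows "mat s ** A = A ** mat s"
  by (simp add: matrix_matrix_mult_def mat_def vec_eq_iff if_distrib[of "\<lambda>x. x * _"] if_distrib[of "\<lambda>x. _ * x"]
      mult.commute cong: if_cong)

lemma mat_mult_mat: "mat s ** mat r = (mat (s * r) :: 'a::comm_ring_1 ^ 'n::finite ^ 'n)"
  by (auto simp: matrix_matrix_mult_def mat_def vec_eq_iff if_distrib[of "\<lambda>x. x * _"] if_distrib[of "\<lambda>x. _ * x"] cong: if_cong)

lemma formal_linear_mult:
  fixes \<phi> \<psi> :: "('k::field_char_0, 'm::finite) mfps"
  shows "formal_linear N (\<phi> * \<psi>) = formal_linear N \<phi> * formal_linear N \<psi>"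
  and formal_linear_power: "formal_linear N (\<phi> ^ k) = formal_linear N \<phi> ^ k"
  and formal_linear_add: "formal_linear N (\<phi> + \<psi>) = formal_linear N \<phi> + formal_linear N \<psi>"
  and formal_linear_mconst: "formal_linear N (mconst c) = (mconst c :: ('k, 'm) mfps)"
  and mcoeff0_formal_linear [simp]: "mcoeff0 (formal_linear N \<phi>) = mcoeff0 \<phi>"
  by (simp_all add: formal_linear_def msubst_mult msubst_power msubst_add)

lemma formal_linear_compose:
  fixes \<phi> :: "('k::field_char_0, 'm::finite) mfps"
  shows "formal_linear A (formal_linear B \<phi>) = formal_linear (B ** A) \<phi>"
proof -
  have "(\<Sum>b\<in>UNIV. mconst (B $ a $ b) * (\<Sum>j\<in>UNIV. mconst (A $ b $ j) * mvar j)) =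
      (\<Sum>j\<in>UNIV. mconst ((B ** A) $ a $ j) * mvar j :: ('k, 'm) mfps)" for a
    unfolding sum_distrib_left matrix_matrix_mult_def
    by (subst sum.swap) (simp add: mconst_sum mconst_mult sum_distrib_right mult.assoc)
  note e = this
  have "formal_linear A (formal_linear B \<phi>) = msubst (formal_linear B \<phi>) (\<lambda>i. \<Sum>j\<in>UNIV. mconst (A $ i $ j) * mvar j)"
    by (simp only: formal_linear_def[of A])
  also have "\<dots> = formal_linear (B ** A) \<phi>"
    by (subst msubst_formal_linear) (simp_all only: e formal_linear_def[of "B ** A"], simp)
  finally show ?thesis .
qed

lemma formal_linear_mat: "formal_linear (mat s) \<phi> = msubst \<phi> (\<lambda>a. mconst s * mvar a)"
proof -
  have "(\<Sum>j\<in>UNIV. mconst (mat s $ a $ j) * mvar j) = (mconst s * mvar a :: ('a, 'b) mfps)" for a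
    unfolding mat_def vec_lambda_beta if_distrib[of mconst] mconst_0
    by (simp add: if_distrib[of "\<lambda>x. x * _"] cong: if_cong)
  then show ?thesis by (simp add: formal_linear_def)
qed

lemma formal_linear_1 [simp]:
  fixes \<phi> :: "('k::field_char_0, 'm::finite) mfps"
  shows "formal_linear (mat 1) \<phi> = \<phi>"
  by (simp add: formal_linear_mat)

lemma minv_mconst_mult:
  fixes X :: "('k::field_char_0, 'm::finite) mfps"
  assumes "s \<noteq> 0" "mcoeff0 X \<noteq> 0"
  shows "minv (mconst s * X) = mconst (1 / s) * minv X"
proof (rule minv_unique)
  have "mconst s * X * (mconst (1 / s) * minv X) = mconst (s * (1 / s)) * (X * minv X)"
    by (simp only: mconst_mult mult_ac)
  then show "mconst s * X * (mconst (1 / s) * minv X) = 1" using assms by (simp add: mult_minv)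
qed

context
  fixes Q :: "'k::field_char_0 ^ 'n::finite hindex" and s :: 'k
  assumes Q: "Q $ Zeroth \<noteq> 0" and s: "s \<noteq> 0"
begin

lemma mat_vec: "mat s *v Q = (\<chi> a. s * Q $ a)"
  by (simp add: matrix_vector_mult_def mat_def vec_eq_iff if_distrib[of "\<lambda>x. x * _"] cong: if_cong)

definition "scaled_coord a = mconst (1 / s) * hcoord (mat s *v Q) a"

lemma scaled_coord_0: "mcoeff0 (scaled_coord a) = Q $ a"
  using s by (simp add: scaled_coord_def mat_vec)

lemma scaled_coord_eq: "scaled_coord a - mconst (Q $ a) = mconst (1 / s) * mvar a"
  using s by (simp add: scaled_coord_def hcoord_def mat_vec distrib_left mconst_mult[symmetric])

lemma minv_scaled_coord: "minv (scaled_coord Zeroth) = mconst s * minv (hcoord (mat s *v Q) Zeroth)"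
proof -
  have "mcoeff0 (hcoord (mat s *v Q) Zeroth) \<noteq> 0" using Q s by (simp add: mat_vec)
  then show ?thesis unfolding scaled_coord_def using s by (subst minv_mconst_mult) simp_all
qed

lemma scaled_ratio: "scaled_coord a * minv (scaled_coord Zeroth) = hcoord (mat s *v Q) a * minv (hcoord (mat s *v Q) Zeroth)"
proof -
  have "scaled_coord a * minv (scaled_coord Zeroth) =
     mconst (1 / s * s) * (hcoord (mat s *v Q) a * minv (hcoord (mat s *v Q) Zeroth))"
    unfolding minv_scaled_coord unfolding scaled_coord_def mconst_mult by (simp only: mult_ac)
  then show ?thesis using s by simp
qed

lemma scaled_affine_part: "affine_part (mat s *v Q) = affine_part Q"
  using s by (simp add: affine_part_def mat_vec vec_eq_iff)

lemma scaled_arg: "dehom_arg Q scaled_coord = dehom_arg (mat s *v Q) (hcoord (mat s *v Q))"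
  by (rule ext) (simp add: dehom_arg_def scaled_ratio scaled_affine_part)

lemma formal_cone_scale: "formal_cone (mat s *v Q) F = formal_linear (mat (1 / s)) (formal_cone Q F)"
proof -
  have "formal_linear (mat (1 / s)) (formal_cone Q F) = msubst (formal_cone Q F) (\<lambda>a. scaled_coord a - mconst (Q $ a))"
    unfolding formal_linear_mat scaled_coord_eq ..
  also have "\<dots> = formal_cone (mat s *v Q) F"
    unfolding msubst_formal_cone[OF Q scaled_coord_0] scaled_ratio scaled_arg
    by (simp only: formal_cone_def formal_dehom_eq)
  finally show ?thesis ..
qed

lemma formal_ampl_scale:
  "formal_linear (mat (1 / s)) (formal_ampl Q G) = mconst (s ^ half_weight TYPE('n)) * formal_ampl (mat s *v Q) G"
proof -
  have "formal_linear (mat (1 / s)) (formal_ampl Q G) = msubst (formal_ampl Q G) (\<lambda>a. scaled_coord a - mconst (Q $ a))"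
    unfolding formal_linear_mat scaled_coord_eq ..
  also have "\<dots> = mconst (s ^ half_weight TYPE('n)) * formal_ampl (mat s *v Q) G"
    unfolding msubst_formal_ampl[OF Q scaled_coord_0] scaled_arg minv_scaled_coord
    by (simp only: formal_ampl_def formal_dehom_eq power_mult_distrib mconst_power mult_ac)
  finally show ?thesis .
qed

end

text \<open>Equality of the densities \<open>\<delta>(h) a\<close> and \<open>\<delta>(h') a'\<close> up to \<open>c\<close>, on the level of \<open>e\<close>-th powers of \<open>a\<close>.\<close>

definition density_eq :: "nat \<Rightarrow> 'k \<Rightarrow> ('k::field_char_0, 'm::finite) mfps \<Rightarrow> ('k, 'm) mfps \<Rightarrow>
    ('k, 'm) mfps \<Rightarrow> ('k, 'm) mfps \<Rightarrow> bool" where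
  "density_eq e c h a h' a' \<longleftrightarrow> (\<exists>U V. mcoeff0 U \<noteq> 0 \<and> h = U * h' \<and> U ^ e * a' = mconst c * a + V * h')"

lemma density_eq_refl: "density_eq e 1 h a h a"
  unfolding density_eq_def by (rule exI[of _ 1], rule exI[of _ 0]) simp

lemma density_eq_linear:
  assumes "density_eq e c h a h' a'"
  shows "density_eq e c (formal_linear N h) (formal_linear N a) (formal_linear N h') (formal_linear N a')"
proof -
  from assms obtain U V where U: "mcoeff0 U \<noteq> 0" and h: "h = U * h'" and a: "U ^ e * a' = mconst c * a + V * h'"
    unfolding density_eq_def by blast
  have "formal_linear N U ^ e * formal_linear N a' = mconst c * formal_linear N a + formal_linear N V * formal_linear N h'"
    using arg_cong[OF a, of "formal_linear N"]
    by (simp add: formal_linear_mult formal_linear_power formal_linear_add formal_linear_mconst)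
  moreover have "formal_linear N h = formal_linear N U * formal_linear N h'" by (simp add: h formal_linear_mult)
  ultimately show ?thesis unfolding density_eq_def using U mcoeff0_formal_linear by metis
qed

lemma density_eq_scale:
  assumes "density_eq e c h a h' a'"
  shows "density_eq e c h (mconst r * a) h' (mconst r * a')"
proof -
  from assms obtain U V where U: "mcoeff0 U \<noteq> 0" and h: "h = U * h'" and a: "U ^ e * a' = mconst c * a + V * h'"
    unfolding density_eq_def by blast
  have "U ^ e * (mconst r * a') = mconst r * (U ^ e * a')" by (simp only: mult_ac)
  also have "\<dots> = mconst c * (mconst r * a) + (mconst r * V) * h'" unfolding a by (simp add: algebra_simps)
  finally show ?thesis unfolding density_eq_def using U h by blast
qed

lemma density_eq_sym:
  assumes "density_eq e c h a h' a'" and c: "c \<noteq> 0"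
  shows "density_eq e (inverse c) h' a' h a"
proof -
  from assms obtain U V where U: "mcoeff0 U \<noteq> 0" and h: "h = U * h'" and a: "U ^ e * a' = mconst c * a + V * h'"
    unfolding density_eq_def by blast
  define W where "W = minv U"
  have WU: "W * U = 1" using mult_minv[OF U] by (simp add: W_def mult.commute)
  have WUe: "W ^ e * U ^ e = 1" by (simp only: power_mult_distrib[symmetric] WU power_one)
  have h': "h' = W * h" unfolding h by (simp only: mult.assoc[symmetric] WU mult_1_left)
  have "mconst (inverse c) * (W ^ e * (U ^ e * a')) = mconst (inverse c) * (W ^ e * (mconst c * a)) + mconst (inverse c) * (W ^ e * (V * h'))"
    unfolding a by (simp only: distrib_left)
  moreover have "W ^ e * (U ^ e * a') = a'" by (simp only: mult.assoc[symmetric] WUe mult_1_left)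
  moreover have "mconst (inverse c) * (W ^ e * (mconst c * a)) = mconst (inverse c * c) * (W ^ e * a)"
    by (simp only: mconst_mult mult_ac)
  ultimately have "mconst (inverse c) * a' = W ^ e * a + mconst (inverse c) * (W ^ e * (V * h'))"
    using c by simp
  then have "W ^ e * a = mconst (inverse c) * a' - mconst (inverse c) * (W ^ e * (V * h'))" by simp
  also have "\<dots> = mconst (inverse c) * a' + (- mconst (inverse c) * W ^ e * V * W) * h"
    unfolding h' by (simp add: mult_ac)
  finally have "W ^ e * a = mconst (inverse c) * a' + (- mconst (inverse c) * W ^ e * V * W) * h" .
  moreover have "mcoeff0 W \<noteq> 0" using U by (simp add: W_def)
  ultimately show ?thesis unfolding density_eq_def using h' by blast
qed

lemma density_eq_trans:
  assumes "density_eq e c h a h' a'" "density_eq e c' h' a' h'' a''"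
  shows "density_eq e (c' * c) h a h'' a''"
proof -
  from assms(1) obtain U V where U: "mcoeff0 U \<noteq> 0" and h: "h = U * h'" and a: "U ^ e * a' = mconst c * a + V * h'"
    unfolding density_eq_def by blast
  from assms(2) obtain U' V' where U': "mcoeff0 U' \<noteq> 0" and h': "h' = U' * h''" and a': "U' ^ e * a'' = mconst c' * a' + V' * h''"
    unfolding density_eq_def by blast
  have "(U * U') ^ e * a'' = U ^ e * (U' ^ e * a'')" by (simp add: power_mult_distrib mult.assoc)
  also have "\<dots> = mconst c' * (U ^ e * a') + U ^ e * V' * h''" unfolding a' by (simp add: algebra_simps)
  also have "\<dots> = mconst (c' * c) * a + (mconst c' * V * U' + U ^ e * V') * h''"
    unfolding a h' by (simp add: algebra_simps mconst_mult)
  finally have "(U * U') ^ e * a'' = mconst (c' * c) * a + (mconst c' * V * U' + U ^ e * V') * h''" .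
  moreover have "h = (U * U') * h''" unfolding h h' by (simp only: mult.assoc)
  moreover have "mcoeff0 (U * U') \<noteq> 0" using U U' by simp
  ultimately show ?thesis unfolding density_eq_def by blast
qed

abbreviation transform_at ::
    "'k::field_char_0 ^ 'n hindex ^ 'n hindex \<Rightarrow> 'k \<Rightarrow> 'k ^ 'n hindex \<Rightarrow>
     ('k, 'n::finite) mfps \<Rightarrow> ('k, 'n) mfps \<Rightarrow> ('k, 'n) mfps \<Rightarrow> ('k, 'n) mfps \<Rightarrow> bool" where
  "transform_at M c Q F G F' G' \<equiv> density_eq (wt_den TYPE('n)) c
     (formal_linear (matrix_inv M) (formal_cone Q F)) (formal_linear (matrix_inv M) (formal_ampl Q G))
     (formal_cone (M *v Q) F') (formal_ampl (M *v Q) G')"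

lemma formal_transform_iff:
  fixes F G F' G' :: "('k::field_char_0, 'n::finite) mfps"
  shows "formal_transform M c (p, F, G) (p', F', G') \<longleftrightarrow>
   (let Q = cone_point p (mcoeff0 F); Q' = M *v Q in
     Q' $ Zeroth \<noteq> 0 \<and> p' = affine_part Q' \<and> mcoeff0 F' = Q' $ Last / Q' $ Zeroth \<and>
     transform_at M c Q F G F' G')"
  by (simp add: formal_transform_def density_eq_def Let_def)

text \<open>\<open>cone_point\<close> normalises x_0 to 1 but \<open>M\<close> does not preserve
  this, so inverse and composite transformations start from a rescaled point. By homogeneity the
  power \<open>half_weight\<close> of \<open>s\<close> appears on both sides of the amplitude
  identity and cancels.\<close>

lemma transform_at_scale:
  fixes F G F' G' :: "('k::field_char_0, 'n::finite) mfps"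
  assumes T: "transform_at M c Q F G F' G'" and Q: "Q $ Zeroth \<noteq> 0" "(M *v Q) $ Zeroth \<noteq> 0" and s: "s \<noteq> 0"
  shows "transform_at M c (mat s *v Q) F G F' G'"
proof -
  let ?N = "matrix_inv M" and ?S = "mat (1 / s) :: 'k ^ 'n hindex ^ 'n hindex"
  let ?k = "s ^ half_weight TYPE('n)"
  have MQ: "M *v (mat s *v Q) = mat s *v (M *v Q)"
    by (simp add: matrix_vector_mul_assoc mat_scalar_mult)
  have comm: "formal_linear ?S (formal_linear ?N \<phi>) = formal_linear ?N (formal_linear ?S \<phi>)" for \<phi> :: "('k, 'n hindex) mfps"
    by (simp add: formal_linear_compose mat_scalar_mult)
  have mc: "formal_linear ?N (mconst ?k * \<phi>) = mconst ?k * formal_linear ?N \<phi>" for \<phi> :: "('k, 'n hindex) mfps"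
    by (simp add: formal_linear_mult formal_linear_mconst)
  have cancel: "mconst (1 / ?k) * (mconst ?k * \<phi>) = \<phi>" for \<phi> :: "('k, 'n hindex) mfps"
    using s by (simp add: mult.assoc[symmetric] mconst_mult[symmetric])
  from density_eq_scale[OF density_eq_linear[OF T, of ?S], of "1 / ?k"]
  show ?thesis
    unfolding comm formal_ampl_scale[OF Q(1) s] formal_ampl_scale[OF Q(2) s] mc cancel MQ
      formal_cone_scale[OF Q(1) s, symmetric] formal_cone_scale[OF Q(2) s, symmetric] .
qed

lemma cone_point_Zeroth [simp]: "cone_point p z $ Zeroth = 1"
  and cone_point_Last [simp]: "cone_point p z $ Last = z"
  and cone_point_Mid [simp]: "cone_point p z $ Mid i = p $ i"
  by (simp_all add: cone_point_def)

lemma mat_vec_nth: "(mat s *v Q) $ a = s * (Q :: 'a::comm_ring_1 ^ 'm::finite) $ a"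
  by (simp add: matrix_vector_mult_def mat_def if_distrib[of "\<lambda>x. x * _"] cong: if_cong)

lemma cone_point_affine_part:
  fixes Q :: "'k::field ^ 'n::finite hindex"
  assumes "Q $ Zeroth \<noteq> 0"
  shows "cone_point (affine_part Q) (Q $ Last / Q $ Zeroth) = mat (1 / Q $ Zeroth) *v Q"
proof -
  have "cone_point (affine_part Q) (Q $ Last / Q $ Zeroth) $ a = (mat (1 / Q $ Zeroth) *v Q) $ a" for a
    using assms by (cases a) (simp_all add: mat_vec_nth affine_part_def)
  then show ?thesis by (simp add: vec_eq_iff)
qed

text \<open>On the cone of \<open>F'\<close> through \<open>Q\<close> the equation of
  \<open>F\<close> restricts to \<open>F' - F\<close>, which must vanish. The unit is then 1,
  because the equation is a nonzero element of a domain, and restricting the amplitudes to the cone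
  removes \<open>V\<close>.\<close>

lemma density_eq_unique:
  fixes F F' G G' :: "('k::field_char_0, 'n::finite) mfps"
  assumes Q: "Q $ Zeroth \<noteq> 0" and F'0: "mcoeff0 F' = Q $ Last / Q $ Zeroth"
    and d: "density_eq (wt_den TYPE('n)) 1 (formal_cone Q F) (formal_ampl Q G) (formal_cone Q F') (formal_ampl Q G')"
  shows "F = F' \<and> G ^ wt_den TYPE('n) = G' ^ wt_den TYPE('n)"
proof -
  let ?e = "wt_den TYPE('n)" and ?h = "half_weight TYPE('n)"
  define X where "X a = mconst (Q $ Zeroth) * cone_param (affine_part Q) F' a" for a
  define r where "r = (\<lambda>a. X a - mconst (Q $ a))"
  have X0: "mcoeff0 (X a) = Q $ a" for a
    using Q by (cases a) (simp_all add: X_def affine_part_def F'0)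
  have r0: "mcoeff0 (r a) = 0" for a by (simp add: r_def X0)
  have mX: "minv (X Zeroth) = mconst (1 / Q $ Zeroth)"
    by (rule minv_unique) (use Q in \<open>simp add: X_def mconst_mult[symmetric]\<close>)
  have ratio: "X a * minv (X Zeroth) = cone_param (affine_part Q) F' a" for a
  proof -
    have "X a * minv (X Zeroth) = mconst (Q $ Zeroth * (1 / Q $ Zeroth)) * cone_param (affine_part Q) F' a"
      unfolding mX by (simp only: X_def mconst_mult mult_ac)
    then show ?thesis using Q by simp
  qed
  have arg: "dehom_arg Q X = mvar"
    by (rule ext) (simp add: dehom_arg_def ratio)
  have cone: "msubst (formal_cone Q W) r = F' - W" for W
    unfolding r_def msubst_formal_cone[OF Q X0] arg ratio by simp
  have ampl: "msubst (formal_ampl Q W) r = W ^ ?e * mconst (1 / Q $ Zeroth) ^ ?h" for W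
    unfolding r_def msubst_formal_ampl[OF Q X0] arg mX by simp
  from d obtain U V where U: "mcoeff0 U \<noteq> 0" and h: "formal_cone Q F = U * formal_cone Q F'"
    and a: "U ^ ?e * formal_ampl Q G' = formal_ampl Q G + V * formal_cone Q F'"
    unfolding density_eq_def by auto
  have FF': "F = F'"
    using arg_cong[OF h, of "\<lambda>W. msubst W r"] by (simp add: msubst_mult[OF r0] cone)
  have "formal_cone Q F' \<noteq> 0"
  proof
    assume "formal_cone Q F' = 0"
    then have "mderiv Last (formal_cone Q F') = 0" by simp
    then have "minv (hcoord Q Zeroth) = 0"
      by (simp add: mderiv_formal_cone[OF Q] mderiv_dehom_arg[OF Q])
    then show False using mult_minv[of "hcoord Q Zeroth"] Q by simp
  qed
  then have "U = 1" using h FF' by simp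
  then have "G' ^ ?e * mconst (1 / Q $ Zeroth) ^ ?h = G ^ ?e * mconst (1 / Q $ Zeroth) ^ ?h"
    using arg_cong[OF a, of "\<lambda>W. msubst W r"] by (simp add: msubst_mult[OF r0] msubst_add cone ampl)
  moreover have "(mconst (1 / Q $ Zeroth) ^ ?h :: ('k, 'n) mfps) \<noteq> 0" using Q by simp
  ultimately show ?thesis using FF' mult_right_cancel by metis
qed

lemma formal_ampl_cong:
  fixes G G' :: "('k::field_char_0, 'n::finite) mfps"
  assumes Q: "Q $ Zeroth \<noteq> 0" and G: "G ^ wt_den TYPE('n) = G' ^ wt_den TYPE('n)"
  shows "formal_ampl Q G = formal_ampl Q G'"
proof -
  have "mcoeff0 (dehom_arg Q (hcoord Q) i) = 0" for i by (rule mcoeff0_dehom_arg[OF Q]) simp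
  then show ?thesis
    unfolding formal_ampl_def formal_dehom_eq using G by (simp add: msubst_power[symmetric])
qed

section \<open>Group laws for formal germs\<close>

lemma matrix_inv_mult:
  fixes A B :: "'k::field ^ 'n::finite ^ 'n"
  assumes "invertible A" "invertible B"
  shows "matrix_inv (A ** B) = matrix_inv B ** matrix_inv A"
proof (rule matrix_inv_unique_field)
  have "A ** B ** (matrix_inv B ** matrix_inv A) = A ** (B ** matrix_inv B) ** matrix_inv A"
    by (simp only: matrix_mul_assoc)
  then show "A ** B ** (matrix_inv B ** matrix_inv A) = mat 1"
    by (simp add: matrix_inv_right_field assms)
qed

lemma matrix_inv_matrix_inv:
  fixes A :: "'k::field ^ 'n::finite ^ 'n"
  assumes "invertible A"
  shows "matrix_inv (matrix_inv A) = A"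
  by (rule matrix_inv_unique_field) (rule matrix_inv_right_field(2)[OF assms])

lemma formal_transform_inverse:
  fixes P P' :: "('k::field_char_0, 'n::finite) formal_germ"
  assumes M: "invertible M" and c: "c \<noteq> 0" and T: "formal_transform M c P P'"
  shows "formal_transform (matrix_inv M) (inverse c) P' P"
proof -
  obtain p F G where P: "P = (p, F, G)" by (cases P)
  obtain p' F' G' where P': "P' = (p', F', G')" by (cases P')
  define Q where "Q = cone_point p (mcoeff0 F)"
  define Q' where "Q' = M *v Q"
  let ?N = "matrix_inv M"
  have T: "Q' $ Zeroth \<noteq> 0" "p' = affine_part Q'" "mcoeff0 F' = Q' $ Last / Q' $ Zeroth" "transform_at M c Q F G F' G'"
    using T by (auto simp: formal_transform_iff P P' Let_def Q_def Q'_def)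
  define s where "s = 1 / Q' $ Zeroth"
  have s: "s \<noteq> 0" using T(1) by (simp add: s_def)
  have Q1: "cone_point p' (mcoeff0 F') = mat s *v Q'"
    unfolding T(2,3) s_def by (rule cone_point_affine_part[OF T(1)])
  have NQ: "?N *v Q' = Q"
    by (simp add: Q'_def matrix_vector_mul_assoc matrix_inv_right_field[OF M])
  have NQ1: "?N *v (mat s *v Q') = mat s *v Q"
    by (simp add: NQ[symmetric] matrix_vector_mul_assoc mat_scalar_mult)
  have Q0: "Q $ Zeroth \<noteq> 0" by (simp add: Q_def)
  have id: "formal_linear M (formal_linear ?N \<phi>) = \<phi>" for \<phi> :: "('k, 'n hindex) mfps"
    by (simp add: formal_linear_compose matrix_inv_right_field[OF M])
  have "transform_at ?N (inverse c) Q' F' G' F G"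
    using density_eq_linear[OF density_eq_sym[OF T(4) c], of M]
    unfolding id matrix_inv_matrix_inv[OF M] NQ Q'_def[symmetric] .
  then have "transform_at ?N (inverse c) (mat s *v Q') F' G' F G"
    by (rule transform_at_scale) (simp_all add: NQ Q0 T(1) s)
  moreover have "affine_part (mat s *v Q) = p"
    unfolding scaled_affine_part[OF Q0 s] by (simp add: Q_def)
  ultimately show ?thesis
    unfolding P P' formal_transform_iff Let_def Q1 NQ1 using s Q0 by (simp add: mat_vec_nth Q_def NQ1)
qed

lemma formal_transform_compose:
  fixes P P' P'' :: "('k::field_char_0, 'n::finite) formal_germ"
  assumes M: "invertible M" "invertible M'"
    and T: "formal_transform M c P P'" and T': "formal_transform M' c' P' P''"
  shows "formal_transform (M' ** M) (c' * c) P P''"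
proof -
  obtain p F G where P: "P = (p, F, G)" by (cases P)
  obtain p' F' G' where P': "P' = (p', F', G')" by (cases P')
  obtain p'' F'' G'' where P'': "P'' = (p'', F'', G'')" by (cases P'')
  define Q where "Q = cone_point p (mcoeff0 F)"
  define Q' where "Q' = M *v Q"
  define Q1 where "Q1 = cone_point p' (mcoeff0 F')"
  define Q'' where "Q'' = M' *v Q1"
  have T: "Q' $ Zeroth \<noteq> 0" "p' = affine_part Q'" "mcoeff0 F' = Q' $ Last / Q' $ Zeroth" "transform_at M c Q F G F' G'"
    using T by (auto simp: formal_transform_iff P P' Let_def Q_def Q'_def)
  have T': "Q'' $ Zeroth \<noteq> 0" "p'' = affine_part Q''" "mcoeff0 F'' = Q'' $ Last / Q'' $ Zeroth"
    "transform_at M' c' Q1 F' G' F'' G''"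
    using T' by (auto simp: formal_transform_iff P' P'' Let_def Q1_def Q''_def)
  define s where "s = Q' $ Zeroth"
  have s: "s \<noteq> 0" using T(1) by (simp add: s_def)
  have "Q1 = mat (1 / s) *v Q'"
    unfolding Q1_def T(2,3) s_def by (rule cone_point_affine_part[OF T(1)])
  then have sQ1: "mat s *v Q1 = Q'"
    using s by (simp add: matrix_vector_mul_assoc mat_mult_mat)
  have MQ: "(M' ** M) *v Q = mat s *v Q''"
    by (simp add: Q''_def sQ1[symmetric] Q'_def[symmetric] matrix_vector_mul_assoc[symmetric])
       (simp add: matrix_vector_mul_assoc mat_scalar_mult)
  have "transform_at M' c' (mat s *v Q1) F' G' F'' G''"
    using T'(4) by (rule transform_at_scale) (use T'(1) s in \<open>simp_all add: Q1_def Q''_def\<close>)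
  then have 2: "transform_at M' c' Q' F' G' F'' G''" unfolding sQ1 .
  have "transform_at (M' ** M) (c' * c) Q F G F'' G''"
    using density_eq_trans[OF density_eq_linear[OF T(4), of "matrix_inv M'"], of c'] 2
    unfolding formal_linear_compose matrix_inv_mult[OF M(2,1)] Q'_def[symmetric]
    by (simp add: Q'_def matrix_vector_mul_assoc)
  moreover have "affine_part (mat s *v Q'') = p''"
    unfolding scaled_affine_part[OF T'(1) s] T'(2) ..
  ultimately show ?thesis
    unfolding P P'' formal_transform_iff Let_def Q_def[symmetric] using s T'(1,3) MQ by (simp add: mat_vec_nth)
qed

lemma formal_transform_same:
  fixes P P' P'' :: "('k::field_char_0, 'n::finite) formal_germ"
  assumes "formal_transform M c P P'"
  shows "formal_same P' P'' \<Longrightarrow> formal_transform M c P P''"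
    and "formal_same P P'' \<Longrightarrow> formal_transform M c P'' P'"
    and "c \<noteq> 0 \<Longrightarrow> formal_transform M c P P'' \<Longrightarrow> formal_same P' P''"
proof -
  obtain p F G where P: "P = (p, F, G)" by (cases P)
  obtain p' F' G' where P': "P' = (p', F', G')" by (cases P')
  obtain p'' F'' G'' where P'': "P'' = (p'', F'', G'')" by (cases P'')
  define Q where "Q = cone_point p (mcoeff0 F)"
  define Q' where "Q' = M *v Q"
  have T: "Q' $ Zeroth \<noteq> 0" "p' = affine_part Q'" "mcoeff0 F' = Q' $ Last / Q' $ Zeroth" "transform_at M c Q F G F' G'"
    using assms by (auto simp: formal_transform_iff P P' Let_def Q_def Q'_def)
  have Q0: "Q $ Zeroth \<noteq> 0" by (simp add: Q_def)
  show "formal_transform M c P P''" if "formal_same P' P''"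
    using that T formal_ampl_cong[OF T(1), of G' G'']
    unfolding P P'' P' formal_same_def formal_transform_iff Let_def Q_def[symmetric] Q'_def[symmetric] by auto
  show "formal_transform M c P'' P'" if "formal_same P P''"
    using that T formal_ampl_cong[OF Q0, of G G'']
    unfolding P P'' P' formal_same_def formal_transform_iff Let_def by (auto simp: Q_def Q'_def)
  show "formal_same P' P''" if c: "c \<noteq> 0" and T': "formal_transform M c P P''"
  proof -
    have T': "p'' = affine_part Q'" "mcoeff0 F'' = Q' $ Last / Q' $ Zeroth" "transform_at M c Q F G F'' G''"
      using T' by (auto simp: formal_transform_iff P P'' Let_def Q_def Q'_def)
    have "density_eq (wt_den TYPE('n)) 1 (formal_cone Q' F') (formal_ampl Q' G') (formal_cone Q' F'') (formal_ampl Q' G'')"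
      using density_eq_trans[OF density_eq_sym[OF T(4) c] T'(3)] c by (simp add: Q'_def)
    from density_eq_unique[OF T(1) T'(2) this] show ?thesis
      unfolding formal_same_def P' P'' using T(2) T'(1) by simp
  qed
qed

lemma formal_transform_id:
  fixes P :: "('k::field_char_0, 'n::finite) formal_germ"
  shows "formal_transform (mat 1) 1 P P"
proof -
  obtain p F G where P: "P = (p, F, G)" by (cases P)
  have "matrix_inv (mat 1) = (mat 1 :: 'k ^ 'n hindex ^ 'n hindex)"
    by (rule matrix_inv_unique_field) simp
  then show ?thesis
    by (simp add: P formal_transform_iff density_eq_refl)
qed

theorem formal_action:
  "partial_GL_action (formal_admissible :: ('k::field_char_0, 'n::finite) formal_germ \<Rightarrow> bool)
     formal_same formal_transform"
  unfolding partial_GL_action_def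
proof (intro conjI allI impI; (elim conjE)?)
  fix M M' :: "'k ^ 'n hindex ^ 'n hindex" and c c' and P P' P'' :: "('k, 'n) formal_germ"
  assume M: "invertible M" and c: "c \<noteq> 0" and P: "formal_admissible P" and T: "formal_transform M c P P'"
  show "formal_admissible P'" using M c P T by (rule formal_admissible_transform)
  show "formal_transform M c P P'' = formal_same P' P''"
    using formal_transform_same(1,3)[OF T] c by blast
  show "formal_transform M c P'' P'" if "formal_same P P''" using formal_transform_same(2)[OF T that] .
  show "formal_transform (matrix_inv M) (inverse c) P' P" using M c T by (rule formal_transform_inverse)
  show "formal_transform (M' ** M) (c' * c) P P''" if "invertible M'" "formal_transform M' c' P' P''"
    using M that(1) T that(2) by (rule formal_transform_compose)
qed (rule formal_transform_id)

section \<open>Inverse functions, square roots and division\<close>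

lemma mord_diff_mult:
  fixes a b :: "('a::comm_ring_1, 'n::finite) mfps"
  assumes "mord d (a - a')" "mord d (b - b')"
  shows "mord d (a * b - a' * b')"
proof -
  have "a * b - a' * b' = (a - a') * b + a' * (b - b')" by (simp add: algebra_simps)
  then show ?thesis using assms by (simp add: mord_add mord_mult_left mord_mult_right)
qed

lemma mord_diff_power: "mord d (a - a') \<Longrightarrow> mord d (a ^ k - a' ^ k)"
  for a :: "('a::comm_ring_1, 'n::finite) mfps"
  by (induction k) (auto intro: mord_diff_mult)

lemma mord_diff_prod:
  fixes f g :: "'b \<Rightarrow> ('a::comm_ring_1, 'n::finite) mfps"
  shows "(\<And>x. x \<in> A \<Longrightarrow> mord d (f x - g x)) \<Longrightarrow> mord d (prod f A - prod g A)"
  by (induction A rule: infinite_finite_induct) (auto intro: mord_diff_mult)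

lemma mord_msubst_diff:
  fixes F :: "('a::comm_ring_1, 'm::finite) mfps" and s s' :: "'m \<Rightarrow> ('a, 'n::finite) mfps"
  assumes s: "\<And>i. mcoeff0 (s i) = 0" "\<And>i. mcoeff0 (s' i) = 0" and d: "\<And>i. mord d (s i - s' i)"
  shows "mord d (msubst F s - msubst F s')"
proof -
  have "mord d (msubst_upto d F s - msubst_upto d F s')"
    unfolding msubst_upto_def sum_subtractf[symmetric] right_diff_distrib[symmetric]
    by (intro mord_sum mord_mult_left mord_diff_prod mord_diff_power d)
  moreover have "mord d (msubst F s - msubst_upto d F s)" "mord d (msubst F s' - msubst_upto d F s')"
    by (rule mord_mono[OF mord_msubst_upto]; simp add: s)+
  ultimately have "mord d ((msubst F s - msubst_upto d F s) + (msubst_upto d F s - msubst_upto d F s') - (msubst F s' - msubst_upto d F s'))"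
    by (intro mord_diff[OF mord_add])
  then show ?thesis by simp
qed

text \<open>Iterates for the equation \<xi> = L + \<rho>(\<xi>) with \<rho> of order at least 2.
  Inverse functions and square roots both take this form, and the iteration is explicit enough to be
  bounded in norm.\<close>

primrec inv_iter ::
    "('m::finite \<Rightarrow> ('a::comm_ring_1, 'm) mfps) \<Rightarrow> ('m \<Rightarrow> ('a, 'n::finite) mfps) \<Rightarrow> nat \<Rightarrow> 'm \<Rightarrow> ('a, 'n) mfps" where
  "inv_iter \<rho> L 0 = (\<lambda>_. 0)"
| "inv_iter \<rho> L (Suc k) = (\<lambda>i. L i + msubst (\<rho> i) (inv_iter \<rho> L k))"

definition inv_lim ::
    "('m::finite \<Rightarrow> ('a::comm_ring_1, 'm) mfps) \<Rightarrow> ('m \<Rightarrow> ('a, 'n::finite) mfps) \<Rightarrow> 'm \<Rightarrow> ('a, 'n) mfps" where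
  "inv_lim \<rho> L i = Abs_mfps (\<lambda>\<alpha>. mcoeff (inv_iter \<rho> L (Suc (mdeg \<alpha>)) i) \<alpha>)"

context
  fixes \<rho> :: "'m::finite \<Rightarrow> ('a::field_char_0, 'm) mfps" and L :: "'m \<Rightarrow> ('a, 'n::finite) mfps"
  assumes \<rho>: "\<And>i. mord 2 (\<rho> i)" and L: "\<And>i. mcoeff0 (L i) = 0"
begin

lemma mcoeff0_inv_iter: "mcoeff0 (inv_iter \<rho> L k i) = 0"
proof -
  have "mcoeff0 (\<rho> i) = 0" for i using \<rho>[of i] by (auto simp: numeral_2_eq_2 mord_Suc_iff)
  then show ?thesis by (cases k) (simp_all add: L)
qed

text \<open>The contraction estimate. Write \<rho> as a sum of \<open>mvar i * r i\<close> with
  \<open>r i\<close> of order 1: a difference in the first factor is multiplied by a series of order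
  1, and a difference inside \<open>r i\<close> is multiplied by \<open>s' i\<close>.\<close>

lemma mord_msubst_diff_Suc:
  assumes s: "\<And>i. mcoeff0 (s i) = 0" "\<And>i. mcoeff0 (s' i) = 0" and d: "\<And>i. mord d (s i - s' i)"
  shows "mord (Suc d) (msubst (\<rho> j) s - msubst (\<rho> j) (s' :: 'm \<Rightarrow> ('a, 'n) mfps))"
proof -
  obtain r where r: "\<rho> j = (\<Sum>i\<in>UNIV. mvar i * r i)" "\<And>i. mord 1 (r i)"
    using mord_decomp[of 1 "\<rho> j"] \<rho>[of j] by (metis Suc_1)
  have "msubst (\<rho> j) s - msubst (\<rho> j) s' =
      (\<Sum>i\<in>UNIV. (s i - s' i) * msubst (r i) s + s' i * (msubst (r i) s - msubst (r i) s'))"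
    unfolding r(1) by (simp add: msubst_sum msubst_mult[OF s(1)] msubst_mult[OF s(2)] msubst_mvar[of s, OF s(1)]
        msubst_mvar[of s', OF s(2)] sum_subtractf[symmetric] algebra_simps)
  moreover have "mord (d + 1) ((s i - s' i) * msubst (r i) s)" for i
    by (intro mord_mult d mord_msubst s r)
  moreover have "mord (1 + d) (s' i * (msubst (r i) s - msubst (r i) s'))" for i
    by (intro mord_mult mord_msubst_diff s d) (simp add: mord_1 s)
  ultimately show ?thesis by (auto intro!: mord_sum mord_add)
qed

lemma mord_inv_iter_step: "mord (Suc k) (inv_iter \<rho> L (Suc k) i - inv_iter \<rho> L k i)"
proof (induction k arbitrary: i)
  case 0
  then show ?case using mcoeff0_inv_iter[of "Suc 0" i] by (simp add: mord_1 del: inv_iter.simps(2))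
next
  case (Suc k)
  have "mord (Suc (Suc k)) (msubst (\<rho> i) (inv_iter \<rho> L (Suc k)) - msubst (\<rho> i) (inv_iter \<rho> L k))"
    by (rule mord_msubst_diff_Suc[OF mcoeff0_inv_iter mcoeff0_inv_iter Suc.IH])
  then show ?case by simp
qed

lemma mord_inv_iter_diff: "k \<le> l \<Longrightarrow> mord (Suc k) (inv_iter \<rho> L l i - inv_iter \<rho> L k i)"
proof (induction l rule: dec_induct)
  case (step l)
  have "mord (Suc k) (inv_iter \<rho> L (Suc l) i - inv_iter \<rho> L l i)"
    using step.hyps by (intro mord_mono[OF mord_inv_iter_step]) simp
  from mord_add[OF this step.IH] show ?case by (simp del: inv_iter.simps)
qed simp

lemma mcoeff_inv_lim: "mdeg \<alpha> \<le> k \<Longrightarrow> mcoeff (inv_lim \<rho> L i) \<alpha> = mcoeff (inv_iter \<rho> L k i) \<alpha>"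
proof -
  assume k: "mdeg \<alpha> \<le> k"
  have 1: "mcoeff (inv_iter \<rho> L k i) \<alpha> = mcoeff (inv_iter \<rho> L (mdeg \<alpha>) i) \<alpha>"
    using mord_inv_iter_diff[OF k, of i] by (simp add: mord_def)
  have 2: "mcoeff (inv_iter \<rho> L (Suc (mdeg \<alpha>)) i) \<alpha> = mcoeff (inv_iter \<rho> L (mdeg \<alpha>) i) \<alpha>"
    using mord_inv_iter_diff[of "mdeg \<alpha>" "Suc (mdeg \<alpha>)" i] by (simp add: mord_def del: inv_iter.simps)
  show ?thesis unfolding inv_lim_def mcoeff_Abs 1 2 ..
qed

lemma mord_inv_lim: "mord (Suc k) (inv_lim \<rho> L i - inv_iter \<rho> L k i)"
  using mcoeff_inv_lim[of _ k i] by (simp add: mord_def less_Suc_eq_le)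

lemma mcoeff0_inv_lim: "mcoeff0 (inv_lim \<rho> L i) = 0"
  using mcoeff_inv_lim[of "\<lambda>_. 0" 0 i] by simp

lemma inv_lim_eq: "inv_lim \<rho> L i = L i + msubst (\<rho> i) (inv_lim \<rho> L)"
proof -
  have "mord d (inv_lim \<rho> L i - (L i + msubst (\<rho> i) (inv_lim \<rho> L)))" for d
  proof -
    have "mord d (inv_lim \<rho> L i - inv_iter \<rho> L (Suc d) i)"
      by (rule mord_mono[OF mord_inv_lim]) simp
    moreover have "mord d (msubst (\<rho> i) (inv_lim \<rho> L) - msubst (\<rho> i) (inv_iter \<rho> L d))"
      by (rule mord_msubst_diff[OF mcoeff0_inv_lim mcoeff0_inv_iter mord_mono[OF mord_inv_lim]]) simp
    ultimately have "mord d ((inv_lim \<rho> L i - inv_iter \<rho> L (Suc d) i) - (msubst (\<rho> i) (inv_lim \<rho> L) - msubst (\<rho> i) (inv_iter \<rho> L d)))"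
      by (rule mord_diff)
    then show ?thesis by (simp add: algebra_simps)
  qed
  then show ?thesis using mord_all by fastforce
qed

end

text \<open>With \<open>B\<close> inverse to the linear part of \<open>s\<close>, the equation
  s(\<xi>) = u reads \<xi> = B u + \<rho>(\<xi>) for this \<rho>, in which the linear parts
  cancel.\<close>

definition inv_rest :: "('n::finite \<Rightarrow> ('a::field_char_0, 'n) mfps) \<Rightarrow> 'a ^ 'n ^ 'n \<Rightarrow> 'n \<Rightarrow> ('a, 'n) mfps" where
  "inv_rest s B i = mvar i - (\<Sum>j\<in>UNIV. mconst (B $ i $ j) * s j)"

definition mfps_inverse :: "('n::finite \<Rightarrow> ('a::field_char_0, 'n) mfps) \<Rightarrow> 'n \<Rightarrow> ('a, 'n) mfps" where
  "mfps_inverse s = (let B = matrix_inv (\<chi> i j. mcoeff0 (mderiv j (s i))) in inv_lim (inv_rest s B) (lin_form B))"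

lemma
  fixes s :: "'n::finite \<Rightarrow> ('a::field_char_0, 'n) mfps"
  assumes s: "\<And>i. mcoeff0 (s i) = 0" and inv: "invertible (\<chi> i j. mcoeff0 (mderiv j (s i)))"
  shows mcoeff0_mfps_inverse: "mcoeff0 (mfps_inverse s i) = 0"
    and msubst_mfps_inverse: "msubst (s i) (mfps_inverse s) = mvar i"
    and mord_inv_rest: "mord 2 (inv_rest s (matrix_inv (\<chi> i j. mcoeff0 (mderiv j (s i)))) i)"
proof -
  let ?J = "\<chi> i j. mcoeff0 (mderiv j (s i))"
  define B where "B = matrix_inv ?J"
  define \<rho> where "\<rho> = inv_rest s B"
  have BJ: "B ** ?J = mat 1" "?J ** B = mat 1" unfolding B_def using inv by (rule matrix_inv_right_field)+
  have BJ1: "(\<Sum>k\<in>UNIV. B $ i $ k * mcoeff0 (mderiv j (s k))) = (if i = j then 1 else 0)" for i j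
    using BJ(1) by (simp add: vec_eq_iff matrix_matrix_mult_def mat_def)
  have BJ2: "(\<Sum>k\<in>UNIV. ?J $ i $ k * B $ k $ j) = (if i = j then 1 else 0)" for i j
    using BJ(2) by (simp add: vec_eq_iff matrix_matrix_mult_def mat_def)
  have \<rho>: "mord 2 (\<rho> i)" for i
    by (simp add: numeral_2_eq_2 mord_Suc_iff \<rho>_def inv_rest_def s mderiv_diff mderiv_sum mderiv_mvar BJ1)
  then show "mord 2 (inv_rest s (matrix_inv ?J) i)" by (simp add: \<rho>_def B_def)
  define \<xi> where "\<xi> = mfps_inverse s"
  have \<xi>_eq: "\<xi> = inv_lim \<rho> (lin_form B)" by (simp add: \<xi>_def mfps_inverse_def Let_def \<rho>_def B_def)
  have \<xi>0: "mcoeff0 (\<xi> i) = 0" for i unfolding \<xi>_eq by (rule mcoeff0_inv_lim[OF \<rho>]) simp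
  then show "mcoeff0 (mfps_inverse s i) = 0" by (simp add: \<xi>_def)
  have "\<xi> k = lin_form B k + msubst (\<rho> k) \<xi>" for k
    unfolding \<xi>_eq by (rule inv_lim_eq[OF \<rho>]) simp
  moreover have "msubst (\<rho> k) \<xi> = \<xi> k - (\<Sum>j\<in>UNIV. mconst (B $ k $ j) * msubst (s j) \<xi>)" for k
    by (simp add: \<rho>_def inv_rest_def msubst_diff msubst_sum msubst_mult[OF \<xi>0] msubst_mvar[of \<xi>, OF \<xi>0])
  ultimately have e: "(\<Sum>j\<in>UNIV. mconst (B $ k $ j) * msubst (s j) \<xi>) = (\<Sum>j\<in>UNIV. mconst (B $ k $ j) * mvar j)" for k
    by (simp add: lin_form_def)
  have f: "(\<Sum>k\<in>UNIV. mconst (?J $ i $ k) * (\<Sum>j\<in>UNIV. mconst (B $ k $ j) * f j)) = f i" for f :: "'n \<Rightarrow> ('a, 'n) mfps"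
  proof -
    have "(\<Sum>k\<in>UNIV. mconst (?J $ i $ k) * (\<Sum>j\<in>UNIV. mconst (B $ k $ j) * f j)) =
       (\<Sum>j\<in>UNIV. mconst (\<Sum>k\<in>UNIV. ?J $ i $ k * B $ k $ j) * f j)"
      unfolding sum_distrib_left mconst_sum sum_distrib_right mconst_mult mult.assoc by (rule sum.swap)
    also have "\<dots> = f i" unfolding BJ2 if_distrib[of mconst] mconst_0 mconst_1 by simp
    finally show ?thesis .
  qed
  have "msubst (s i) \<xi> = (\<Sum>k\<in>UNIV. mconst (?J $ i $ k) * (\<Sum>j\<in>UNIV. mconst (B $ k $ j) * msubst (s j) \<xi>))"
    by (rule f[symmetric])
  also have "\<dots> = mvar i"
    unfolding e by (rule f)
  finally show "msubst (s i) (mfps_inverse s) = mvar i"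
    unfolding \<xi>_def .
qed

text \<open>For a root 1 + x of \<open>W\<close> the equation becomes x = (W - 1)/2 - x^2/2, a fixed
  point equation with quadratic right-hand side.\<close>

definition mfps_sqrt :: "('a::field_char_0, 'n::finite) mfps \<Rightarrow> ('a, 'n) mfps" where
  "mfps_sqrt W = 1 + inv_lim (\<lambda>_ :: unit. mconst (- 1 / 2) * (mvar () * mvar ())) (\<lambda>_. mconst (1 / 2) * (W - 1)) ()"

lemma mfps_sqrt:
  assumes W: "mcoeff0 W = 1"
  shows "mfps_sqrt W ^ 2 = (W :: ('a::field_char_0, 'n::finite) mfps)"
proof -
  let ?\<rho> = "\<lambda>_ :: unit. mconst (- 1 / 2) * (mvar () * mvar ()) :: ('a, unit) mfps"
  let ?L = "\<lambda>_ :: unit. mconst (1 / 2) * (W - 1)"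
  have \<rho>: "mord 2 (?\<rho> i)" for i
  proof -
    have "mord 2 (mvar () * mvar () :: ('a, unit) mfps)"
      using mord_mult[OF mord_mvar mord_mvar, of "()" "()"] by (simp add: numeral_2_eq_2)
    then show ?thesis by (rule mord_mult_left)
  qed
  have L: "mcoeff0 (?L i) = 0" for i by (simp add: W)
  define x where "x = inv_lim ?\<rho> ?L"
  have x0: "mcoeff0 (x i) = 0" for i unfolding x_def by (rule mcoeff0_inv_lim[OF \<rho> L])
  have "x () = ?L () + msubst (?\<rho> ()) x"
    unfolding x_def by (rule inv_lim_eq[OF \<rho> L])
  moreover have "msubst (?\<rho> ()) x = - (mconst (1 / 2) * (x () * x ()))"
    by (simp add: mconst_uminus msubst_uminus msubst_mult[OF x0] msubst_mvar[of x, OF x0])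
  ultimately have "x () = mconst (1 / 2) * (W - 1) - mconst (1 / 2) * (x () * x ())"
    by (simp only: diff_conv_add_uminus)
  from arg_cong[OF this, of "(*) (mconst 2)"]
  have "mconst 2 * x () = mconst (2 * (1 / 2)) * (W - 1) - mconst (2 * (1 / 2)) * (x () * x ())"
    unfolding mconst_mult by (simp only: mult.assoc right_diff_distrib)
  then have "2 * x () = W - 1 - x () * x ()" by (simp add: mconst_numeral)
  moreover have "mfps_sqrt W = 1 + x ()" by (simp add: mfps_sqrt_def x_def)
  moreover have "(1 + x ()) ^ 2 = 1 + 2 * x () + x () * x ()"
    by (simp add: power2_eq_square algebra_simps)
  ultimately show ?thesis by simp
qed

section \<open>Division by the equation of a graph\<close>

definition mshift :: "'m \<Rightarrow> ('a, 'm) mfps \<Rightarrow> ('a, 'm) mfps" where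
  "mshift l W = Abs_mfps (\<lambda>\<alpha>. mcoeff W (\<alpha>(l := Suc (\<alpha> l))))"

text \<open>The difference \<open>W - mvar l * mshift l W\<close> consists of the monomials of
  \<open>W\<close> without \<open>l\<close>, so it coincides with its restriction to the hyperplane
  on which the \<open>l\<close>-th coordinate is 0.\<close>

lemma mvar_mult_mshift:
  fixes W :: "('a::field_char_0, 'm::finite) mfps"
  assumes W: "msubst W (\<lambda>a. if a = l then 0 else mvar a) = 0"
  shows "W = mvar l * mshift l W"
proof -
  let ?e = "\<lambda>a. if a = l then 0 else mvar a :: ('a, 'm) mfps"
  define W0 where "W0 = W - mvar l * mshift l W"
  have e0: "mcoeff0 (?e a) = 0" for a by simp
  have "mderiv l W0 = 0"
  proof (rule mfps_eqI)
    fix \<alpha> :: "'m \<Rightarrow> nat"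
    have "mcoeff W0 (\<alpha>(l := Suc (\<alpha> l))) = 0"
      by (simp add: W0_def mcoeff_mvar_mult mshift_def)
    then show "mcoeff (mderiv l W0) \<alpha> = mcoeff 0 \<alpha>" by (simp add: mcoeff_mderiv del: of_nat_Suc)
  qed
  moreover have "mord d (msubst Y ?e - Y)" if "mderiv l Y = 0" for d Y
    using that
  proof (induction d arbitrary: Y)
    case (Suc d)
    have "mderiv j (msubst Y ?e - Y) = msubst (mderiv j Y) ?e - mderiv j Y" for j
    proof -
      have "(\<Sum>i\<in>UNIV. msubst (mderiv i Y) ?e * mderiv j (?e i)) =
          (\<Sum>i\<in>UNIV. msubst (mderiv i Y) ?e * (if j = i then 1 else 0))"
        by (rule sum.cong) (auto simp: mderiv_mvar Suc.prems)
      then show ?thesis by (simp add: mderiv_diff mderiv_msubst[OF e0])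
    qed
    moreover have "mderiv l (mderiv j Y) = 0" for j
      using Suc.prems by (simp add: mderiv_commute[of l j])
    ultimately show ?case using Suc.IH by (auto simp: mord_Suc_iff)
  qed simp
  ultimately have "msubst W0 ?e - W0 = 0" by (intro mord_all) blast
  moreover have "msubst W0 ?e = 0"
    by (simp add: W0_def msubst_diff msubst_mult[OF e0] msubst_mvar[of ?e, OF e0] W)
  ultimately have "W0 = 0" by simp
  then show ?thesis by (simp add: W0_def)
qed

definition mdivide :: "'m \<Rightarrow> ('a::field_char_0, 'm::finite) mfps \<Rightarrow> ('a, 'm) mfps \<Rightarrow> ('a, 'm) mfps" where
  "mdivide l z W = msubst (mshift l (msubst W (\<lambda>a. if a = l then mvar l + z else mvar a)))
     (\<lambda>a. if a = l then mvar l - z else mvar a)"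

text \<open>The shear \<open>x\<^sub>l \<mapsto> x\<^sub>l + z\<close> reduces division by \<open>x\<^sub>l - z\<close> to division by \<open>x\<^sub>l\<close>.\<close>

lemma mult_mdivide:
  fixes W :: "('a::field_char_0, 'm::finite) mfps"
  assumes z0: "mcoeff0 z = 0"
    and z: "\<And>x. mcoeff0 x = 0 \<Longrightarrow> msubst z (\<lambda>a. if a = l then x else mvar a) = z"
    and W: "msubst W (\<lambda>a. if a = l then z else mvar a) = 0"
  shows "W = (mvar l - z) * mdivide l z W"
proof -
  let ?e = "\<lambda>x a. if a = l then x else mvar a :: ('a, 'm) mfps"
  have e0: "mcoeff0 x = 0 \<Longrightarrow> mcoeff0 (?e x a) = 0" for x a by simp
  have comp: "msubst (msubst Y (?e x)) (?e x') = msubst Y (?e (msubst x (?e x')))"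
    if x: "mcoeff0 x = 0" "mcoeff0 x' = 0" for x x' Y
  proof -
    have "(\<lambda>i. msubst (?e x i) (?e x')) = ?e (msubst x (?e x'))"
    proof
      fix i show "msubst (?e x i) (?e x') = ?e (msubst x (?e x')) i"
        using msubst_mvar[of "?e x'" i, OF e0[OF x(2)]] by simp
    qed
    then show ?thesis by (subst msubst_assoc[OF e0[OF x(1)] e0[OF x(2)]]) simp
  qed
  have m0: "mcoeff0 (mvar l + z) = 0" "mcoeff0 (mvar l - z) = 0" by (simp_all add: z0)
  define W1 where "W1 = msubst W (?e (mvar l + z))"
  have mv: "mcoeff0 x = 0 \<Longrightarrow> msubst (mvar l) (?e x) = x" for x
    using msubst_mvar[of "?e x" l, OF e0] by simp
  have "msubst W1 (?e 0) = msubst W (?e z)"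
  proof -
    have "msubst (mvar l + z) (?e 0) = z" by (simp add: msubst_add mv z)
    moreover have "msubst W1 (?e 0) = msubst W (?e (msubst (mvar l + z) (?e 0)))"
      unfolding W1_def by (rule comp[OF m0(1)]) simp
    ultimately show ?thesis by (simp only:)
  qed
  then have "W1 = mvar l * mshift l W1"
    by (intro mvar_mult_mshift) (simp add: W)
  then have "msubst W1 (?e (mvar l - z)) = msubst (mvar l * mshift l W1) (?e (mvar l - z))" by simp
  also have "\<dots> = (mvar l - z) * mdivide l z W"
    by (simp add: msubst_mult[OF e0[OF m0(2)]] mv[OF m0(2)] mdivide_def W1_def)
  also have "msubst W1 (?e (mvar l - z)) = W"
  proof -
    have "msubst (mvar l + z) (?e (mvar l - z)) = mvar l"
      by (simp add: msubst_add mv[OF m0(2)] z[OF m0(2)])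
    moreover have "?e (mvar l) = mvar" by auto
    ultimately show ?thesis unfolding W1_def comp[OF m0] by (simp only: msubst_ident)
  qed
  finally show ?thesis .
qed

section \<open>Existence of the transformed germ\<close>

text \<open>The derivative of the old equation along column \<open>Last\<close> of \<open>N\<close>,
  the preimage of the new direction x_(n+1). It refers to \<open>F\<close> and \<open>N\<close>
  alone, so transversality of the transformed cone to that direction can be expressed before the
  image germ exists.\<close>

definition cotheta :: "'a::comm_ring_1 ^ 'n hindex ^ 'n hindex \<Rightarrow> 'a ^ 'n \<Rightarrow> ('a, 'n::finite) mfps \<Rightarrow> ('a, 'n) mfps" where
  "cotheta N t F = mconst (N $ Last $ Last) - mconst (N $ Zeroth $ Last) * F
     - (\<Sum>j\<in>UNIV. mderiv j F * (mconst (N $ Mid j $ Last) - mconst (N $ Zeroth $ Last) * cone_param t F (Mid j)))"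

definition image_arg :: "'a::field ^ 'n hindex ^ 'n hindex \<Rightarrow> 'a ^ 'n \<Rightarrow> ('a, 'n::finite) mfps \<Rightarrow> 'n \<Rightarrow> ('a, 'n) mfps" where
  "image_arg M p F = dehom_arg (M *v cone_point p (mcoeff0 F)) (cone_image M p F)"

definition image_inverse :: "'a::field_char_0 ^ 'n hindex ^ 'n hindex \<Rightarrow> 'a ^ 'n \<Rightarrow> ('a, 'n::finite) mfps \<Rightarrow> 'n \<Rightarrow> ('a, 'n) mfps" where
  "image_inverse M p F = mfps_inverse (image_arg M p F)"

definition image_F :: "'a::field_char_0 ^ 'n hindex ^ 'n hindex \<Rightarrow> 'a ^ 'n \<Rightarrow> ('a, 'n::finite) mfps \<Rightarrow> ('a, 'n) mfps" where
  "image_F M p F = msubst (cone_image M p F Last * minv (cone_image M p F Zeroth)) (image_inverse M p F)"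

text \<open>\<open>R\<close> is a root of a constant times a power of the zeroth coordinate of the
  image; it is supplied from outside because its existence depends on the constant. The two inverses
  undo the unit between the equations, whose value on the cone is that coordinate times
  \<open>cotheta\<close>.\<close>

definition image_G :: "'a::field_char_0 ^ 'n hindex ^ 'n hindex \<Rightarrow> 'a ^ 'n \<Rightarrow> ('a, 'n::finite) mfps \<Rightarrow> ('a, 'n) mfps \<Rightarrow>
    ('a, 'n) mfps \<Rightarrow> ('a, 'n) mfps" where
  "image_G M p F R G = msubst (minv (cone_image M p F Zeroth) * minv (cotheta (matrix_inv M) p F) * R * G) (image_inverse M p F)"

text \<open>The first derivatives of \<open>F\<close> cancel; the vanishing of
  \<open>cotheta\<close> thereby becomes a statement about the kernel of the Hessian.\<close>

lemma mderiv_cotheta: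
  "mderiv b (cotheta N t F) =
    - (\<Sum>j\<in>UNIV. mderiv b (mderiv j F) * (mconst (N $ Mid j $ Last) - mconst (N $ Zeroth $ Last) * cone_param t F (Mid j)))"
proof -
  have "mderiv b (mconst (N $ Mid j $ Last) - mconst (N $ Zeroth $ Last) * cone_param t F (Mid j)) =
      - mconst (N $ Zeroth $ Last) * (if b = j then 1 else 0)" for j
    by (simp add: mderiv_diff mderiv_add mderiv_mvar)
  then have "mderiv b (cotheta N t F) = - (mconst (N $ Zeroth $ Last) * mderiv b F)
     - (\<Sum>j\<in>UNIV. mderiv b (mderiv j F) * (mconst (N $ Mid j $ Last) - mconst (N $ Zeroth $ Last) * cone_param t F (Mid j)))
     + (\<Sum>j\<in>UNIV. mconst (N $ Zeroth $ Last) * mderiv j F * (if b = j then 1 else 0))"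
    by (simp only: cotheta_def mderiv_diff mderiv_sum mderiv_mult mderiv_mconst sum.distrib)
       (simp add: sum_negf mult_ac)
  then show ?thesis by simp
qed

lemma mcoeff0_cotheta:
  "mcoeff0 (cotheta N t F) = N $ Last $ Last - N $ Zeroth $ Last * mcoeff0 F
     - (\<Sum>j\<in>UNIV. mcoeff0 (mderiv j F) * (N $ Mid j $ Last - N $ Zeroth $ Last * t $ j))"
  by (simp add: cotheta_def)

text \<open>The projection along x_(n+1) onto the cone, written as an increment from
  \<open>Q\<close>. The series killed by this substitution are the multiples of the equation of the
  cone.\<close>

definition cone_section :: "'a::field ^ 'n hindex \<Rightarrow> ('a, 'n::finite) mfps \<Rightarrow> 'n hindex \<Rightarrow> ('a, 'n hindex) mfps" where
  "cone_section Q F a = (if a = Last then hcoord Q Zeroth * formal_dehom Q F - mconst (Q $ Last) else mvar a)"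

context
  fixes Q :: "'k::field_char_0 ^ 'n::finite hindex" and F :: "('k, 'n) mfps"
  assumes Q0: "Q $ Zeroth \<noteq> 0" and F0: "mcoeff0 F = Q $ Last / Q $ Zeroth"
begin

lemma mcoeff0_cone_section: "mcoeff0 (cone_section Q F a) = 0"
  using Q0 F0 by (simp add: cone_section_def formal_dehom_eq)

lemma hcoord_Zeroth_mult_minv: "hcoord Q Zeroth * minv (hcoord Q Zeroth) = 1"
  by (rule mult_minv) (simp add: Q0)

lemma msubst_cone_section: "msubst (formal_cone Q F) (cone_section Q F) = 0"
proof -
  define tX where "tX a = (if a = Last then hcoord Q Zeroth * formal_dehom Q F else hcoord Q a)" for a
  have tX0: "mcoeff0 (tX a) = Q $ a" for a
    using Q0 by (auto simp: tX_def formal_dehom_eq F0)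
  have e_eq: "cone_section Q F = (\<lambda>a. tX a - mconst (Q $ a))"
    by (rule ext) (auto simp: cone_section_def tX_def hcoord_def)
  have "dehom_arg Q tX = dehom_arg Q (hcoord Q)"
    by (rule ext) (simp add: dehom_arg_def tX_def)
  then show ?thesis
    unfolding e_eq msubst_formal_cone[OF Q0 tX0] using hcoord_Zeroth_mult_minv by (simp add: tX_def formal_dehom_eq mult_ac)
qed

text \<open>x_0 times the equation is \<open>mvar Last - z\<close>, where z does not involve
  x_(n+1); division by such a difference is \<open>mult_mdivide\<close>.\<close>

lemma cone_divide:
  assumes W: "msubst W (cone_section Q F) = 0"
  shows "W = hcoord Q Zeroth * mdivide Last (hcoord Q Zeroth * formal_dehom Q F - mconst (Q $ Last)) W * formal_cone Q F"
proof -
  let ?X = "hcoord Q"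
  define z where "z = ?X Zeroth * formal_dehom Q F - mconst (Q $ Last)"
  have z0: "mcoeff0 z = 0" using mcoeff0_cone_section[of Last] by (simp add: cone_section_def z_def)
  have z_indep: "msubst z (\<lambda>a. if a = Last then x else mvar a) = z" if x0: "mcoeff0 x = 0" for x
  proof -
    define tx where "tx a = (if a = Last then x + mconst (Q $ Last) else ?X a)" for a
    have tx0: "mcoeff0 (tx a) = Q $ a" for a by (simp add: tx_def x0)
    have eq: "(\<lambda>a. if a = Last then x else mvar a) = (\<lambda>a. tx a - mconst (Q $ a))"
      by (rule ext) (auto simp: tx_def hcoord_def)
    have r0: "mcoeff0 (tx a - mconst (Q $ a)) = 0" for a by (simp add: tx0)
    have "dehom_arg Q tx = dehom_arg Q ?X" by (rule ext) (simp add: dehom_arg_def tx_def)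
    moreover have "msubst (?X Zeroth) (\<lambda>a. tx a - mconst (Q $ a)) = ?X Zeroth"
      unfolding msubst_hcoord[OF tx0] by (simp add: tx_def)
    ultimately show ?thesis
      unfolding eq z_def msubst_diff msubst_mult[OF r0] msubst_formal_dehom[OF Q0 tx0] by (simp add: formal_dehom_eq)
  qed
  have "W = (mvar Last - z) * mdivide Last z W"
    using z0 z_indep W[unfolded cone_section_def[abs_def], folded z_def] by (rule mult_mdivide)
  moreover have "mvar Last - z = ?X Zeroth * formal_cone Q F"
  proof -
    have "?X Zeroth * formal_cone Q F = (?X Zeroth * minv (?X Zeroth)) * ?X Last - ?X Zeroth * formal_dehom Q F"
      by (simp add: formal_cone_def right_diff_distrib mult_ac)
    then show ?thesis unfolding hcoord_Zeroth_mult_minv by (simp add: z_def hcoord_def)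
  qed
  ultimately have "W = ?X Zeroth * formal_cone Q F * mdivide Last z W" by simp
  then show ?thesis by (simp only: z_def mult_ac)
qed

end

context
  fixes M :: "'k::field_char_0 ^ 'n::finite hindex ^ 'n hindex" and p :: "'k ^ 'n" and F :: "('k, 'n) mfps"
  assumes M: "invertible M"
    and lam0: "mcoeff0 (cone_image M p F Zeroth) \<noteq> 0"
    and cot0: "mcoeff0 (cotheta (matrix_inv M) p F) \<noteq> 0"
begin

lemma N_sum: "(\<Sum>b\<in>UNIV. matrix_inv M $ a $ b * (\<Sum>d\<in>UNIV. M $ b $ d * f d)) = f a"
proof -
  have "matrix_inv M *v (M *v (\<chi> d. f d)) = (\<chi> d. f d)"
    by (simp add: matrix_vector_mul_assoc matrix_inv_right_field[OF M])
  from arg_cong[OF this, of "\<lambda>v. v $ a"] show ?thesis by (simp add: matrix_vector_mult_def)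
qed

lemma mcoeff0_image_arg: "mcoeff0 (image_arg M p F i) = 0"
  unfolding image_arg_def by (rule mcoeff0_dehom_arg) (use lam0 in \<open>simp_all add: mcoeff0_cone_image\<close>)

text \<open>A kernel vector \<open>w\<close> of the Jacobian gives a tangent vector of the cone mapped by \<open>M\<close> to the direction \<open>x\<^sub>n\<^sub>+\<^sub>1\<close>.\<close>

lemma invertible_image_arg: "invertible (\<chi> i j. mcoeff0 (mderiv j (image_arg M p F i)))"
proof -
  let ?y = "cone_image M p F" and ?N = "matrix_inv M"
  define l where "l = mcoeff0 (?y Zeroth)"
  have l: "l \<noteq> 0" using lam0 by (simp add: l_def)
  define J where "J i j = mcoeff0 (mderiv j (image_arg M p F i))" for i j
  have J: "mcoeff0 (mderiv j (?y (Mid i))) = mcoeff0 (mderiv j (?y Zeroth)) * (mcoeff0 (?y (Mid i)) / l) + l * J i j" for i j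
    using l unfolding J_def image_arg_def dehom_arg_def
    by (simp add: mderiv_diff mderiv_mult mderiv_minv[OF lam0] l_def[symmetric] field_simps lam0)
  have "w = 0" if w: "(\<chi> i j. J i j) *v w = 0" for w
  proof -
    have Jw: "(\<Sum>j\<in>UNIV. J i j * w $ j) = 0" for i
      using arg_cong[OF w, of "\<lambda>v. v $ i"] by (simp add: matrix_vector_mult_def)
    \<comment> \<open>With this multiple of the point itself subtracted, the vector \<open>v\<close>
      below is mapped by \<open>M\<close> to a vector whose component \<open>Zeroth\<close> is
      0.\<close>
    define \<beta> where "\<beta> = (\<Sum>j\<in>UNIV. mcoeff0 (mderiv j (?y Zeroth)) * w $ j) / l"
    define D where "D a = (\<Sum>j\<in>UNIV. w $ j * mcoeff0 (mderiv j (cone_param p F a)))" for a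
    define v where "v a = D a - \<beta> * mcoeff0 (cone_param p F a)" for a
    have Mv: "(\<Sum>d\<in>UNIV. M $ b $ d * v d) = (\<Sum>j\<in>UNIV. w $ j * mcoeff0 (mderiv j (?y b))) - \<beta> * mcoeff0 (?y b)" for b
    proof -
      have "(\<Sum>d\<in>UNIV. M $ b $ d * D d) = (\<Sum>j\<in>UNIV. w $ j * mcoeff0 (mderiv j (?y b)))"
        unfolding D_def cone_image_def sum_distrib_left mderiv_sum mcoeff_sum mderiv_mconst_mult mcoeff_mconst_mult
        by (subst sum.swap) (simp add: mult_ac)
      then show ?thesis
        by (simp add: v_def right_diff_distrib sum_subtractf cone_image_def sum_distrib_left mult_ac)
    qed
    have Mv0: "(\<Sum>d\<in>UNIV. M $ Zeroth $ d * v d) = 0"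
      unfolding Mv using l by (simp add: \<beta>_def l_def[symmetric] mult.commute)
    have Mvi: "(\<Sum>d\<in>UNIV. M $ Mid i $ d * v d) = 0" for i
    proof -
      have "(\<Sum>j\<in>UNIV. w $ j * mcoeff0 (mderiv j (?y (Mid i)))) =
         (\<Sum>j\<in>UNIV. mcoeff0 (mderiv j (?y Zeroth)) * w $ j) * (mcoeff0 (?y (Mid i)) / l) + l * (\<Sum>j\<in>UNIV. J i j * w $ j)"
        unfolding J by (simp add: algebra_simps sum.distrib sum_distrib_left)
      also have "\<dots> = \<beta> * mcoeff0 (?y (Mid i))" unfolding Jw \<beta>_def by simp
      finally show ?thesis unfolding Mv by simp
    qed
    define a where "a = (\<Sum>d\<in>UNIV. M $ Last $ d * v d)"
    have v: "v b = ?N $ b $ Last * a" for b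
    proof -
      have "v b = (\<Sum>b'\<in>UNIV. ?N $ b $ b' * (\<Sum>d\<in>UNIV. M $ b' $ d * v d))" by (rule N_sum[symmetric])
      also have "\<dots> = ?N $ b $ Last * a"
        unfolding sum_hindex[of "\<lambda>b'. ?N $ b $ b' * (\<Sum>d\<in>UNIV. M $ b' $ d * v d)"] Mv0 Mvi a_def[symmetric] by simp
      finally show ?thesis .
    qed
    have D: "D Zeroth = 0" "D (Mid i) = w $ i" "D Last = (\<Sum>j\<in>UNIV. w $ j * mcoeff0 (mderiv j F))" for i
      by (simp_all add: D_def mderiv_add mderiv_mvar if_distrib[of mcoeff0] mcoeff_one if_distrib[of "\<lambda>x. mcoeff x _"] cong: if_cong)
    \<comment> \<open>\<open>v\<close> is tangent to the cone of \<open>F\<close>, so the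
      differential of the equation annihilates it; on column \<open>Last\<close> of the inverse
      matrix this differential is \<open>cotheta\<close>.\<close>
    have "a * mcoeff0 (cotheta ?N p F) = v Last - v Zeroth * mcoeff0 F
       - (\<Sum>j\<in>UNIV. mcoeff0 (mderiv j F) * (v (Mid j) - v Zeroth * p $ j))"
      unfolding mcoeff0_cotheta v by (simp add: algebra_simps sum_distrib_left)
    also have "\<dots> = 0"
      by (simp add: v_def D algebra_simps sum.distrib sum_distrib_left sum_subtractf)
    finally have "a = 0" using cot0 by simp
    then have v0: "v b = 0" for b by (simp add: v)
    from v0[of Zeroth] have "\<beta> = 0" by (simp add: v_def D)
    then have "w $ i = 0" for i using v0[of "Mid i"] by (simp add: v_def D)
    then show ?thesis by (simp add: vec_eq_iff)
  qed
  then have "\<exists>B. B ** (\<chi> i j. J i j) = mat 1" using matrix_left_invertible_ker by blast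
  then show ?thesis unfolding J_def invertible_left_inverse .
qed

lemma mcoeff0_image_inverse: "mcoeff0 (image_inverse M p F i) = 0"
  and msubst_image_inverse: "msubst (image_arg M p F i) (image_inverse M p F) = mvar i"
  unfolding image_inverse_def
  using mcoeff0_mfps_inverse[of "image_arg M p F"] msubst_mfps_inverse[of "image_arg M p F"]
    mcoeff0_image_arg invertible_image_arg by blast+

text \<open>Everything is tested on the section of the new cone, because vanishing there means
  divisibility by the new equation. \<open>image_F\<close> is made so that the old equation vanishes
  on the section, which yields the unit. The value of the unit on the section dictates
  \<open>image_G\<close>, and divisibility of the difference of the amplitudes yields
  \<open>V\<close>.\<close>

lemma formal_transform_exists:
  assumes R: "R ^ wt_den TYPE('n) = mconst c * cone_image M p F Zeroth ^ half_weight TYPE('n)"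
  shows "formal_transform M c (p, F, G)
     (affine_part (M *v cone_point p (mcoeff0 F)), image_F M p F, image_G M p F R G)" (is ?T)
    and "formal_linear (matrix_inv M) (formal_cone (cone_point p (mcoeff0 F)) F) =
       (hcoord (M *v cone_point p (mcoeff0 F)) Zeroth *
        mdivide Last (hcoord (M *v cone_point p (mcoeff0 F)) Zeroth * formal_dehom (M *v cone_point p (mcoeff0 F)) (image_F M p F)
            - mconst ((M *v cone_point p (mcoeff0 F)) $ Last))
          (formal_linear (matrix_inv M) (formal_cone (cone_point p (mcoeff0 F)) F))) *
       formal_cone (M *v cone_point p (mcoeff0 F)) (image_F M p F)" (is ?U)
proof -
  let ?e = "wt_den TYPE('n)" and ?h = "half_weight TYPE('n)"
  define Q where "Q = cone_point p (mcoeff0 F)"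
  define Q' where "Q' = M *v Q"
  define N where "N = matrix_inv M"
  define y where "y = cone_image M p F"
  define \<xi> where "\<xi> = image_inverse M p F"
  define F' where "F' = image_F M p F"
  define G' where "G' = image_G M p F R G"
  define th where "th = cotheta N p F"
  have th0: "mcoeff0 th \<noteq> 0" using cot0 by (simp add: th_def N_def)
  have y0: "mcoeff0 (y a) = Q' $ a" for a by (simp add: y_def mcoeff0_cone_image Q'_def Q_def)
  have Q'0: "Q' $ Zeroth \<noteq> 0" using lam0 by (simp add: y0[symmetric] y_def)
  have ly0: "mcoeff0 (y Zeroth) \<noteq> 0" by (simp add: y0 Q'0)
  have Q0: "Q $ Zeroth \<noteq> 0" by (simp add: Q_def)
  have \<xi>0: "mcoeff0 (\<xi> i) = 0" for i unfolding \<xi>_def by (rule mcoeff0_image_inverse)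
  have \<xi>: "msubst (y (Mid i) * minv (y Zeroth) - mconst (affine_part Q' $ i)) \<xi> = mvar i" for i
    using msubst_image_inverse[of i] by (simp add: image_arg_def dehom_arg_def \<xi>_def y_def Q'_def Q_def)
  define X where "X = hcoord Q'"
  define A where "A = dehom_arg Q' X"
  have X0: "mcoeff0 (X a) = Q' $ a" for a by (simp add: X_def)
  have xu: "mcoeff0 (X Zeroth) \<noteq> 0" by (simp add: X0 Q'0)
  have A0: "mcoeff0 (A i) = 0" for i unfolding A_def by (rule mcoeff0_dehom_arg[OF Q'0 X0])
  have dehom: "formal_dehom Q' W = msubst W A" for W by (simp add: formal_dehom_eq A_def X_def)
  define \<omega> where "\<omega> i = msubst (\<xi> i) A" for i
  have \<omega>0: "mcoeff0 (\<omega> i) = 0" for i by (simp add: \<omega>_def \<xi>0)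
  have sub: "msubst (msubst W \<xi>) A = msubst W \<omega>" for W
    unfolding \<omega>_def[abs_def] by (rule msubst_assoc[OF \<xi>0 A0])
  define z where "z = X Zeroth * formal_dehom Q' F' - mconst (Q' $ Last)"
  define e where "e a = (if a = Last then z else mvar a)" for a
  define tX where "tX a = (if a = Last then X Zeroth * formal_dehom Q' F' else X a)" for a
  have F'0: "mcoeff0 F' = Q' $ Last / Q' $ Zeroth"
    using ly0 by (simp add: F'_def image_F_def y_def[symmetric] y0 divide_inverse)
  have tX0: "mcoeff0 (tX a) = Q' $ a" for a
    using Q'0 by (auto simp: tX_def X0 dehom F'0)
  have e_eq: "e = (\<lambda>a. tX a - mconst (Q' $ a))"
    by (rule ext) (auto simp: e_def tX_def z_def X_def hcoord_def)
  have e0: "mcoeff0 (e a) = 0" for a by (simp add: e_eq tX0)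
  define lam where "lam = msubst (y Zeroth) \<omega>"
  have lam_nz: "mcoeff0 lam \<noteq> 0" by (simp add: lam_def y0 Q'0)
  have mlam: "msubst (minv (y Zeroth)) \<omega> = minv lam"
    unfolding lam_def by (rule msubst_minv[OF \<omega>0 ly0])
  have ll: "lam * minv lam = 1" by (rule mult_minv[OF lam_nz])
  have xx: "X Zeroth * minv (X Zeroth) = 1" by (rule mult_minv[OF xu])
  \<comment> \<open>On the section x_0 is a free coordinate, whereas the parametrised point with the
    same affine part has x_0 = \<open>lam\<close>; \<kappa> is the ratio.\<close>
  define \<kappa> where "\<kappa> = X Zeroth * minv lam"
  have \<kappa>0: "mcoeff0 \<kappa> \<noteq> 0" using Q'0 lam_nz by (simp add: \<kappa>_def X0)
  have kk: "\<kappa> * minv \<kappa> = 1" by (rule mult_minv[OF \<kappa>0])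
  have \<kappa>lam: "\<kappa> * lam = X Zeroth" using ll by (simp add: \<kappa>_def mult_ac)
  have tX_eq: "tX a = \<kappa> * msubst (y a) \<omega>" for a
  proof (cases a)
    case Zeroth
    then show ?thesis by (simp add: tX_def lam_def[symmetric] \<kappa>lam)
  next
    case (Mid i)
    have "msubst (y (Mid i)) \<omega> * minv lam - mconst (affine_part Q' $ i) = A i"
      using arg_cong[OF \<xi>[of i], of "\<lambda>W. msubst W A"] unfolding sub
      by (simp add: msubst_diff msubst_mult[OF \<omega>0] mlam msubst_mvar[of A, OF A0])
    then have "msubst (y (Mid i)) \<omega> * minv lam = X (Mid i) * minv (X Zeroth)"
      by (simp add: A_def dehom_arg_def)
    then have "X Zeroth * (msubst (y (Mid i)) \<omega> * minv lam) = X (Mid i) * (X Zeroth * minv (X Zeroth))"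
      by (simp add: mult_ac)
    then show ?thesis using Mid xx by (simp add: tX_def \<kappa>_def mult_ac)
  next
    case Last
    have "formal_dehom Q' F' = msubst (y Last) \<omega> * minv lam"
      unfolding dehom F'_def image_F_def \<xi>_def[symmetric] y_def[symmetric] sub by (simp add: msubst_mult[OF \<omega>0] mlam)
    then show ?thesis using Last by (simp add: tX_def \<kappa>_def mult_ac)
  qed
  define x where "x a = msubst (cone_param p F a) \<omega>" for a
  define Y where "Y a = \<kappa> * x a" for a
  have Ne: "(\<Sum>b\<in>UNIV. mconst (N $ a $ b) * e b) = Y a - mconst (Q $ a)" for a
  proof -
    have "(\<Sum>b\<in>UNIV. mconst (N $ a $ b) * y b) = cone_param p F a"
      unfolding y_def sum_cone_image N_def matrix_inv_right_field(2)[OF M] cone_image_mat_1 ..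
    then have "(\<Sum>b\<in>UNIV. mconst (N $ a $ b) * msubst (y b) \<omega>) = x a"
      unfolding x_def by (simp add: msubst_sum[symmetric] msubst_mult[OF \<omega>0, of "mconst _", simplified, symmetric])
    moreover have "(\<Sum>b\<in>UNIV. N $ a $ b * Q' $ b) = Q $ a"
      using N_sum[of a "\<lambda>d. Q $ d"] by (simp add: N_def Q'_def matrix_vector_mult_def)
    then have "(\<Sum>b\<in>UNIV. mconst (N $ a $ b) * mconst (Q' $ b)) = (mconst (Q $ a) :: ('k, 'n hindex) mfps)"
      by (simp only: mconst_mult[symmetric] mconst_sum[symmetric])
    moreover have "(\<Sum>b\<in>UNIV. mconst (N $ a $ b) * (\<kappa> * msubst (y b) \<omega>)) = \<kappa> * (\<Sum>b\<in>UNIV. mconst (N $ a $ b) * msubst (y b) \<omega>)"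
      by (simp add: sum_distrib_left mult_ac)
    ultimately show ?thesis by (simp add: e_eq tX_eq right_diff_distrib sum_subtractf Y_def)
  qed
  have Y0: "mcoeff0 (Y a) = Q $ a" for a
    using arg_cong[OF Ne[of a], of mcoeff0] by (simp add: e0)
  have lin: "msubst (formal_linear N W) e = msubst W (\<lambda>a. Y a - mconst (Q $ a))" for W
    unfolding msubst_formal_linear[OF e0] Ne ..
  have x_simps: "x Zeroth = 1" "x (Mid i) = mconst (p $ i) + \<omega> i" "x Last = msubst F \<omega>" for i
    by (simp_all add: x_def msubst_add msubst_mvar[of \<omega>, OF \<omega>0])
  have ratio: "Y a * minv (Y Zeroth) = x a" for a
    using kk by (simp add: Y_def x_simps mult_ac)
  have argY: "dehom_arg Q Y = \<omega>"
    by (rule ext) (simp add: dehom_arg_def ratio x_simps Q_def)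
  have cone_e: "msubst (formal_linear N (formal_cone Q F)) e = 0"
    unfolding lin msubst_formal_cone[OF Q0 Y0] argY ratio x_simps by simp
  have ampl_e: "msubst (formal_linear N (formal_ampl Q G)) e = msubst G \<omega> ^ ?e * minv \<kappa> ^ ?h"
    unfolding lin msubst_formal_ampl[OF Q0 Y0] argY by (simp add: Y_def x_simps)
  have A_tX: "dehom_arg Q' tX = A"
    by (rule ext) (simp add: dehom_arg_def tX_def A_def)
  have dehom_e: "msubst (formal_dehom Q' W) e = formal_dehom Q' W" for W
    unfolding e_eq msubst_formal_dehom[OF Q'0 tX0] A_tX by (rule dehom[symmetric])
  have X0_e: "msubst (X Zeroth) e = X Zeroth"
    unfolding e_eq X_def msubst_hcoord[OF tX0] by (simp add: tX_def X_def)
  have mX0_e: "msubst (minv (X Zeroth)) e = minv (X Zeroth)"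
    unfolding msubst_minv[OF e0 xu] X0_e ..
  have e_section: "e = cone_section Q' F'" by (rule ext) (simp add: e_def z_def cone_section_def X_def)
  have cone'_e: "msubst (formal_cone Q' F') e = 0"
    unfolding e_section by (rule msubst_cone_section[OF Q'0 F'0])
  have div: "W = X Zeroth * mdivide Last z W * formal_cone Q' F'" if "msubst W e = 0" for W
    using cone_divide[OF Q'0 F'0, of W] that by (simp add: e_section X_def z_def)
  define H where "H = formal_linear N (formal_cone Q F)"
  define U where "U = X Zeroth * mdivide Last z H"
  have HU: "H = U * formal_cone Q' F'"
    unfolding U_def using div[of H] cone_e by (simp add: H_def)
  then show ?U unfolding H_def U_def z_def X_def F'_def N_def Q'_def Q_def .
  \<comment> \<open>Differentiate \<open>HU\<close> in x_(n+1). On the section the new equation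
    vanishes, so one side reduces to \<open>U\<close> divided by x_0; the chain rule expresses the
    other side by \<open>cotheta\<close>.\<close>
  have U_e: "msubst U e = lam * msubst th \<omega>"
  proof -
    have "msubst (mderiv Last H) e = msubst U e * minv (X Zeroth)"
    proof -
      have "mderiv Last (formal_cone Q' F') = minv (X Zeroth)"
        by (simp add: mderiv_formal_cone[OF Q'0] mderiv_dehom_arg[OF Q'0] X_def)
      then show ?thesis unfolding HU
        by (simp add: mderiv_mult msubst_add msubst_mult[OF e0] cone'_e mX0_e)
    qed
    moreover have "msubst (mderiv Last H) e = minv \<kappa> * msubst th \<omega>"
    proof -
      define r where "r = (\<lambda>a. Y a - mconst (Q $ a))"
      have r0: "mcoeff0 (r a) = 0" for a by (simp add: r_def Y0)
      have hq: "mcoeff0 (hcoord Q Zeroth) \<noteq> 0" using Q0 by simp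
      have rh: "msubst (hcoord Q a) r = \<kappa> * x a" for a
      proof -
        have "msubst (hcoord Q a) r = Y a" unfolding r_def by (rule msubst_hcoord[OF Y0])
        then show ?thesis by (simp only: Y_def)
      qed
      have rm: "msubst (minv (hcoord Q Zeroth)) r = minv \<kappa>"
        unfolding msubst_minv[OF r0 hq] rh by (simp add: x_simps)
      have rd: "msubst (formal_dehom Q W) r = msubst W \<omega>" for W
        unfolding r_def msubst_formal_dehom[OF Q0 Y0] argY ..
      have k2: "\<kappa> * (minv \<kappa> * W) = W" for W using kk by (simp add: mult.assoc[symmetric])
      have da: "msubst (mderiv a (dehom_arg Q (hcoord Q) i)) r =
         minv \<kappa> * ((if a = Mid i then 1 else 0) - (if a = Zeroth then 1 else 0) * x (Mid i))" for a i
        by (simp add: mderiv_dehom_arg[OF Q0] msubst_diff msubst_mult[OF r0] rh rm mult_ac k2)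
      have dc: "msubst (mderiv a (formal_cone Q F)) r = minv \<kappa> * ((if a = Last then 1 else 0) - (if a = Zeroth then 1 else 0) * x Last
          - (\<Sum>i\<in>UNIV. msubst (mderiv i F) \<omega> * ((if a = Mid i then 1 else 0) - (if a = Zeroth then 1 else 0) * x (Mid i))))" for a
        unfolding mderiv_formal_cone[OF Q0] msubst_diff msubst_sum msubst_mult[OF r0] rh rm rd da
        by (simp add: right_diff_distrib sum_distrib_left mult_ac k2)
      have "msubst (mderiv Last H) e = (\<Sum>b\<in>UNIV. msubst (mderiv b (formal_cone Q F)) r * mconst (N $ b $ Last))"
        unfolding H_def mderiv_formal_linear msubst_sum msubst_mult[OF e0] lin r_def by simp
      also have "\<dots> = minv \<kappa> * (mconst (N $ Last $ Last) - mconst (N $ Zeroth $ Last) * x Last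
          - (\<Sum>i\<in>UNIV. msubst (mderiv i F) \<omega> * (mconst (N $ Mid i $ Last) - mconst (N $ Zeroth $ Last) * x (Mid i))))"
      proof -
        have d: "(\<Sum>i\<in>UNIV. msubst (mderiv i F) \<omega> * (if j = i then 1 else 0)) = msubst (mderiv j F) \<omega>" for j by simp
        show ?thesis
          unfolding dc sum_hindex[of "\<lambda>b. _ b * mconst (N $ b $ Last)"]
          by (simp add: algebra_simps sum.distrib sum_subtractf sum_negf sum_distrib_left sum_distrib_right)
      qed
      also have "\<dots> = minv \<kappa> * msubst th \<omega>"
        by (simp add: th_def cotheta_def msubst_diff msubst_sum msubst_mult[OF \<omega>0] x_def msubst_add)
      finally show ?thesis .
    qed
    ultimately have "msubst U e * minv (X Zeroth) = minv \<kappa> * msubst th \<omega>" by simp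
    then have "msubst U e * (X Zeroth * minv (X Zeroth)) = (\<kappa> * lam) * (minv \<kappa> * msubst th \<omega>)"
      unfolding \<kappa>lam by (simp add: mult_ac)
    also have "\<dots> = (\<kappa> * minv \<kappa>) * (lam * msubst th \<omega>)" by (simp only: mult_ac)
    finally show ?thesis unfolding xx kk by simp
  qed
  have U0: "mcoeff0 U \<noteq> 0"
    using arg_cong[OF U_e, of mcoeff0] lam_nz th0 by simp
  define W where "W = U ^ ?e * formal_ampl Q' G' - mconst c * formal_linear N (formal_ampl Q G)"
  have "msubst (formal_ampl Q' G') e = (minv lam * minv (msubst th \<omega>) * msubst R \<omega> * msubst G \<omega>) ^ ?e * minv (X Zeroth) ^ ?h"
  proof -
    have "formal_dehom Q' G' = minv lam * minv (msubst th \<omega>) * msubst R \<omega> * msubst G \<omega>"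
      unfolding dehom G'_def image_G_def \<xi>_def[symmetric] y_def[symmetric] sub N_def[symmetric] th_def[symmetric]
      by (simp add: msubst_mult[OF \<omega>0] mlam msubst_minv[OF \<omega>0 th0])
    then show ?thesis
      unfolding formal_ampl_def msubst_mult[OF e0] msubst_power[OF e0] dehom_e X_def[symmetric] mX0_e by simp
  qed
  then have "msubst (U ^ ?e * formal_ampl Q' G') e =
     ((lam * minv lam) * (msubst th \<omega> * minv (msubst th \<omega>))) ^ ?e * msubst R \<omega> ^ ?e * msubst G \<omega> ^ ?e * minv (X Zeroth) ^ ?h"
    unfolding msubst_mult[OF e0] msubst_power[OF e0] U_e by (simp add: power_mult_distrib mult_ac)
  also have "msubst th \<omega> * minv (msubst th \<omega>) = 1" using th0 by (intro mult_minv) simp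
  also have "msubst R \<omega> ^ ?e = mconst c * lam ^ ?h"
    unfolding msubst_power[OF \<omega>0, symmetric] R by (simp add: msubst_mult[OF \<omega>0] msubst_power[OF \<omega>0] lam_def y_def)
  finally have "msubst W e = mconst c * (lam ^ ?h * msubst G \<omega> ^ ?e * minv (X Zeroth) ^ ?h - msubst G \<omega> ^ ?e * minv \<kappa> ^ ?h)"
    unfolding W_def msubst_diff msubst_mult[OF e0, of "mconst c"] ampl_e ll by (simp add: algebra_simps)
  moreover have "minv \<kappa> = lam * minv (X Zeroth)"
    by (rule minv_unique) (use \<kappa>lam xx in \<open>simp add: mult.assoc[symmetric]\<close>)
  ultimately have "msubst W e = 0" by (simp add: power_mult_distrib mult_ac)
  from div[OF this] have "W = X Zeroth * mdivide Last z W * formal_cone Q' F'" .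
  then have "U ^ ?e * formal_ampl Q' G' = mconst c * formal_linear N (formal_ampl Q G) + X Zeroth * mdivide Last z W * formal_cone Q' F'"
    unfolding W_def by (simp add: algebra_simps)
  then have "density_eq ?e c H (formal_linear N (formal_ampl Q G)) (formal_cone Q' F') (formal_ampl Q' G')"
    unfolding density_eq_def using U0 HU by blast
  then show ?T
    unfolding formal_transform_iff Let_def Q_def[symmetric] Q'_def[symmetric] F'_def[symmetric] G'_def[symmetric]
    using Q'0 F'0 by (simp add: H_def N_def)
qed

end

section \<open>Existence at the generic point\<close>

lemma idom_hom_gexp: "idom_hom (gexp :: ('k::field_char_0, 'n::finite) mfps \<Rightarrow> _)"
proof
  fix F :: "('k, 'n) mfps" assume "gexp F = 0"
  then have "mcoeff0 (gexp F) = 0" by simp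
  then show "F = 0" by simp
qed (simp_all add: gexp_add gexp_mult)

lemma gexp_taylor_coeff:
  fixes F :: "('k::field_char_0, 'n::finite) mfps"
  shows "gexp (taylor_coeff \<alpha> F) = taylor_coeff \<alpha> (gexp F)"
proof -
  have "mord d (gexp (taylor_coeff \<alpha> F) - taylor_coeff \<alpha> (gexp F))" for d
  proof (induction d arbitrary: F)
    case (Suc d)
    have "mcoeff0 (taylor_coeff \<alpha> (gexp F)) = to_fract (taylor_coeff \<alpha> F)"
      by (simp add: taylor_coeff_def[of \<alpha> "gexp F"] mcoeff_gexp)
    then show ?case
      using Suc.IH by (simp add: mord_Suc_iff mderiv_diff mderiv_gexp mderiv_taylor_coeff)
  qed simp
  then show ?thesis using mord_all by fastforce
qed

text \<open>A germ and its germ at the generic point have the same coefficients \<open>A\<^sub>k\<close>, up to the embedding \<open>t \<mapsto> t + u\<close> of scalars.\<close>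

lemma formal_admissible_generic_germ:
  fixes P :: "('k::field_char_0, 'n::finite) formal_germ"
  assumes "formal_admissible P"
  shows "formal_admissible (generic_germ P)"
proof -
  obtain p F G where P: "P = (p, F, G)" by (cases P)
  have adm: "det (hess (gexp F)) \<noteq> 0" "G \<noteq> 0" "\<And>k. k \<ge> 1 \<Longrightarrow> sp_coeff k (gexp F) (gexp G) = 0"
    using assms by (auto simp: formal_admissible_def P)
  interpret idom_hom "gexp :: ('k, 'n) mfps \<Rightarrow> _" by (rule idom_hom_gexp)
  interpret h: field_hom fract_map by (rule field_hom_fract_map)
  have m: "map_coeffs fract_map (gexp W) = gexp (gexp W)" for W :: "('k, 'n) mfps"
    by (rule mfps_eqI) (simp add: mcoeff_gexp fract_map_to_fract gexp_taylor_coeff)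
  have "det (hess (gexp (gexp F))) \<noteq> 0"
    unfolding m[symmetric] h.det_hess_hom using adm(1) by simp
  moreover have "gexp G \<noteq> 0" using adm(2) s_inj by blast
  moreover have "sp_coeff k (gexp (gexp F)) (gexp (gexp G)) = 0" if "k \<ge> 1" for k
    unfolding m[symmetric] h.sp_coeff_hom[OF adm(1)] adm(3)[OF that] by simp
  ultimately show ?thesis by (simp add: formal_admissible_def generic_germ_def P)
qed

text \<open>The generic Hessian is the matrix of second derivatives seen in the fraction field,
  where it is invertible; hence it has no kernel among vectors of series.\<close>

lemma det_hess_gexp_vector:
  fixes F :: "('k::field_char_0, 'n::finite) mfps"
  assumes "det (hess (gexp F)) \<noteq> 0" and "\<And>b. (\<Sum>j\<in>UNIV. mderiv b (mderiv j F) * v j) = 0"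
  shows "v i = 0"
proof -
  let ?H = "hess (gexp F)"
  have H: "?H $ b $ j = to_fract (mderiv b (mderiv j F))" for b j
    by (simp add: hess_def mderiv_gexp)
  have "?H *v (\<chi> j. to_fract (v j)) = 0"
    using assms(2) by (simp add: vec_eq_iff matrix_vector_mult_def H to_fract_mult[symmetric] to_fract_sum[symmetric])
  moreover have "invertible ?H" using assms(1) by (simp add: invertible_det_nz)
  ultimately have "(\<chi> j. to_fract (v j)) = (0 :: ('k, 'n) mfps fract ^ 'n)"
    by (metis matrix_inv_right_field(2) matrix_vector_mul_assoc matrix_vector_mul_lid matrix_vector_mult_0_right)
  from arg_cong[OF this, of "\<lambda>w. w $ i"] show ?thesis by simp
qed

lemma invertible_zero_row:
  fixes M :: "'k::field ^ 'm::finite ^ 'm"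
  assumes "invertible M" "\<And>j. M $ i $ j = 0" shows False
proof -
  have "(M ** matrix_inv M) $ i $ i = 1" by (simp add: matrix_inv_right_field[OF assms(1)] mat_def)
  then show False by (simp add: matrix_matrix_mult_def assms(2))
qed

lemma invertible_zero_column:
  fixes M :: "'k::field ^ 'm::finite ^ 'm"
  assumes "invertible M" "\<And>j. M $ j $ i = 0" shows False
proof -
  have "(matrix_inv M ** M) $ i $ i = 1" by (simp add: matrix_inv_right_field[OF assms(1)] mat_def)
  then show False by (simp add: matrix_matrix_mult_def assms(2))
qed

lemma invertible_matrix_inv:
  fixes M :: "'k::field ^ 'm::finite ^ 'm"
  assumes "invertible M" shows "invertible (matrix_inv M)"
  using matrix_inv_right_field[OF assms] invertible_def by blast

context
  fixes F :: "('k::field_char_0, 'n::finite) mfps" and M :: "'k ^ 'n hindex ^ 'n hindex"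
  assumes det: "det (hess (gexp F)) \<noteq> 0" and M: "invertible M"
begin

text \<open>Were the series zero, so would be its second derivatives, which are
  \<open>M $ Zeroth $ Last\<close> times those of \<open>F\<close>. The Hessian being nondegenerate,
  this entry is 0; gradient and value then make the rest of the row of \<open>M\<close>
  vanish.\<close>

lemma cone_image_Zeroth_neq_0: "cone_image M p F Zeroth \<noteq> 0"
proof
  assume z: "cone_image M p F Zeroth = 0"
  have m: "M $ Zeroth $ Last = 0"
  proof (rule ccontr)
    assume nz: "M $ Zeroth $ Last \<noteq> 0"
    have "mconst (M $ Zeroth $ Last) * mderiv b (mderiv j F) = 0" for b j
      using mderiv2_cone_image[of b j M p F Zeroth] z by simp
    then have "(\<Sum>j\<in>UNIV. mderiv b (mderiv j F) * 1) = 0" for b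
      using nz by simp
    from det_hess_gexp_vector[OF det this] show False by simp
  qed
  have mid: "M $ Zeroth $ Mid j = 0" for j
    using mderiv_cone_image[of j M p F Zeroth] z m by simp
  have "M $ Zeroth $ Zeroth = 0"
    using z m mid by (simp add: cone_image_def sum_hindex)
  then have "M $ Zeroth $ b = 0" for b using m mid by (cases b) auto
  then show False using invertible_zero_row[OF M] by blast
qed

text \<open>By \<open>mderiv_cotheta\<close> a vanishing series would put \<open>v\<close> into the
  kernel of the Hessian. Then \<open>v\<close> is zero, and as it is affine in the coordinates, the
  whole column \<open>Last\<close> of the inverse matrix vanishes.\<close>

lemma cotheta_neq_0: "cotheta (matrix_inv M) p F \<noteq> 0"
proof
  let ?N = "matrix_inv M"
  define v where "v j = mconst (?N $ Mid j $ Last) - mconst (?N $ Zeroth $ Last) * cone_param p F (Mid j)" for j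
  assume z: "cotheta ?N p F = 0"
  have "(\<Sum>j\<in>UNIV. mderiv b (mderiv j F) * v j) = 0" for b
    using mderiv_cotheta[of b ?N p F] z by (simp add: v_def)
  then have v: "v j = 0" for j by (rule det_hess_gexp_vector[OF det])
  have "mderiv j (v j) = - mconst (?N $ Zeroth $ Last)" for j
    by (simp add: v_def mderiv_diff mderiv_add mderiv_mvar)
  then have n0: "?N $ Zeroth $ Last = 0" using v by simp
  have nm: "?N $ Mid j $ Last = 0" for j using v[of j] n0 by (simp add: v_def)
  have "?N $ Last $ Last = 0" using z n0 nm by (simp add: cotheta_def)
  then have "?N $ b $ Last = 0" for b using n0 nm by (cases b) auto
  then show False using invertible_zero_column[OF invertible_matrix_inv[OF M]] by blast
qed

end

lemma generic_cone_image':
  fixes F :: "('k::field_char_0, 'n::finite) mfps"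
  shows "cone_image (generic_matrix M) (\<chi> i. to_fract (mconst (p $ i) + mvar i)) (gexp F) a = gexp (cone_image M p F a)"
proof -
  have "cone_param (\<chi> i. to_fract (mconst (p $ i) + mvar i)) (gexp F) a = gexp (cone_param p F a)" for a
    by (cases a) (simp_all add: gexp_add gexp_mconst gexp_mvar to_fract_add mconst_add)
  then show ?thesis
    by (simp add: cone_image_def gexp_sum gexp_mult gexp_mconst generic_matrix_def)
qed

lemma generic_matrix_mult':
  "generic_matrix A ** generic_matrix B = (generic_matrix (A ** B) :: ('k::field, 'n::finite) mfps fract ^ 'm::finite ^ 'm)"
  by (simp add: generic_matrix_def matrix_matrix_mult_def vec_eq_iff to_fract_sum to_fract_mult mconst_sum mconst_mult)

lemma generic_matrix_inv:
  fixes M :: "'k::field ^ 'm::finite ^ 'm"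
  assumes "invertible M"
  shows "invertible (generic_matrix M :: ('k, 'n::finite) mfps fract ^ 'm ^ 'm)"
    and "matrix_inv (generic_matrix M) = (generic_matrix (matrix_inv M) :: ('k, 'n) mfps fract ^ 'm ^ 'm)"
proof -
  have 1: "(generic_matrix (mat 1) :: ('k, 'n) mfps fract ^ 'm ^ 'm) = mat 1"
    by (simp add: generic_matrix_def mat_def vec_eq_iff)
  have 2: "generic_matrix M ** generic_matrix (matrix_inv M) = (mat 1 :: ('k, 'n) mfps fract ^ 'm ^ 'm)"
    "generic_matrix (matrix_inv M) ** generic_matrix M = (mat 1 :: ('k, 'n) mfps fract ^ 'm ^ 'm)"
    unfolding generic_matrix_mult' matrix_inv_right_field[OF assms] 1 by simp_all
  then show "invertible (generic_matrix M :: ('k, 'n) mfps fract ^ 'm ^ 'm)" unfolding invertible_def by blast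
  show "matrix_inv (generic_matrix M) = (generic_matrix (matrix_inv M) :: ('k, 'n) mfps fract ^ 'm ^ 'm)"
    using 2(1) by (rule matrix_inv_unique_field)
qed

text \<open>For odd n the exponent \<open>half_weight\<close> is odd while \<open>wt_den\<close> is
  2, so a square root of a multiple of \<open>l\<close> is required; the constant is chosen to make
  the constant term 1.\<close>

lemma ampl_root_exists:
  fixes l :: "('k::field_char_0, 'n::finite) mfps"
  assumes l: "mcoeff0 l \<noteq> 0"
  obtains c R where "c \<noteq> 0" "even CARD('n) \<Longrightarrow> c = 1"
    "R ^ wt_den TYPE('n) = mconst c * l ^ half_weight TYPE('n)"
proof (cases "even CARD('n)")
  case True
  then show ?thesis by (intro that[of 1 "l ^ half_weight TYPE('n)"]) (simp_all add: wt_den_def)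
next
  case False
  then obtain k where k: "CARD('n) = 2 * k + 1" by (elim oddE)
  define c where "c = inverse (mcoeff0 l)"
  have c: "c \<noteq> 0" using l by (simp add: c_def)
  have q: "mfps_sqrt (mconst c * l) ^ 2 = mconst c * l"
    by (rule mfps_sqrt) (simp add: c_def l)
  have e: "wt_den TYPE('n) = 2" "half_weight TYPE('n) = 2 * (k + 1) + 1"
    using k by (simp_all add: wt_den_def half_weight_def)
  have "(l ^ (k + 1) * mfps_sqrt (mconst c * l)) ^ wt_den TYPE('n) = mconst c * l ^ half_weight TYPE('n)"
    unfolding e power_mult_distrib q power_mult[symmetric] power_add by (simp add: power2_eq_square mult_ac)
  then show ?thesis using False c that by blast
qed

theorem formal_generic_transform:
  fixes P :: "('k::field_char_0, 'n::finite) formal_germ" and M :: "'k ^ 'n hindex ^ 'n hindex"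
  assumes M: "invertible M" and P: "formal_admissible P"
  shows "\<exists>c P'. c \<noteq> 0 \<and> (even CARD('n) \<longrightarrow> c = 1) \<and>
    formal_transform (generic_matrix M) c (generic_germ P) P' \<and> formal_admissible P'"
proof -
  obtain p F G where P_eq: "P = (p, F, G)" by (cases P)
  have det: "det (hess (gexp F)) \<noteq> 0" using P by (simp add: formal_admissible_def P_eq)
  define t where "t = (\<chi> i. to_fract (mconst (p $ i) + mvar i :: ('k, 'n) mfps))"
  define MM where "MM = (generic_matrix M :: ('k, 'n) mfps fract ^ 'n hindex ^ 'n hindex)"
  have MM: "invertible MM" unfolding MM_def by (rule generic_matrix_inv(1)[OF M])
  have image: "cone_image MM t (gexp F) a = gexp (cone_image M p F a)" for a
    unfolding MM_def t_def by (rule generic_cone_image')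
  have lam0: "mcoeff0 (cone_image MM t (gexp F) Zeroth) \<noteq> 0"
    unfolding image using cone_image_Zeroth_neq_0[OF det M] by simp
  have "mcoeff0 (cotheta (matrix_inv MM) t (gexp F)) = to_fract (cotheta (matrix_inv M) p F)"
    unfolding mcoeff0_cotheta MM_def generic_matrix_inv(2)[OF M]
    by (simp add: cotheta_def generic_matrix_def t_def mderiv_gexp to_fract_diff to_fract_sum to_fract_mult to_fract_add)
  then have cot0: "mcoeff0 (cotheta (matrix_inv MM) t (gexp F)) \<noteq> 0"
    using cotheta_neq_0[OF det M] by simp
  obtain c R where c: "c \<noteq> 0" "even CARD('n) \<Longrightarrow> c = 1"
    and R: "R ^ wt_den TYPE('n) = mconst c * cone_image MM t (gexp F) Zeroth ^ half_weight TYPE('n)"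
    using ampl_root_exists[OF lam0] by blast
  from formal_transform_exists(1)[OF MM lam0 cot0 R, of "gexp G"]
  obtain P' where T: "formal_transform MM c (generic_germ P) P'"
    unfolding generic_germ_def P_eq t_def[symmetric] by (auto simp: t_def)
  have "formal_admissible P'"
    using formal_admissible_transform[OF MM c(1) formal_admissible_generic_germ[OF P] T] .
  then show ?thesis using c T unfolding MM_def by blast
qed

text \<open>The constant term of \<open>cotheta\<close> is that of \<theta> for the inverse
  transformation, to which \<open>formal_transform_chart\<close> applies.\<close>

lemma formal_transform_good:
  fixes F F' G G' :: "('k::field_char_0, 'n::finite) mfps"
  assumes M: "invertible M" and c: "c \<noteq> 0" and T: "formal_transform M c (p, F, G) (p', F', G')"
  shows "mcoeff0 (cone_image M p F Zeroth) \<noteq> 0" "mcoeff0 (cotheta (matrix_inv M) p F) \<noteq> 0"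
proof -
  interpret A: cone_chart F F' M "matrix_inv M" p p' by (rule formal_transform_chart(1)[OF M c T])
  show "mcoeff0 (cone_image M p F Zeroth) \<noteq> 0" by (rule A.lam0)
  let ?N = "matrix_inv M"
  have T': "formal_transform ?N (inverse c) (p', F', G') (p, F, G)"
    by (rule formal_transform_inverse[OF M c T])
  have N: "invertible ?N" and c': "inverse c \<noteq> 0" using invertible_matrix_inv[OF M] c by auto
  interpret B: cone_chart F' F ?N "matrix_inv ?N" p' p by (rule formal_transform_chart(1)[OF N c' T'])
  have "mcoeff0 B.\<theta> \<noteq> 0" by (rule formal_transform_chart(2)[OF N c' T'])
  moreover have "mcoeff0 (B.\<psi> i) = p $ i" for i using B.s0[of i] by (simp add: B.s_def)
  then have "mcoeff0 B.\<theta> = mcoeff0 (cotheta ?N p F)"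
    by (simp add: B.\<theta>_def B.\<mu>_def B.f_def B.f'_def mcoeff0_cotheta)
  ultimately show "mcoeff0 (cotheta ?N p F) \<noteq> 0" by simp
qed

section \<open>Convergent power series\<close>

no_notation Infinite_Set_Sum.abs_summable_on (infix \<open>abs'_summable'_on\<close> 50)

abbreviation mpow :: "'c::comm_monoid_mult ^ 'n::finite \<Rightarrow> ('n \<Rightarrow> nat) \<Rightarrow> 'c" where
  "mpow u \<alpha> \<equiv> (\<Prod>i\<in>UNIV. (u $ i) ^ \<alpha> i)"

definition mconv_at :: "real \<Rightarrow> ('c::real_normed_field, 'n::finite) mfps \<Rightarrow> bool" where
  "mconv_at r F \<longleftrightarrow> (\<lambda>\<alpha>. norm (mcoeff F \<alpha>) * r ^ mdeg \<alpha>) summable_on UNIV"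

text \<open>A weighted l^1 norm. It is submultiplicative and bounds the values on the closed
  polydisc of radius \<open>r\<close>, so convergence of a construction becomes an estimate of
  norms.\<close>

definition mnorm :: "real \<Rightarrow> ('c::real_normed_field, 'n::finite) mfps \<Rightarrow> real" where
  "mnorm r F = (\<Sum>\<^sub>\<infinity>\<alpha>. norm (mcoeff F \<alpha>) * r ^ mdeg \<alpha>)"

definition meval :: "('c::real_normed_field, 'n::finite) mfps \<Rightarrow> 'c ^ 'n \<Rightarrow> 'c" where
  "meval F u = (\<Sum>\<^sub>\<infinity>\<alpha>. mcoeff F \<alpha> * mpow u \<alpha>)"

lemma abs_summable_real_nonneg:
  fixes f :: "'a \<Rightarrow> real"
  shows "f summable_on A \<Longrightarrow> f abs_summable_on A"
  using summable_on_iff_abs_summable_on_real by blast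

lemma summable_on_le:
  fixes f g :: "'a \<Rightarrow> real"
  assumes "g summable_on A" "\<And>x. x \<in> A \<Longrightarrow> 0 \<le> f x" "\<And>x. x \<in> A \<Longrightarrow> f x \<le> g x"
  shows "f summable_on A"
proof -
  have "f abs_summable_on A"
    by (rule Infinite_Sum.abs_summable_on_comparison_test[OF abs_summable_real_nonneg[OF assms(1)]])
       (use assms(2,3) in \<open>auto intro: order_trans[OF _ abs_ge_self]\<close>)
  then show ?thesis by (rule abs_summable_summable)
qed

lemma abs_summable_le:
  fixes f :: "'a \<Rightarrow> 'b::real_normed_vector" and g :: "'a \<Rightarrow> real"
  assumes "g summable_on A" "\<And>x. x \<in> A \<Longrightarrow> norm (f x) \<le> g x"
  shows "f abs_summable_on A"
  using assms by (intro summable_on_le[OF assms(1)]) auto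

lemma abs_summable_times:
  fixes f :: "'a \<Rightarrow> 'd::{real_normed_field, banach}" and g :: "'b \<Rightarrow> 'd"
  assumes f: "f abs_summable_on UNIV" and g: "g abs_summable_on UNIV"
  shows "(\<lambda>p. f (fst p) * g (snd p)) abs_summable_on UNIV"
    and "(\<Sum>\<^sub>\<infinity>p. f (fst p) * g (snd p)) = infsum f UNIV * infsum g UNIV"
proof -
  have "(\<lambda>p. f (fst p) * g (snd p)) abs_summable_on UNIV \<times> UNIV"
    unfolding Infinite_Sum.abs_summable_on_Sigma_iff
  proof (intro conjI ballI)
    show "(\<lambda>y. f (fst (x, y)) * g (snd (x, y))) abs_summable_on UNIV" for x
      using summable_on_cmult_right[OF g, of "norm (f x)"] by (simp add: norm_mult)
    have "(\<lambda>x. norm (f x) * (\<Sum>\<^sub>\<infinity>y. norm (g y))) abs_summable_on UNIV"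
      using abs_summable_real_nonneg[OF summable_on_cmult_left[OF f]] .
    then show "(\<lambda>x. \<Sum>\<^sub>\<infinity>y. norm (f (fst (x, y)) * g (snd (x, y)))) abs_summable_on UNIV"
      by (simp add: norm_mult infsum_cmult_right')
  qed
  then show s: "(\<lambda>p. f (fst p) * g (snd p)) abs_summable_on UNIV" by simp
  have "(\<Sum>\<^sub>\<infinity>p. f (fst p) * g (snd p)) = (\<Sum>\<^sub>\<infinity>x. \<Sum>\<^sub>\<infinity>y. f x * g y)"
    using infsum_Sigma_banach[of "\<lambda>p. f (fst p) * g (snd p)" UNIV "\<lambda>_. UNIV"] abs_summable_summable[OF s] by simp
  also have "\<dots> = infsum f UNIV * infsum g UNIV"
    by (simp add: infsum_cmult_right' infsum_cmult_left')
  finally show "(\<Sum>\<^sub>\<infinity>p. f (fst p) * g (snd p)) = infsum f UNIV * infsum g UNIV" .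
qed

text \<open>The grouping behind the Cauchy product: the double family is reindexed by pairs of a
  multi-index and one of its splits, and the splits are finite in number.\<close>

lemma midx_double_sum:
  fixes h :: "('n::finite \<Rightarrow> nat) \<times> ('n \<Rightarrow> nat) \<Rightarrow> 'd::banach"
  assumes h: "h summable_on UNIV"
  shows "((\<lambda>\<alpha>. \<Sum>p\<in>midx_splits \<alpha>. h p) has_sum infsum h UNIV) UNIV"
proof -
  define j where "j p = (midx_add (fst p) (snd p), p)" for p :: "('n \<Rightarrow> nat) \<times> ('n \<Rightarrow> nat)"
  have inj: "inj_on j UNIV" by (auto simp: j_def inj_on_def)
  have im: "j ` UNIV = Sigma UNIV midx_splits"
    by (auto simp: j_def midx_splits_def image_iff)
  have "((h \<circ> snd) \<circ> j has_sum infsum h UNIV) UNIV"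
    using h by (simp add: j_def o_def)
  then have "((h \<circ> snd) has_sum infsum h UNIV) (Sigma UNIV midx_splits)"
    unfolding im[symmetric] has_sum_reindex[OF inj] .
  then show ?thesis
    by (rule has_sum_SigmaD) (simp add: has_sum_finite)
qed

lemma midx_double_summable:
  fixes h :: "('n::finite \<Rightarrow> nat) \<times> ('n \<Rightarrow> nat) \<Rightarrow> 'd::real_normed_vector"
  assumes "(\<lambda>\<alpha>. \<Sum>p\<in>midx_splits \<alpha>. norm (h p)) summable_on UNIV"
  shows "h abs_summable_on UNIV"
proof -
  define j where "j p = (midx_add (fst p) (snd p), p)" for p :: "('n \<Rightarrow> nat) \<times> ('n \<Rightarrow> nat)"
  have inj: "inj_on j UNIV" by (auto simp: j_def inj_on_def)
  have im: "j ` UNIV = Sigma UNIV midx_splits"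
    by (auto simp: j_def midx_splits_def image_iff)
  have "(\<lambda>q. norm (h (snd q))) summable_on Sigma UNIV midx_splits"
    by (rule summable_on_SigmaI[where g = "\<lambda>\<alpha>. \<Sum>p\<in>midx_splits \<alpha>. norm (h p)"])
       (simp_all add: has_sum_finite assms)
  then have "(\<lambda>q. norm (h (snd q))) \<circ> j summable_on UNIV"
    unfolding im[symmetric] summable_on_reindex[OF inj] .
  then show ?thesis by (simp add: j_def o_def)
qed

lemma norm_mpow_le:
  fixes u :: "'c::real_normed_field ^ 'n::finite"
  assumes "\<And>i. norm (u $ i) \<le> r"
  shows "norm (mpow u \<alpha>) \<le> r ^ mdeg \<alpha>"
proof -
  have "norm (mpow u \<alpha>) = (\<Prod>i\<in>UNIV. norm (u $ i) ^ \<alpha> i)"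
    by (simp add: prod_norm[symmetric] norm_power)
  also have "\<dots> \<le> (\<Prod>i\<in>UNIV. r ^ \<alpha> i)"
    using assms by (intro prod_mono) (auto intro: power_mono)
  finally show ?thesis by (simp add: power_sum)
qed

lemma mpow_midx_add: "mpow u (midx_add \<alpha> \<beta>) = mpow u \<alpha> * mpow u \<beta>"
  by (simp add: power_add prod.distrib)

lemma mdeg_midx_add: "mdeg (midx_add \<alpha> \<beta>) = mdeg \<alpha> + mdeg \<beta>"
  by (simp add: sum.distrib)

context
  fixes F :: "('c::{real_normed_field, banach}, 'n::finite) mfps" and r :: real
  assumes F: "mconv_at r F"
begin

lemma meval_abs_summable:
  assumes "\<And>i. norm (u $ i) \<le> r"
  shows "(\<lambda>\<alpha>. mcoeff F \<alpha> * mpow u \<alpha>) abs_summable_on UNIV"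
  by (rule abs_summable_le[OF F[unfolded mconv_at_def]])
     (simp add: norm_mult mult_left_mono norm_mpow_le[OF assms])

lemma meval_has_sum:
  assumes "\<And>i. norm (u $ i) \<le> r"
  shows "((\<lambda>\<alpha>. mcoeff F \<alpha> * mpow u \<alpha>) has_sum meval F u) UNIV"
  unfolding meval_def by (rule has_sum_infsum[OF abs_summable_summable[OF meval_abs_summable[OF assms]]])

lemma norm_meval_le:
  assumes "\<And>i. norm (u $ i) \<le> r"
  shows "norm (meval F u) \<le> mnorm r F"
proof -
  have "norm (meval F u) \<le> (\<Sum>\<^sub>\<infinity>\<alpha>. norm (mcoeff F \<alpha> * mpow u \<alpha>))"
    unfolding meval_def by (rule norm_infsum_bound[OF meval_abs_summable[OF assms]])
  also have "\<dots> \<le> mnorm r F"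
    unfolding mnorm_def using meval_abs_summable[OF assms] F[unfolded mconv_at_def]
    by (rule infsum_mono) (simp add: norm_mult mult_left_mono norm_mpow_le[OF assms])
  finally show ?thesis .
qed

lemma mconv_at_mono:
  assumes "0 \<le> r'" "r' \<le> r"
  shows "mconv_at r' F"
  unfolding mconv_at_def
  by (rule summable_on_le[OF F[unfolded mconv_at_def]]) (use assms in \<open>auto intro!: mult_left_mono power_mono\<close>)

text \<open>A monomial of degree at least \<open>d\<close> shrinks at least by the
  \<open>d\<close>-th power of the ratio of the radii. Smallness near the origin and the bounds for
  the fixed point iteration come from here.\<close>

lemma mnorm_shrink:
  assumes d: "mord d F" and r': "0 \<le> r'" "r' \<le> r" and r: "r > 0"
  shows "mnorm r' F \<le> (r' / r) ^ d * mnorm r F"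
proof -
  have *: "norm (mcoeff F \<alpha>) * r' ^ mdeg \<alpha> \<le> (r' / r) ^ d * (norm (mcoeff F \<alpha>) * r ^ mdeg \<alpha>)" for \<alpha>
  proof (cases "mdeg \<alpha> < d")
    case False
    obtain k where k: "mdeg \<alpha> = d + k" by (rule that[of "mdeg \<alpha> - d"]) (use False in linarith)
    have "r' ^ mdeg \<alpha> = (r' / r) ^ d * (r ^ d * r' ^ k)"
      unfolding k using r by (simp add: power_add power_divide)
    also have "\<dots> \<le> (r' / r) ^ d * (r ^ d * r ^ k)"
      using r r' by (intro mult_left_mono power_mono) auto
    finally have "r' ^ mdeg \<alpha> \<le> (r' / r) ^ d * r ^ mdeg \<alpha>" by (simp add: k power_add)
    then have "norm (mcoeff F \<alpha>) * r' ^ mdeg \<alpha> \<le> norm (mcoeff F \<alpha>) * ((r' / r) ^ d * r ^ mdeg \<alpha>)"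
      by (rule mult_left_mono) simp
    then show ?thesis by (simp only: mult_ac)
  qed (use d in \<open>simp add: mord_def\<close>)
  have "mnorm r' F \<le> (\<Sum>\<^sub>\<infinity>\<alpha>. (r' / r) ^ d * (norm (mcoeff F \<alpha>) * r ^ mdeg \<alpha>))"
    unfolding mnorm_def
    by (rule infsum_mono) (use mconv_at_mono[OF r'] F * in \<open>auto simp: mconv_at_def intro: summable_on_cmult_right\<close>)
  then show ?thesis by (simp add: mnorm_def infsum_cmult_right')
qed

lemma meval_bound:
  assumes d: "mord d F" and r: "r > 0" and r': "0 \<le> r'" "r' \<le> r" and u: "\<And>i. norm (u $ i) \<le> r'"
  shows "norm (meval F u) \<le> (r' / r) ^ d * mnorm r F"
proof -
  have "norm (meval F u) \<le> mnorm r' F"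
  proof -
    have "(\<lambda>\<alpha>. mcoeff F \<alpha> * mpow u \<alpha>) abs_summable_on UNIV"
      using u r' by (intro meval_abs_summable) (meson order_trans)
    from norm_infsum_bound[OF this] have "norm (meval F u) \<le> (\<Sum>\<^sub>\<infinity>\<alpha>. norm (mcoeff F \<alpha> * mpow u \<alpha>))"
      by (simp add: meval_def)
    also have "\<dots> \<le> mnorm r' F"
      unfolding mnorm_def using \<open>(\<lambda>\<alpha>. mcoeff F \<alpha> * mpow u \<alpha>) abs_summable_on UNIV\<close> mconv_at_mono[OF r', unfolded mconv_at_def]
      by (rule infsum_mono) (simp add: norm_mult mult_left_mono norm_mpow_le[OF u])
    finally show ?thesis .
  qed
  with mnorm_shrink[OF d r' r] show ?thesis by simp
qed

end

section \<open>Sums, products and composites on a fixed polydisc\<close>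

lemma mnorm_nonneg: "0 \<le> r \<Longrightarrow> 0 \<le> mnorm r F"
  unfolding mnorm_def by (rule infsum_nonneg) simp

lemma mconv_at_finite:
  assumes "finite {\<alpha>. mcoeff F \<alpha> \<noteq> 0}"
  shows "mconv_at r F"
  unfolding mconv_at_def
  by (rule finite_nonzero_values_imp_summable_on) (rule finite_subset[OF _ assms], auto)

lemma mconv_at_mconst: "mconv_at r (mconst c)"
  by (rule mconv_at_finite, rule finite_subset[of _ "{\<lambda>_. 0}"]) (auto simp: mcoeff_mconst)

lemma mconv_at_mvar: "mconv_at r (mvar i)"
  by (rule mconv_at_finite, rule finite_subset[of _ "{unit_idx i}"]) (auto simp: mcoeff_mvar)

lemma meval_mconst: "meval (mconst c) u = c"
proof -
  have "meval (mconst c) u = (\<Sum>\<^sub>\<infinity>\<alpha>\<in>{\<lambda>_. 0}. mcoeff (mconst c) \<alpha> * mpow u \<alpha>)"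
    unfolding meval_def by (rule infsum_cong_neutral) (auto simp: mcoeff_mconst)
  then show ?thesis by simp
qed

lemma mnorm_mconst: "mnorm r (mconst c :: ('c::real_normed_field, 'n::finite) mfps) = norm c"
proof -
  have "mnorm r (mconst c :: ('c, 'n) mfps) = (\<Sum>\<^sub>\<infinity>\<alpha>\<in>{\<lambda>_. 0}. norm (mcoeff (mconst c :: ('c, 'n) mfps) \<alpha>) * r ^ mdeg \<alpha>)"
    unfolding mnorm_def by (rule infsum_cong_neutral) (auto simp: mcoeff_mconst)
  then show ?thesis by simp
qed

lemma meval_mvar: "meval (mvar i) u = u $ i"
proof -
  have "meval (mvar i) u = (\<Sum>\<^sub>\<infinity>\<alpha>\<in>{unit_idx i}. mcoeff (mvar i) \<alpha> * mpow u \<alpha>)"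
    unfolding meval_def by (rule infsum_cong_neutral) (auto simp: mcoeff_mvar)
  also have "\<dots> = mpow u (unit_idx i)" by (simp add: mcoeff_mvar)
  also have "\<dots> = (\<Prod>j\<in>UNIV. if j = i then u $ j else 1)" by (rule prod.cong) auto
  also have "\<dots> = u $ i" by (simp add: prod.delta)
  finally show ?thesis .
qed

lemma meval_0_arg:
  fixes F :: "('c::real_normed_field, 'n::finite) mfps"
  shows "meval F 0 = mcoeff0 F"
proof -
  have "mpow (0 :: 'c ^ 'n) \<alpha> = 0" if "\<alpha> \<noteq> (\<lambda>_. 0)" for \<alpha>
  proof -
    from that obtain i where "\<alpha> i \<noteq> 0" by auto
    then show ?thesis by (intro prod_zero bexI[of _ i]) (auto simp: power_0_left)
  qed
  then have "meval F 0 = (\<Sum>\<^sub>\<infinity>\<alpha>\<in>{\<lambda>_. 0}. mcoeff F \<alpha> * mpow 0 \<alpha>)"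
    unfolding meval_def by (intro infsum_cong_neutral) auto
  then show ?thesis by simp
qed

lemma meval_zero [simp]: "meval 0 u = 0"
  by (simp add: meval_def)

context
  fixes F G :: "('c::{real_normed_field, banach}, 'n::finite) mfps" and r :: real
  assumes F: "mconv_at r F" and G: "mconv_at r G" and r: "0 \<le> r"
begin

lemma mconv_at_add: "mconv_at r (F + G)"
  unfolding mconv_at_def
  by (rule summable_on_le[OF summable_on_add[OF F[unfolded mconv_at_def] G[unfolded mconv_at_def]]])
     (use r in \<open>auto simp: distrib_right[symmetric] intro!: mult_right_mono norm_triangle_ineq\<close>)

lemma mnorm_add: "mnorm r (F + G) \<le> mnorm r F + mnorm r G"
proof -
  have "mnorm r (F + G) \<le> (\<Sum>\<^sub>\<infinity>\<alpha>. norm (mcoeff F \<alpha>) * r ^ mdeg \<alpha> + norm (mcoeff G \<alpha>) * r ^ mdeg \<alpha>)"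
    unfolding mnorm_def
    using mconv_at_add[unfolded mconv_at_def] summable_on_add[OF F[unfolded mconv_at_def] G[unfolded mconv_at_def]]
    by (rule infsum_mono) (use r in \<open>auto simp: distrib_right[symmetric] intro!: mult_right_mono norm_triangle_ineq\<close>)
  also have "\<dots> = mnorm r F + mnorm r G"
    unfolding mnorm_def using F G by (intro infsum_add) (auto simp: mconv_at_def)
  finally show ?thesis .
qed

lemma meval_add:
  assumes "\<And>i. norm (u $ i) \<le> r"
  shows "meval (F + G) u = meval F u + meval G u"
  using has_sum_add[OF meval_has_sum[OF F assms] meval_has_sum[OF G assms]]
  by (simp add: meval_def distrib_right infsumI)

lemma mult_splits:
  "(\<Sum>p\<in>midx_splits \<alpha>. (norm (mcoeff F (fst p)) * r ^ mdeg (fst p)) * (norm (mcoeff G (snd p)) * r ^ mdeg (snd p))) =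
   (\<Sum>p\<in>midx_splits \<alpha>. norm (mcoeff F (fst p) * mcoeff G (snd p))) * r ^ mdeg \<alpha>"
  unfolding sum_distrib_right
  by (rule sum.cong) (auto simp: midx_splits_def norm_mult mdeg_midx_add power_add)

lemma mult_has_sum:
  "((\<lambda>\<alpha>. (\<Sum>p\<in>midx_splits \<alpha>. norm (mcoeff F (fst p) * mcoeff G (snd p))) * r ^ mdeg \<alpha>) has_sum mnorm r F * mnorm r G) UNIV"
proof -
  note FG = F[unfolded mconv_at_def, THEN abs_summable_real_nonneg] G[unfolded mconv_at_def, THEN abs_summable_real_nonneg]
  from midx_double_sum[OF abs_summable_summable[OF abs_summable_times(1)[OF FG]]]
  show ?thesis unfolding abs_summable_times(2)[OF FG] mult_splits mnorm_def .
qed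

lemma mult_coeff_le: "norm (mcoeff (F * G) \<alpha>) * r ^ mdeg \<alpha> \<le> (\<Sum>p\<in>midx_splits \<alpha>. norm (mcoeff F (fst p) * mcoeff G (snd p))) * r ^ mdeg \<alpha>"
  unfolding mcoeff_mult using r by (intro mult_right_mono norm_sum) simp

lemma mconv_at_mult: "mconv_at r (F * G)"
  unfolding mconv_at_def
  by (rule summable_on_le[OF has_sum_imp_summable[OF mult_has_sum]]) (use r mult_coeff_le in auto)

lemma mnorm_mult: "mnorm r (F * G) \<le> mnorm r F * mnorm r G"
  unfolding infsumI[OF mult_has_sum, symmetric] unfolding mnorm_def[of r "F * G"]
  using mconv_at_mult[unfolded mconv_at_def] has_sum_imp_summable[OF mult_has_sum] mult_coeff_le by (rule infsum_mono)

lemma meval_mult: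
  assumes u: "\<And>i. norm (u $ i) \<le> r"
  shows "meval (F * G) u = meval F u * meval G u"
proof -
  note FG = meval_abs_summable[OF F u] meval_abs_summable[OF G u]
  have *: "(\<Sum>p\<in>midx_splits \<alpha>. mcoeff F (fst p) * mpow u (fst p) * (mcoeff G (snd p) * mpow u (snd p))) = mcoeff (F * G) \<alpha> * mpow u \<alpha>" for \<alpha>
    unfolding mcoeff_mult sum_distrib_right
    by (rule sum.cong) (auto simp: midx_splits_def mpow_midx_add simp del: power_add)
  from midx_double_sum[OF abs_summable_summable[OF abs_summable_times(1)[OF FG]]]
  show ?thesis unfolding abs_summable_times(2)[OF FG] * by (simp add: meval_def infsumI)
qed

end

context
  fixes r :: real
  assumes r: "0 \<le> r"
begin

lemma mconv_at_sum:
  fixes f :: "'b \<Rightarrow> ('c::{real_normed_field, banach}, 'n::finite) mfps"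
  shows "(\<And>x. x \<in> A \<Longrightarrow> mconv_at r (f x)) \<Longrightarrow> mconv_at r (sum f A)"
  using mconv_at_mconst[of r 0] by (induction A rule: infinite_finite_induct) (auto intro!: mconv_at_add r)

lemma meval_sum:
  fixes f :: "'b \<Rightarrow> ('c::{real_normed_field, banach}, 'n::finite) mfps"
  assumes u: "\<And>i. norm (u $ i) \<le> r"
  shows "(\<And>x. x \<in> A \<Longrightarrow> mconv_at r (f x)) \<Longrightarrow> meval (sum f A) u = (\<Sum>x\<in>A. meval (f x) u)"
  by (induction A rule: infinite_finite_induct) (auto simp: meval_add[OF _ mconv_at_sum r u])

lemma mconv_at_power:
  fixes F :: "('c::{real_normed_field, banach}, 'n::finite) mfps"
  assumes F: "mconv_at r F"
  shows "mconv_at r (F ^ k)" and "mnorm r (F ^ k) \<le> mnorm r F ^ k"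
    and "(\<And>i. norm (u $ i) \<le> r) \<Longrightarrow> meval (F ^ k) u = meval F u ^ k"
proof -
  have one: "mconv_at r (1 :: ('c, 'n) mfps)" "mnorm r (1 :: ('c, 'n) mfps) = 1" "meval (1 :: ('c, 'n) mfps) u = 1"
    using mconv_at_mconst[of r 1] mnorm_mconst[of r 1] meval_mconst[of 1] by simp_all
  show c: "mconv_at r (F ^ k)" for k
    by (induction k) (auto intro: one mconv_at_mult F r)
  show "mnorm r (F ^ k) \<le> mnorm r F ^ k"
  proof (induction k)
    case (Suc k)
    have "mnorm r (F ^ Suc k) \<le> mnorm r F * mnorm r (F ^ k)" using mnorm_mult[OF F c r] by simp
    also have "\<dots> \<le> mnorm r F * mnorm r F ^ k" using Suc.IH mnorm_nonneg[OF r] by (intro mult_left_mono)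
    finally show ?case by simp
  qed (simp add: one)
  show "meval (F ^ k) u = meval F u ^ k" if "\<And>i. norm (u $ i) \<le> r"
    by (induction k) (auto simp: one meval_mult[OF F c r that])
qed

lemma mconv_at_prod:
  fixes f :: "'b \<Rightarrow> ('c::{real_normed_field, banach}, 'n::finite) mfps"
  assumes f: "\<And>x. mconv_at r (f x)"
  shows "mconv_at r (prod f A)" and "mnorm r (prod f A) \<le> (\<Prod>x\<in>A. mnorm r (f x))"
    and "(\<And>i. norm (u $ i) \<le> r) \<Longrightarrow> meval (prod f A) u = (\<Prod>x\<in>A. meval (f x) u)"
proof -
  have one: "mconv_at r (1 :: ('c, 'n) mfps)" "mnorm r (1 :: ('c, 'n) mfps) = 1" "meval (1 :: ('c, 'n) mfps) u = 1"
    using mconv_at_mconst[of r 1] mnorm_mconst[of r 1] meval_mconst[of 1] by simp_all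
  show c: "mconv_at r (prod f A)" for A
    by (induction A rule: infinite_finite_induct) (auto intro: one mconv_at_mult f r)
  show "mnorm r (prod f A) \<le> (\<Prod>x\<in>A. mnorm r (f x))"
  proof (induction A rule: infinite_finite_induct)
    case (insert x A)
    have "mnorm r (prod f (insert x A)) \<le> mnorm r (f x) * mnorm r (prod f A)"
      using mnorm_mult[OF f c r] insert.hyps by simp
    also have "\<dots> \<le> mnorm r (f x) * (\<Prod>x\<in>A. mnorm r (f x))"
      using insert.IH mnorm_nonneg[OF r] by (intro mult_left_mono)
    finally show ?case using insert.hyps by simp
  qed (simp_all add: one)
  show "meval (prod f A) u = (\<Prod>x\<in>A. meval (f x) u)" if "\<And>i. norm (u $ i) \<le> r"
    by (induction A rule: infinite_finite_induct) (auto simp: one meval_mult[OF f c r that])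
qed

end

context
  fixes F :: "('c::{real_normed_field, banach}, 'm::finite) mfps" and s :: "'m \<Rightarrow> ('c, 'n::finite) mfps"
    and r \<rho> :: real
  assumes F: "mconv_at \<rho> F" and r: "0 \<le> r" and s: "\<And>i. mconv_at r (s i)" and s\<rho>: "\<And>i. mnorm r (s i) \<le> \<rho>"
    and s0: "\<And>i. mcoeff0 (s i) = 0"
begin

lemma mconv_at_mmono: "mconv_at r (mmono s \<alpha>)"
  by (intro mconv_at_prod(1) mconv_at_power(1) r s)

lemma mnorm_mmono: "mnorm r (mmono s \<alpha>) \<le> \<rho> ^ mdeg \<alpha>"
proof -
  have "mnorm r (mmono s \<alpha>) \<le> (\<Prod>i\<in>UNIV. mnorm r (s i ^ \<alpha> i))"
    by (rule mconv_at_prod(2)[OF r]) (intro mconv_at_power(1) r s)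
  also have "\<dots> \<le> (\<Prod>i\<in>UNIV. \<rho> ^ \<alpha> i)"
  proof (rule prod_mono)
    fix i
    have "mnorm r (s i ^ \<alpha> i) \<le> mnorm r (s i) ^ \<alpha> i" by (rule mconv_at_power(2)[OF r s])
    also have "\<dots> \<le> \<rho> ^ \<alpha> i" using s\<rho> mnorm_nonneg[OF r] by (intro power_mono)
    finally show "0 \<le> mnorm r (s i ^ \<alpha> i) \<and> mnorm r (s i ^ \<alpha> i) \<le> \<rho> ^ \<alpha> i" using mnorm_nonneg[OF r] by blast
  qed
  finally show ?thesis by (simp add: power_sum)
qed

lemma mcoeff_mmono_eq_0: "mdeg \<beta> < mdeg \<alpha> \<Longrightarrow> mcoeff (mmono s \<alpha>) \<beta> = 0"
  using mord_mmono[of s \<alpha>] s0 by (simp add: mord_def)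

lemma mcoeff_msubst_has_sum: "((\<lambda>\<alpha>. mcoeff F \<alpha> * mcoeff (mmono s \<alpha>) \<beta>) has_sum mcoeff (msubst F s) \<beta>) UNIV"
  unfolding msubst_def mcoeff_Abs
  by (rule has_sum_finite_neutralI[where B = "{\<alpha>. mdeg \<alpha> \<le> mdeg \<beta>}"])
     (use mcoeff_mmono_eq_0 in \<open>auto simp: finite_mdeg_le not_le\<close>)

text \<open>Monomials in \<open>s\<close> have norm at most the corresponding power of \<rho>, so
  the double series over the exponents of \<open>F\<close> and of the result is dominated by
  \<open>F\<close> at radius \<rho>. This permits exchanging the summations.\<close>

lemma msubst_double_summable:
  "(\<lambda>p. norm (mcoeff F (fst p)) * (norm (mcoeff (mmono s (fst p)) (snd p)) * r ^ mdeg (snd p))) summable_on UNIV \<times> UNIV"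
proof (rule summable_on_SigmaI)
  show "((\<lambda>\<beta>. norm (mcoeff F (fst (\<alpha>, \<beta>))) * (norm (mcoeff (mmono s (fst (\<alpha>, \<beta>))) (snd (\<alpha>, \<beta>))) * r ^ mdeg (snd (\<alpha>, \<beta>))))
      has_sum norm (mcoeff F \<alpha>) * mnorm r (mmono s \<alpha>)) UNIV" for \<alpha>
    using has_sum_cmult_right[OF has_sum_infsum[OF mconv_at_mmono[unfolded mconv_at_def]], of "norm (mcoeff F \<alpha>)" \<alpha>]
    by (simp add: mnorm_def)
  show "(\<lambda>\<alpha>. norm (mcoeff F \<alpha>) * mnorm r (mmono s \<alpha>)) summable_on UNIV"
    by (rule summable_on_le[OF F[unfolded mconv_at_def]]) (simp_all add: mnorm_nonneg[OF r] mnorm_mmono mult_left_mono)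
qed (use r in auto)

lemma msubst_coeff_le:
  "norm (mcoeff (msubst F s) \<beta>) * r ^ mdeg \<beta> \<le> (\<Sum>\<^sub>\<infinity>\<alpha>. norm (mcoeff F \<alpha>) * (norm (mcoeff (mmono s \<alpha>) \<beta>) * r ^ mdeg \<beta>))"
proof -
  have "(\<lambda>\<alpha>. norm (mcoeff F \<alpha>) * (norm (mcoeff (mmono s \<alpha>) \<beta>) * r ^ mdeg \<beta>)) summable_on UNIV"
  proof (rule finite_nonzero_values_imp_summable_on, rule finite_subset[OF _ finite_mdeg_le[of "mdeg \<beta>"]], rule subsetI)
    fix \<alpha>
    assume "\<alpha> \<in> {\<alpha> \<in> UNIV. norm (mcoeff F \<alpha>) * (norm (mcoeff (mmono s \<alpha>) \<beta>) * r ^ mdeg \<beta>) \<noteq> 0}"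
    then have "mcoeff (mmono s \<alpha>) \<beta> \<noteq> 0" by auto
    with mcoeff_mmono_eq_0[of \<beta> \<alpha>] show "\<alpha> \<in> {\<alpha>. mdeg \<alpha> \<le> mdeg \<beta>}" by (simp add: not_less[symmetric], blast)
  qed
  from finite_sum_le_infsum[OF this, of "{\<alpha>. mdeg \<alpha> \<le> mdeg \<beta>}"]
  have "(\<Sum>\<alpha> | mdeg \<alpha> \<le> mdeg \<beta>. norm (mcoeff F \<alpha>) * (norm (mcoeff (mmono s \<alpha>) \<beta>) * r ^ mdeg \<beta>)) \<le>
      (\<Sum>\<^sub>\<infinity>\<alpha>. norm (mcoeff F \<alpha>) * (norm (mcoeff (mmono s \<alpha>) \<beta>) * r ^ mdeg \<beta>))"
    using r by (simp add: finite_mdeg_le)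
  moreover have "norm (mcoeff (msubst F s) \<beta>) * r ^ mdeg \<beta> \<le>
      (\<Sum>\<alpha> | mdeg \<alpha> \<le> mdeg \<beta>. norm (mcoeff F \<alpha>) * (norm (mcoeff (mmono s \<alpha>) \<beta>) * r ^ mdeg \<beta>))"
    unfolding msubst_def mcoeff_Abs mult.assoc[symmetric] sum_distrib_right[symmetric] norm_mult[symmetric]
    using r by (intro mult_right_mono norm_sum) simp
  ultimately show ?thesis by linarith
qed

lemma mconv_at_msubst: "mconv_at r (msubst F s)"
  and mnorm_msubst: "mnorm r (msubst F s) \<le> mnorm \<rho> F"
proof -
  let ?h = "\<lambda>\<alpha> \<beta>. norm (mcoeff F \<alpha>) * (norm (mcoeff (mmono s \<alpha>) \<beta>) * r ^ mdeg \<beta>)"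
  have sum: "(\<lambda>(\<alpha>, \<beta>). ?h \<alpha> \<beta>) summable_on UNIV \<times> UNIV"
    using msubst_double_summable by (simp add: case_prod_unfold)
  then have "(\<lambda>(\<beta>, \<alpha>). ?h \<alpha> \<beta>) summable_on UNIV \<times> UNIV"
    using summable_on_swap[of "\<lambda>(\<beta>, \<alpha>). ?h \<alpha> \<beta>" UNIV UNIV] by (simp add: case_prod_unfold)
  then have "(\<lambda>\<beta>. \<Sum>\<^sub>\<infinity>\<alpha>. ?h \<alpha> \<beta>) summable_on UNIV"
    using summable_on_Sigma_banach[of "\<lambda>\<beta> \<alpha>. ?h \<alpha> \<beta>" UNIV "\<lambda>_. UNIV"] by simp
  note o = this
  show c: "mconv_at r (msubst F s)"
    unfolding mconv_at_def by (rule summable_on_le[OF o]) (use r msubst_coeff_le in auto)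
  have "mnorm r (msubst F s) \<le> (\<Sum>\<^sub>\<infinity>\<beta>. \<Sum>\<^sub>\<infinity>\<alpha>. ?h \<alpha> \<beta>)"
    unfolding mnorm_def[of r "msubst F s"] using c[unfolded mconv_at_def] o msubst_coeff_le by (rule infsum_mono)
  also have "\<dots> = (\<Sum>\<^sub>\<infinity>\<alpha>. \<Sum>\<^sub>\<infinity>\<beta>. ?h \<alpha> \<beta>)"
    by (rule infsum_swap_banach[OF sum, symmetric])
  also have "\<dots> = (\<Sum>\<^sub>\<infinity>\<alpha>. norm (mcoeff F \<alpha>) * mnorm r (mmono s \<alpha>))"
    by (simp add: infsum_cmult_right' mnorm_def)
  also have "\<dots> \<le> mnorm \<rho> F"
    unfolding mnorm_def[of \<rho> F]
  proof (rule infsum_mono)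
    show "(\<lambda>\<alpha>. norm (mcoeff F \<alpha>) * mnorm r (mmono s \<alpha>)) summable_on UNIV"
      by (rule summable_on_le[OF F[unfolded mconv_at_def]]) (simp_all add: mnorm_nonneg[OF r] mnorm_mmono mult_left_mono)
  qed (use F[unfolded mconv_at_def] mnorm_mmono in \<open>auto intro: mult_left_mono\<close>)
  finally show "mnorm r (msubst F s) \<le> mnorm \<rho> F" .
qed

lemma meval_msubst:
  assumes u: "\<And>i. norm (u $ i) \<le> r"
  shows "meval (msubst F s) u = meval F (\<chi> i. meval (s i) u)"
proof -
  let ?h = "\<lambda>\<alpha> \<beta>. mcoeff F \<alpha> * (mcoeff (mmono s \<alpha>) \<beta> * mpow u \<beta>)"
  have "(\<lambda>p. ?h (fst p) (snd p)) abs_summable_on UNIV \<times> UNIV"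
    by (rule abs_summable_le[OF msubst_double_summable])
       (simp add: norm_mult mult_left_mono norm_mpow_le[OF u])
  then have "(\<lambda>(\<alpha>, \<beta>). ?h \<alpha> \<beta>) summable_on UNIV \<times> UNIV"
    by (simp add: case_prod_unfold abs_summable_summable)
  from infsum_swap_banach[OF this]
  have "(\<Sum>\<^sub>\<infinity>\<beta>. \<Sum>\<^sub>\<infinity>\<alpha>. ?h \<alpha> \<beta>) = (\<Sum>\<^sub>\<infinity>\<alpha>. \<Sum>\<^sub>\<infinity>\<beta>. ?h \<alpha> \<beta>)" by simp
  moreover have "(\<Sum>\<^sub>\<infinity>\<alpha>. ?h \<alpha> \<beta>) = mcoeff (msubst F s) \<beta> * mpow u \<beta>" for \<beta>
    using has_sum_cmult_left[OF mcoeff_msubst_has_sum, of \<beta> "mpow u \<beta>"] by (simp add: infsumI mult.assoc)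
  moreover have "(\<Sum>\<^sub>\<infinity>\<beta>. ?h \<alpha> \<beta>) = mcoeff F \<alpha> * mpow (\<chi> i. meval (s i) u) \<alpha>" for \<alpha>
  proof -
    have "meval (mmono s \<alpha>) u = (\<Prod>i\<in>UNIV. meval (s i ^ \<alpha> i) u)"
      by (rule mconv_at_prod(3)[OF r _ u]) (intro mconv_at_power(1) r s)
    also have "\<dots> = mpow (\<chi> i. meval (s i) u) \<alpha>"
      by (simp add: mconv_at_power(3)[OF r s u])
    finally show ?thesis by (simp add: infsum_cmult_right' meval_def)
  qed
  ultimately show ?thesis by (simp add: meval_def)
qed

end

text \<open>In finite dimension finitely many real coordinates bound the norm, and for real families
  summability is absolute. This converts the pointwise \<open>has_sum\<close> in
  \<open>has_mfps_expansion\<close> into a bound on norms.\<close>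

lemma summable_imp_abs_summable:
  fixes f :: "'a \<Rightarrow> 'b::euclidean_space"
  assumes "f summable_on A"
  shows "f abs_summable_on A"
proof -
  have b: "(\<lambda>x. \<bar>f x \<bullet> b\<bar>) summable_on A" for b
    using abs_summable_real_nonneg[OF summable_on_bounded_linear[OF bounded_linear_inner_left assms, of b]] by simp
  have s: "(\<lambda>x. \<Sum>b\<in>B. \<bar>f x \<bullet> b\<bar>) summable_on A" if "finite B" for B
    using that by (induction B) (auto intro: summable_on_add b)
  show ?thesis by (rule abs_summable_le[OF s[OF finite_Basis] norm_le_l1])
qed

section \<open>Convergent series as germs of functions\<close>

definition mconv :: "('c::real_normed_field, 'n::finite) mfps \<Rightarrow> bool" where
  "mconv F \<longleftrightarrow> (\<exists>r>0. mconv_at r F)"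

text \<open>As a statement about all small radii it can be intersected with finitely many others,
  which supplies common radii.\<close>

lemma mconv_eventually:
  fixes F :: "('c::{real_normed_field, banach}, 'n::finite) mfps"
  shows "mconv F \<longleftrightarrow> (\<forall>\<^sub>F r in at_right 0. mconv_at r F)"
proof
  assume "mconv F"
  then obtain r where "r > 0" "mconv_at r F" by (auto simp: mconv_def)
  then show "\<forall>\<^sub>F r in at_right 0. mconv_at r F"
    unfolding eventually_at_right_field by (intro exI[of _ r]) (auto intro: mconv_at_mono)
next
  assume "\<forall>\<^sub>F r in at_right 0. mconv_at r F"
  then have "\<forall>\<^sub>F r in at_right 0. r > 0 \<and> mconv_at r F"
    using eventually_at_right_less[of "0 :: real"] by eventually_elim simp
  from eventually_happens[OF this] show "mconv F" by (auto simp: mconv_def)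
qed

lemma eventually_small_vec:
  assumes "r > 0"
  shows "\<forall>\<^sub>F u in nhds (0 :: 'c::real_normed_vector ^ 'n::finite). (\<forall>i. norm (u $ i) \<le> r) \<and> norm u \<le> r"
proof -
  have "\<forall>\<^sub>F u in nhds (0 :: 'c ^ 'n). dist u 0 < r" using assms by (intro eventually_nhds_metric[THEN iffD2]) auto
  then show ?thesis
    by (rule eventually_mono) (auto intro!: order_trans[OF Finite_Cartesian_Product.norm_nth_le less_imp_le])
qed

lemma eventually_nhds_shift:
  fixes t :: "'b::real_normed_vector"
  shows "(\<forall>\<^sub>F x in nhds t. P x) \<longleftrightarrow> (\<forall>\<^sub>F u in nhds 0. P (t + u))"
proof
  assume "\<forall>\<^sub>F x in nhds t. P x"
  moreover have "filterlim (\<lambda>u. t + u) (nhds t) (nhds 0)"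
    using tendsto_add[OF tendsto_const[of t "nhds 0"] filterlim_ident] by simp
  ultimately show "\<forall>\<^sub>F u in nhds 0. P (t + u)" by (rule eventually_compose_filterlim)
next
  assume *: "\<forall>\<^sub>F u in nhds 0. P (t + u)"
  have "filterlim (\<lambda>x. x - t) (nhds 0) (nhds t)"
    using tendsto_diff[OF filterlim_ident tendsto_const[of t "nhds t"]] by simp
  from eventually_compose_filterlim[OF * this] show "\<forall>\<^sub>F x in nhds t. P x" by simp
qed

lemma has_mfps_expansion_iff:
  fixes f :: "'c::{real_normed_field, euclidean_space} ^ 'n::finite \<Rightarrow> 'c"
  shows "has_mfps_expansion f t F \<longleftrightarrow> mconv F \<and> (\<forall>\<^sub>F u in nhds 0. f (t + u) = meval F u)"
proof
  assume "has_mfps_expansion f t F"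
  then obtain r where r: "r > 0" and s: "\<And>u. norm u < r \<Longrightarrow> ((\<lambda>\<alpha>. mcoeff F \<alpha> * mpow u \<alpha>) has_sum f (t + u)) UNIV"
    by (auto simp: has_mfps_expansion_def)
  have "\<forall>\<^sub>F u in nhds 0. dist u 0 < r" using r by (intro eventually_nhds_metric[THEN iffD2]) auto
  then have "\<forall>\<^sub>F u in nhds 0. f (t + u) = meval F u"
    by (rule eventually_mono) (auto simp: meval_def infsumI[OF s])
  moreover have "mconv F"
  proof -
    \<comment> \<open>On the diagonal the modulus of each monomial depends on its degree alone, so
      summability at the multiple of \<open>?v\<close> by \<open>s\<close> is convergence at radius
      \<open>s\<close>.\<close>
    let ?v = "(\<chi> i. 1) :: 'c ^ 'n"
    have "((\<lambda>s. s *\<^sub>R ?v) \<longlongrightarrow> 0 *\<^sub>R ?v) (at_right (0 :: real))"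
      by (intro tendsto_intros)
    then have "((\<lambda>s. norm (s *\<^sub>R ?v)) \<longlongrightarrow> 0) (at_right (0 :: real))"
      by (intro tendsto_norm_zero) simp
    from order_tendstoD(2)[OF this r] have "\<forall>\<^sub>F s in at_right 0. mconv_at s F"
      using eventually_at_right_less[of "0 :: real"]
    proof eventually_elim
      case (elim s)
      let ?u = "s *\<^sub>R ?v"
      have "(\<lambda>\<alpha>. mcoeff F \<alpha> * mpow ?u \<alpha>) abs_summable_on UNIV"
        using s[OF elim(1)] by (intro summable_imp_abs_summable has_sum_imp_summable)
      moreover have "norm (mpow ?u \<alpha>) = s ^ mdeg \<alpha>" for \<alpha>
        using elim(2) by (simp add: prod_norm[symmetric] norm_power power_sum)
      ultimately show ?case by (simp add: mconv_at_def norm_mult)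
    qed
    then show ?thesis by (simp add: mconv_eventually)
  qed
  ultimately show "mconv F \<and> (\<forall>\<^sub>F u in nhds 0. f (t + u) = meval F u)" by blast
next
  assume *: "mconv F \<and> (\<forall>\<^sub>F u in nhds 0. f (t + u) = meval F u)"
  then obtain r where r: "r > 0" "mconv_at r F" by (auto simp: mconv_def)
  from * eventually_small_vec[OF r(1), where 'c = 'c and 'n = 'n]
  have "\<forall>\<^sub>F u in nhds 0. f (t + u) = meval F u \<and> (\<forall>i. norm (u $ i) \<le> r)"
    by (auto elim: eventually_elim2)
  then obtain d where d: "d > 0" "\<And>u. dist u 0 < d \<Longrightarrow> f (t + u) = meval F u \<and> (\<forall>i. norm (u $ i) \<le> r)"
    unfolding eventually_nhds_metric by blast
  then show "has_mfps_expansion f t F"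
    unfolding has_mfps_expansion_def using meval_has_sum[OF r(2)] by (intro exI[of _ d]) auto
qed

section \<open>Re-expansion at nearby points\<close>

lemma binom_splits:
  fixes u v :: "'a::comm_ring_1 ^ 'n::finite"
  shows "(\<Sum>p\<in>midx_splits \<gamma>. (\<Prod>i\<in>UNIV. of_nat ((fst p i + snd p i) choose fst p i)) * (mpow u (fst p) * mpow v (snd p))) = mpow (u + v) \<gamma>"
proof -
  have "mpow (u + v) \<gamma> = (\<Prod>i\<in>UNIV. \<Sum>k\<in>{..\<gamma> i}. of_nat (\<gamma> i choose k) * (u $ i) ^ k * (v $ i) ^ (\<gamma> i - k))"
    by (simp add: binomial_ring)
  also have "\<dots> = (\<Sum>g\<in>PiE UNIV (\<lambda>i. {..\<gamma> i}). \<Prod>i\<in>UNIV. of_nat (\<gamma> i choose g i) * (u $ i) ^ g i * (v $ i) ^ (\<gamma> i - g i))"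
    by (rule prod_sum_PiE) auto
  also have "\<dots> = (\<Sum>p\<in>midx_splits \<gamma>. (\<Prod>i\<in>UNIV. of_nat ((fst p i + snd p i) choose fst p i)) * (mpow u (fst p) * mpow v (snd p)))"
    by (rule sum.reindex_bij_witness[where j = "\<lambda>g. (g, \<lambda>i. \<gamma> i - g i)" and i = fst])
       (auto simp: midx_splits_def prod.distrib PiE_def Pi_def mult.assoc)
  finally show ?thesis ..
qed

definition mtaylor :: "'c::real_normed_field ^ 'n::finite \<Rightarrow> ('c, 'n) mfps \<Rightarrow> ('c, 'n) mfps" where
  "mtaylor t F = Abs_mfps (\<lambda>\<alpha>. meval (taylor_coeff \<alpha> F) t)"

context
  fixes F :: "('c::{real_normed_field, banach}, 'n::finite) mfps" and r :: real
  assumes F: "mconv_at r F" and r: "0 < r"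
begin

text \<open>By the binomial theorem for \<open>r / 2 + r / 2\<close> the terms with a given sum of
  indices add up to the term of \<open>F\<close> at radius \<open>r\<close>. One half of the radius
  is spent on the base point, the other on the increment.\<close>

lemma taylor_double_summable:
  "(\<lambda>p. norm (mcoeff (taylor_coeff (fst p) F) (snd p)) * ((r / 2) ^ mdeg (fst p) * (r / 2) ^ mdeg (snd p))) summable_on UNIV"
proof -
  let ?h = "\<lambda>p. norm (mcoeff (taylor_coeff (fst p) F) (snd p)) * ((r / 2) ^ mdeg (fst p) * (r / 2) ^ mdeg (snd p))"
  have "(\<Sum>p\<in>midx_splits \<gamma>. norm (?h p)) = norm (mcoeff F \<gamma>) * r ^ mdeg \<gamma>" for \<gamma>
  proof -
    have m: "mpow (\<chi> i. s) \<alpha> = s ^ mdeg \<alpha>" for s :: real and \<alpha> :: "'n \<Rightarrow> nat" by (simp add: power_sum)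
    have "(\<chi> i. r / 2) + (\<chi> i. r / 2) = ((\<chi> i. r) :: real ^ 'n)" by (simp add: vec_eq_iff)
    with binom_splits[of "(\<chi> i. r / 2) :: (real, 'n) vec" "(\<chi> i. r / 2)" \<gamma>]
    have b: "(\<Sum>p\<in>midx_splits \<gamma>. (\<Prod>i\<in>UNIV. real ((fst p i + snd p i) choose fst p i)) * ((r / 2) ^ mdeg (fst p) * (r / 2) ^ mdeg (snd p))) = r ^ mdeg \<gamma>"
      by (simp only: m)
    have "(\<Sum>p\<in>midx_splits \<gamma>. norm (?h p)) = (\<Sum>p\<in>midx_splits \<gamma>. norm (mcoeff F \<gamma>) *
       ((\<Prod>i\<in>UNIV. real ((fst p i + snd p i) choose fst p i)) * ((r / 2) ^ mdeg (fst p) * (r / 2) ^ mdeg (snd p))))"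
    proof (rule sum.cong[OF refl])
      fix p assume "p \<in> midx_splits \<gamma>"
      then have p: "midx_add (fst p) (snd p) = \<gamma>" by (auto simp: midx_splits_def)
      show "norm (?h p) = norm (mcoeff F \<gamma>) *
       ((\<Prod>i\<in>UNIV. real ((fst p i + snd p i) choose fst p i)) * ((r / 2) ^ mdeg (fst p) * (r / 2) ^ mdeg (snd p)))"
        using r by (simp add: taylor_coeff_def p norm_mult prod_norm[symmetric] abs_mult abs_prod)
    qed
    then show ?thesis by (simp only: sum_distrib_left[symmetric] b)
  qed
  then have "?h abs_summable_on UNIV"
    using F[unfolded mconv_at_def] by (intro midx_double_summable) simp
  then show ?thesis by (rule abs_summable_summable)
qed

lemma mconv_at_taylor_coeff: "mconv_at (r / 2) (taylor_coeff \<alpha> F)"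
  and taylor_coeff_summable: "(\<lambda>\<alpha>. mnorm (r / 2) (taylor_coeff \<alpha> F) * (r / 2) ^ mdeg \<alpha>) summable_on UNIV"
proof -
  have "(\<lambda>p. norm (mcoeff (taylor_coeff (fst p) F) (snd p)) * ((r / 2) ^ mdeg (fst p) * (r / 2) ^ mdeg (snd p))) abs_summable_on UNIV \<times> UNIV"
    using abs_summable_real_nonneg[OF taylor_double_summable] by simp
  note s = this[unfolded Infinite_Sum.abs_summable_on_Sigma_iff]
  have "(\<lambda>\<beta>. norm (mcoeff (taylor_coeff \<alpha> F) \<beta>) * ((r / 2) ^ mdeg \<alpha> * (r / 2) ^ mdeg \<beta>)) abs_summable_on UNIV"
    using bspec[OF conjunct1[OF s], of \<alpha>] by (simp only: fst_conv snd_conv UNIV_I)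
  from summable_on_cmult_right[OF abs_summable_summable[OF this], of "inverse ((r / 2) ^ mdeg \<alpha>)"]
  show "mconv_at (r / 2) (taylor_coeff \<alpha> F)"
    using r by (simp add: mconv_at_def field_simps)
  have e: "(\<Sum>\<^sub>\<infinity>\<beta>. norm (norm (mcoeff (taylor_coeff \<alpha> F) \<beta>) * ((r / 2) ^ mdeg \<alpha> * (r / 2) ^ mdeg \<beta>))) =
      mnorm (r / 2) (taylor_coeff \<alpha> F) * (r / 2) ^ mdeg \<alpha>" for \<alpha>
  proof -
    have "norm (norm (mcoeff (taylor_coeff \<alpha> F) \<beta>) * ((r / 2) ^ mdeg \<alpha> * (r / 2) ^ mdeg \<beta>)) =
       norm (mcoeff (taylor_coeff \<alpha> F) \<beta>) * (r / 2) ^ mdeg \<beta> * (r / 2) ^ mdeg \<alpha>" for \<beta>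
      using r by (simp add: abs_mult)
    then show ?thesis unfolding mnorm_def by (simp only: infsum_cmult_left')
  qed
  show "(\<lambda>\<alpha>. mnorm (r / 2) (taylor_coeff \<alpha> F) * (r / 2) ^ mdeg \<alpha>) summable_on UNIV"
    using abs_summable_summable[OF conjunct2[OF s]] by (simp only: fst_conv snd_conv e)
qed

lemma mconv_at_mtaylor:
  assumes t: "\<And>i. norm (t $ i) \<le> r / 2"
  shows "mconv_at (r / 2) (mtaylor t F)"
  unfolding mconv_at_def mtaylor_def mcoeff_Abs
  by (rule summable_on_le[OF taylor_coeff_summable])
     (use r norm_meval_le[OF mconv_at_taylor_coeff t] in \<open>auto intro!: mult_right_mono\<close>)

lemma meval_mtaylor:
  assumes t: "\<And>i. norm (t $ i) \<le> r / 2" and u: "\<And>i. norm (u $ i) \<le> r / 2"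
  shows "meval (mtaylor t F) u = meval F (t + u)"
proof -
  define h where "h p = mcoeff (taylor_coeff (fst p) F) (snd p) * (mpow u (fst p) * mpow t (snd p))" for p
  have h: "h summable_on UNIV"
  proof (rule abs_summable_summable, rule abs_summable_le[OF taylor_double_summable])
    fix p
    show "norm (h p) \<le> norm (mcoeff (taylor_coeff (fst p) F) (snd p)) * ((r / 2) ^ mdeg (fst p) * (r / 2) ^ mdeg (snd p))"
      unfolding h_def norm_mult using r
      by (intro mult_left_mono mult_mono norm_mpow_le t u) auto
  qed
  have "(\<Sum>p\<in>midx_splits \<gamma>. h p) = mcoeff F \<gamma> * mpow (u + t) \<gamma>" for \<gamma>
    unfolding binom_splits[symmetric] sum_distrib_left
    by (rule sum.cong) (auto simp: h_def taylor_coeff_def midx_splits_def mult_ac)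
  with midx_double_sum[OF h] have 1: "infsum h UNIV = meval F (u + t)"
    by (simp add: meval_def infsumI)
  have "infsum h UNIV = (\<Sum>\<^sub>\<infinity>\<alpha>. \<Sum>\<^sub>\<infinity>\<beta>. h (\<alpha>, \<beta>))"
    using infsum_Sigma_banach[of h UNIV "\<lambda>_. UNIV"] h by simp
  moreover have "(\<Sum>\<^sub>\<infinity>\<beta>. h (\<alpha>, \<beta>)) = mcoeff (mtaylor t F) \<alpha> * mpow u \<alpha>" for \<alpha>
  proof -
    have "h (\<alpha>, \<beta>) = mcoeff (taylor_coeff \<alpha> F) \<beta> * mpow t \<beta> * mpow u \<alpha>" for \<beta> by (simp add: h_def mult_ac)
    then show ?thesis by (simp add: mtaylor_def meval_def infsum_cmult_left')
  qed
  ultimately show ?thesis using 1 by (simp add: meval_def add.commute)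
qed

end

lemma meval_mconst_mult: "meval (mconst c * F) u = c * meval F u"
  by (simp add: meval_def mult.assoc infsum_cmult_right')

lemma mderiv_mtaylor: "mderiv i (mtaylor t F) = mtaylor t (mderiv i F)"
  by (rule mfps_eqI)
     (simp add: mcoeff_mderiv mtaylor_def taylor_coeff_mderiv mconst_of_nat[symmetric] meval_mconst_mult del: of_nat_Suc)

lemma mcoeff0_mtaylor: "mcoeff0 (mtaylor t F) = meval F t"
  by (simp add: mtaylor_def)

lemma taylor_coeff_unit_idx: "taylor_coeff (unit_idx i) F = mderiv i (F :: ('c::field, 'n::finite) mfps)"
proof -
  have "(\<lambda>_. 0)(i := Suc 0) = unit_idx i" by auto
  then show ?thesis using taylor_coeff_mderiv[of "\<lambda>_. 0" i F] by simp
qed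

lemma mconv_taylor_coeff: "mconv F \<Longrightarrow> mconv (taylor_coeff \<alpha> F)"
  for F :: "('c::{real_normed_field, banach}, 'n::finite) mfps"
  unfolding mconv_def using mconv_at_taylor_coeff by (metis half_gt_zero)

lemma mconv_mderiv: "mconv F \<Longrightarrow> mconv (mderiv i F)"
  for F :: "('c::{real_normed_field, banach}, 'n::finite) mfps"
  using mconv_taylor_coeff[of F "unit_idx i"] by (simp add: taylor_coeff_unit_idx)

lemma meval_diff:
  fixes F G :: "('c::{real_normed_field, banach}, 'n::finite) mfps"
  assumes "mconv_at r F" "mconv_at r G" "0 \<le> r" "\<And>i. norm (u $ i) \<le> r"
  shows "meval (F - G) u = meval F u - meval G u" and "mconv_at r (F - G)"
proof -
  have m: "F - G = F + mconst (-1) * G" by (simp add: mconst_uminus)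
  have c: "mconv_at r (mconst (-1) * G)" by (rule mconv_at_mult[OF mconv_at_mconst assms(2,3)])
  show "meval (F - G) u = meval F u - meval G u"
    unfolding m using meval_add[OF assms(1) c assms(3,4)] by (simp add: meval_mconst_mult)
  show "mconv_at r (F - G)" unfolding m by (rule mconv_at_add[OF assms(1) c assms(3)])
qed

text \<open>Along a coordinate axis the linear part grows like s, the rest at most like s^2;
  dividing by s and letting s tend to 0 isolates the derivative.\<close>

lemma mderiv_eq_0_of_meval_eq_0:
  fixes G :: "('c::{real_normed_field, banach}, 'n::finite) mfps"
  assumes r: "mconv_at r G" "r > 0" and z: "\<forall>\<^sub>F u in nhds 0. meval G u = 0"
  shows "mcoeff0 G = 0" "mcoeff0 (mderiv i G) = 0"
proof -
  show G0: "mcoeff0 G = 0" using eventually_nhds_x_imp_x[OF z] by (simp add: meval_0_arg)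
  define g where "g j = mcoeff0 (mderiv j G)" for j
  define L where "L = (\<Sum>j\<in>UNIV. mconst (g j) * mvar j :: ('c, 'n) mfps)"
  have Lc: "mconv_at r L"
    unfolding L_def using r(2) by (intro mconv_at_sum mconv_at_mult mconv_at_mconst mconv_at_mvar) simp_all
  have LE: "meval L u = (\<Sum>j\<in>UNIV. g j * u $ j)" if "\<And>i. norm (u $ i) \<le> r" for u
    unfolding L_def using r(2) that
    by (subst meval_sum[where r = r]) (auto intro!: mconv_at_mult mconv_at_mconst mconv_at_mvar simp: meval_mconst_mult meval_mvar)
  have "mord 2 (G - L)"
    by (simp add: numeral_2_eq_2 mord_Suc_iff G0 L_def mderiv_diff mderiv_sum mderiv_mvar g_def)
  have R: "mconv_at r (G - L)" by (rule meval_diff(2)[OF r(1) Lc, of 0]) (use r in auto)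
  let ?K = "mnorm r (G - L) / r ^ 2"
  let ?u = "\<lambda>s :: real. s *\<^sub>R axis i 1 :: 'c ^ 'n"
  have un: "norm (?u s $ j) \<le> s" if "s \<ge> 0" for s j using that by (simp add: axis_def)
  have "(?u \<longlongrightarrow> 0 *\<^sub>R axis i 1) (at_right (0 :: real))" by (intro tendsto_intros)
  then have lim: "filterlim ?u (nhds 0) (at_right 0)" by simp
  have "\<forall>\<^sub>F s in at_right 0. s < r"
    using r(2) unfolding eventually_at_right_field by blast
  with eventually_compose_filterlim[OF z lim] eventually_at_right_less[of "0 :: real"]
  have "\<forall>\<^sub>F s in at_right 0. norm (g i) \<le> s * ?K"
  proof eventually_elim
    case (elim s)
    have us: "norm (?u s $ j) \<le> r" for j by (rule order_trans[OF un]) (use elim in auto)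
    have "(\<Sum>j\<in>UNIV. g j * ?u s $ j) = g i * of_real s"
      by (simp add: axis_def if_distrib[of "\<lambda>x. _ * x"] if_distrib[of "\<lambda>x. _ *\<^sub>R x"] of_real_def cong: if_cong)
    then have "meval (G - L) (?u s) = - (g i * of_real s)"
      using meval_diff(1)[OF r(1) Lc _ us] r(2) elim LE[OF us] by simp
    then have "norm (g i) * s = norm (meval (G - L) (?u s))"
      using elim by (simp add: norm_mult)
    also have "\<dots> \<le> (s / r) ^ 2 * mnorm r (G - L)"
      using elim by (intro meval_bound[OF R \<open>mord 2 (G - L)\<close> r(2)] un) auto
    finally have "norm (g i) * s \<le> (s * ?K) * s" by (simp add: power2_eq_square mult_ac)
    then show ?case using elim by (simp only: mult_le_cancel_right_pos)
  qed
  moreover have "((\<lambda>s. s * ?K) \<longlongrightarrow> 0 * ?K) (at_right 0)" by (intro tendsto_intros)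
  ultimately have "norm (g i) \<le> 0 * ?K"
    by (intro tendsto_lowerbound[where F = "at_right (0 :: real)"]) auto
  then show "mcoeff0 (mderiv i G) = 0" by (simp add: g_def)
qed

text \<open>A function vanishing near 0 also vanishes near every close point t. Re-expansion at t
  and the first-order case show that its derivatives vanish there too, so the order can be raised by
  induction.\<close>

lemma meval_eq_0_imp_eq_0:
  fixes F :: "('c::{real_normed_field, banach}, 'n::finite) mfps"
  assumes "mconv F" "\<forall>\<^sub>F u in nhds 0. meval F u = 0"
  shows "F = 0"
proof -
  have "mord d F" for d
    using assms
  proof (induction d arbitrary: F)
    case (Suc d)
    then obtain r where r: "r > 0" "mconv_at r F" by (auto simp: mconv_def)
    have "mord d (mderiv i F)" for i
    proof (rule Suc.IH[OF mconv_mderiv[OF Suc.prems(1)]])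
      have "\<forall>\<^sub>F t in nhds 0. \<forall>\<^sub>F y in nhds t. meval F y = 0" using Suc.prems(2) by (simp add: eventually_eventually)
      then show "\<forall>\<^sub>F t in nhds 0. meval (mderiv i F) t = 0"
        using eventually_small_vec[OF half_gt_zero[OF r(1)]]
      proof eventually_elim
        case (elim t)
        then have t: "\<And>i. norm (t $ i) \<le> r / 2" by blast
        have "\<forall>\<^sub>F u in nhds 0. meval (mtaylor t F) u = 0"
          using elim(1)[unfolded eventually_nhds_shift[of _ t]] eventually_small_vec[OF half_gt_zero[OF r(1)], where 'c = 'c and 'n = 'n]
          by eventually_elim (simp add: meval_mtaylor[OF r(2,1) t])
        from mderiv_eq_0_of_meval_eq_0(2)[OF mconv_at_mtaylor[OF r(2,1) t] half_gt_zero[OF r(1)] this, of i]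
        show ?case by (simp add: mderiv_mtaylor mcoeff0_mtaylor)
      qed
    qed
    moreover have "mcoeff0 F = 0" using mderiv_eq_0_of_meval_eq_0(1)[OF r(2,1) Suc.prems(2)] .
    ultimately show ?case by (simp add: mord_Suc_iff)
  qed simp
  then show ?thesis by (rule mord_all)
qed

lemma mconv_mconst [intro, simp]: "mconv (mconst c)"
  unfolding mconv_def using mconv_at_mconst zero_less_one by blast

lemma mconv_mvar [intro, simp]: "mconv (mvar i)"
  unfolding mconv_def using mconv_at_mvar zero_less_one by blast

context
  fixes F G :: "('c::{real_normed_field, banach}, 'n::finite) mfps"
  assumes F: "mconv F" and G: "mconv G"
begin

lemma mconv_common: "\<exists>r>0. mconv_at r F \<and> mconv_at r G"
proof -
  have "\<forall>\<^sub>F r in at_right 0. r > 0 \<and> mconv_at r F \<and> mconv_at r G"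
    using eventually_at_right_less[of "0 :: real"] F[unfolded mconv_eventually] G[unfolded mconv_eventually]
    by eventually_elim simp
  from eventually_happens[OF this] show ?thesis by auto
qed

lemma mconv_add: "mconv (F + G)" and mconv_diff: "mconv (F - G)" and mconv_mult: "mconv (F * G)"
proof -
  from mconv_common obtain r where r: "r > 0" "mconv_at r F" "mconv_at r G" by blast
  show "mconv (F + G)" using r mconv_at_add[OF r(2,3)] by (auto simp: mconv_def)
  show "mconv (F - G)" using r meval_diff(2)[OF r(2,3), of 0] by (auto simp: mconv_def)
  show "mconv (F * G)" using r mconv_at_mult[OF r(2,3)] by (auto simp: mconv_def)
qed

lemma eventually_meval_add: "\<forall>\<^sub>F u in nhds 0. meval (F + G) u = meval F u + meval G u"
  and eventually_meval_diff: "\<forall>\<^sub>F u in nhds 0. meval (F - G) u = meval F u - meval G u"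
  and eventually_meval_mult: "\<forall>\<^sub>F u in nhds 0. meval (F * G) u = meval F u * meval G u"
proof -
  from mconv_common obtain r where r: "r > 0" "mconv_at r F" "mconv_at r G" by blast
  note * = eventually_small_vec[OF r(1), where 'c = 'c and 'n = 'n]
  show "\<forall>\<^sub>F u in nhds 0. meval (F + G) u = meval F u + meval G u"
    using * by eventually_elim (use r meval_add[OF r(2,3)] in auto)
  show "\<forall>\<^sub>F u in nhds 0. meval (F - G) u = meval F u - meval G u"
    using * by eventually_elim (use r meval_diff(1)[OF r(2,3)] in auto)
  show "\<forall>\<^sub>F u in nhds 0. meval (F * G) u = meval F u * meval G u"
    using * by eventually_elim (use r meval_mult[OF r(2,3)] in auto)
qed

end

lemma mconv_sum: "(\<And>x. x \<in> A \<Longrightarrow> mconv (f x)) \<Longrightarrow> mconv (sum f A)"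
  for f :: "'b \<Rightarrow> ('c::{real_normed_field, banach}, 'n::finite) mfps"
  using mconv_mconst[of 0] by (induction A rule: infinite_finite_induct) (auto intro: mconv_add)

lemma mconv_power: "mconv F \<Longrightarrow> mconv (F ^ k)"
  for F :: "('c::{real_normed_field, banach}, 'n::finite) mfps"
  using mconv_mconst[of 1] by (induction k) (auto intro: mconv_mult)

lemma tendsto_meval:
  fixes F :: "('c::{real_normed_field, banach}, 'n::finite) mfps"
  assumes "mconv F"
  shows "(meval F \<longlongrightarrow> mcoeff0 F) (nhds 0)"
proof -
  obtain r where r: "r > 0" "mconv_at r F" using assms by (auto simp: mconv_def)
  let ?G = "F - mconst (mcoeff0 F)"
  have G: "mconv_at r ?G" by (rule meval_diff(2)[OF r(2) mconv_at_mconst, of 0]) (use r in auto)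
  have "\<forall>\<^sub>F u in nhds 0. norm (meval ?G u) \<le> norm u * (mnorm r ?G / r)"
    using eventually_small_vec[OF r(1), where 'c = 'c and 'n = 'n]
  proof eventually_elim
    case (elim u)
    have "norm (meval ?G u) \<le> (norm u / r) ^ Suc 0 * mnorm r ?G"
      using elim by (intro meval_bound[OF G _ r(1)]) (auto simp: mord_1 Finite_Cartesian_Product.norm_nth_le)
    then show ?case by simp
  qed
  from tendsto_0_le[OF filterlim_ident this] have "(meval ?G \<longlongrightarrow> 0) (nhds 0)" .
  then have "((\<lambda>u. meval ?G u + mcoeff0 F) \<longlongrightarrow> 0 + mcoeff0 F) (nhds 0)" by (intro tendsto_intros)
  moreover have "\<forall>\<^sub>F u in nhds 0. meval ?G u + mcoeff0 F = meval F u"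
    using eventually_meval_diff[OF assms mconv_mconst, of "mcoeff0 F"]
    by eventually_elim (simp add: meval_mconst)
  ultimately show ?thesis by (simp add: tendsto_cong)
qed

section \<open>Convergence of composites, inverses, roots and quotients\<close>

lemma eventually_mnorm_le:
  fixes F :: "('c::{real_normed_field, banach}, 'n::finite) mfps"
  assumes "mconv F" "mcoeff0 F = 0" "e > 0"
  shows "\<forall>\<^sub>F r in at_right 0. mconv_at r F \<and> mnorm r F \<le> e"
proof -
  obtain R where R: "R > 0" "mconv_at R F" using assms by (auto simp: mconv_def)
  have "((\<lambda>r. (r / R) * mnorm R F) \<longlongrightarrow> (0 / R) * mnorm R F) (at_right 0)" using R by (intro tendsto_intros) auto
  from order_tendstoD(2)[OF this] assms(3) have "\<forall>\<^sub>F r in at_right 0. (r / R) * mnorm R F < e" by simp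
  moreover have "\<forall>\<^sub>F r in at_right 0. r < R" using R(1) unfolding eventually_at_right_field by blast
  ultimately show ?thesis
    using eventually_at_right_less[of "0 :: real"] assms(1)[unfolded mconv_eventually]
  proof eventually_elim
    case (elim r)
    have "mnorm r F \<le> (r / R) ^ Suc 0 * mnorm R F"
      using elim R assms(2) by (intro mnorm_shrink[OF R(2)]) (auto simp: mord_1)
    then show ?case using elim by simp
  qed
qed

lemma
  fixes F :: "('c::{real_normed_field, banach}, 'm::finite) mfps" and s :: "'m \<Rightarrow> ('c, 'n::finite) mfps"
  assumes F: "mconv F" and s: "\<And>i. mconv (s i)" "\<And>i. mcoeff0 (s i) = 0"
  shows mconv_msubst: "mconv (msubst F s)"
    and eventually_meval_msubst: "\<forall>\<^sub>F u in nhds 0. meval (msubst F s) u = meval F (\<chi> i. meval (s i) u)"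
proof -
  obtain \<rho> where \<rho>: "\<rho> > 0" "mconv_at \<rho> F" using F by (auto simp: mconv_def)
  have "\<forall>\<^sub>F r in at_right 0. r > 0 \<and> (\<forall>i. mconv_at r (s i) \<and> mnorm r (s i) \<le> \<rho>)"
    using eventually_at_right_less[of "0 :: real"] eventually_all_finite[OF eventually_mnorm_le[OF s \<rho>(1)]]
    by eventually_elim simp
  from eventually_happens[OF this] obtain r where r: "r > 0" "\<And>i. mconv_at r (s i)" "\<And>i. mnorm r (s i) \<le> \<rho>" by auto
  show "mconv (msubst F s)"
    unfolding mconv_def using mconv_at_msubst[OF \<rho>(2) _ r(2,3) s(2)] r(1) by (intro exI[of _ r]) auto
  show "\<forall>\<^sub>F u in nhds 0. meval (msubst F s) u = meval F (\<chi> i. meval (s i) u)"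
    using eventually_small_vec[OF r(1), where 'c = 'c and 'n = 'n]
    by eventually_elim (use r(1) meval_msubst[OF \<rho>(2) _ r(2,3) s(2)] in auto)
qed

text \<open>A finite partial sum involves coefficients up to some degree only, and there
  \<open>F\<close> agrees with one of the \<open>S k\<close>; a uniform bound on the norms therefore
  suffices.\<close>

lemma mconv_at_limit:
  fixes F :: "('c::real_normed_field, 'n::finite) mfps"
  assumes r: "0 \<le> r" and S: "\<And>k. mconv_at r (S k)" "\<And>k. mnorm r (S k) \<le> C"
    and F: "\<And>k \<alpha>. mdeg \<alpha> \<le> k \<Longrightarrow> mcoeff F \<alpha> = mcoeff (S k) \<alpha>"
  shows "mconv_at r F"
  unfolding mconv_at_def
proof (rule nonneg_bdd_above_summable_on)
  show "bdd_above (sum (\<lambda>\<alpha>. norm (mcoeff F \<alpha>) * r ^ mdeg \<alpha>) ` {A. A \<subseteq> UNIV \<and> finite A})"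
  proof (rule bdd_aboveI2)
    fix A :: "('n \<Rightarrow> nat) set" assume "A \<in> {A. A \<subseteq> UNIV \<and> finite A}"
    then have A: "finite A" by simp
    define k where "k = (\<Sum>\<alpha>\<in>A. mdeg \<alpha>)"
    have "mdeg \<alpha> \<le> k" if "\<alpha> \<in> A" for \<alpha> unfolding k_def using that A by (intro member_le_sum) auto
    then have "(\<Sum>\<alpha>\<in>A. norm (mcoeff F \<alpha>) * r ^ mdeg \<alpha>) = (\<Sum>\<alpha>\<in>A. norm (mcoeff (S k) \<alpha>) * r ^ mdeg \<alpha>)"
      using F[of _ k] by (intro sum.cong) auto
    also have "\<dots> \<le> mnorm r (S k)"
      unfolding mnorm_def using S(1)[unfolded mconv_at_def] A r by (intro finite_sum_le_infsum) auto
    finally show "(\<Sum>\<alpha>\<in>A. norm (mcoeff F \<alpha>) * r ^ mdeg \<alpha>) \<le> C" using S(2)[of k] by linarith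
  qed
qed (use r in auto)

lemma mconv_minv:
  fixes F :: "('c::{real_normed_field, banach}, 'n::finite) mfps"
  assumes F: "mconv F" and F0: "mcoeff0 F \<noteq> 0"
  shows "mconv (minv F)"
proof -
  define W where "W = 1 - mconst (1 / mcoeff0 F) * F"
  have W0: "mcoeff0 W = 0" using F0 by (simp add: W_def)
  have W: "mconv W" unfolding W_def mconst_1[symmetric] by (intro mconv_diff mconv_mult mconv_mconst F)
  have "\<forall>\<^sub>F r in at_right 0. r > 0 \<and> mconv_at r W \<and> mnorm r W \<le> 1 / 2"
    using eventually_at_right_less[of "0 :: real"] eventually_mnorm_le[OF W W0, of "1 / 2"]
    by (auto elim: eventually_elim2)
  from eventually_happens[OF this] obtain r where r: "0 \<le> r" "r > 0" "mconv_at r W" "mnorm r W \<le> 1 / 2" by auto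
  have u: "(1 - W) * minv (1 - W) = 1" by (rule mult_minv) (simp add: W0)
  define S where "S k = (\<Sum>j\<le>k. W ^ j)" for k
  have S_Suc: "S (Suc k) = mconst 1 + W * S k" for k
    unfolding S_def sum.atMost_Suc_shift by (simp add: sum_distrib_left)
  \<comment> \<open>As \<open>W\<close> has norm at most 1/2, the recursion S \<mapsto> 1 + W S
    preserves the ball of radius 2.\<close>
  have S: "mconv_at r (S k) \<and> mnorm r (S k) \<le> 2" for k
  proof (induction k)
    case 0
    have "S 0 = mconst 1" by (simp add: S_def)
    then show ?case by (simp only: mconv_at_mconst mnorm_mconst) simp
  next
    case (Suc k)
    have c: "mconv_at r (W * S k)" using Suc by (intro mconv_at_mult r) auto
    have "mnorm r (W * S k) \<le> mnorm r W * mnorm r (S k)" using Suc by (intro mnorm_mult r) auto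
    also have "\<dots> \<le> 1 / 2 * 2" using Suc r mnorm_nonneg[OF r(1)] by (intro mult_mono) auto
    finally have "mnorm r (S (Suc k)) \<le> 1 + 1"
      unfolding S_Suc using mnorm_add[OF mconv_at_mconst c r(1), of 1] by (simp only: mnorm_mconst) simp
    then show ?case using mconv_at_add[OF mconv_at_mconst c r(1), of 1] by (simp add: S_Suc)
  qed
  have "mconv_at r (minv (1 - W))"
  proof (rule mconv_at_limit[of r S 2])
    fix k \<alpha> assume k: "mdeg (\<alpha> :: 'n \<Rightarrow> nat) \<le> k"
    have "minv (1 - W) * ((1 - W) * S k) = S k * ((1 - W) * minv (1 - W))" by (simp only: mult_ac)
    then have "minv (1 - W) * (1 - W ^ Suc k) = S k" unfolding S_def sum_gp_basic u by simp
    then have "minv (1 - W) - S k = minv (1 - W) * W ^ Suc k" by (simp add: algebra_simps)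
    moreover have "mord (Suc k * Suc 0) (W ^ Suc k)" by (rule mord_power) (simp add: mord_1 W0)
    ultimately have "mord (Suc k) (minv (1 - W) - S k)" by (simp only: mord_mult_left mult_1_right One_nat_def[symmetric])
    then show "mcoeff (minv (1 - W)) \<alpha> = mcoeff (S k) \<alpha>" using k by (simp add: mord_def)
  qed (use r S in auto)
  then have "mconv (minv (1 - W))" using r(2) by (auto simp: mconv_def)
  moreover have "minv F = mconst (1 / mcoeff0 F) * minv (1 - W)"
  proof (rule minv_unique)
    have "F * (mconst (1 / mcoeff0 F) * minv (1 - W)) = (mconst (1 / mcoeff0 F) * F) * minv (1 - W)" by (simp only: mult_ac)
    also have "mconst (1 / mcoeff0 F) * F = 1 - W" by (simp add: W_def)
    finally show "F * (mconst (1 / mcoeff0 F) * minv (1 - W)) = 1" unfolding u .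
  qed
  ultimately show ?thesis by (simp add: mconv_mult)
qed

text \<open>All iterates stay in the ball of radius \<delta>: for small \<open>r\<close> the term
  \<open>L\<close> takes up at most half of it, and \<rho> takes up at most the other half because
  its order 2 makes it decay quadratically.\<close>

lemma mconv_inv_lim:
  fixes \<rho> :: "'m::finite \<Rightarrow> ('c::{real_normed_field, banach}, 'm) mfps" and L :: "'m \<Rightarrow> ('c, 'n::finite) mfps"
  assumes \<rho>: "\<And>i. mconv (\<rho> i)" "\<And>i. mord 2 (\<rho> i)" and L: "\<And>i. mconv (L i)" "\<And>i. mcoeff0 (L i) = 0"
  shows "mconv (inv_lim \<rho> L i)"
proof -
  have "\<forall>\<^sub>F r in at_right 0. r > 0 \<and> (\<forall>i. mconv_at r (\<rho> i))"
    using eventually_at_right_less[of "0 :: real"] eventually_all_finite[OF \<rho>(1)[unfolded mconv_eventually]]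
    by eventually_elim simp
  from eventually_happens[OF this] obtain R where R: "R > 0" "\<And>i. mconv_at R (\<rho> i)" by auto
  define K where "K = (\<Sum>i\<in>UNIV. mnorm R (\<rho> i)) + 1"
  have K: "mnorm R (\<rho> i) \<le> K" for i
  proof -
    have "mnorm R (\<rho> i) \<le> (\<Sum>i\<in>UNIV. mnorm R (\<rho> i))" by (rule member_le_sum) (use R(1) in \<open>auto intro: mnorm_nonneg\<close>)
    then show ?thesis by (simp add: K_def)
  qed
  have K0: "K > 0" unfolding K_def using mnorm_nonneg[of R] R(1) by (intro add_nonneg_pos sum_nonneg) auto
  \<comment> \<open>So small that (\<delta>/R)^2 K is at most \<delta>/2.\<close>
  define \<delta> where "\<delta> = min R (R ^ 2 / (2 * K))"
  have \<delta>: "\<delta> > 0" "\<delta> \<le> R" using R(1) K0 by (auto simp: \<delta>_def)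
  have half: "(\<delta> / R) ^ 2 * mnorm R (\<rho> i) \<le> \<delta> / 2" for i
  proof -
    have "(\<delta> / R) ^ 2 * mnorm R (\<rho> i) \<le> (\<delta> / R) ^ 2 * K" using K by (intro mult_left_mono) auto
    also have "\<dots> = \<delta> * (\<delta> * K / R ^ 2)" by (simp add: power2_eq_square)
    also have "\<dots> \<le> \<delta> * (1 / 2)"
    proof (rule mult_left_mono)
      have "\<delta> * K \<le> R ^ 2 / (2 * K) * K" using K0 by (intro mult_right_mono) (auto simp: \<delta>_def)
      then show "\<delta> * K / R ^ 2 \<le> 1 / 2" using K0 R(1) by (simp add: field_simps)
    qed (use \<delta> in simp)
    finally show ?thesis by simp
  qed
  have "\<forall>\<^sub>F r in at_right 0. r > 0 \<and> (\<forall>i. mconv_at r (L i) \<and> mnorm r (L i) \<le> \<delta> / 2)"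
    using eventually_at_right_less[of "0 :: real"] eventually_all_finite[OF eventually_mnorm_le[OF L half_gt_zero[OF \<delta>(1)]]]
    by eventually_elim simp
  from eventually_happens[OF this] obtain r where r: "0 \<le> r" "r > 0" "\<And>i. mconv_at r (L i)" "\<And>i. mnorm r (L i) \<le> \<delta> / 2" by auto
  have it: "mconv_at r (inv_iter \<rho> L k i) \<and> mnorm r (inv_iter \<rho> L k i) \<le> \<delta>" for k i
  proof (induction k arbitrary: i)
    case 0
    have "mconv_at r (mconst 0 :: ('c, 'n) mfps)" "mnorm r (mconst 0 :: ('c, 'n) mfps) = norm (0 :: 'c)"
      by (rule mconv_at_mconst mnorm_mconst)+
    then show ?case using \<delta> by simp
  next
    case (Suc k)
    have d: "mconv_at \<delta> (\<rho> i)" by (rule mconv_at_mono[OF R(2)]) (use \<delta> in auto)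
    note h = d r(1) conjunct1[OF Suc] conjunct2[OF Suc] mcoeff0_inv_iter[OF \<rho>(2) L(2)]
    have "mnorm r (msubst (\<rho> i) (inv_iter \<rho> L k)) \<le> mnorm \<delta> (\<rho> i)" by (rule mnorm_msubst[where s = "inv_iter \<rho> L k", OF h])
    also have "\<dots> \<le> (\<delta> / R) ^ 2 * mnorm R (\<rho> i)" using \<delta> R by (intro mnorm_shrink \<rho>(2)) auto
    also note half
    finally show ?case
      using mconv_at_add[OF r(3) mconv_at_msubst[where s = "inv_iter \<rho> L k", OF h] r(1)]
        mnorm_add[OF r(3) mconv_at_msubst[where s = "inv_iter \<rho> L k", OF h] r(1), of i] r(4)[of i] by simp
  qed
  have "mconv_at r (inv_lim \<rho> L i)"
    by (rule mconv_at_limit[of r "\<lambda>k. inv_iter \<rho> L k i" \<delta>]) (use it r mcoeff_inv_lim[OF \<rho>(2) L(2)] in auto)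
  then show ?thesis using r(2) by (auto simp: mconv_def)
qed

lemma mconv_mshift:
  fixes W :: "('c::{real_normed_field, banach}, 'n::finite) mfps"
  assumes "mconv W"
  shows "mconv (mshift l W)"
proof -
  obtain r where r: "r > 0" "mconv_at r W" using assms by (auto simp: mconv_def)
  let ?j = "\<lambda>\<alpha> :: 'n \<Rightarrow> nat. \<alpha>(l := Suc (\<alpha> l))"
  have inj: "inj ?j" by (rule injI) (metis fun_upd_eqD fun_upd_triv fun_upd_upd nat.inject)
  have "(\<lambda>\<alpha>. norm (mcoeff W \<alpha>) * r ^ mdeg \<alpha>) summable_on range ?j"
    by (rule summable_on_subset_banach[OF r(2)[unfolded mconv_at_def]]) simp
  then have "(\<lambda>\<alpha>. norm (mcoeff W (?j \<alpha>)) * r ^ Suc (mdeg \<alpha>)) summable_on UNIV"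
    unfolding summable_on_reindex[OF inj] o_def mdeg_upd_Suc .
  from summable_on_cmult_right[OF this, of "inverse r"] have "mconv_at r (mshift l W)"
    using r(1) by (simp add: mconv_at_def mshift_def field_simps)
  then show ?thesis using r(1) by (auto simp: mconv_def)
qed

lemma mconv_mdivide:
  fixes z W :: "('c::{real_normed_field, banach}, 'n::finite) mfps"
  assumes "mconv z" "mcoeff0 z = 0" "mconv W"
  shows "mconv (mdivide l z W)"
  unfolding mdivide_def
  using assms by (intro mconv_msubst mconv_mshift) (auto intro: mconv_add mconv_diff)

lemma mconv_mfps_inverse:
  fixes s :: "'n::finite \<Rightarrow> ('c::{real_normed_field, banach}, 'n) mfps"
  assumes "\<And>i. mconv (s i)" "\<And>i. mcoeff0 (s i) = 0" "invertible (\<chi> i j. mcoeff0 (mderiv j (s i)))"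
  shows "mconv (mfps_inverse s i)"
  unfolding mfps_inverse_def Let_def
  using assms(1) mord_inv_rest[OF assms(2,3)]
  by (intro mconv_inv_lim) (auto simp: inv_rest_def lin_form_def intro!: mconv_diff mconv_sum mconv_mult)

lemma mconv_mfps_sqrt:
  fixes W :: "('c::{real_normed_field, banach}, 'n::finite) mfps"
  assumes "mconv W" "mcoeff0 W = 1"
  shows "mconv (mfps_sqrt W)"
proof -
  have one: "mconv (1 :: ('c, 'n) mfps)" unfolding mconst_1[symmetric] by (rule mconv_mconst)
  have "mord 2 (mconst (- 1 / 2) * (mvar () * mvar ()) :: ('c, unit) mfps)"
    using mord_mult[OF mord_mvar mord_mvar, of "()" "()"] by (subst mord_mult_left) (simp_all add: numeral_2_eq_2)
  then show ?thesis
    unfolding mfps_sqrt_def mconst_1[symmetric]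
    using assms one by (intro mconv_add mconv_mconst mconv_inv_lim) (auto intro!: mconv_diff mconv_mult)
qed

lemma mconv_hcoord: "mconv (hcoord Q i :: ('c::{real_normed_field, banach}, 'n::finite hindex) mfps)"
  by (simp add: hcoord_def mconv_add)

lemma mconv_dehom_arg:
  fixes X :: "'n::finite hindex \<Rightarrow> ('c::{real_normed_field, banach}, 'm::finite) mfps"
  shows "(\<And>a. mconv (X a)) \<Longrightarrow> mcoeff0 (X Zeroth) \<noteq> 0 \<Longrightarrow> mconv (dehom_arg Q X i)"
  unfolding dehom_arg_def by (intro mconv_diff mconv_mult mconv_minv mconv_mconst)

lemma mconv_formal_dehom:
  fixes F :: "('c::{real_normed_field, banach}, 'n::finite) mfps"
  assumes "mconv F" "Q $ Zeroth \<noteq> 0"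
  shows "mconv (formal_dehom Q F)"
  unfolding formal_dehom_eq using assms
  by (intro mconv_msubst mconv_dehom_arg mconv_hcoord mcoeff0_dehom_arg) auto

lemma mconv_cone_image:
  fixes F :: "('c::{real_normed_field, banach}, 'n::finite) mfps"
  assumes "mconv F"
  shows "mconv (cone_image M p F a)"
proof -
  have "mconv (cone_param p F b)" for b
    using assms mconv_mconst[of 1] by (cases b) (auto intro: mconv_add)
  then show ?thesis unfolding cone_image_def by (intro mconv_sum mconv_mult mconv_mconst)
qed

lemma mconv_cotheta:
  fixes F :: "('c::{real_normed_field, banach}, 'n::finite) mfps"
  shows "mconv F \<Longrightarrow> mconv (cotheta N p F)"
  unfolding cotheta_def cone_param_simps by (intro mconv_diff mconv_sum mconv_mult mconv_mconst mconv_mderiv mconv_add mconv_mvar)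

context
  fixes M :: "'c::{real_normed_field, banach} ^ 'n::finite hindex ^ 'n hindex" and p :: "'c ^ 'n" and F :: "('c, 'n) mfps"
  assumes M: "invertible M" and lam0: "mcoeff0 (cone_image M p F Zeroth) \<noteq> 0"
    and cot0: "mcoeff0 (cotheta (matrix_inv M) p F) \<noteq> 0" and F: "mconv F"
begin

lemma mconv_image_inverse: "mconv (image_inverse M p F i)"
  unfolding image_inverse_def
proof (rule mconv_mfps_inverse)
  show "mconv (image_arg M p F i)" for i
    unfolding image_arg_def by (intro mconv_dehom_arg mconv_cone_image F lam0)
qed (rule mcoeff0_image_arg[OF M lam0 cot0] invertible_image_arg[OF M lam0 cot0])+

lemma mconv_image_F: "mconv (image_F M p F)"
  unfolding image_F_def
  by (intro mconv_msubst mconv_mult mconv_minv mconv_cone_image F lam0 mconv_image_inverse mcoeff0_image_inverse[OF M lam0 cot0])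

lemma mconv_image_G: "mconv R \<Longrightarrow> mconv G \<Longrightarrow> mconv (image_G M p F R G)"
  unfolding image_G_def
  by (intro mconv_msubst mconv_mult mconv_minv mconv_cone_image mconv_cotheta F lam0 cot0 mconv_image_inverse mcoeff0_image_inverse[OF M lam0 cot0])

end

section \<open>Analytic functions\<close>

lemma eventually_nhds_diff: "\<forall>\<^sub>F u in nhds 0. P u \<Longrightarrow> \<forall>\<^sub>F x in nhds t. P (x - t)"
  for t :: "'b::real_normed_vector"
  by (simp add: eventually_nhds_shift[of _ t])

lemma expansion_iff:
  fixes f :: "'c::{real_normed_field, euclidean_space} ^ 'n::finite \<Rightarrow> 'c"
  shows "has_mfps_expansion f t F \<longleftrightarrow> mconv F \<and> (\<forall>\<^sub>F x in nhds t. f x = meval F (x - t))"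
  by (simp add: has_mfps_expansion_iff eventually_nhds_shift[of _ t])

lemma expansion_meval: "mconv F \<Longrightarrow> has_mfps_expansion (\<lambda>x. meval F (x - t)) t F"
  for t :: "'c::{real_normed_field, euclidean_space} ^ 'n::finite"
  by (simp add: expansion_iff)

lemma expansion_mconv: "has_mfps_expansion f t F \<Longrightarrow> mconv F"
  for t :: "'c::{real_normed_field, euclidean_space} ^ 'n::finite"
  by (simp add: expansion_iff)

context
  fixes f g :: "'c::{real_normed_field, euclidean_space} ^ 'n::finite \<Rightarrow> 'c" and t F
  assumes F: "has_mfps_expansion f t F"
begin

lemma expansion_cong: "\<forall>\<^sub>F x in nhds t. f x = g x \<Longrightarrow> has_mfps_expansion g t F"
proof -
  assume "\<forall>\<^sub>F x in nhds t. f x = g x"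
  moreover have "\<forall>\<^sub>F x in nhds t. f x = meval F (x - t)" using F by (simp add: expansion_iff)
  ultimately have "\<forall>\<^sub>F x in nhds t. g x = meval F (x - t)" by eventually_elim simp
  then show ?thesis using F by (simp add: expansion_iff)
qed

lemma expansion_value: "f t = mcoeff0 F"
  using eventually_nhds_x_imp_x[of "\<lambda>x. f x = meval F (x - t)" t] F by (simp add: expansion_iff meval_0_arg)

lemma expansion_tendsto: "(f \<longlongrightarrow> f t) (nhds t)"
proof -
  have "filterlim (\<lambda>x. x - t) (nhds 0) (nhds t)"
    using tendsto_diff[OF filterlim_ident tendsto_const[of t "nhds t"]] by simp
  from filterlim_compose[OF tendsto_meval[OF expansion_mconv[OF F]] this]
  have "((\<lambda>x. meval F (x - t)) \<longlongrightarrow> f t) (nhds t)" by (simp add: expansion_value)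
  moreover have "\<forall>\<^sub>F x in nhds t. f x = meval F (x - t)" using F by (simp add: expansion_iff)
  ultimately show ?thesis by (simp add: tendsto_cong)
qed

lemma expansion_eventually_neq_0: "f t \<noteq> 0 \<Longrightarrow> \<forall>\<^sub>F x in nhds t. f x \<noteq> 0"
  using expansion_tendsto tendsto_imp_eventually_ne by blast

lemma expansion_zero_iff: "F = 0 \<longleftrightarrow> (\<forall>\<^sub>F x in nhds t. f x = 0)"
proof -
  have e: "\<forall>\<^sub>F x in nhds t. f x = meval F (x - t)" using F by (simp add: expansion_iff)
  show ?thesis
  proof
    assume "F = 0" then show "\<forall>\<^sub>F x in nhds t. f x = 0" using e by simp
  next
    assume "\<forall>\<^sub>F x in nhds t. f x = 0"
    with e have "\<forall>\<^sub>F x in nhds t. meval F (x - t) = 0" by eventually_elim simp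
    then show "F = 0"
      by (intro meval_eq_0_imp_eq_0 expansion_mconv[OF F]) (simp add: eventually_nhds_shift[of _ t])
  qed
qed

lemma expansion_mtaylor: "\<forall>\<^sub>F s in nhds t. has_mfps_expansion f s (mtaylor (s - t) F)"
proof -
  obtain r where r: "r > 0" "mconv_at r F" using expansion_mconv[OF F] by (auto simp: mconv_def)
  note h = half_gt_zero[OF r(1)]
  have "\<forall>\<^sub>F x in nhds t. f x = meval F (x - t)" using F by (simp add: expansion_iff)
  then have "\<forall>\<^sub>F s in nhds t. \<forall>\<^sub>F x in nhds s. f x = meval F (x - t)" by (simp add: eventually_eventually)
  then show ?thesis
    using eventually_nhds_diff[OF eventually_small_vec[OF h], of t]
  proof eventually_elim
    case (elim s)
    then have s: "\<And>i. norm ((s - t) $ i) \<le> r / 2" by blast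
    have "\<forall>\<^sub>F x in nhds s. f x = meval (mtaylor (s - t) F) (x - s)"
      using elim(1) eventually_nhds_diff[OF eventually_small_vec[OF h], of s]
      by eventually_elim (simp add: meval_mtaylor[OF r(2,1) s])
    moreover have "mconv (mtaylor (s - t) F)"
      using mconv_at_mtaylor[OF r(2,1) s] h unfolding mconv_def by blast
    ultimately show ?case by (simp add: expansion_iff)
  qed
qed

text \<open>Identity theorem: if \<open>f\<close> vanishes near a point \<open>z\<close> close to \<open>t\<close>, re-expansion at \<open>z\<close> shows that \<open>f\<close> vanishes near \<open>t\<close>.\<close>

lemma expansion_neq_0_eventually:
  assumes "F \<noteq> 0"
  shows "\<forall>\<^sub>F z in nhds t. \<not> (\<forall>\<^sub>F x in nhds z. f x = 0)"
proof -
  obtain r where r: "r > 0" "mconv_at r F" using expansion_mconv[OF F] by (auto simp: mconv_def)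
  \<comment> \<open>Quarters, because both z - t and u - (z - t) have to stay within r/2, the range
    in which re-expansion is valid.\<close>
  have q: "r / 4 > 0" using r by simp
  show ?thesis
    using expansion_mtaylor eventually_nhds_diff[OF eventually_small_vec[OF q], of t]
  proof eventually_elim
    case (elim z)
    show ?case
    proof
      assume "\<forall>\<^sub>F x in nhds z. f x = 0"
      moreover have "mconv (mtaylor (z - t) F)" "\<forall>\<^sub>F x in nhds z. f x = meval (mtaylor (z - t) F) (x - z)"
        using elim(1) by (simp_all add: expansion_iff)
      ultimately have "\<forall>\<^sub>F u in nhds 0. meval (mtaylor (z - t) F) u = 0"
        unfolding eventually_nhds_shift[of _ z] by (auto elim: eventually_elim2)
      then have z: "mtaylor (z - t) F = 0" by (rule meval_eq_0_imp_eq_0[OF \<open>mconv (mtaylor (z - t) F)\<close>])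
      have "\<forall>\<^sub>F u in nhds 0. meval F u = 0"
        using eventually_small_vec[OF q, where 'c = 'c and 'n = 'n]
      proof eventually_elim
        case u: (elim u)
        have "norm ((u - (z - t)) $ i) \<le> r / 2" for i
        proof -
          have "norm (u $ i) \<le> r / 4" "norm ((z - t) $ i) \<le> r / 4" using u elim(2) by blast+
          then show ?thesis using norm_triangle_ineq4[of "u $ i" "(z - t) $ i"] unfolding vector_minus_component[of u] by linarith
        qed
        moreover have "norm ((z - t) $ i) \<le> r / 2" for i
        proof -
          have "norm ((z - t) $ i) \<le> r / 4" using elim(2) by blast
          then show ?thesis using r(1) by simp
        qed
        ultimately have "meval (mtaylor (z - t) F) (u - (z - t)) = meval F ((z - t) + (u - (z - t)))"
          by (intro meval_mtaylor[OF r(2,1)])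
        then show ?case by (simp add: z)
      qed
      with assms show False using meval_eq_0_imp_eq_0[OF expansion_mconv[OF F]] by blast
    qed
  qed
qed

lemma expansion_inverse:
  assumes "f t \<noteq> 0"
  shows "has_mfps_expansion (\<lambda>x. inverse (f x)) t (minv F)"
proof -
  have F0: "mcoeff0 F \<noteq> 0" using assms by (simp add: expansion_value)
  note c = mconv_minv[OF expansion_mconv[OF F] F0]
  have "\<forall>\<^sub>F x in nhds t. f x = meval F (x - t)" using F by (simp add: expansion_iff)
  then have "\<forall>\<^sub>F x in nhds t. inverse (f x) = meval (minv F) (x - t)"
    using eventually_nhds_diff[OF eventually_meval_mult[OF expansion_mconv[OF F] c], of t]
  proof eventually_elim
    case (elim x)
    have "f x * meval (minv F) (x - t) = 1"
      using elim meval_mconst[of 1 "x - t"] by (simp add: mult_minv[OF F0])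
    then show ?case by (rule inverse_unique)
  qed
  then show ?thesis using c by (simp add: expansion_iff)
qed

context
  fixes G
  assumes G: "has_mfps_expansion g t G"
begin

lemma expansion_add: "has_mfps_expansion (\<lambda>x. f x + g x) t (F + G)"
  and expansion_diff: "has_mfps_expansion (\<lambda>x. f x - g x) t (F - G)"
  and expansion_mult: "has_mfps_expansion (\<lambda>x. f x * g x) t (F * G)"
proof -
  have e: "\<forall>\<^sub>F x in nhds t. f x = meval F (x - t)" "\<forall>\<^sub>F x in nhds t. g x = meval G (x - t)"
    using F G by (simp_all add: expansion_iff)
  note c = expansion_mconv[OF F] expansion_mconv[OF G]
  have "\<forall>\<^sub>F x in nhds t. f x + g x = meval (F + G) (x - t)"
    using e eventually_nhds_diff[OF eventually_meval_add[OF c], of t] by eventually_elim simp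
  then show "has_mfps_expansion (\<lambda>x. f x + g x) t (F + G)" by (simp add: expansion_iff mconv_add c)
  have "\<forall>\<^sub>F x in nhds t. f x - g x = meval (F - G) (x - t)"
    using e eventually_nhds_diff[OF eventually_meval_diff[OF c], of t] by eventually_elim simp
  then show "has_mfps_expansion (\<lambda>x. f x - g x) t (F - G)" by (simp add: expansion_iff mconv_diff c)
  have "\<forall>\<^sub>F x in nhds t. f x * g x = meval (F * G) (x - t)"
    using e eventually_nhds_diff[OF eventually_meval_mult[OF c], of t] by eventually_elim simp
  then show "has_mfps_expansion (\<lambda>x. f x * g x) t (F * G)" by (simp add: expansion_iff mconv_mult c)
qed

end

end

lemma expansion_eq_iff:
  fixes f g :: "'c::{real_normed_field, euclidean_space} ^ 'n::finite \<Rightarrow> 'c"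
  assumes "has_mfps_expansion f t F" "has_mfps_expansion g t G"
  shows "F = G \<longleftrightarrow> (\<forall>\<^sub>F x in nhds t. f x = g x)"
  using expansion_zero_iff[OF expansion_diff[OF assms]] by simp

lemma expansion_const: "has_mfps_expansion (\<lambda>_. c) t (mconst c)"
  for t :: "'c::{real_normed_field, euclidean_space} ^ 'n::finite"
  by (simp add: expansion_iff meval_mconst)

lemma expansion_coord: "has_mfps_expansion (\<lambda>x. x $ i) t (mconst (t $ i) + mvar i)"
  for t :: "'c::{real_normed_field, euclidean_space} ^ 'n::finite"
proof -
  have "has_mfps_expansion (\<lambda>x. (x - t) $ i) t (mvar i)"
    using expansion_meval[OF mconv_mvar[of i], of t] by (simp add: meval_mvar)
  from expansion_add[OF expansion_const[where c = "t $ i"] this] show ?thesis by simp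
qed

lemma expansion_power: "has_mfps_expansion f t F \<Longrightarrow> has_mfps_expansion (\<lambda>x. f x ^ k) t (F ^ k)"
  for t :: "'c::{real_normed_field, euclidean_space} ^ 'n::finite"
proof (induction k)
  case 0
  show ?case using expansion_const[where c = 1 and t = t] by simp
next
  case (Suc k)
  then show ?case using expansion_mult[where f = f and t = t and F = F and g = "\<lambda>x. f x ^ k" and G = "F ^ k"] by simp
qed

lemma expansion_sum:
  fixes t :: "'c::{real_normed_field, euclidean_space} ^ 'n::finite"
  shows "(\<And>i. i \<in> A \<Longrightarrow> has_mfps_expansion (f i) t (F i)) \<Longrightarrow> has_mfps_expansion (\<lambda>x. \<Sum>i\<in>A. f i x) t (\<Sum>i\<in>A. F i)"
  using expansion_const[where c = 0 and t = t] by (induction A rule: infinite_finite_induct) (auto intro: expansion_add)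

lemma tendsto_vec: "(\<And>i. (f i \<longlongrightarrow> l $ i) X) \<Longrightarrow> ((\<lambda>x. \<chi> i. f i x) \<longlongrightarrow> l) X"
  by (rule vec_tendstoI) simp

lemma expansion_compose:
  fixes f :: "'c::{real_normed_field, euclidean_space} ^ 'm::finite \<Rightarrow> 'c" and t :: "'c ^ 'n::finite"
  assumes F: "has_mfps_expansion f y F" and s: "\<And>i. has_mfps_expansion (s i) t (S i)" and y: "\<And>i. s i t = y $ i"
  shows "has_mfps_expansion (\<lambda>x. f (\<chi> i. s i x)) t (msubst F (\<lambda>i. S i - mconst (y $ i)))"
proof -
  let ?T = "\<lambda>i. S i - mconst (y $ i)"
  have T: "has_mfps_expansion (\<lambda>x. s i x - y $ i) t (?T i)" for i by (rule expansion_diff[OF s expansion_const])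
  have c: "mconv (?T i)" "mcoeff0 (?T i) = 0" for i
    using expansion_mconv[OF T] expansion_value[OF T[of i]] by (simp_all add: y)
  have "((\<lambda>x. \<chi> i. s i x) \<longlongrightarrow> y) (nhds t)"
    using expansion_tendsto[OF s] by (intro tendsto_vec) (simp add: y)
  moreover have "\<forall>\<^sub>F x in nhds y. f x = meval F (x - y)" using F by (simp add: expansion_iff)
  ultimately have "\<forall>\<^sub>F x in nhds t. f (\<chi> i. s i x) = meval F ((\<chi> i. s i x) - y)"
    by (rule eventually_compose_filterlim[rotated])
  moreover have "\<forall>\<^sub>F x in nhds t. \<forall>i. s i x - y $ i = meval (?T i) (x - t)"
    using T by (intro eventually_all_finite) (simp add: expansion_iff)
  ultimately have "\<forall>\<^sub>F x in nhds t. f (\<chi> i. s i x) = meval (msubst F ?T) (x - t)"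
    using eventually_nhds_diff[where t = t, OF eventually_meval_msubst[where s = ?T, OF expansion_mconv[OF F] c]]
  proof eventually_elim
    case (elim x)
    have "(\<chi> i. s i x) - y = (\<chi> i. meval (?T i) (x - t))" using elim(2) by (simp add: vec_eq_iff)
    then show ?case using elim by simp
  qed
  then show ?thesis using mconv_msubst[where s = ?T, OF expansion_mconv[OF F] c] by (simp add: expansion_iff)
qed

section \<open>Taylor series of the functions defining the density\<close>

lemma taylor_eq:
  fixes f :: "'c::{real_normed_field, euclidean_space} ^ 'n::finite \<Rightarrow> 'c"
  assumes "has_mfps_expansion f t F"
  shows "taylor f t = F"
  unfolding taylor_def
proof (rule the_equality[where P = "has_mfps_expansion f t", OF assms])
  fix G assume "has_mfps_expansion f t G"
  then show "G = F" by (simp add: expansion_eq_iff[OF _ assms])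
qed

lemma expansion_taylor: "manalytic_at f t \<Longrightarrow> has_mfps_expansion f t (taylor f t)"
  for t :: "'c::{real_normed_field, euclidean_space} ^ 'n::finite"
  unfolding manalytic_at_def using taylor_eq by metis

lemma expansion_taylor_coeff:
  fixes f :: "'c::{real_normed_field, euclidean_space} ^ 'n::finite \<Rightarrow> 'c"
  assumes "has_mfps_expansion f t F"
  shows "has_mfps_expansion (\<lambda>s. mcoeff (taylor f s) \<alpha>) t (taylor_coeff \<alpha> F)"
proof -
  have "\<forall>\<^sub>F s in nhds t. meval (taylor_coeff \<alpha> F) (s - t) = mcoeff (taylor f s) \<alpha>"
    using expansion_mtaylor[OF assms] by eventually_elim (simp add: taylor_eq mtaylor_def)
  with expansion_meval[OF mconv_taylor_coeff[OF expansion_mconv[OF assms]]] show ?thesis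
    by (rule expansion_cong)
qed

lemma expansion_mderiv:
  fixes f :: "'c::{real_normed_field, euclidean_space} ^ 'n::finite \<Rightarrow> 'c"
  assumes "has_mfps_expansion f t F"
  shows "has_mfps_expansion (\<lambda>s. mcoeff0 (mderiv i (taylor f s))) t (mderiv i F)"
proof -
  have "(\<lambda>_. 0)(i := Suc 0) = unit_idx i" by auto
  then show ?thesis using expansion_taylor_coeff[OF assms, of "unit_idx i"] by (simp add: taylor_coeff_unit_idx mcoeff_mderiv)
qed

lemma expansion_dehom:
  fixes f :: "'c::{real_normed_field, euclidean_space} ^ 'n::finite \<Rightarrow> 'c"
  assumes f: "has_mfps_expansion f (affine_part Q) F" and Q: "Q $ Zeroth \<noteq> 0"
  shows "has_mfps_expansion (\<lambda>X. f (affine_part X)) Q (formal_dehom Q F)"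
proof -
  have "has_mfps_expansion (\<lambda>X. X $ Mid i * inverse (X $ Zeroth)) Q (hcoord Q (Mid i) * minv (hcoord Q Zeroth))" for i
    unfolding hcoord_def by (intro expansion_mult expansion_inverse expansion_coord Q)
  from expansion_compose[OF f this] show ?thesis
    by (simp add: affine_part_def divide_inverse formal_dehom_def)
qed

lemma expansion_cone:
  fixes f :: "'c::{real_normed_field, euclidean_space} ^ 'n::finite \<Rightarrow> 'c"
  assumes f: "has_mfps_expansion f (affine_part Q) F" and Q: "Q $ Zeroth \<noteq> 0"
  shows "has_mfps_expansion (analytic_cone f) Q (formal_cone Q F)"
proof -
  have "has_mfps_expansion (\<lambda>X. X $ Last * inverse (X $ Zeroth) - f (affine_part X)) Q (formal_cone Q F)"
    unfolding formal_cone_def using f Q unfolding hcoord_def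
    by (intro expansion_diff expansion_mult expansion_inverse expansion_coord expansion_dehom) 
  then show ?thesis by (simp add: analytic_cone_def[abs_def] divide_inverse)
qed

lemma expansion_ampl:
  fixes g :: "'c::{real_normed_field, euclidean_space} ^ 'n::finite \<Rightarrow> 'c"
  assumes g: "has_mfps_expansion g (affine_part Q) G" and Q: "Q $ Zeroth \<noteq> 0"
  shows "has_mfps_expansion (analytic_ampl g) Q (formal_ampl Q G)"
proof -
  have "has_mfps_expansion (\<lambda>X. g (affine_part X) ^ wt_den TYPE('n) * inverse (X $ Zeroth) ^ half_weight TYPE('n)) Q (formal_ampl Q G)"
    unfolding formal_ampl_def using g Q unfolding hcoord_def
    by (intro expansion_mult expansion_power expansion_inverse expansion_coord expansion_dehom)
  then show ?thesis by (simp add: analytic_ampl_def[abs_def] divide_inverse power_inverse)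
qed

lemma expansion_linear:
  fixes \<phi> :: "'c::{real_normed_field, euclidean_space} ^ 'm::finite \<Rightarrow> 'c"
  assumes "has_mfps_expansion \<phi> (N *v Q) \<Phi>"
  shows "has_mfps_expansion (\<lambda>X. \<phi> (N *v X)) Q (formal_linear N \<Phi>)"
proof -
  have s: "has_mfps_expansion (\<lambda>X. \<Sum>j\<in>UNIV. N $ i $ j * X $ j) Q (\<Sum>j\<in>UNIV. mconst (N $ i $ j) * (mconst (Q $ j) + mvar j))" for i
    by (intro expansion_sum expansion_mult expansion_const expansion_coord)
  have "(\<Sum>j\<in>UNIV. mconst (N $ i $ j) * (mconst (Q $ j) + mvar j)) - mconst ((N *v Q) $ i) = (\<Sum>j\<in>UNIV. mconst (N $ i $ j) * mvar j)" for i
    by (simp add: matrix_vector_mult_def distrib_left sum.distrib mconst_sum mconst_mult)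
  then show ?thesis
    using expansion_compose[where s = "\<lambda>i X. \<Sum>j\<in>UNIV. N $ i $ j * X $ j", OF assms s] by (simp add: matrix_vector_mult_def formal_linear_def)
qed

section \<open>Analytic germs\<close>

text \<open>
  \<open>merom_rel h p H a x\<close>: the function \<open>a\<close>, defined where \<open>h \<noteq> 0\<close>, is meromorphic near \<open>p\<close> with a power of \<open>h\<close> as
  denominator, and \<open>x\<close> is its expansion at \<open>p\<close>.
\<close>

definition merom_rel ::
    "('c::real_normed_field ^ 'n::finite \<Rightarrow> 'c) \<Rightarrow> 'c ^ 'n \<Rightarrow> ('c, 'n) mfps \<Rightarrow> ('c ^ 'n \<Rightarrow> 'c) \<Rightarrow> ('c, 'n) mfps fract \<Rightarrow> bool" where
  "merom_rel h p H a x \<longleftrightarrow> (\<exists>b B N. has_mfps_expansion b p B \<and>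
     (\<forall>\<^sub>F t in nhds p. h t \<noteq> 0 \<longrightarrow> a t * h t ^ N = b t) \<and> x * to_fract H ^ N = to_fract B)"

lemma merom_rel_expansion: "has_mfps_expansion a p A \<Longrightarrow> merom_rel h p H a (to_fract A)"
  unfolding merom_rel_def by (rule exI[of _ a], rule exI[of _ A], rule exI[of _ 0]) simp

context
  fixes h :: "'c::{real_normed_field, euclidean_space} ^ 'n::finite \<Rightarrow> 'c" and p H
  assumes h: "has_mfps_expansion h p H"
begin

lemma scalar_rel_merom_rel: "scalar_rel (merom_rel h p H)"
proof
  fix a b :: "'c ^ 'n \<Rightarrow> 'c" and x y
  assume "merom_rel h p H a x" "merom_rel h p H b y"
  then obtain a' A N b' B K
    where a: "has_mfps_expansion a' p A" "\<forall>\<^sub>F t in nhds p. h t \<noteq> 0 \<longrightarrow> a t * h t ^ N = a' t" "x * to_fract H ^ N = to_fract A"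
      and b: "has_mfps_expansion b' p B" "\<forall>\<^sub>F t in nhds p. h t \<noteq> 0 \<longrightarrow> b t * h t ^ K = b' t" "y * to_fract H ^ K = to_fract B"
    unfolding merom_rel_def by blast
  have "\<forall>\<^sub>F t in nhds p. h t \<noteq> 0 \<longrightarrow> (a t + b t) * h t ^ (N + K) = a' t * h t ^ K + b' t * h t ^ N"
    using a(2) b(2) by eventually_elim (auto simp: power_add algebra_simps)
  moreover have "(x + y) * to_fract H ^ (N + K) = to_fract (A * H ^ K + B * H ^ N)"
    unfolding to_fract_add to_fract_mult to_fract_power a(3)[symmetric] b(3)[symmetric] by (simp add: power_add algebra_simps)
  moreover have "has_mfps_expansion (\<lambda>t. a' t * h t ^ K + b' t * h t ^ N) p (A * H ^ K + B * H ^ N)"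
    by (intro expansion_add expansion_mult expansion_power a b h)
  ultimately show "merom_rel h p H (\<lambda>t. a t + b t) (x + y)" unfolding merom_rel_def by blast
  have "\<forall>\<^sub>F t in nhds p. h t \<noteq> 0 \<longrightarrow> (a t * b t) * h t ^ (N + K) = a' t * b' t"
    using a(2) b(2)
  proof eventually_elim
    case (elim t)
    have "(a t * b t) * h t ^ (N + K) = (a t * h t ^ N) * (b t * h t ^ K)" by (simp add: power_add)
    then show ?case using elim by metis
  qed
  moreover have "(x * y) * to_fract H ^ (N + K) = to_fract (A * B)"
    unfolding to_fract_mult a(3)[symmetric] b(3)[symmetric] by (simp add: power_add)
  ultimately show "merom_rel h p H (\<lambda>t. a t * b t) (x * y)"
    unfolding merom_rel_def using expansion_mult[OF a(1) b(1)] by blast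
next
  show "merom_rel h p H (\<lambda>_. 0) 0" "merom_rel h p H (\<lambda>_. 1) 1" "merom_rel h p H (\<lambda>_. - 1) (- 1)"
    using merom_rel_expansion[OF expansion_const[where t = p and c = 0]] merom_rel_expansion[OF expansion_const[where t = p and c = 1]]
      merom_rel_expansion[OF expansion_const[where t = p and c = "- 1"]] to_fract_diff[of 0 "1 :: ('c, 'n) mfps"] by (simp_all add: mconst_uminus)
  fix k :: nat assume "k > 0"
  then have "to_fract (mconst (1 / of_nat k) :: ('c, 'n) mfps) * of_nat k = 1"
    unfolding to_fract_of_nat[symmetric] to_fract_mult[symmetric] mconst_of_nat[symmetric] mconst_mult[symmetric] by simp
  then have "to_fract (mconst (1 / of_nat k) :: ('c, 'n) mfps) = 1 / of_nat k" using \<open>k > 0\<close> by (simp add: field_simps)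
  then show "merom_rel h p H (\<lambda>_. 1 / of_nat k) (1 / of_nat k)"
    using merom_rel_expansion[OF expansion_const[where t = p and c = "1 / of_nat k"]] by simp
qed

lemma merom_rel_eq_0_iff:
  assumes H: "H \<noteq> 0" and a: "merom_rel h p H a x"
  shows "x = 0 \<longleftrightarrow> (\<forall>\<^sub>F t in nhds p. h t \<noteq> 0 \<longrightarrow> a t = 0)"
proof -
  obtain b B N where b: "has_mfps_expansion b p B" "\<forall>\<^sub>F t in nhds p. h t \<noteq> 0 \<longrightarrow> a t * h t ^ N = b t" "x * to_fract H ^ N = to_fract B"
    using a unfolding merom_rel_def by blast
  have "x = 0 \<longleftrightarrow> B = 0" using b(3) H by (metis mult_eq_0_iff power_eq_0_iff to_fract_eq_0_iff)
  \<comment> \<open>The factor \<open>h\<close> absorbs the points with \<open>h t = 0\<close>,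
    where the relation says nothing about \<open>a\<close>.\<close>
  also have "\<dots> \<longleftrightarrow> B * H = 0" using H by simp
  also have "\<dots> \<longleftrightarrow> (\<forall>\<^sub>F t in nhds p. b t * h t = 0)" by (rule expansion_zero_iff[OF expansion_mult[OF b(1) h]])
  also have "\<dots> \<longleftrightarrow> (\<forall>\<^sub>F t in nhds p. h t \<noteq> 0 \<longrightarrow> a t = 0)"
  proof (rule eventually_cong[OF b(2)])
    fix t assume "h t \<noteq> 0 \<longrightarrow> a t * h t ^ N = b t"
    then show "b t * h t = 0 \<longleftrightarrow> (h t \<noteq> 0 \<longrightarrow> a t = 0)" by (cases "h t = 0") auto
  qed
  finally show ?thesis .
qed

lemma merom_rel_divide:
  assumes D: "merom_rel h p H D D'" and a: "\<And>t. h t \<noteq> 0 \<Longrightarrow> a t * h t = D t" and x: "x * to_fract H = D'"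
  shows "merom_rel h p H a x"
proof -
  obtain b B N where b: "has_mfps_expansion b p B" "\<forall>\<^sub>F t in nhds p. h t \<noteq> 0 \<longrightarrow> D t * h t ^ N = b t" "D' * to_fract H ^ N = to_fract B"
    using D unfolding merom_rel_def by blast
  have "\<forall>\<^sub>F t in nhds p. h t \<noteq> 0 \<longrightarrow> a t * h t ^ Suc N = b t"
    using b(2) by eventually_elim (simp add: a mult.assoc[symmetric])
  moreover have "x * to_fract H ^ Suc N = to_fract B" using b(3) by (simp add: x[symmetric] mult.assoc)
  ultimately show ?thesis unfolding merom_rel_def using b(1) by blast
qed

end

text \<open>Cramer's rule exhibits the entries of the inverse as polynomial expressions divided by
  the determinant, the denominator that \<open>merom_rel\<close> allows.\<close>

lemma matrix_inv_cramer:
  fixes A :: "'a::field ^ 'n::finite ^ 'n"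
  assumes "det A \<noteq> 0"
  shows "matrix_inv A $ i $ j * det A = det (\<chi> a b. if b = i then (if a = j then 1 else 0) else A $ a $ b)"
proof -
  have inv: "invertible A" using assms by (simp add: invertible_det_nz)
  let ?x = "\<chi> k. matrix_inv A $ k $ j" and ?b = "\<chi> a. if a = j then 1 else 0 :: 'a ^ 'n"
  have "A *v ?x = (\<chi> a. (A ** matrix_inv A) $ a $ j)" by (simp add: matrix_vector_mult_def matrix_matrix_mult_def)
  also have "\<dots> = ?b" unfolding matrix_inv_right_field(1)[OF inv] by (simp add: mat_def)
  finally have "?x = (\<chi> k. det (\<chi> a b. if b = k then ?b $ a else A $ a $ b) / det A)" unfolding cramer[OF assms] .
  from arg_cong[OF this, of "\<lambda>v. v $ i"] show ?thesis using assms by (simp add: field_simps cong: if_cong)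
qed

text \<open>With denominator 1 the relation \<open>merom_rel\<close> describes analytic functions,
  and the determinant is polynomial in the Taylor coefficients.\<close>

lemma det_hess_expansion:
  fixes f :: "'c::{real_normed_field, euclidean_space} ^ 'n::finite \<Rightarrow> 'c"
  assumes f: "has_mfps_expansion f p F"
  obtains H where "has_mfps_expansion (\<lambda>t. det (hess (taylor f t))) p H" "det (hess (gexp F)) = to_fract H"
proof -
  have one: "has_mfps_expansion (\<lambda>_. 1) p 1" using expansion_const[where c = 1 and t = p] by simp
  interpret scalar_rel "merom_rel (\<lambda>_. 1) p 1" by (rule scalar_rel_merom_rel[OF one])
  have "mrel (taylor f) (gexp F)"
    by (auto simp: mrel_def mcoeff_gexp intro!: merom_rel_expansion expansion_taylor_coeff f)
  from R_det[OF R_hess[OF this]] obtain b B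
    where b: "has_mfps_expansion b p B" "\<forall>\<^sub>F t in nhds p. det (hess (taylor f t)) = b t" "det (hess (gexp F)) = to_fract B"
    by (auto simp: merom_rel_def)
  have "\<forall>\<^sub>F t in nhds p. b t = det (hess (taylor f t))" using b(2) by eventually_elim simp
  from that[OF expansion_cong[OF b(1) this] b(3)] show ?thesis .
qed

text \<open>Each coefficient is meromorphic near \<open>p\<close> with poles along the Hessian
  determinant, and its expansion is the coefficient at the generic point. By
  \<open>merom_rel_eq_0_iff\<close> the function vanishes off the poles exactly if the expansion is
  zero.\<close>

lemma analytic_admissible_iff:
  fixes f g :: "'c::{real_normed_field, euclidean_space} ^ 'n::finite \<Rightarrow> 'c"
  shows "analytic_admissible (p, f, g) \<longleftrightarrow>
    manalytic_at f p \<and> manalytic_at g p \<and> formal_admissible (p, taylor f p, taylor g p)"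
proof (cases "manalytic_at f p \<and> manalytic_at g p")
  case True
  let ?F = "taylor f p" and ?G = "taylor g p"
  have f: "has_mfps_expansion f p ?F" and g: "has_mfps_expansion g p ?G" using True by (simp_all add: expansion_taylor)
  define h where "h t = det (hess (taylor f t))" for t
  obtain H where H: "has_mfps_expansion h p H" "det (hess (gexp ?F)) = to_fract H"
    using det_hess_expansion[OF f] unfolding h_def[abs_def] .
  interpret scalar_rel "merom_rel h p H" by (rule scalar_rel_merom_rel[OF H(1)])
  have mf: "mrel (taylor f) (gexp ?F)" and mg: "mrel (taylor g) (gexp ?G)"
    by (auto simp: mrel_def mcoeff_gexp intro!: merom_rel_expansion expansion_taylor_coeff f g)
  have sp: "sp_coeff k (gexp ?F) (gexp ?G) = 0 \<longleftrightarrow> (\<forall>\<^sub>F t in nhds p. h t \<noteq> 0 \<longrightarrow> sp_coeff k (taylor f t) (taylor g t) = 0)"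
    if "H \<noteq> 0" for k
  proof (rule merom_rel_eq_0_iff[OF H(1) that R_sp_coeff[OF mf mg]])
    fix i j
    let ?A = "\<lambda>A :: 'c ^ 'n ^ 'n. (\<chi> a b. if b = i then (if a = j then 1 else 0) else A $ a $ b) :: 'c ^ 'n ^ 'n"
    let ?B = "\<lambda>A :: ('c, 'n) mfps fract ^ 'n ^ 'n. (\<chi> a b. if b = i then (if a = j then 1 else 0) else A $ a $ b) :: ('c, 'n) mfps fract ^ 'n ^ 'n"
    have "merom_rel h p H (\<lambda>t. det (?A (hess (taylor f t)))) (det (?B (hess (gexp ?F))))"
    proof (rule R_det)
      fix a b
      show "merom_rel h p H (\<lambda>t. ?A (hess (taylor f t)) $ a $ b) (?B (hess (gexp ?F)) $ a $ b)"
        using R_0 R_1 R_hess[OF mf] by (cases "b = i"; cases "a = j") simp_all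
    qed
    then show "merom_rel h p H (\<lambda>t. matrix_inv (hess (taylor f t)) $ i $ j) (matrix_inv (hess (gexp ?F)) $ i $ j)"
    proof (rule merom_rel_divide[OF H(1)])
      show "matrix_inv (hess (taylor f t)) $ i $ j * h t = det (?A (hess (taylor f t)))" if "h t \<noteq> 0" for t
        using that unfolding h_def by (rule matrix_inv_cramer)
      show "matrix_inv (hess (gexp ?F)) $ i $ j * to_fract H = det (?B (hess (gexp ?F)))"
        unfolding H(2)[symmetric] using that by (intro matrix_inv_cramer) (simp add: H(2))
    qed
  qed
  show ?thesis
    unfolding analytic_admissible_def formal_admissible_def prod.case h_def[symmetric] H(2)
      expansion_zero_iff[OF H(1), symmetric] expansion_zero_iff[OF g, symmetric]
    using True sp by auto
qed (auto simp: analytic_admissible_def)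

section \<open>Transformation of analytic germs\<close>

context
  fixes Q :: "'k::field_char_0 ^ 'n::finite hindex" and F :: "('k, 'n) mfps"
  assumes Q0: "Q $ Zeroth \<noteq> 0" and F0: "mcoeff0 F = Q $ Last / Q $ Zeroth"
begin

lemma cone_dvd_iff: "(\<exists>V. W = V * formal_cone Q F) \<longleftrightarrow> msubst W (cone_section Q F) = 0"
  using cone_divide[OF Q0 F0] by (auto simp: msubst_mult[OF mcoeff0_cone_section[OF Q0 F0]] msubst_cone_section[OF Q0 F0])

lemma cone_quotient:
  assumes W: "W = V * formal_cone Q F"
  shows "V = hcoord Q Zeroth * mdivide Last (hcoord Q Zeroth * formal_dehom Q F - mconst (Q $ Last)) W"
proof -
  have "msubst W (cone_section Q F) = 0" using W cone_dvd_iff by blast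
  from cone_divide[OF Q0 F0 this] W
  have "V * formal_cone Q F = (hcoord Q Zeroth * mdivide Last (hcoord Q Zeroth * formal_dehom Q F - mconst (Q $ Last)) W) * formal_cone Q F"
    by simp
  moreover have "mderiv Last (formal_cone Q F) = minv (hcoord Q Zeroth)"
    by (simp add: mderiv_formal_cone[OF Q0] mderiv_dehom_arg[OF Q0])
  then have "mcoeff0 (mderiv Last (formal_cone Q F)) \<noteq> 0" using Q0 by simp
  then have "formal_cone Q F \<noteq> 0" by auto
  ultimately show ?thesis by simp
qed

end

text \<open>The quotient is unique, hence given by the explicit formula with \<open>mdivide\<close>,
  which preserves convergence.\<close>

lemma mconv_cone_quotient:
  fixes F :: "('c::{real_normed_field, banach}, 'n::finite) mfps"
  assumes "Q $ Zeroth \<noteq> 0" "mcoeff0 F = Q $ Last / Q $ Zeroth" "mconv F" "mconv W" "W = V * formal_cone Q F"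
  shows "mconv V"
proof -
  have "mcoeff0 (hcoord Q Zeroth * formal_dehom Q F - mconst (Q $ Last)) = 0"
    using mcoeff0_cone_section[OF assms(1,2), of Last] by (simp add: cone_section_def)
  moreover have "mconv (hcoord Q Zeroth * formal_dehom Q F - mconst (Q $ Last))"
    using assms by (intro mconv_diff mconv_mult mconv_hcoord mconv_formal_dehom mconv_mconst)
  ultimately show ?thesis
    unfolding cone_quotient[OF assms(1,2,5)] using assms(4) by (intro mconv_mult mconv_hcoord mconv_mdivide)
qed

text \<open>The section of the cone replaces the coordinate \<open>x\<^sub>n\<^sub>+\<^sub>1\<close> by its value on the cone.\<close>

lemma eventually_cone_zero_iff:
  fixes f :: "'c::{real_normed_field, euclidean_space} ^ 'n::finite \<Rightarrow> 'c"
  assumes Q0: "Q $ Zeroth \<noteq> 0" and f: "has_mfps_expansion f (affine_part Q) F" and fQ: "f (affine_part Q) = Q $ Last / Q $ Zeroth"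
    and w: "has_mfps_expansion w Q W"
  shows "(\<forall>\<^sub>F X in nhds Q. analytic_cone f X = 0 \<longrightarrow> w X = 0) \<longleftrightarrow> msubst W (cone_section Q F) = 0"
proof -
  define s where "s a X = (if a = Last then X $ Zeroth * f (affine_part X) else X $ a)" for a and X :: "'c ^ 'n hindex"
  define S where "S a = (if a = Last then hcoord Q Zeroth * formal_dehom Q F else hcoord Q a)" for a
  let ?\<sigma> = "\<lambda>X. \<chi> a. s a X"
  have hc: "has_mfps_expansion (\<lambda>X. X $ a) Q (hcoord Q a)" for a
    unfolding hcoord_def by (rule expansion_coord)
  have s: "has_mfps_expansion (s a) Q (S a)" for a
    using expansion_mult[OF hc expansion_dehom[OF f Q0], of Zeroth] hc[of a]
    by (cases "a = Last") (simp_all add: s_def[abs_def] S_def)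
  have sQ: "s a Q = Q $ a" for a using Q0 fQ by (auto simp: s_def)
  have e: "(\<lambda>a. S a - mconst (Q $ a)) = cone_section Q F"
    by (rule ext) (auto simp: S_def cone_section_def hcoord_def)
  have nz: "\<forall>\<^sub>F X in nhds Q. X $ Zeroth \<noteq> 0"
    by (rule expansion_eventually_neq_0[OF hc Q0])
  have \<sigma>: "analytic_cone f (?\<sigma> X) = 0" if "X $ Zeroth \<noteq> 0" for X
  proof -
    have "affine_part (?\<sigma> X) = affine_part X" by (simp add: affine_part_def s_def)
    then show ?thesis using that by (simp add: analytic_cone_def s_def)
  qed
  have id: "?\<sigma> X = X" if "X $ Zeroth \<noteq> 0" "analytic_cone f X = 0" for X
    using that by (auto simp: vec_eq_iff s_def analytic_cone_def field_simps)
  have "msubst W (cone_section Q F) = 0 \<longleftrightarrow> (\<forall>\<^sub>F X in nhds Q. w (?\<sigma> X) = 0)"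
    using expansion_zero_iff[OF expansion_compose[where s = s and S = S, OF w s sQ]] by (simp add: e)
  also have "\<dots> \<longleftrightarrow> (\<forall>\<^sub>F X in nhds Q. analytic_cone f X = 0 \<longrightarrow> w X = 0)"
  proof
    assume "\<forall>\<^sub>F X in nhds Q. w (?\<sigma> X) = 0"
    with nz show "\<forall>\<^sub>F X in nhds Q. analytic_cone f X = 0 \<longrightarrow> w X = 0"
      by eventually_elim (use id in force)
  next
    assume *: "\<forall>\<^sub>F X in nhds Q. analytic_cone f X = 0 \<longrightarrow> w X = 0"
    have "filterlim ?\<sigma> (nhds Q) (nhds Q)"
      using expansion_tendsto[OF s] by (intro tendsto_vec) (simp add: sQ)
    from eventually_compose_filterlim[OF * this] nz show "\<forall>\<^sub>F X in nhds Q. w (?\<sigma> X) = 0"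
      by eventually_elim (use \<sigma> in blast)
  qed
  finally show ?thesis ..
qed

text \<open>A formal unit between the equations is a quotient of convergent series, so by
  \<open>mconv_cone_quotient\<close> it defines an analytic function. The series \<open>V\<close>
  only expresses divisibility, and divisibility is tested on the section of the cone by
  \<open>eventually_cone_zero_iff\<close>.\<close>

lemma analytic_transform_iff:
  fixes f g f' g' :: "'c::{real_normed_field, euclidean_space} ^ 'n::finite \<Rightarrow> 'c"
  assumes M: "invertible M" and fg: "manalytic_at f p" "manalytic_at g p"
  shows "analytic_transform M c (p, f, g) (p', f', g') \<longleftrightarrow> manalytic_at f' p' \<and> manalytic_at g' p' \<and>
    formal_transform M c (p, taylor f p, taylor g p) (p', taylor f' p', taylor g' p')"
proof -
  let ?F = "taylor f p" and ?G = "taylor g p" and ?F' = "taylor f' p'" and ?G' = "taylor g' p'"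
  let ?N = "matrix_inv M" and ?e = "wt_den TYPE('n)"
  define Q where "Q = cone_point p (f p)"
  define Q' where "Q' = M *v Q"
  have f: "has_mfps_expansion f p ?F" and g: "has_mfps_expansion g p ?G" using fg by (simp_all add: expansion_taylor)
  have F0: "mcoeff0 ?F = f p" using expansion_value[OF f] by simp
  have Q: "Q $ Zeroth \<noteq> 0" "affine_part Q = p" by (simp_all add: Q_def affine_part_def vec_eq_iff cone_point_def)
  have NQ: "?N *v Q' = Q" by (simp add: Q'_def matrix_vector_mul_assoc matrix_inv_right_field[OF M])
  let ?K = "Q' $ Zeroth \<noteq> 0 \<and> p' = affine_part Q' \<and> f' p' = Q' $ Last / Q' $ Zeroth \<and> manalytic_at f' p' \<and> manalytic_at g' p'"
  let ?A = "\<exists>U. manalytic_at U Q' \<and> U Q' \<noteq> 0 \<and>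
        (\<forall>\<^sub>F X in nhds Q'. analytic_cone f (?N *v X) = U X * analytic_cone f' X) \<and>
        (\<forall>\<^sub>F X in nhds Q'. analytic_cone f' X = 0 \<longrightarrow>
           U X ^ ?e * analytic_ampl g' X = c * analytic_ampl g (?N *v X))"
  let ?H = "formal_linear ?N (formal_cone Q ?F)" and ?C = "formal_cone Q' ?F'"
  let ?a = "formal_linear ?N (formal_ampl Q ?G)" and ?a' = "formal_ampl Q' ?G'"
  have A_iff: "?A \<longleftrightarrow> density_eq ?e c ?H ?a ?C ?a'" if K: ?K
  proof -
    have Q'0: "Q' $ Zeroth \<noteq> 0" and f'Q': "f' (affine_part Q') = Q' $ Last / Q' $ Zeroth" using K by auto
    have f': "has_mfps_expansion f' (affine_part Q') ?F'" and g': "has_mfps_expansion g' (affine_part Q') ?G'"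
      using K expansion_taylor by metis+
    have F'0: "mcoeff0 ?F' = Q' $ Last / Q' $ Zeroth" using expansion_value[OF f'] f'Q' by simp
    have H: "has_mfps_expansion (\<lambda>X. analytic_cone f (?N *v X)) Q' ?H"
      by (rule expansion_linear) (use expansion_cone[of f Q ?F] f Q NQ in simp)
    have a: "has_mfps_expansion (\<lambda>X. analytic_ampl g (?N *v X)) Q' ?a"
      by (rule expansion_linear) (use expansion_ampl[of g Q ?G] g Q NQ in simp)
    note C = expansion_cone[OF f' Q'0] and a' = expansion_ampl[OF g' Q'0]
    have second: "(\<forall>\<^sub>F X in nhds Q'. analytic_cone f' X = 0 \<longrightarrow> U X ^ ?e * analytic_ampl g' X = c * analytic_ampl g (?N *v X))
       \<longleftrightarrow> (\<exists>V. Us ^ ?e * ?a' = mconst c * ?a + V * ?C)" if U: "has_mfps_expansion U Q' Us" for U Us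
    proof -
      have w: "has_mfps_expansion (\<lambda>X. U X ^ ?e * analytic_ampl g' X - c * analytic_ampl g (?N *v X)) Q' (Us ^ ?e * ?a' - mconst c * ?a)"
        by (intro expansion_diff expansion_mult expansion_power U a a' expansion_const)
      from eventually_cone_zero_iff[OF Q'0 f' f'Q' w]
      show ?thesis unfolding cone_dvd_iff[OF Q'0 F'0, symmetric] by (simp add: diff_eq_eq add.commute)
    qed
    show ?thesis
    proof
      assume ?A
      then obtain U where U: "manalytic_at U Q'" "U Q' \<noteq> 0"
        and 1: "\<forall>\<^sub>F X in nhds Q'. analytic_cone f (?N *v X) = U X * analytic_cone f' X"
        and 2: "\<forall>\<^sub>F X in nhds Q'. analytic_cone f' X = 0 \<longrightarrow> U X ^ ?e * analytic_ampl g' X = c * analytic_ampl g (?N *v X)"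
        by blast
      note Us = expansion_taylor[OF U(1)]
      have "?H = taylor U Q' * ?C" using 1 expansion_eq_iff[OF H expansion_mult[OF Us C]] by simp
      moreover have "mcoeff0 (taylor U Q') \<noteq> 0" using U(2) expansion_value[OF Us] by simp
      ultimately show "density_eq ?e c ?H ?a ?C ?a'" using 2 second[OF Us] unfolding density_eq_def by blast
    next
      assume "density_eq ?e c ?H ?a ?C ?a'"
      then obtain Us V where U0: "mcoeff0 Us \<noteq> 0" and 1: "?H = Us * ?C" and 2: "Us ^ ?e * ?a' = mconst c * ?a + V * ?C"
        unfolding density_eq_def by blast
      have "mconv Us" by (rule mconv_cone_quotient[OF Q'0 F'0 expansion_mconv[OF f'] expansion_mconv[OF H] 1])
      note Us = expansion_meval[OF this, of Q']
      have "\<forall>\<^sub>F X in nhds Q'. analytic_cone f (?N *v X) = meval Us (X - Q') * analytic_cone f' X"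
        using 1 expansion_eq_iff[OF H expansion_mult[OF Us C]] by simp
      then show ?A using second[OF Us] U0 2 Us by (intro exI[of _ "\<lambda>X. meval Us (X - Q')"]) (auto simp: manalytic_at_def meval_0_arg)
    qed
  qed
  have "analytic_transform M c (p, f, g) (p', f', g') \<longleftrightarrow> ?K \<and> ?A"
    unfolding analytic_transform_def prod.case Let_def Q_def[symmetric] Q'_def[symmetric] by blast
  also have "\<dots> \<longleftrightarrow> ?K \<and> density_eq ?e c ?H ?a ?C ?a'" using A_iff by blast
  also have "\<dots> \<longleftrightarrow> manalytic_at f' p' \<and> manalytic_at g' p' \<and> formal_transform M c (p, ?F, ?G) (p', ?F', ?G')"
  proof -
    have "manalytic_at f' p' \<Longrightarrow> mcoeff0 ?F' = f' p'" using expansion_value[OF expansion_taylor] by metis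
    then show ?thesis
      unfolding formal_transform_iff Let_def F0 Q_def[symmetric] Q'_def[symmetric] by auto
  qed
  finally show ?thesis .
qed

lemma analytic_same_iff:
  fixes f g f' g' :: "'c::{real_normed_field, euclidean_space} ^ 'n::finite \<Rightarrow> 'c"
  assumes fg: "manalytic_at f p" "manalytic_at g p"
  shows "analytic_same (p, f, g) (p', f', g') \<longleftrightarrow> manalytic_at f' p' \<and> manalytic_at g' p' \<and>
    formal_same (p, taylor f p, taylor g p) (p', taylor f' p', taylor g' p')"
proof (cases "p = p' \<and> manalytic_at f' p' \<and> manalytic_at g' p'")
  case True
  then have e: "has_mfps_expansion f p (taylor f p)" "has_mfps_expansion f' p (taylor f' p)"
    "has_mfps_expansion g p (taylor g p)" "has_mfps_expansion g' p (taylor g' p)"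
    using fg by (auto intro: expansion_taylor)
  show ?thesis
    using True expansion_eq_iff[OF e(1,2)] expansion_eq_iff[OF expansion_power[OF e(3)] expansion_power[OF e(4)]]
    by (auto simp: analytic_same_def formal_same_def)
qed (auto simp: analytic_same_def formal_same_def)

text \<open>To be applied with \<open>\<tau>\<close> passing from functions to Taylor series and
  \<open>R\<close> expressing analyticity. \<open>R P'\<close> stands on the right-hand sides
  because the relations between analytic germs themselves demand analyticity of the second
  germ.\<close>

lemma partial_GL_action_transfer:
  assumes act: "partial_GL_action A2 E2 T2"
    and A: "\<And>P. A1 P \<longleftrightarrow> R P \<and> A2 (\<tau> P)"
    and E: "\<And>P P'. R P \<Longrightarrow> E1 P P' \<longleftrightarrow> R P' \<and> E2 (\<tau> P) (\<tau> P')"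
    and T: "\<And>M c P P'. invertible M \<Longrightarrow> R P \<Longrightarrow> T1 M c P P' \<longleftrightarrow> R P' \<and> T2 M c (\<tau> P) (\<tau> P')"
  shows "partial_GL_action A1 E1 (T1 :: 'k::field ^ 'm ^ 'm::finite \<Rightarrow> _)"
proof -
  have inv: "invertible (mat 1 :: 'k ^ 'm ^ 'm)" by (simp add: invertible_def)
  have minv: "invertible (matrix_inv M)" if "invertible M" for M :: "'k ^ 'm ^ 'm" using that by (rule invertible_matrix_inv)
  have mm: "invertible (M' ** M)" if "invertible M" "invertible M'" for M M' :: "'k ^ 'm ^ 'm" using that invertible_mult by blast
  note act' = act[unfolded partial_GL_action_def]
  show ?thesis
    unfolding partial_GL_action_def
  proof (intro conjI)
    show "\<forall>M c P P'. invertible M \<and> c \<noteq> 0 \<and> A1 P \<and> T1 M c P P' \<longrightarrow> A1 P'"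
      using conjunct1[OF act'] A T by meson
    show "\<forall>M c P P' P''. invertible M \<and> c \<noteq> 0 \<and> A1 P \<and> T1 M c P P' \<longrightarrow> (T1 M c P P'' \<longleftrightarrow> E1 P' P'')"
      using conjunct1[OF conjunct2[OF act']] A T E by meson
    show "\<forall>M c P P' P''. invertible M \<and> c \<noteq> 0 \<and> A1 P \<and> T1 M c P P' \<and> E1 P P'' \<longrightarrow> T1 M c P'' P'"
      using conjunct1[OF conjunct2[OF conjunct2[OF act']]] A T E by meson
    show "\<forall>P. A1 P \<longrightarrow> T1 (mat 1) 1 P P"
      using conjunct1[OF conjunct2[OF conjunct2[OF conjunct2[OF act']]]] A T[OF inv] by meson
    show "\<forall>M c P P'. invertible M \<and> c \<noteq> 0 \<and> A1 P \<and> T1 M c P P' \<longrightarrow> T1 (matrix_inv M) (inverse c) P' P"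
      using conjunct1[OF conjunct2[OF conjunct2[OF conjunct2[OF conjunct2[OF act']]]]] A T T[OF minv] by meson
    show "\<forall>M M' c c' P P' P''. invertible M \<and> invertible M' \<and> c \<noteq> 0 \<and> c' \<noteq> 0 \<and>
        A1 P \<and> T1 M c P P' \<and> T1 M' c' P' P'' \<longrightarrow> T1 (M' ** M) (c' * c) P P''"
      using conjunct2[OF conjunct2[OF conjunct2[OF conjunct2[OF conjunct2[OF act']]]]] A T T[OF mm] by meson
  qed
qed

theorem analytic_action:
  "partial_GL_action (analytic_admissible :: ('c::{real_normed_field, euclidean_space}, 'n::finite) analytic_germ \<Rightarrow> bool)
     analytic_same analytic_transform"
proof (rule partial_GL_action_transfer[OF formal_action,
      where R = "\<lambda>(p, f, g). manalytic_at f p \<and> manalytic_at g p" and \<tau> = "\<lambda>(p, f, g). (p, taylor f p, taylor g p)"])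
  show "analytic_admissible P \<longleftrightarrow> (case P of (p, f, g) \<Rightarrow> manalytic_at f p \<and> manalytic_at g p) \<and>
      formal_admissible (case P of (p, f, g) \<Rightarrow> (p, taylor f p, taylor g p))" for P :: "('c, 'n) analytic_germ"
    by (cases P) (simp add: analytic_admissible_iff)
qed (auto simp: analytic_same_iff analytic_transform_iff)

section \<open>Density of the good points\<close>

text \<open>For odd n the series root is taken of \<open>l\<close> divided by its constant term,
  where \<open>mfps_sqrt\<close> applies; the remaining constant has the root \<open>s\<close> by
  assumption.\<close>

lemma ampl_root_mconv:
  fixes l :: "('c::{real_normed_field, banach}, 'n::finite) mfps"
  assumes l: "mcoeff0 l \<noteq> 0" "mconv l" and c: "s ^ wt_den TYPE('n) = c * mcoeff0 l"
  shows "\<exists>R. mconv R \<and> R ^ wt_den TYPE('n) = mconst c * l ^ half_weight TYPE('n)"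
proof (cases "even CARD('n)")
  case True
  then show ?thesis
    using l by (intro exI[of _ "mconst c * l ^ half_weight TYPE('n)"]) (simp add: wt_den_def mconv_mult mconv_power)
next
  case False
  then obtain k where k: "CARD('n) = 2 * k + 1" by (elim oddE)
  have e: "wt_den TYPE('n) = 2" "half_weight TYPE('n) = 2 * (k + 1) + 1"
    using k by (simp_all add: wt_den_def half_weight_def)
  define W where "W = mconst (1 / mcoeff0 l) * l"
  have W: "mcoeff0 W = 1" "mconv W" using l by (simp_all add: W_def mconv_mult)
  have "(l ^ (k + 1) * (mconst s * mfps_sqrt W)) ^ wt_den TYPE('n) = l ^ (2 * (k + 1)) * (mconst (s ^ 2) * W)"
    unfolding e power_mult_distrib mfps_sqrt[OF W(1)] mconst_power power_mult[symmetric] by (simp only: mult.commute)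
  also have "mconst (s ^ 2) * W = mconst c * (mconst (mcoeff0 l * (1 / mcoeff0 l)) * l)"
    unfolding c[unfolded e] W_def mconst_mult by (simp only: mult_ac)
  also have "\<dots> = mconst c * l" using l by simp
  also have "l ^ (2 * (k + 1)) * (mconst c * l) = mconst c * l ^ half_weight TYPE('n)"
    unfolding e by (simp add: mult_ac)
  finally show ?thesis
    using l W by (intro exI[of _ "l ^ (k + 1) * (mconst s * mfps_sqrt W)"]) (auto intro!: mconv_mult mconv_power mconv_mfps_sqrt)
qed

lemma open_iff_eventually: "open S \<longleftrightarrow> (\<forall>x\<in>S. \<forall>\<^sub>F y in nhds x. y \<in> S)"
  by (metis eventually_nhds eventually_nhds_in_open open_subopen subsetI)

context
  fixes M :: "'c::{real_normed_field, euclidean_space} ^ 'n::finite hindex ^ 'n hindex" and f g :: "'c ^ 'n \<Rightarrow> 'c"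
  assumes M: "invertible M"
begin

text \<open>Collects both obstructions to the existence of the image in one function of the base
  point, so that a single application of the identity theorem handles them.\<close>

definition "graph_factor t = mcoeff0 (cone_image M t (taylor f t) Zeroth) * mcoeff0 (cotheta (matrix_inv M) t (taylor f t))"

lemma expansion_graph_factor:
  assumes "manalytic_at f t"
  shows "has_mfps_expansion graph_factor t (cone_image M t (taylor f t) Zeroth * cotheta (matrix_inv M) t (taylor f t))"
proof -
  note F = expansion_taylor[OF assms]
  have F0: "has_mfps_expansion (\<lambda>s. mcoeff0 (taylor f s)) t (taylor f t)"
    using expansion_taylor_coeff[OF F, of "\<lambda>_. 0"] by simp
  have p: "has_mfps_expansion (\<lambda>s. mcoeff0 (cone_param s (taylor f s) b)) t (cone_param t (taylor f t) b)" for b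
    using F0 expansion_const[where c = 1 and t = t] expansion_coord[of _ t] by (cases b) simp_all
  have 1: "has_mfps_expansion (\<lambda>s. mcoeff0 (cone_image M s (taylor f s) Zeroth)) t (cone_image M t (taylor f t) Zeroth)"
    unfolding cone_image_def mcoeff_sum mcoeff_mconst_mult by (intro expansion_sum expansion_mult expansion_const p)
  have 2: "has_mfps_expansion (\<lambda>s. mcoeff0 (cotheta (matrix_inv M) s (taylor f s))) t (cotheta (matrix_inv M) t (taylor f t))"
    unfolding mcoeff0_cotheta unfolding cotheta_def cone_param_simps
    by (intro expansion_diff expansion_sum expansion_mult expansion_const expansion_mderiv expansion_coord F F0)
  show ?thesis unfolding graph_factor_def[abs_def] by (rule expansion_mult[OF 1 2])
qed

text \<open>\<open>root\<close> provides a constant in \<open>C\<close> for which the amplitude has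
  the required root. Sufficiency then rests on the convergence of the constructed image, necessity
  on \<open>formal_transform_good\<close>.\<close>

lemma good_points_iff:
  assumes fg: "manalytic_at f t" "manalytic_at g t" and C: "0 \<notin> C"
    and root: "\<And>l. l \<noteq> 0 \<Longrightarrow> \<exists>c\<in>C. \<exists>s. s ^ wt_den TYPE('n) = c * l"
  shows "t \<in> good_points C M f g \<longleftrightarrow> graph_factor t \<noteq> 0"
proof
  assume "t \<in> good_points C M f g"
  then obtain c p' f' g' where c: "c \<in> C" and T: "analytic_transform M c (t, f, g) (p', f', g')"
    by (auto simp: good_points_def)
  have "c \<noteq> 0" using c C by auto
  from formal_transform_good[OF M this] T show "graph_factor t \<noteq> 0"
    unfolding analytic_transform_iff[OF M fg] graph_factor_def by auto
next
  let ?F = "taylor f t" and ?G = "taylor g t"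
  assume "graph_factor t \<noteq> 0"
  then have nz: "mcoeff0 (cone_image M t ?F Zeroth) \<noteq> 0" "mcoeff0 (cotheta (matrix_inv M) t ?F) \<noteq> 0"
    by (simp_all add: graph_factor_def)
  have F: "mconv ?F" and G: "mconv ?G" using fg by (auto intro: expansion_mconv expansion_taylor)
  obtain c s where c: "c \<in> C" "s ^ wt_den TYPE('n) = c * mcoeff0 (cone_image M t ?F Zeroth)"
    using root[OF nz(1)] by blast
  obtain R where R: "mconv R" "R ^ wt_den TYPE('n) = mconst c * cone_image M t ?F Zeroth ^ half_weight TYPE('n)"
    using ampl_root_mconv[OF nz(1) mconv_cone_image[OF F] c(2)] by blast
  let ?p' = "affine_part (M *v cone_point t (mcoeff0 ?F))"
  have F': "has_mfps_expansion (\<lambda>x. meval (image_F M t ?F) (x - ?p')) ?p' (image_F M t ?F)"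
    and G': "has_mfps_expansion (\<lambda>x. meval (image_G M t ?F R ?G) (x - ?p')) ?p' (image_G M t ?F R ?G)"
    by (intro expansion_meval mconv_image_F[OF M nz F] mconv_image_G[OF M nz F R(1) G])+
  have "analytic_transform M c (t, f, g)
      (?p', \<lambda>x. meval (image_F M t ?F) (x - ?p'), \<lambda>x. meval (image_G M t ?F R ?G) (x - ?p'))"
    unfolding analytic_transform_iff[OF M fg] taylor_eq[OF F'] taylor_eq[OF G']
    using F' G' formal_transform_exists(1)[OF M nz R(2), of ?G] unfolding manalytic_at_def by blast
  then show "t \<in> good_points C M f g" unfolding good_points_def using c(1) by blast
qed

text \<open>\<open>S\<close> is a ball, for the sake of connectedness. The points near which
  \<open>graph_factor\<close> vanishes identically form an open set \<open>Z\<close>; its complement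
  in \<open>S\<close> is open by the identity theorem, and \<open>p\<close> is not in
  \<open>Z\<close> since neither factor of the expansion at \<open>p\<close> is zero. Hence
  \<open>Z\<close> is empty, and the zeros have no interior.\<close>

theorem good_points_dense:
  assumes adm: "analytic_admissible (p, f, g)" and C: "0 \<notin> C"
    and root: "\<And>l. l \<noteq> 0 \<Longrightarrow> \<exists>c\<in>C. \<exists>s. s ^ wt_den TYPE('n) = c * l"
  shows "\<exists>S D. open S \<and> p \<in> S \<and> open D \<and> S \<subseteq> closure D \<and> D = S \<inter> good_points C M f g"
proof -
  have an: "manalytic_at f p" "manalytic_at g p" and adm': "formal_admissible (p, taylor f p, taylor g p)"
    using adm by (simp_all add: analytic_admissible_iff)
  have "\<forall>\<^sub>F t in nhds p. manalytic_at f t \<and> manalytic_at g t"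
    using expansion_mtaylor[OF expansion_taylor[OF an(1)]] expansion_mtaylor[OF expansion_taylor[OF an(2)]]
    by eventually_elim (auto simp: manalytic_at_def)
  then obtain d where d: "d > 0" "\<And>t. dist t p < d \<Longrightarrow> manalytic_at f t \<and> manalytic_at g t"
    unfolding eventually_nhds_metric by blast
  define S where "S = ball p d"
  have S: "open S" "p \<in> S" "connected S" using d(1) by (simp_all add: S_def)
  have anS: "manalytic_at f t" "manalytic_at g t" if "t \<in> S" for t
    using d(2)[of t] that by (simp_all add: S_def dist_commute)
  have in_S: "\<forall>\<^sub>F y in nhds x. y \<in> S" if "x \<in> S" for x using S(1) that by (rule eventually_nhds_in_open)
  define D where "D = S \<inter> good_points C M f g"
  have D: "D = {t \<in> S. graph_factor t \<noteq> 0}"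
    using good_points_iff[OF anS C root] by (auto simp: D_def)
  have "open D"
    unfolding open_iff_eventually
  proof
    fix x assume "x \<in> D"
    then have x: "x \<in> S" "graph_factor x \<noteq> 0" by (simp_all add: D)
    show "\<forall>\<^sub>F y in nhds x. y \<in> D"
      using in_S[OF x(1)] expansion_eventually_neq_0[OF expansion_graph_factor[OF anS(1)[OF x(1)]] x(2)]
      by eventually_elim (simp add: D)
  qed
  define Z where "Z = {x \<in> S. \<forall>\<^sub>F y in nhds x. graph_factor y = 0}"
  have "open Z"
    unfolding open_iff_eventually
  proof
    fix x assume "x \<in> Z"
    then have x: "x \<in> S" "\<forall>\<^sub>F y in nhds x. graph_factor y = 0" by (simp_all add: Z_def)
    then have "\<forall>\<^sub>F y in nhds x. \<forall>\<^sub>F z in nhds y. graph_factor z = 0" by (simp add: eventually_eventually)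
    with in_S[OF x(1)] show "\<forall>\<^sub>F y in nhds x. y \<in> Z" by eventually_elim (simp add: Z_def)
  qed
  moreover have "open (S - Z)"
    unfolding open_iff_eventually
  proof
    fix x assume x: "x \<in> S - Z"
    note e = expansion_graph_factor[OF anS(1), of x]
    have "cone_image M x (taylor f x) Zeroth * cotheta (matrix_inv M) x (taylor f x) \<noteq> 0"
      using x expansion_zero_iff[OF e] by (auto simp: Z_def)
    from in_S[of x] expansion_neq_0_eventually[OF e this] x
    show "\<forall>\<^sub>F y in nhds x. y \<in> S - Z" by (auto simp: Z_def elim: eventually_elim2)
  qed
  moreover have "p \<notin> Z"
  proof
    assume "p \<in> Z"
    then have "cone_image M p (taylor f p) Zeroth * cotheta (matrix_inv M) p (taylor f p) = 0"
      using expansion_zero_iff[OF expansion_graph_factor[OF an(1)]] by (simp add: Z_def)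
    moreover have "det (hess (gexp (taylor f p))) \<noteq> 0" using adm' by (simp add: formal_admissible_def)
    ultimately show False using cone_image_Zeroth_neq_0[OF _ M] cotheta_neq_0[OF _ M] by auto
  qed
  ultimately have "Z = {}"
    using connectedD[OF S(3), of Z "S - Z"] S(2) by (auto simp: Z_def)
  have "S \<subseteq> closure D"
  proof
    fix x assume x: "x \<in> S"
    show "x \<in> closure D"
    proof (rule ccontr)
      assume "x \<notin> closure D"
      then have "\<forall>\<^sub>F y in nhds x. y \<in> - closure D" by (intro eventually_nhds_in_open) auto
      with in_S[OF x] have "\<forall>\<^sub>F y in nhds x. graph_factor y = 0"
        by eventually_elim (use closure_subset[of D] D in auto)
      then show False using x \<open>Z = {}\<close> by (auto simp: Z_def)
    qed
  qed
  then show ?thesis using S \<open>open D\<close> D_def by blast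
qed

end

theorem corollary3p2p1:
  shows
    "\<comment> \<open>formal germs over an arbitrary field of characteristic 0\<close>
     partial_GL_action
       (formal_admissible :: ('k::field_char_0, 'n::finite) formal_germ \<Rightarrow> bool)
       formal_same formal_transform \<and>
     (\<forall>M (P :: ('k, 'n) formal_germ). invertible M \<and> formal_admissible P \<longrightarrow>
       (\<exists>c P'. c \<noteq> 0 \<and> (even CARD('n) \<longrightarrow> c = 1) \<and>
         formal_transform (generic_matrix M) c (generic_germ P) P' \<and> formal_admissible P')) \<and>
     \<comment> \<open>real analytic germs\<close>
     partial_GL_action
       (analytic_admissible :: (real, 'n) analytic_germ \<Rightarrow> bool)
       analytic_same analytic_transform \<and>
     (\<forall>M p (f :: real ^ 'n \<Rightarrow> real) g. invertible M \<and> analytic_admissible (p, f, g) \<longrightarrow>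
       (\<exists>S D. open S \<and> p \<in> S \<and> open D \<and> S \<subseteq> closure D \<and>
         D = S \<inter> good_points (if even CARD('n) then {1} else {1, -1}) M f g)) \<and>
     \<comment> \<open>complex analytic germs\<close>
     partial_GL_action
       (analytic_admissible :: (complex, 'n) analytic_germ \<Rightarrow> bool)
       analytic_same analytic_transform \<and>
     (\<forall>M p (f :: complex ^ 'n \<Rightarrow> complex) g. invertible M \<and> analytic_admissible (p, f, g) \<longrightarrow>
       (\<exists>S D. open S \<and> p \<in> S \<and> open D \<and> S \<subseteq> closure D \<and>
         D = S \<inter> good_points {1} M f g))"
proof -
  have real_root: "\<exists>c\<in>(if even CARD('n) then {1} else {1, -1}). \<exists>s. s ^ wt_den TYPE('n) = c * l" for l :: real
  proof (cases "even CARD('n)")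
    case True
    then show ?thesis by (auto simp: wt_den_def)
  next
    case False
    \<comment> \<open>The sign of \<open>l\<close> decides which of the two constants is
      taken.\<close>
    have "\<exists>c\<in>{1, -1}. (sqrt \<bar>l\<bar>) ^ 2 = c * l" by auto
    then show ?thesis unfolding wt_den_def using False by (simp only: if_False) blast
  qed
  have complex_root: "\<exists>c\<in>{1}. \<exists>s. s ^ wt_den TYPE('n) = c * l" for l :: complex
    using power2_csqrt[of l] by (auto simp: wt_den_def intro!: exI[of _ "csqrt l"])
  show ?thesis
  proof (intro conjI allI impI)
    fix M :: "real ^ 'n hindex ^ 'n hindex" and p and f g :: "real ^ 'n \<Rightarrow> real"
    assume *: "invertible M \<and> analytic_admissible (p, f, g)"
    show "\<exists>S D. open S \<and> p \<in> S \<and> open D \<and> S \<subseteq> closure D \<and>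
         D = S \<inter> good_points (if even CARD('n) then {1} else {1, -1}) M f g"
      by (rule good_points_dense[OF conjunct1[OF *] conjunct2[OF *] _ real_root]) simp
  next
    fix M :: "complex ^ 'n hindex ^ 'n hindex" and p and f g :: "complex ^ 'n \<Rightarrow> complex"
    assume *: "invertible M \<and> analytic_admissible (p, f, g)"
    show "\<exists>S D. open S \<and> p \<in> S \<and> open D \<and> S \<subseteq> closure D \<and> D = S \<inter> good_points {1} M f g"
      by (rule good_points_dense[OF conjunct1[OF *] conjunct2[OF *] _ complex_root]) simp
  next
    fix M :: "'k ^ 'n hindex ^ 'n hindex" and P :: "('k, 'n) formal_germ"
    assume *: "invertible M \<and> formal_admissible P"
    then show "\<exists>c P'. c \<noteq> 0 \<and> (even CARD('n) \<longrightarrow> c = 1) \<and>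
         formal_transform (generic_matrix M) c (generic_germ P) P' \<and> formal_admissible P'"
      by (intro formal_generic_transform) auto
  qed (rule formal_action analytic_action)+
qed

end
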